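(* Suppose that $c_1(\mathbb P_\Sigma)$ is semi-positive and that the triangulation $\mathcal T_\Sigma$ is regular. Then the deformed Gamma series $B_\Sigma(a)$ modulo $J_\Sigma$ gives analytic solutions to the GKZ $\mathcal A$-hypergeometric system with $\beta=(-1,0,\dots,0)$ on some domain; that is, writing $B_\Sigma(a)\equiv\sum_iw_i(a)\alpha_i$ modulo $J_\Sigma$ with $\{\alpha_i\}$ a homogeneous basis of $\mathbb C[D_0,\dots,D_p]/J_\Sigma$, the coefficients $w_i(a)$ are analytic solutions on some domain (near a large radius limit). If $\mathbb P_\Sigma$ is nonsingular, then this gives a complete set of solutions.
   Context: $\Sigma$ is a possibly incomplete simplicial (rational) fan in $\mathbb Z^n$ such that every maximal cone is $n$-dimensional and the support $|\Sigma|$ is convex; $\mathbb P_\Sigma$ is its toric variety. $\Sigma(1)=\{\mu_1,\dots,\mu_p\}$ is the set of integral generators of the $1$-cones, $\mu_0=0$, $\nabla=\mathrm{conv}(\Sigma(1)\cup\{0\})$. $c_1(\mathbb P_\Sigma)$ is represented by the function $\alpha_\Sigma:|\Sigma|\to\mathbb R$, linear on each cone, with $\alpha_\Sigma(\mu_i)=1$ for $1\le i\le p$; $c_1(\mathbb P_\Sigma)$ is semi-positive if $\alpha_\Sigma$ is convex, i.e. $\alpha_\Sigma(x+y)\le\alpha_\Sigma(x)+\alpha_\Sigma(y)$. Let $\bar w=(1,w)$, $\mathcal A=\{\bar\mu_0,\dots,\bar\mu_p\}\subset\{1\}\times\mathbb Z^n$, and $L=\{l=(l_0,\dots,l_p)\in\mathbb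 Z^{p+1}:\sum_il_i\bar\mu_i=0\}$. Under the semi-positivity assumption, the sets $\sigma\cap\nabla$, $\sigma$ an $n$-cone of $\Sigma$, are $n$-simplices with vertices $\mu_0$ and the $n$ generators of $\sigma$, and form a triangulation of $\nabla$; $\mathcal T_\Sigma$ denotes this triangulation and the corresponding triangulation of $\mathrm{conv}(\mathcal A)=(1,\nabla)$. $C(\mathcal T_\Sigma)\subset L^*\otimes\mathbb R$ is the cone of $\mathcal T_\Sigma$-piecewise linear convex functions modulo linear functions (a function is identified with its values on $\mathcal A$), and $C(\mathcal T_\Sigma)^\vee$ its dual cone; $l\in C(\mathcal T_\Sigma)^\vee$ below means $l\in L\cap C(\mathcal T_\Sigma)^\vee$. $\mathcal T_\Sigma$ is regular if $C(\mathcal T_\Sigma)$ is full-dimensional, equivalently $C(\mathcal T_\Sigma)^\vee$ is strongly convex. The GKZ $\mathcal A$-hypergeometric system with $\beta=(-1,0,\dots,0)\in\mathbb C^{n+1}$, for functions of $a=(a_0,\dots,a_p)$, consists of $\big(\sum_{i=0}^p\bar\mu_i\,a_i\frac{\partial}{\partial a_i}-\beta\big)\Phi=0$ and $\mathcal D_l\Phi=0$ for $l\in L$, where $\mathcal D_l=\prod_{l_i>0}(\partial/\partial a_i)^{l_i}-\prod_{l_i<0}(\partial/\partial a_i)^{-l_i}$. "Complete set of solutions" means that the $w_i$ form a basis of the solution space. $SR_\Sigma\subset\mathbb C[D_1,\dots,D_p]$ is the Stanley–Reisner ideal of $\Sigma$; $J_\Sigma\subset\mathbb C[D_0,\dots,D_p]$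 is the ideal generated by $SR_\Sigma$ and the linear forms given by the components of $\sum_{i=0}^p\bar\mu_iD_i$. The deformed Gamma series is $$B_\Sigma(a)=\frac1{a_0}\sum_{l\in C(\mathcal T_\Sigma)^\vee}\frac{\Gamma(-l_0-D_0+1)}{\prod_{j=1}^p\Gamma(l_j+D_j+1)}\,a^{l+D},\qquad a^{l+D}=\prod_{i=0}^pa_i^{l_i+D_i},$$ with coefficients expanded as power series in the $D_i$ (and $a_i^{D_i}=e^{D_i\log a_i}$).
   Formalization: The summand of B_Σ(a) carries an extra sign (-1)^{l_0}; without it the printed series is not annihilated by D_l when l_0 is odd (for P^2 and l=(-3,1,1,1), D_l applied to the coefficient of 1 begins 12/a_0^4). *)

theory Defs
  imports "HOL-Complex_Analysis.Complex_Analysis" "HOL-Library.Poly_Mapping"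
begin

section \<open>Rational simplicial fans\<close>

definition integer_lattice :: "(real ^ 'n) set" where
  "integer_lattice = {v. \<forall>i. v $ i \<in> \<int>}"

definition rational_cone :: "(real ^ 'n) set \<Rightarrow> bool" where
  "rational_cone \<sigma> \<longleftrightarrow> (\<exists>G. finite G \<and> G \<subseteq> integer_lattice \<and> \<sigma> = convex_cone hull G)"

definition strongly_convex :: "(real ^ 'n) set \<Rightarrow> bool" where
  "strongly_convex \<sigma> \<longleftrightarrow> (\<forall>x. x \<in> \<sigma> \<and> - x \<in> \<sigma> \<longrightarrow> x = 0)"

text \<open>The library relation \<open>face_of\<close> counts the empty set as a face.\<close>

definition fan :: "(real ^ 'n) set set \<Rightarrow> bool" where
  "fan \<Sigma> \<longleftrightarrow> finite \<Sigma> \<and> \<Sigma> \<noteq> {} \<and>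
     (\<forall>\<sigma>\<in>\<Sigma>. rational_cone \<sigma> \<and> strongly_convex \<sigma>) \<and>
     (\<forall>\<sigma>\<in>\<Sigma>. \<forall>\<tau>. \<tau> face_of \<sigma> \<and> \<tau> \<noteq> {} \<longrightarrow> \<tau> \<in> \<Sigma>) \<and>
     (\<forall>\<sigma>\<in>\<Sigma>. \<forall>\<tau>\<in>\<Sigma>. (\<sigma> \<inter> \<tau>) face_of \<sigma> \<and> (\<sigma> \<inter> \<tau>) face_of \<tau>)"

definition simplicial_fan :: "(real ^ 'n) set set \<Rightarrow> bool" where
  "simplicial_fan \<Sigma> \<longleftrightarrow> fan \<Sigma> \<and> (\<forall>\<sigma>\<in>\<Sigma>. \<exists>B. independent B \<and> \<sigma> = convex_cone hull B)"

definition maximal_cones_full_dimensional :: "(real ^ 'n) set set \<Rightarrow> bool" where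
  "maximal_cones_full_dimensional \<Sigma> \<longleftrightarrow>
     (\<forall>\<sigma>\<in>\<Sigma>. (\<forall>\<tau>\<in>\<Sigma>. \<sigma> \<subseteq> \<tau> \<longrightarrow> \<tau> = \<sigma>) \<longrightarrow> dim \<sigma> = CARD('n))"

definition fan_support :: "(real ^ 'n) set set \<Rightarrow> (real ^ 'n) set" where
  "fan_support \<Sigma> = \<Union>\<Sigma>"

definition ray_generators :: "(real ^ 'n) set set \<Rightarrow> (real ^ 'n) set" where
  "ray_generators \<Sigma> = {v. \<exists>\<rho>\<in>\<Sigma>. dim \<rho> = 1 \<and> v \<in> \<rho> \<inter> integer_lattice \<and> v \<noteq> 0 \<and>
     (\<forall>w \<in> \<rho> \<inter> integer_lattice. \<exists>k::nat. w = real k *\<^sub>R v)}"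

definition c1_function :: "(real ^ 'n) set set \<Rightarrow> (real ^ 'n \<Rightarrow> real) \<Rightarrow> bool" where
  "c1_function \<Sigma> \<alpha> \<longleftrightarrow>
     (\<forall>\<sigma>\<in>\<Sigma>. \<exists>f. linear f \<and> (\<forall>x\<in>\<sigma>. \<alpha> x = f x)) \<and> (\<forall>v\<in>ray_generators \<Sigma>. \<alpha> v = 1)"

text \<open>On a simplicial fan, \<open>c1_function\<close> determines \<open>\<alpha>\<close> uniquely on the support.\<close>

definition c1_semi_positive :: "(real ^ 'n) set set \<Rightarrow> bool" where
  "c1_semi_positive \<Sigma> \<longleftrightarrow> (\<exists>\<alpha>. c1_function \<Sigma> \<alpha> \<and>
     (\<forall>x\<in>fan_support \<Sigma>. \<forall>y\<in>fan_support \<Sigma>. \<alpha> (x + y) \<le> \<alpha> x + \<alpha> y))"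


section \<open>Linear algebra modulo a subspace, and nonsingular toric varieties\<close>

definition pm_scale :: "complex \<Rightarrow> ('k \<Rightarrow>\<^sub>0 complex) \<Rightarrow> ('k::comm_monoid_add \<Rightarrow>\<^sub>0 complex)" where
  "pm_scale c f = Poly_Mapping.single 0 c * f"

text \<open>The classes of \<open>b 0, \<dots>, b (m - 1)\<close> form a basis of the complex vector space \<open>V / W\<close>.\<close>

definition basis_modulo ::
  "('k::comm_monoid_add \<Rightarrow>\<^sub>0 complex) set \<Rightarrow> ('k \<Rightarrow>\<^sub>0 complex) set \<Rightarrow> nat \<Rightarrow>
     (nat \<Rightarrow> ('k \<Rightarrow>\<^sub>0 complex)) \<Rightarrow> bool" where
  "basis_modulo V W m b \<longleftrightarrow>
     (\<forall>i<m. b i \<in> V) \<and>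
     (\<forall>f\<in>V. \<exists>c. f - (\<Sum>i<m. pm_scale (c i) (b i)) \<in> W) \<and>
     (\<forall>c. (\<Sum>i<m. pm_scale (c i) (b i)) \<in> W \<longrightarrow> (\<forall>i<m. c i = 0))"

text \<open>
  The toric variety is glued from the affine charts Spec \<open>\<complex>[S\<^sub>\<sigma>]\<close>, where \<open>S\<^sub>\<sigma>\<close> is the semigroup
  of lattice points of the dual cone.  Closed points of such a chart are the semigroup
  homomorphisms \<open>x\<close> from \<open>S\<^sub>\<sigma>\<close> to \<open>(\<complex>, \<cdot>)\<close>, with maximal ideal \<open>\<mm>\<^sub>x\<close>.  The variety has pure
  dimension \<open>n\<close>, so it is nonsingular iff every cotangent space \<open>\<mm>\<^sub>x / \<mm>\<^sub>x\<^sup>2\<close> has dimension \<open>n\<close>.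
\<close>

definition dual_semigroup :: "(real ^ 'n) set \<Rightarrow> (int ^ 'n) set" where
  "dual_semigroup \<sigma> = {u. \<forall>x\<in>\<sigma>. (\<Sum>i\<in>UNIV. of_int (u $ i) * x $ i) \<ge> 0}"

definition chart_points :: "(real ^ 'n) set \<Rightarrow> (int ^ 'n \<Rightarrow> complex) set" where
  "chart_points \<sigma> = {x. x 0 = 1 \<and>
     (\<forall>u\<in>dual_semigroup \<sigma>. \<forall>v\<in>dual_semigroup \<sigma>. x (u + v) = x u * x v)}"

definition chart_maximal_ideal ::
  "(real ^ 'n) set \<Rightarrow> (int ^ 'n \<Rightarrow> complex) \<Rightarrow> (int ^ 'n \<Rightarrow>\<^sub>0 complex) set" where
  "chart_maximal_ideal \<sigma> x = {f. Poly_Mapping.keys f \<subseteq> dual_semigroup \<sigma> \<and>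
     (\<Sum>u\<in>Poly_Mapping.keys f. Poly_Mapping.lookup f u * x u) = 0}"

definition nonsingular_toric_variety :: "(real ^ 'n) set set \<Rightarrow> bool" where
  "nonsingular_toric_variety \<Sigma> \<longleftrightarrow> (\<forall>\<sigma>\<in>\<Sigma>. \<forall>x\<in>chart_points \<sigma>.
     let \<mm> = chart_maximal_ideal \<sigma> x in
     \<exists>b. basis_modulo \<mm> (module.span pm_scale {f * g | f g. f \<in> \<mm> \<and> g \<in> \<mm>}) CARD('n) b)"


section \<open>The triangulation and its cone of convex piecewise linear functions\<close>

text \<open>
  The rays are enumerated by \<open>\<mu> :: 'p \<Rightarrow> real ^ 'n\<close>; the index set \<open>{0, \<dots>, p}\<close> becomes
  \<open>'p option\<close>, with \<open>None\<close> for the index \<open>0\<close>.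
\<close>

definition mu :: "('p \<Rightarrow> real ^ 'n) \<Rightarrow> 'p option \<Rightarrow> real ^ 'n" where
  "mu \<mu> i = (case i of None \<Rightarrow> 0 | Some j \<Rightarrow> \<mu> j)"

definition mu_bar :: "('p \<Rightarrow> real ^ 'n) \<Rightarrow> 'p option \<Rightarrow> real \<times> (real ^ 'n)" where
  "mu_bar \<mu> i = (1, mu \<mu> i)"

definition relation_lattice :: "('p::finite \<Rightarrow> real ^ 'n) \<Rightarrow> (int ^ 'p option) set" where
  "relation_lattice \<mu> = {l. (\<Sum>i\<in>UNIV. real_of_int (l $ i) *\<^sub>R mu_bar \<mu> i) = 0}"

definition nabla :: "(real ^ 'n) set set \<Rightarrow> (real ^ 'n) set" where
  "nabla \<Sigma> = convex hull (insert 0 (ray_generators \<Sigma>))"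

definition triangulation_cells :: "(real ^ 'n) set set \<Rightarrow> (real ^ 'n) set set" where
  "triangulation_cells \<Sigma> = {\<sigma> \<inter> nabla \<Sigma> | \<sigma>. \<sigma> \<in> \<Sigma> \<and> dim \<sigma> = CARD('n)}"

text \<open>
  Value vectors on \<open>{\<mu>\<^sub>0, \<dots>, \<mu>\<^sub>p}\<close> of convex functions that are affine on every cell; affine
  functions on \<open>\<nabla>\<close> are linear functions on \<open>(1, \<nabla>)\<close>.  This set is the preimage in
  \<open>\<real>\<^bsup>p+1\<^esup>\<close> of the cone \<open>C\<close> in \<open>L\<^sup>* \<otimes> \<real> = \<real>\<^bsup>p+1\<^esup> / {linear functions}\<close>; it contains
  all linear functions, so it is full-dimensional in \<open>\<real>\<^bsup>p+1\<^esup>\<close> iff \<open>C\<close> is in the quotient.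
\<close>

definition pl_cone :: "(real ^ 'n) set set \<Rightarrow> ('p::finite \<Rightarrow> real ^ 'n) \<Rightarrow> (real ^ 'p option) set" where
  "pl_cone \<Sigma> \<mu> = {c. \<exists>g. convex_on (nabla \<Sigma>) g \<and>
     (\<forall>S\<in>triangulation_cells \<Sigma>. \<exists>f b. linear f \<and> (\<forall>x\<in>S. g x = f x + b)) \<and>
     (\<forall>i. c $ i = g (mu \<mu> i))}"

definition regular_triangulation :: "(real ^ 'n) set set \<Rightarrow> ('p::finite \<Rightarrow> real ^ 'n) \<Rightarrow> bool" where
  "regular_triangulation \<Sigma> \<mu> \<longleftrightarrow> dim (pl_cone \<Sigma> \<mu>) = CARD('p option)"

definition dual_cone_lattice ::
  "(real ^ 'n) set set \<Rightarrow> ('p::finite \<Rightarrow> real ^ 'n) \<Rightarrow> (int ^ 'p option) set" where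
  "dual_cone_lattice \<Sigma> \<mu> = {l \<in> relation_lattice \<mu>.
     \<forall>c\<in>pl_cone \<Sigma> \<mu>. (\<Sum>i\<in>UNIV. real_of_int (l $ i) * c $ i) \<ge> 0}"


section \<open>The GKZ system\<close>

definition holomorphic_Cn :: "(complex ^ 'i \<Rightarrow> complex) \<Rightarrow> (complex ^ 'i) set \<Rightarrow> bool" where
  "holomorphic_Cn \<Phi> U \<longleftrightarrow>
     (\<forall>a\<in>U. \<exists>F. (\<Phi> has_derivative F) (at a) \<and> (\<forall>c v. F (c *s v) = c * F v))"

definition partial :: "'i \<Rightarrow> (complex ^ 'i \<Rightarrow> complex) \<Rightarrow> (complex ^ 'i \<Rightarrow> complex)" where
  "partial i \<Phi> a = deriv (\<lambda>z. \<Phi> (\<chi> j. if j = i then z else a $ j)) (a $ i)"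

text \<open>Partial derivatives of a function holomorphic on an open set commute there, so the choice
  of the order in which they are taken does not matter.\<close>

definition index_list :: "'i::finite list" where
  "index_list = (SOME is. distinct is \<and> set is = UNIV)"

definition multi_partial ::
  "('i::finite \<Rightarrow> nat) \<Rightarrow> (complex ^ 'i \<Rightarrow> complex) \<Rightarrow> (complex ^ 'i \<Rightarrow> complex)" where
  "multi_partial k \<Phi> = foldr (\<lambda>i. partial i ^^ k i) index_list \<Phi>"

definition box_operator ::
  "int ^ 'i::finite \<Rightarrow> (complex ^ 'i \<Rightarrow> complex) \<Rightarrow> (complex ^ 'i \<Rightarrow> complex)" where
  "box_operator l \<Phi> a =
     multi_partial (\<lambda>i. nat (l $ i)) \<Phi> a - multi_partial (\<lambda>i. nat (- l $ i)) \<Phi> a"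

definition gkz_solution ::
  "('p::finite \<Rightarrow> real ^ 'n) \<Rightarrow> complex \<times> (complex ^ 'n) \<Rightarrow> (complex ^ 'p option) set \<Rightarrow>
     (complex ^ 'p option \<Rightarrow> complex) \<Rightarrow> bool" where
  "gkz_solution \<mu> \<beta> U \<Phi> \<longleftrightarrow> holomorphic_Cn \<Phi> U \<and> (\<forall>a\<in>U.
     (\<Sum>i\<in>UNIV. of_real (fst (mu_bar \<mu> i)) * (a $ i * partial i \<Phi> a)) - fst \<beta> * \<Phi> a = 0 \<and>
     (\<forall>k. (\<Sum>i\<in>UNIV. of_real (snd (mu_bar \<mu> i) $ k) * (a $ i * partial i \<Phi> a))
            - snd \<beta> $ k * \<Phi> a = 0) \<and>
     (\<forall>l\<in>relation_lattice \<mu>. box_operator l \<Phi> a = 0))"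

definition complete_gkz_solutions ::
  "('p::finite \<Rightarrow> real ^ 'n) \<Rightarrow> complex \<times> (complex ^ 'n) \<Rightarrow> (complex ^ 'p option) set \<Rightarrow> nat \<Rightarrow>
     (nat \<Rightarrow> complex ^ 'p option \<Rightarrow> complex) \<Rightarrow> bool" where
  "complete_gkz_solutions \<mu> \<beta> U m w \<longleftrightarrow>
     (\<forall>i<m. gkz_solution \<mu> \<beta> U (w i)) \<and>
     (\<forall>c. (\<forall>a\<in>U. (\<Sum>i<m. c i * w i a) = 0) \<longrightarrow> (\<forall>i<m. c i = 0)) \<and>
     (\<forall>\<Phi>. gkz_solution \<mu> \<beta> U \<Phi> \<longrightarrow> (\<exists>c. \<forall>a\<in>U. \<Phi> a = (\<Sum>i<m. c i * w i a)))"


section \<open>The ideal and congruence of power series\<close>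

type_synonym 'p monomial = "'p option \<Rightarrow>\<^sub>0 nat"
type_synonym 'p cpoly = "'p monomial \<Rightarrow>\<^sub>0 complex"

definition D_var :: "'p option \<Rightarrow> 'p cpoly" where
  "D_var i = Poly_Mapping.single (Poly_Mapping.single i 1) 1"

definition stanley_reisner_generators ::
  "(real ^ 'n) set set \<Rightarrow> ('p::finite \<Rightarrow> real ^ 'n) \<Rightarrow> 'p cpoly set" where
  "stanley_reisner_generators \<Sigma> \<mu> =
     {\<Prod>j\<in>S. D_var (Some j) | S. \<not> (\<exists>\<sigma>\<in>\<Sigma>. \<mu> ` S \<subseteq> \<sigma>)}"

definition linear_forms :: "('p::finite \<Rightarrow> real ^ 'n) \<Rightarrow> 'p cpoly set" where
  "linear_forms \<mu> =
     {\<Sum>i\<in>UNIV. pm_scale (of_real (fst (mu_bar \<mu> i))) (D_var i)} \<union>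
     {\<Sum>i\<in>UNIV. pm_scale (of_real (snd (mu_bar \<mu> i) $ k)) (D_var i) | k. True}"

definition J_ideal :: "(real ^ 'n) set set \<Rightarrow> ('p::finite \<Rightarrow> real ^ 'n) \<Rightarrow> 'p cpoly set" where
  "J_ideal \<Sigma> \<mu> = module.span (*) (stanley_reisner_generators \<Sigma> \<mu> \<union> linear_forms \<mu>)"

definition total_degree :: "('p::finite) monomial \<Rightarrow> nat" where
  "total_degree k = (\<Sum>i\<in>UNIV. Poly_Mapping.lookup k i)"

definition homogeneous :: "('p::finite) cpoly \<Rightarrow> bool" where
  "homogeneous f \<longleftrightarrow> (\<exists>d. \<forall>k\<in>Poly_Mapping.keys f. total_degree k = d)"

definition homogeneous_quotient_basis ::
  "('p::finite) cpoly set \<Rightarrow> nat \<Rightarrow> (nat \<Rightarrow> 'p cpoly) \<Rightarrow> bool" where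
  "homogeneous_quotient_basis J m \<alpha> \<longleftrightarrow> (\<forall>i<m. homogeneous (\<alpha> i)) \<and> basis_modulo UNIV J m \<alpha>"

text \<open>A formal power series in the \<open>D\<^sub>i\<close> is given by its coefficient function.\<close>

definition homogeneous_part :: "nat \<Rightarrow> (('p::finite) monomial \<Rightarrow> complex) \<Rightarrow> 'p cpoly" where
  "homogeneous_part d F = (\<Sum>k | total_degree k = d. Poly_Mapping.single k (F k))"

text \<open>For a homogeneous ideal \<open>J\<close>, the difference of a power series and a polynomial lies in
  \<open>J\<cdot>\<complex>[[D]]\<close> iff all its homogeneous parts lie in \<open>J\<close>.\<close>

definition series_cong_mod ::
  "('p::finite) cpoly set \<Rightarrow> ('p monomial \<Rightarrow> complex) \<Rightarrow> 'p cpoly \<Rightarrow> bool" where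
  "series_cong_mod J F P \<longleftrightarrow>
     (\<forall>d. homogeneous_part d F - homogeneous_part d (Poly_Mapping.lookup P) \<in> J)"


section \<open>The deformed Gamma series\<close>

text \<open>
  The factor of the summand for \<open>l\<close> that involves \<open>D\<^sub>i\<close>, as a function of \<open>z = D\<^sub>i\<close>, with the
  principal branch of the logarithm in \<open>powr\<close>; \<open>rGamma\<close> is the entire function \<open>1 / \<Gamma>\<close>.

  The factor \<open>(-1)\<^bsup>l\<^sub>0\<^esup>\<close> is needed because \<open>\<partial>/\<partial>a\<^sub>0\<close> maps
  \<open>\<Gamma>(1 - l\<^sub>0 - D\<^sub>0) a\<^sub>0\<^bsup>l\<^sub>0 + D\<^sub>0 - 1\<^esup>\<close> to
  \<open>- \<Gamma>(1 - (l\<^sub>0 - 1) - D\<^sub>0) a\<^sub>0\<^bsup>(l\<^sub>0 - 1) + D\<^sub>0 - 1\<^esup>\<close>.  In a formula printed without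
  it, \<open>a\<^sub>0\<close> has to stand for \<open>- a\<^sub>0\<close>.  In the coordinates of \<open>box_operator\<close> the
  unsigned series is not a solution: for the projective plane and \<open>l = (-3, 1, 1, 1)\<close> its
  constant term begins \<open>1/a\<^sub>0 + 6 a\<^sub>1 a\<^sub>2 a\<^sub>3 / a\<^sub>0\<^sup>4\<close>, while
  \<open>\<partial>\<^sub>1 \<partial>\<^sub>2 \<partial>\<^sub>3\<close> of the second summand is \<open>6 / a\<^sub>0\<^sup>4\<close> and \<open>\<partial>\<^sub>0\<^sup>3\<close> of the
  first is \<open>- 6 / a\<^sub>0\<^sup>4\<close>.
\<close>

definition gamma_factor ::
  "complex ^ 'p option \<Rightarrow> int ^ 'p option \<Rightarrow> ('p::finite) option \<Rightarrow> complex \<Rightarrow> complex" where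
  "gamma_factor a l i z = (case i of
       None \<Rightarrow> (-1) powi (l $ None) * Gamma (- of_int (l $ None) - z + 1)
     | Some j \<Rightarrow> rGamma (of_int (l $ Some j) + z + 1))
     * (a $ i) powr (of_int (l $ i) + z)"

text \<open>Since every factor involves only one of the \<open>D\<^sub>i\<close>, the coefficient of a monomial in the
  product is the product of the univariate Taylor coefficients.\<close>

definition gamma_term ::
  "complex ^ 'p option \<Rightarrow> ('p::finite) monomial \<Rightarrow> int ^ 'p option \<Rightarrow> complex" where
  "gamma_term a k l =
     (\<Prod>i\<in>UNIV. fps_nth (fps_expansion (gamma_factor a l i) 0) (Poly_Mapping.lookup k i))"

definition gamma_series ::
  "(real ^ 'n) set set \<Rightarrow> ('p::finite \<Rightarrow> real ^ 'n) \<Rightarrow> complex ^ 'p option \<Rightarrow>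
     ('p monomial \<Rightarrow> complex)" where
  "gamma_series \<Sigma> \<mu> a k = 1 / (a $ None) * infsum (gamma_term a k) (dual_cone_lattice \<Sigma> \<mu>)"

definition gamma_series_converges ::
  "(real ^ 'n) set set \<Rightarrow> ('p::finite \<Rightarrow> real ^ 'n) \<Rightarrow> complex ^ 'p option \<Rightarrow> bool" where
  "gamma_series_converges \<Sigma> \<mu> a \<longleftrightarrow>
     (\<forall>k. gamma_term a k summable_on dual_cone_lattice \<Sigma> \<mu>)"

text \<open>
  The large radius limit attached to the triangulation is approached when \<open>(- log |a\<^sub>i|)\<^sub>i\<close> tends
  to infinity inside the cone of convex piecewise linear functions.
\<close>

definition near_large_radius_limit ::
  "(real ^ 'n) set set \<Rightarrow> ('p::finite \<Rightarrow> real ^ 'n) \<Rightarrow> (complex ^ 'p option) set \<Rightarrow> bool" where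
  "near_large_radius_limit \<Sigma> \<mu> U \<longleftrightarrow> (\<exists>v. \<forall>a. (\<forall>i. a $ i \<notin> \<real>\<^sub>\<le>\<^sub>0) \<and>
     (\<chi> i. - ln (cmod (a $ i))) - v \<in> pl_cone \<Sigma> \<mu> \<longrightarrow> a \<in> U)"

end

theory Submission
  imports Defs
begin

text \<open>
  Write the Gamma series as \<open>\<Sum>\<^sub>k S\<^sub>k(a) D\<^sup>k\<close>.  A linear functional \<open>\<phi>\<close> on the polynomials that
  vanishes on the ideal \<open>J\<close> turns it into the function \<open>w\<^sub>\<phi> = \<Sum>\<^sub>k \<phi>(D\<^sup>k) S\<^sub>k\<close>, a finite sum because
  \<open>J\<close> contains all monomials of degree greater than \<open>p\<close> (\<open>J_high_degree\<close>).  The coefficients of the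
  series with respect to a homogeneous basis of the quotient are the \<open>w\<^sub>\<phi>\<close> for the coordinate
  functionals of that basis (\<open>quotient_coordinates\<close>).

  The functional equation of \<open>\<Gamma>\<close> says that \<open>\<partial>/\<partial>a\<^sub>i\<close> maps the summand with exponent \<open>m\<close> to the one
  with exponent \<open>m - e\<^sub>i\<close>.  Hence \<open>\<partial>\<^sup>\<kappa>\<close> of the series is the sum over the translate \<open>K - \<kappa>\<close> of the
  dual cone \<open>K\<close>, and the two sides of a box equation are sums over two translates of \<open>K\<close>.  A summand
  that occurs on one side only has an exponent \<open>m\<close> for which \<open>{j. m\<^sub>j < 0}\<close> is not a face: a relation
  whose negative part lies in a cone belongs to \<open>K\<close>, since a convex piecewise linear function lies
  above each of its affine pieces (\<open>in_dual_cone_if_negative_part_in_cone\<close>).  As \<open>1 / \<Gamma>\<close> vanishes at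
  the nonpositive integers, that summand is divisible by the Stanley-Reisner monomial of this set,
  and \<open>\<phi>\<close> kills it.  The Euler equations hold because \<open>\<phi>\<close> kills the linear forms.

  Regularity supplies a point \<open>v\<^sub>0\<close> whose pairing with \<open>l \<in> K\<close> is at least \<open>\<epsilon> |l|\<close> in the \<open>1\<close>-norm.
  The entries of \<open>l\<close> sum to zero, so the quotient of Gamma values grows only exponentially in \<open>|l|\<close>,
  and the series converges where \<open>- log |a|\<close> lies in a translate of the interior of the cone.

  Independence: with \<open>a\<^sub>i = exp (- x\<^sub>i)\<close> and \<open>x\<close> tending to infinity in direction \<open>w\<close>, the summand
  \<open>l = 0\<close> dominates.  It is a polynomial in \<open>x\<close>, and its leading form determines \<open>\<phi>\<close> in the highest
  degree in which \<open>\<phi>\<close> does not vanish (\<open>wsol_independent\<close>).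

  Completeness: for a solution \<open>\<Phi>\<close> and a point \<open>a\<close> let \<open>\<psi>(D\<^sup>\<kappa>) = a\<^sup>\<kappa> \<partial>\<^sup>\<kappa>\<Phi>(a)\<close>.  By the Euler
  equations \<open>\<psi>\<close> maps a multiple of a linear form to a multiple of a value of \<open>\<psi>\<close> in lower degree.  If
  the variety is nonsingular and \<open>S\<close> is not a face, then a box equation relates the monomial of \<open>S\<close> to
  one of the same degree that is supported on a cone (\<open>nonface_reduction\<close>), with a factor \<open>a\<^sup>l\<close> that is
  as small as desired when \<open>a\<close> is close to the large radius limit.  So \<open>\<psi>\<close> is nearly a functional on the
  quotient ring: if it vanishes on a basis of the quotient, then a bound that is uniform in the
  degree forces \<open>\<psi> = 0\<close> (\<open>bounded_reduction\<close>, \<open>jets_determined_by_basis\<close>), and \<open>\<Phi> = 0\<close> by the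
  identity theorem.  Thus the solution space is no larger than the quotient ring.
\<close>

(* The dollar sign is needed for the components of vectors. *)
no_notation fps_nth (infixl "$" 75)

section \<open>Holomorphic functions of several variables\<close>

lemma linear_times_vec: "linear (\<lambda>t::complex. t *s (h :: complex ^ 'i))"
  by (rule linearI) (simp_all add: vec_eq_iff algebra_simps)

text \<open>A complex linear map is determined by its values on the axes; this turns the existential definition of holomorphy into a formula for the derivative.\<close>

lemma complex_linear_expand:
  fixes F :: "complex ^ 'i::finite \<Rightarrow> complex"
  assumes "linear F" "\<And>c v. F (c *s v) = c * F v"
  shows "F h = (\<Sum>i\<in>UNIV. h $ i * F (axis i 1))"
proof -
  have "F h = F (\<Sum>i\<in>UNIV. h $ i *s axis i 1)" by (simp add: basis_expansion)
  also have "\<dots> = (\<Sum>i\<in>UNIV. h $ i * F (axis i 1))"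
    using assms by (simp add: linear_sum)
  finally show ?thesis .
qed

lemma has_derivative_along_line:
  fixes F :: "complex ^ 'i::finite \<Rightarrow> complex"
  assumes F: "(\<Phi> has_derivative F) (at (b + t *s h))" and lin: "\<And>c v. F (c *s v) = c * F v"
  shows "((\<lambda>t. \<Phi> (b + t *s h)) has_field_derivative F h) (at t)"
proof -
  have "((\<lambda>t. b + t *s h) has_derivative (\<lambda>t. t *s h)) (at t)"
    by (rule has_derivative_eq_rhs[OF has_derivative_add[OF has_derivative_const
        bounded_linear_imp_has_derivative]])
      (simp_all add: linear_times_vec linear_linear[symmetric] linear_conv_bounded_linear[symmetric])
  from diff_chain_at[OF this, of \<Phi> F] F
  have "((\<lambda>t. \<Phi> (b + t *s h)) has_derivative (\<lambda>s. F (s *s h))) (at t)"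
    by (simp add: o_def)
  then show ?thesis by (simp add: has_field_derivative_def lin mult.commute[of _ "F h"])
qed

lemma update_eq_line: "(\<chi> j. if j = i then z else a $ j) = a + (z - a $ i) *s axis i (1::complex)"
  by (auto simp: vec_eq_iff axis_def)

lemma has_derivative_partial:
  fixes F :: "complex ^ 'i::finite \<Rightarrow> complex"
  assumes F: "(\<Phi> has_derivative F) (at a)" and lin: "\<And>c v. F (c *s v) = c * F v"
  shows "partial i \<Phi> a = F (axis i 1)"
proof -
  let ?b = "a - a $ i *s axis i 1"
  have eq: "(\<chi> j. if j = i then z else a $ j) = ?b + z *s axis i 1" for z
    unfolding update_eq_line by (simp add: vec_eq_iff algebra_simps)
  have "((\<lambda>z. \<Phi> (?b + z *s axis i 1)) has_field_derivative F (axis i 1)) (at (a $ i))"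
    by (rule has_derivative_along_line[OF _ lin]) (use F in simp)
  then show ?thesis unfolding partial_def eq by (rule DERIV_imp_deriv)
qed

lemma holomorphic_Cn_has_derivative:
  fixes \<Phi> :: "complex ^ 'i::finite \<Rightarrow> complex"
  assumes "holomorphic_Cn \<Phi> U" "a \<in> U"
  shows "(\<Phi> has_derivative (\<lambda>h. \<Sum>i\<in>UNIV. h $ i * partial i \<Phi> a)) (at a)"
proof -
  obtain F where F: "(\<Phi> has_derivative F) (at a)" "\<And>c v. F (c *s v) = c * F v"
    using assms unfolding holomorphic_Cn_def by blast
  have "F = (\<lambda>h. \<Sum>i\<in>UNIV. h $ i * partial i \<Phi> a)"
    unfolding has_derivative_partial[OF F]
    by (rule ext) (rule complex_linear_expand[OF has_derivative_linear[OF F(1)] F(2)])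
  with F(1) show ?thesis by (simp only:)
qed

lemma sum_axis [simp]: "(\<Sum>j\<in>UNIV. axis i (1::complex) $ j * f j) = f (i::'i::finite)"
proof -
  have "axis i (1::complex) $ j * f j = (if j = i then f j else 0)" for j
    by (simp add: axis_def)
  then show ?thesis by simp
qed

lemma holomorphic_CnI:
  fixes \<Phi> :: "complex ^ 'i::finite \<Rightarrow> complex"
  assumes "\<And>a. a \<in> U \<Longrightarrow> (\<Phi> has_derivative (\<lambda>h. \<Sum>i\<in>UNIV. h $ i * D a i)) (at a)"
  shows "holomorphic_Cn \<Phi> U" "a \<in> U \<Longrightarrow> partial i \<Phi> a = D a i"
proof -
  have lin: "(\<Sum>i\<in>UNIV. (c *s v) $ i * D a i) = c * (\<Sum>i\<in>UNIV. v $ i * D a i)" for c v a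
    by (simp add: sum_distrib_left mult.assoc)
  show "holomorphic_Cn \<Phi> U"
    unfolding holomorphic_Cn_def using assms lin by blast
  show "partial i \<Phi> a = D a i" if "a \<in> U"
    unfolding has_derivative_partial[OF assms[OF that] lin]
    by (rule sum_axis)
qed

lemma holomorphic_Cn_line:
  fixes \<Phi> :: "complex ^ 'i::finite \<Rightarrow> complex"
  assumes "holomorphic_Cn \<Phi> U" "b + t *s h \<in> U"
  shows "((\<lambda>t. \<Phi> (b + t *s h)) has_field_derivative (\<Sum>i\<in>UNIV. h $ i * partial i \<Phi> (b + t *s h))) (at t)"
  by (rule has_derivative_along_line[OF holomorphic_Cn_has_derivative[OF assms]])
    (simp add: sum_distrib_left mult.assoc)

lemma norm_times_vec_le: "norm (t *s (h :: complex ^ 'i::finite)) = norm t * norm h"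
  by (simp add: norm_vec_def norm_mult L2_set_right_distrib)

lemma norm_times_axis [simp]: "norm (t *s axis (i::'i::finite) (1::complex)) = norm t"
proof -
  have "norm (t *s axis i 1) = sqrt (\<Sum>j\<in>UNIV. if j = i then (norm t)\<^sup>2 else 0)"
    unfolding norm_vec_def L2_set_def by (intro arg_cong[where f = sqrt] sum.cong) (auto simp: axis_def)
  then show ?thesis by simp
qed

lemma dist_line [simp]: "dist a (a + t *s axis (i::'i::finite) (1::complex)) = norm t"
  by (subst dist_commute) (simp only: dist_norm add_diff_cancel_left' norm_times_axis)

lemma partial_cong:
  fixes \<Phi> :: "complex ^ 'i::finite \<Rightarrow> complex"
  assumes U: "open U" "a \<in> U" and eq: "\<And>a. a \<in> U \<Longrightarrow> \<Phi> a = \<Psi> a"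
  shows "partial i \<Phi> a = partial i \<Psi> a"
  unfolding partial_def update_eq_line
proof (rule deriv_cong_ev[OF _ refl])
  obtain r where r: "r > 0" "ball a r \<subseteq> U" using U openE by blast
  have "a + (z - a $ i) *s axis i 1 \<in> U" if "dist z (a $ i) < r" for z
  proof (rule subsetD[OF r(2)])
    show "a + (z - a $ i) *s axis i 1 \<in> ball a r"
      using that unfolding mem_ball dist_line by (simp only: dist_norm)
  qed
  then show "\<forall>\<^sub>F z in nhds (a $ i). \<Phi> (a + (z - a $ i) *s axis i 1) = \<Psi> (a + (z - a $ i) *s axis i 1)"
    unfolding eventually_nhds_metric using r(1) eq by blast
qed

context
  fixes \<Phi> :: "complex ^ 'i::finite \<Rightarrow> complex" and U
  assumes U: "open U" and hol: "holomorphic_Cn \<Phi> U"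
begin

lemma holomorphic_Cn_continuous: "continuous_on U \<Phi>"
  by (meson continuous_at_imp_continuous_on has_derivative_continuous hol holomorphic_Cn_has_derivative)

text \<open>Cauchy's inequality on a disc in direction \<open>i\<close>: closeness of two functions on the disc gives closeness of their derivatives at its centre.\<close>

lemma line_deriv_estimate:
  assumes "\<And>t. norm t \<le> r \<Longrightarrow> b + t *s axis i 1 \<in> U \<and> norm (\<Phi> (b + t *s axis i 1) - \<Psi> t) \<le> B"
    and \<Psi>: "\<And>t. norm t \<le> r \<Longrightarrow> (\<Psi> has_field_derivative \<Psi>' t) (at t)" and r: "r > 0"
  shows "norm (partial i \<Phi> b - \<Psi>' 0) \<le> B / r"
proof -
  let ?g = "\<lambda>t. \<Phi> (b + t *s axis i 1) - \<Psi> t"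
  have d: "(?g has_field_derivative (partial i \<Phi> (b + t *s axis i 1) - \<Psi>' t)) (at t)" if "norm t \<le> r" for t
    using DERIV_diff[OF holomorphic_Cn_line[OF hol, of b t "axis i 1"] \<Psi>[OF that]] assms(1)[OF that]
    by simp
  have "norm ((deriv ^^ 1) ?g 0) \<le> fact 1 * B / r ^ 1"
  proof (rule Cauchy_inequality)
    show "?g holomorphic_on ball 0 r"
      unfolding holomorphic_on_open[OF open_ball] by (intro ballI exI, rule d) simp
    show "continuous_on (cball 0 r) ?g"
      by (intro continuous_at_imp_continuous_on ballI, rule DERIV_isCont, rule d) simp
  qed (use assms in auto)
  moreover have "deriv ?g 0 = partial i \<Phi> b - \<Psi>' 0"
    using DERIV_imp_deriv[OF d[of 0]] r by simp
  ultimately show ?thesis by simp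
qed

text \<open>Mere differentiability is assumed, so continuity of the partial derivatives has to be proved: near \<open>a\<close> the function is uniformly close to its translate, and Cauchy estimates in direction \<open>i\<close> transfer this to the derivative.\<close>

lemma partial_continuous: "continuous_on U (partial i \<Phi>)"
proof (rule continuous_at_imp_continuous_on, rule ballI)
  fix a assume "a \<in> U"
  then obtain r0 where r0: "r0 > 0" "cball a r0 \<subseteq> U" using U open_contains_cball by metis
  define r where "r = r0 / 2"
  have r: "r > 0" "cball a (2 * r) \<subseteq> U" using r0 by (auto simp: r_def)
  have "uniformly_continuous_on (cball a (2 * r)) \<Phi>"
    using compact_uniformly_continuous[OF continuous_on_subset[OF holomorphic_Cn_continuous r(2)] compact_cball] .
  note unif = this[unfolded uniformly_continuous_on_def, rule_format]
  show "isCont (partial i \<Phi>) a"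
    unfolding continuous_at_eps_delta dist_norm
  proof (intro allI impI)
    fix e :: real assume e: "e > 0"
    with r(1) have "e * r / 2 > 0" by simp
    from unif[OF this] obtain d where d: "d > 0"
      "\<And>x x'. x \<in> cball a (2 * r) \<Longrightarrow> x' \<in> cball a (2 * r) \<Longrightarrow> dist x' x < d \<Longrightarrow> dist (\<Phi> x') (\<Phi> x) < e * r / 2"
      by blast
    show "\<exists>d>0. \<forall>x'. norm (x' - a) < d \<longrightarrow> norm (partial i \<Phi> x' - partial i \<Phi> a) < e"
    proof (intro exI[of _ "min d r"] conjI allI impI)
      fix b assume b: "norm (b - a) < min d r"
      have in1: "a + t *s axis i 1 \<in> cball a (2 * r)" "b + t *s axis i 1 \<in> cball a (2 * r)" if "norm t \<le> r" for t
      proof -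
        have n: "norm (t *s (axis i 1 :: complex ^ 'i)) \<le> r" using that by simp
        then show "a + t *s axis i 1 \<in> cball a (2 * r)" using r by simp
        have "norm (a - (b + t *s axis i 1)) \<le> norm (a - b) + norm (t *s (axis i 1 :: complex ^ 'i))"
          using norm_triangle_ineq4[of "a - b" "t *s axis i 1"] by (simp add: algebra_simps)
        then show "b + t *s axis i 1 \<in> cball a (2 * r)" using b n by (simp add: dist_norm norm_minus_commute)
      qed
      have "norm (partial i \<Phi> b - partial i \<Phi> (a + 0 *s axis i 1)) \<le> (e * r / 2) / r"
      proof (rule line_deriv_estimate[where \<Psi> = "\<lambda>t. \<Phi> (a + t *s axis i 1)" and \<Psi>' = "\<lambda>t. partial i \<Phi> (a + t *s axis i 1)"])
        fix t :: complex assume t: "norm t \<le> r"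
        have "dist (\<Phi> (b + t *s axis i 1)) (\<Phi> (a + t *s axis i 1)) < e * r / 2"
          by (rule d(2)) (use in1[OF t] b in \<open>auto simp: dist_norm\<close>)
        then show "b + t *s axis i 1 \<in> U \<and> norm (\<Phi> (b + t *s axis i 1) - \<Phi> (a + t *s axis i 1)) \<le> e * r / 2"
          using in1[OF t] r(2) by (auto simp: dist_norm)
        show "((\<lambda>t. \<Phi> (a + t *s axis i 1)) has_field_derivative partial i \<Phi> (a + t *s axis i 1)) (at t)"
          using holomorphic_Cn_line[OF hol subsetD[OF r(2) in1(1)[OF t]]] by simp
      qed (use r in simp)
      also have "(e * r / 2) / r < e" using e r by simp
      finally show "norm (partial i \<Phi> b - partial i \<Phi> a) < e" by simp
    qed (use d r in auto)
  qed
qed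

text \<open>The mean value inequality along the segment from \<open>b\<close> to \<open>b + h\<close>, after subtracting the linear part.\<close>

lemma linear_approximation:
  assumes "\<And>t. norm t \<le> 1 \<Longrightarrow> b + t *s h \<in> U"
    and "\<And>t j. norm t \<le> 1 \<Longrightarrow> norm (partial j \<Phi> (b + t *s h) - partial j \<Phi> b) \<le> e"
  shows "norm (\<Phi> (b + h) - \<Phi> b - (\<Sum>j\<in>UNIV. h $ j * partial j \<Phi> b)) \<le> CARD('i) * (e::real) * norm h"
proof -
  let ?D = "\<Sum>j\<in>UNIV. h $ j * partial j \<Phi> b"
  let ?g = "\<lambda>t. \<Phi> (b + t *s h) - t * ?D"
  have "norm (?g 1 - ?g 0) \<le> (CARD('i) * e * norm h) * norm (1 - 0 :: complex)"
  proof (rule field_differentiable_bound)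
    fix t :: complex assume t: "t \<in> cball 0 1"
    then have t': "norm t \<le> 1" by simp
    show "(?g has_field_derivative ((\<Sum>j\<in>UNIV. h $ j * partial j \<Phi> (b + t *s h)) - ?D)) (at t within cball 0 1)"
      by (rule DERIV_subset[OF DERIV_diff[OF holomorphic_Cn_line[OF hol assms(1)[OF t']] DERIV_cmult_Id[of ?D, unfolded mult.commute[of ?D]]]])
         simp
    have "norm ((\<Sum>j\<in>UNIV. h $ j * partial j \<Phi> (b + t *s h)) - ?D) =
       norm (\<Sum>j\<in>UNIV. h $ j * (partial j \<Phi> (b + t *s h) - partial j \<Phi> b))"
      by (simp add: sum_subtractf algebra_simps)
    also have "\<dots> \<le> (\<Sum>j\<in>(UNIV :: 'i set). norm h * e)"
      by (rule sum_norm_le) (auto simp: norm_mult intro!: mult_mono Finite_Cartesian_Product.norm_nth_le assms(2)[OF t'])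
    finally show "norm ((\<Sum>j\<in>UNIV. h $ j * partial j \<Phi> (b + t *s h)) - ?D) \<le> CARD('i) * e * norm h"
      by (simp add: algebra_simps)
  qed auto
  then show ?thesis by (simp add: algebra_simps)
qed

lemma uniform_partial_continuity:
  assumes "cball a r \<subseteq> U" "e > 0"
  shows "\<exists>d>0. \<forall>x\<in>cball a r. \<forall>y\<in>cball a r. dist x y < d \<longrightarrow> (\<forall>j. norm (partial j \<Phi> x - partial j \<Phi> y) < e)"
proof -
  have "\<exists>d>0. \<forall>x\<in>cball a r. \<forall>y\<in>cball a r. dist x y < d \<longrightarrow> norm (partial j \<Phi> x - partial j \<Phi> y) < e" for j
    using compact_uniformly_continuous[OF continuous_on_subset[OF partial_continuous assms(1)] compact_cball]
      assms(2) unfolding uniformly_continuous_on_def dist_norm by (metis norm_minus_commute)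
  then obtain d where d: "\<And>j. d j > 0"
    "\<And>j x y. x \<in> cball a r \<Longrightarrow> y \<in> cball a r \<Longrightarrow> dist x y < d j \<Longrightarrow> norm (partial j \<Phi> x - partial j \<Phi> y) < e"
    by metis
  have "Min (range d) > 0" using d by (simp add: Min_gr_iff)
  then show ?thesis using d(2) by (intro exI[of _ "Min (range d)"]) (auto simp: Min_gr_iff)
qed

lemma line_shift:
  assumes "((\<lambda>\<zeta>. \<Psi> ((a + t *s e) + \<zeta> *s e)) has_field_derivative D) (at 0)"
  shows "((\<lambda>s. \<Psi> (a + s *s e)) has_field_derivative D) (at t)"
proof -
  have "((\<lambda>s. \<Psi> ((a + t *s e) + (s - t) *s e)) has_field_derivative D * 1) (at t)"
    by (rule DERIV_chain2[where g = "\<lambda>s. s - t" and f = "\<lambda>\<zeta>. \<Psi> ((a + t *s e) + \<zeta> *s e)"])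
      (use assms in \<open>auto intro!: derivative_eq_intros\<close>)
  moreover have "(a + t *s e) + (s - t) *s e = a + s *s e" for s
    by (simp add: vec_eq_iff algebra_simps)
  ultimately show ?thesis by simp
qed

lemma partial_line:
  fixes \<Psi> :: "complex ^ 'i \<Rightarrow> complex"
  assumes "((\<lambda>\<zeta>. \<Psi> (a + \<zeta> *s axis i 1)) has_field_derivative D) (at 0)"
  shows "partial i \<Psi> a = D"
proof -
  have "((\<lambda>z. \<Psi> (a + (z - a $ i) *s axis i 1)) has_field_derivative D * 1) (at (a $ i))"
    by (rule DERIV_chain2[where g = "\<lambda>z. z - a $ i" and f = "\<lambda>\<zeta>. \<Psi> (a + \<zeta> *s axis i 1)"])
      (use assms in \<open>auto intro!: derivative_eq_intros\<close>)
  then show ?thesis unfolding partial_def update_eq_line by (simp add: DERIV_imp_deriv)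
qed

text \<open>The difference quotients of \<open>\<Phi>\<close> in direction \<open>j\<close> converge to the partial derivative locally uniformly along the line in direction \<open>i\<close>.  By the theorem of Weierstrass the limit is differentiable and the derivatives converge; this gives both the holomorphy of partial derivatives and the symmetry of mixed ones.\<close>

lemma mixed_partial_limit:
  assumes a: "a \<in> U"
  shows "\<exists>D t. ((\<lambda>\<zeta>. partial j \<Phi> (a + \<zeta> *s axis i 1)) has_field_derivative D) (at 0) \<and>
    (\<forall>n::nat. t n \<noteq> 0) \<and> t \<longlonglongrightarrow> 0 \<and>
    (\<lambda>n. (partial i \<Phi> (a + t n *s axis j 1) - partial i \<Phi> a) / t n) \<longlonglongrightarrow> D"
proof -
  obtain r0 where r0: "r0 > 0" "cball a r0 \<subseteq> U" using U a open_contains_cball by metis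
  define r where "r = r0 / 2"
  have r: "r > 0" "cball a (2 * r) \<subseteq> U" using r0 by (auto simp: r_def)
  define t where "t n = complex_of_real (r / Suc n)" for n
  have tn: "norm (t n) = r / Suc n" for n using r by (simp add: t_def norm_divide del: of_nat_Suc)
  have t0: "t n \<noteq> 0" for n using tn[of n] r by (metis divide_pos_pos norm_eq_zero of_nat_0_less_iff order_less_irrefl zero_less_Suc)
  have tr: "norm (t n) \<le> r" for n
    unfolding tn using r(1) by (simp add: divide_le_eq mult_le_cancel_left1)
  have tlim: "(\<lambda>n. norm (t n)) \<longlonglongrightarrow> 0" unfolding tn
    using LIMSEQ_Suc[OF lim_const_over_n[of r]] by simp
  let ?e = "\<lambda>k. axis k (1::complex) :: complex ^ 'i"
  have inc: "a + \<zeta> *s ?e i \<in> cball a (2 * r)" "a + \<zeta> *s ?e i + s *s ?e j \<in> cball a (2 * r)"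
    if "norm \<zeta> \<le> r" "norm s \<le> r" for \<zeta> s
  proof -
    show "a + \<zeta> *s ?e i \<in> cball a (2 * r)" using that r by simp
    have "dist a (a + \<zeta> *s ?e i + s *s ?e j) \<le> norm \<zeta> + norm s"
      using dist_triangle[of a "a + \<zeta> *s ?e i + s *s ?e j" "a + \<zeta> *s ?e i"]
      by (simp only: dist_line)
    then show "a + \<zeta> *s ?e i + s *s ?e j \<in> cball a (2 * r)" using that by simp
  qed
  have swap: "a + s *s ?e j + \<zeta> *s ?e i = a + \<zeta> *s ?e i + s *s ?e j" for s \<zeta>
    by (simp add: algebra_simps)
  let ?f = "\<lambda>n \<zeta>. (\<Phi> (a + t n *s ?e j + \<zeta> *s ?e i) - \<Phi> (a + \<zeta> *s ?e i)) / t n"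
  let ?f' = "\<lambda>n \<zeta>. (partial i \<Phi> (a + t n *s ?e j + \<zeta> *s ?e i) - partial i \<Phi> (a + \<zeta> *s ?e i)) / t n"
  have "\<exists>g'. \<forall>\<zeta>\<in>ball 0 r. ((\<lambda>\<zeta>. partial j \<Phi> (a + \<zeta> *s ?e i)) has_field_derivative g' \<zeta>) (at \<zeta>) \<and>
      (\<lambda>n. ?f' n \<zeta>) \<longlonglongrightarrow> g' \<zeta>"
  proof (rule has_complex_derivative_uniform_sequence)
    fix n \<zeta> assume "\<zeta> \<in> ball (0::complex) r"
    then have \<zeta>: "norm \<zeta> \<le> r" by simp
    have 1: "a + t n *s ?e j + \<zeta> *s ?e i \<in> U" "a + \<zeta> *s ?e i \<in> U"
      unfolding swap using inc[OF \<zeta> tr] r(2) by blast+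
    show "(?f n has_field_derivative ?f' n \<zeta>) (at \<zeta>)"
      using DERIV_cdivide[OF DERIV_diff[OF holomorphic_Cn_line[OF hol 1(1)] holomorphic_Cn_line[OF hol 1(2)]]]
      by simp
  next
    fix x assume x: "x \<in> ball (0::complex) r"
    then obtain d where d: "d > 0" "cball x d \<subseteq> ball 0 r" using open_contains_cball[of "ball (0::complex) r"] by blast
    have "uniform_limit (cball x d) ?f (\<lambda>\<zeta>. partial j \<Phi> (a + \<zeta> *s ?e i)) sequentially"
    proof (rule uniform_limitI)
      fix e :: real assume e: "e > 0"
      let ?e' = "e / (2 * CARD('i))"
      have "?e' > 0" using e by simp
      from uniform_partial_continuity[OF r(2) this] obtain dd where dd: "dd > 0"
        "\<And>x y j. x \<in> cball a (2 * r) \<Longrightarrow> y \<in> cball a (2 * r) \<Longrightarrow> dist x y < dd \<Longrightarrow> norm (partial j \<Phi> x - partial j \<Phi> y) < ?e'"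
        by blast
      have "\<forall>\<^sub>F n in sequentially. norm (t n) < dd"
        using order_tendstoD(2)[OF tlim dd(1)] .
      then show "\<forall>\<^sub>F n in sequentially. \<forall>\<zeta>\<in>cball x d. dist (?f n \<zeta>) (partial j \<Phi> (a + \<zeta> *s ?e i)) < e"
      proof eventually_elim
        case (elim n)
        show ?case
        proof
          fix \<zeta> assume "\<zeta> \<in> cball x d"
          then have \<zeta>: "norm \<zeta> \<le> r" using d(2) by (auto simp: subset_iff)
          let ?b = "a + \<zeta> *s ?e i"
          have scale: "s *s (t n *s ?e j) = (s * t n) *s ?e j" for s by (simp add: vector_smult_assoc)
          have st: "norm (s * t n) \<le> r" "norm (s * t n) < dd" if "norm s \<le> 1" for s
            using tr[of n] elim mult_right_mono[OF that, of "norm (t n)"] by (auto simp: norm_mult)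
          have "norm (\<Phi> (?b + t n *s ?e j) - \<Phi> ?b - (\<Sum>k\<in>UNIV. (t n *s ?e j) $ k * partial k \<Phi> ?b)) \<le> CARD('i) * ?e' * norm (t n *s ?e j)"
          proof (rule linear_approximation)
            fix s :: complex assume s: "norm s \<le> 1"
            show "?b + s *s (t n *s ?e j) \<in> U"
              unfolding scale using inc(2)[OF \<zeta> st(1)[OF s]] r(2) by blast
            fix k
            have "dist (?b + (s * t n) *s ?e j) ?b < dd"
              using st(2)[OF s] by (subst dist_commute) simp
            from dd(2)[OF inc(2)[OF \<zeta> st(1)[OF s]] inc(1)[OF \<zeta> st(1)[OF s]] this, of k]
            show "norm (partial k \<Phi> (?b + s *s (t n *s ?e j)) - partial k \<Phi> ?b) \<le> ?e'"
              unfolding scale by simp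
          qed
          also have "(\<Sum>k\<in>UNIV. (t n *s ?e j) $ k * partial k \<Phi> ?b) = t n * partial j \<Phi> ?b"
            by (simp add: mult.assoc flip: sum_distrib_left)
          also have "CARD('i) * ?e' * norm (t n *s ?e j) = (e / 2) * norm (t n)" by simp
          finally have "norm (\<Phi> (?b + t n *s ?e j) - \<Phi> ?b - t n * partial j \<Phi> ?b) / norm (t n) \<le> e / 2"
            using t0[of n] by (simp add: divide_le_eq)
          also have "norm (\<Phi> (?b + t n *s ?e j) - \<Phi> ?b - t n * partial j \<Phi> ?b) / norm (t n) =
            norm ((\<Phi> (?b + t n *s ?e j) - \<Phi> ?b) / t n - partial j \<Phi> ?b)"
            unfolding norm_divide[symmetric] using t0[of n] by (simp add: diff_divide_distrib)
          finally show "dist (?f n \<zeta>) (partial j \<Phi> ?b) < e"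
            unfolding swap dist_norm using e by linarith
        qed
      qed
    qed
    then show "\<exists>d>0. cball x d \<subseteq> ball 0 r \<and> uniform_limit (cball x d) ?f (\<lambda>\<zeta>. partial j \<Phi> (a + \<zeta> *s ?e i)) sequentially"
      using d by blast
  qed simp
  then obtain g' where g': "\<And>\<zeta>. \<zeta> \<in> ball 0 r \<Longrightarrow> ((\<lambda>\<zeta>. partial j \<Phi> (a + \<zeta> *s ?e i)) has_field_derivative g' \<zeta>) (at \<zeta>)"
     "\<And>\<zeta>. \<zeta> \<in> ball 0 r \<Longrightarrow> (\<lambda>n. ?f' n \<zeta>) \<longlonglongrightarrow> g' \<zeta>" by blast
  have 0: "0 \<in> ball (0::complex) r" using r by simp
  show ?thesis
    using g'[OF 0] t0 tlim by (intro exI[of _ "g' 0"] exI[of _ t]) (simp add: tendsto_norm_zero_iff)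
qed

lemma partial_has_line_derivative:
  assumes "a + t *s axis i 1 \<in> U"
  shows "((\<lambda>t. partial j \<Phi> (a + t *s axis i 1)) has_field_derivative
    partial i (partial j \<Phi>) (a + t *s axis i 1)) (at t)"
proof -
  obtain D where D: "((\<lambda>\<zeta>. partial j \<Phi> (a + t *s axis i 1 + \<zeta> *s axis i 1)) has_field_derivative D) (at 0)"
    using mixed_partial_limit[OF assms] by blast
  from line_shift[OF D] partial_line[OF D] show ?thesis by simp
qed

lemma partial_commute:
  assumes a: "a \<in> U"
  shows "partial i (partial j \<Phi>) a = partial j (partial i \<Phi>) a"
proof -
  obtain D t where D: "((\<lambda>\<zeta>. partial j \<Phi> (a + \<zeta> *s axis i 1)) has_field_derivative D) (at 0)"
    and t: "\<forall>n::nat. t n \<noteq> 0" "t \<longlonglongrightarrow> 0"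
      "(\<lambda>n. (partial i \<Phi> (a + t n *s axis j 1) - partial i \<Phi> a) / t n) \<longlonglongrightarrow> D"
    using mixed_partial_limit[OF a] by blast
  have "((\<lambda>t. partial i \<Phi> (a + t *s axis j 1)) has_field_derivative partial j (partial i \<Phi>) a) (at 0)"
    using partial_has_line_derivative[of a 0 j i] a by simp
  then have "(\<lambda>h. (partial i \<Phi> (a + h *s axis j 1) - partial i \<Phi> a) / h) \<midarrow>0\<rightarrow> partial j (partial i \<Phi>) a"
    unfolding DERIV_def by simp
  then have "(\<lambda>n. (partial i \<Phi> (a + t n *s axis j 1) - partial i \<Phi> a) / t n) \<longlonglongrightarrow> partial j (partial i \<Phi>) a"
    by (rule filterlim_compose) (use t in \<open>auto intro!: filterlim_atI\<close>)
  then have "partial j (partial i \<Phi>) a = D" using t(3) LIMSEQ_unique by blast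
  then show ?thesis using partial_line[OF D] by simp
qed

text \<open>Apply Cauchy's inequality in direction \<open>i\<close> to the error of the linear approximation of the function; this bounds the error of the linear approximation of its partial derivative.\<close>

lemma holomorphic_Cn_partial: "holomorphic_Cn (partial i \<Phi>) U"
proof (rule holomorphic_CnI(1))
  fix a assume "a \<in> U"
  then obtain r0 where r0: "r0 > 0" "cball a r0 \<subseteq> U" using U open_contains_cball by metis
  define r where "r = r0 / 2"
  have r: "r > 0" "cball a (2 * r) \<subseteq> U" using r0 by (auto simp: r_def)
  let ?e = "axis i (1::complex) :: complex ^ 'i"
  let ?L = "\<lambda>h. \<Sum>j\<in>UNIV. h $ j * partial i (partial j \<Phi>) a"
  show "(partial i \<Phi> has_derivative ?L) (at a)"
    unfolding has_derivative_at_alt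
  proof (intro conjI allI impI)
    have "linear ?L"
      by (rule linearI) (simp_all add: algebra_simps sum.distrib scaleR_sum_right)
    then show "bounded_linear ?L" by (simp add: linear_conv_bounded_linear)
  next
    fix e :: real assume e: "e > 0"
    let ?e' = "e * r / CARD('i)"
    have "?e' > 0" using e r by simp
    from uniform_partial_continuity[OF r(2) this] obtain d where d: "d > 0"
        "\<And>x y j. x \<in> cball a (2 * r) \<Longrightarrow> y \<in> cball a (2 * r) \<Longrightarrow> dist x y < d \<Longrightarrow> norm (partial j \<Phi> x - partial j \<Phi> y) < ?e'"
      by blast
    show "\<exists>d>0. \<forall>y. norm (y - a) < d \<longrightarrow> norm (partial i \<Phi> y - partial i \<Phi> a - ?L (y - a)) \<le> e * norm (y - a)"
    proof (intro exI[of _ "min d r"] conjI allI impI)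
      fix y assume y: "norm (y - a) < min d r"
      define h where "h = y - a"
      have h: "norm h < d" "norm h \<le> r" "y = a + h" using y by (auto simp: h_def)
      let ?\<Psi> = "\<lambda>t. \<Phi> (a + t *s ?e) + (\<Sum>j\<in>UNIV. h $ j * partial j \<Phi> (a + t *s ?e))"
      let ?\<Psi>' = "\<lambda>t. partial i \<Phi> (a + t *s ?e) + (\<Sum>j\<in>UNIV. h $ j * partial i (partial j \<Phi>) (a + t *s ?e))"
      have inc: "a + t *s ?e + s *s h \<in> cball a (2 * r)" if "norm t \<le> r" "norm s \<le> 1" for t s
      proof -
        have "norm (s *s h) \<le> r"
          unfolding norm_times_vec_le using mult_mono[OF that(2) h(2)] by simp
        moreover have "dist a (a + t *s ?e + s *s h) \<le> norm (t *s ?e) + norm (s *s h)"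
          by (subst dist_commute, unfold dist_norm) (use norm_triangle_ineq[of "t *s ?e" "s *s h"] in \<open>simp add: algebra_simps\<close>)
        ultimately show ?thesis using that by simp
      qed
      have "norm (partial i \<Phi> y - ?\<Psi>' 0) \<le> (CARD('i) * ?e' * norm h) / r"
      proof (rule line_deriv_estimate)
        fix t :: complex assume t: "norm t \<le> r"
        have inU: "a + t *s ?e \<in> U" using inc[OF t, of 0] r(2) by auto
        have eq: "y + t *s ?e = a + t *s ?e + h" by (simp add: h(3) algebra_simps)
        have "norm (\<Phi> (a + t *s ?e + h) - \<Phi> (a + t *s ?e) - (\<Sum>j\<in>UNIV. h $ j * partial j \<Phi> (a + t *s ?e)))
          \<le> CARD('i) * ?e' * norm h"
        proof (rule linear_approximation)
          fix s :: complex assume s: "norm s \<le> 1"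
          show "a + t *s ?e + s *s h \<in> U" using inc[OF t s] r(2) by blast
          fix k
          have "norm (s *s h) < d" unfolding norm_times_vec_le
            using mult_right_mono[OF s, of "norm h"] h(1) by simp
          then have "dist (a + t *s ?e + s *s h) (a + t *s ?e) < d"
            unfolding dist_norm add_diff_cancel_left' .
          then have "norm (partial k \<Phi> (a + t *s ?e + s *s h) - partial k \<Phi> (a + t *s ?e)) < ?e'"
            using d(2)[OF inc[OF t s], of "a + t *s ?e" k] inc[OF t, of 0] by simp
          then show "norm (partial k \<Phi> (a + t *s ?e + s *s h) - partial k \<Phi> (a + t *s ?e)) \<le> ?e'"
            by simp
        qed
        moreover have "y + t *s ?e \<in> U" unfolding eq using inc[OF t, of 1] r(2) by auto
        ultimately show "y + t *s ?e \<in> U \<and> norm (\<Phi> (y + t *s ?e) - ?\<Psi> t) \<le> CARD('i) * ?e' * norm h"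
          unfolding eq by (simp add: diff_diff_eq)
        have "((\<lambda>t. \<Phi> (a + t *s ?e)) has_field_derivative partial i \<Phi> (a + t *s ?e)) (at t)"
          using holomorphic_Cn_line[OF hol inU] by simp
        then show "(?\<Psi> has_field_derivative ?\<Psi>' t) (at t)"
          by (intro DERIV_add DERIV_sum DERIV_cmult partial_has_line_derivative inU)
      qed (rule r)
      also have "(CARD('i) * ?e' * norm h) / r = e * norm h" using r by simp
      finally show "norm (partial i \<Phi> y - partial i \<Phi> a - ?L (y - a)) \<le> e * norm (y - a)"
        by (simp add: h_def diff_diff_eq)
    qed (use d r in auto)
  qed
qed

end

subsection \<open>Iterated partial derivatives\<close>

lemma index_list: "distinct (index_list :: 'i::finite list)" "set (index_list :: 'i list) = UNIV"
proof -
  have "\<exists>is :: 'i list. distinct is \<and> set is = UNIV"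
    using finite_distinct_list[of "UNIV :: 'i set"] by auto
  from someI_ex[OF this] show "distinct (index_list :: 'i list)" "set (index_list :: 'i list) = UNIV"
    unfolding index_list_def by auto
qed

lemma partial_funpow_cong:
  fixes f :: "complex ^ 'i::finite \<Rightarrow> complex"
  assumes "open U" "\<And>a. a \<in> U \<Longrightarrow> f a = g a" "a \<in> U"
  shows "(partial i ^^ n) f a = (partial i ^^ n) g a"
  using assms(3)
  by (induction n arbitrary: a) (auto simp: assms(2) intro: partial_cong[OF assms(1)])

text \<open>All iterated derivatives are computed at once from a family of functions that is closed under the partial derivatives.  The family is what one can write down for the Gamma series.\<close>

lemma multi_partial_family:
  fixes S :: "('i::finite \<Rightarrow> nat) \<Rightarrow> complex ^ 'i \<Rightarrow> complex"
  assumes U: "open U"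
    and S: "\<And>\<kappa> i a. a \<in> U \<Longrightarrow> partial i (S \<kappa>) a = S (\<kappa>(i := Suc (\<kappa> i))) a"
    and \<Phi>: "\<And>a. a \<in> U \<Longrightarrow> \<Phi> a = S (\<lambda>_. 0) a" and a: "a \<in> U"
  shows "multi_partial \<kappa> \<Phi> a = S \<kappa> a"
proof -
  have pow: "(partial i ^^ n) (S \<kappa>) a = S (\<kappa>(i := \<kappa> i + n)) a" if "a \<in> U" for i n \<kappa> a
    using that
  proof (induction n arbitrary: a)
    case (Suc n)
    have "(partial i ^^ Suc n) (S \<kappa>) a = partial i ((partial i ^^ n) (S \<kappa>)) a" by simp
    also have "\<dots> = partial i (S (\<kappa>(i := \<kappa> i + n))) a"
      by (rule partial_cong[OF U Suc.prems Suc.IH])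
    finally have "(partial i ^^ Suc n) (S \<kappa>) a = S ((\<kappa>(i := \<kappa> i + n))(i := Suc ((\<kappa>(i := \<kappa> i + n)) i))) a"
      unfolding S[OF Suc.prems] .
    also have "(\<kappa>(i := \<kappa> i + n))(i := Suc ((\<kappa>(i := \<kappa> i + n)) i)) = \<kappa>(i := \<kappa> i + Suc n)"
      by (rule ext) simp
    finally show ?case .
  qed simp
  have "foldr (\<lambda>i. partial i ^^ \<kappa> i) L \<Phi> a = S (\<lambda>i. if i \<in> set L then \<kappa> i else 0) a"
    if "distinct L" "a \<in> U" for L a
    using that
  proof (induction L arbitrary: a)
    case (Cons i L)
    have "foldr (\<lambda>i. partial i ^^ \<kappa> i) (i # L) \<Phi> a = (partial i ^^ \<kappa> i) (foldr (\<lambda>i. partial i ^^ \<kappa> i) L \<Phi>) a"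
      by simp
    also have "\<dots> = (partial i ^^ \<kappa> i) (S (\<lambda>i. if i \<in> set L then \<kappa> i else 0)) a"
      using Cons by (intro partial_funpow_cong[OF U]) auto
    also have "\<dots> = S ((\<lambda>i. if i \<in> set L then \<kappa> i else 0)(i := 0 + \<kappa> i)) a"
      using Cons.prems by (subst pow) auto
    also have "(\<lambda>i. if i \<in> set L then \<kappa> i else 0)(i := 0 + \<kappa> i) = (\<lambda>j. if j \<in> set (i # L) then \<kappa> j else 0)"
      by auto
    finally show ?case .
  qed (simp add: \<Phi>)
  from this[OF index_list(1) a] show ?thesis
    unfolding multi_partial_def by (simp add: index_list)
qed

context
  fixes \<Phi> :: "complex ^ 'i::finite \<Rightarrow> complex" and U
  assumes U: "open U" and hol: "holomorphic_Cn \<Phi> U"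
begin

lemma holomorphic_Cn_partial_funpow:
  assumes "holomorphic_Cn f U"
  shows "holomorphic_Cn ((partial i ^^ n) f) U"
  by (induction n) (auto simp: assms intro: holomorphic_Cn_partial[OF U])

lemma holomorphic_Cn_foldr: "holomorphic_Cn (foldr (\<lambda>i. partial i ^^ \<kappa> i) L \<Phi>) U"
  by (induction L) (auto simp: hol intro: holomorphic_Cn_partial_funpow)

lemma holomorphic_Cn_multi_partial: "holomorphic_Cn (multi_partial \<kappa> \<Phi>) U"
  unfolding multi_partial_def by (rule holomorphic_Cn_foldr)

lemma partial_funpow_commute:
  assumes f: "holomorphic_Cn f U" and "a \<in> U"
  shows "partial i ((partial j ^^ n) f) a = (partial j ^^ n) (partial i f) a"
  using assms(2)
proof (induction n arbitrary: a)
  case (Suc n)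
  have "partial i ((partial j ^^ Suc n) f) a = partial i (partial j ((partial j ^^ n) f)) a" by simp
  also have "\<dots> = partial j (partial i ((partial j ^^ n) f)) a"
    by (rule partial_commute[OF U holomorphic_Cn_partial_funpow[OF f] Suc.prems])
  also have "\<dots> = partial j ((partial j ^^ n) (partial i f)) a"
    by (rule partial_cong[OF U Suc.prems Suc.IH])
  finally show ?case by simp
qed simp

text \<open>The fixed order of differentiation in \<open>multi_partial\<close> is harmless because partial derivatives commute.\<close>

lemma partial_multi_partial:
  assumes "a \<in> U"
  shows "partial i (multi_partial \<kappa> \<Phi>) a = multi_partial (\<kappa>(i := Suc (\<kappa> i))) \<Phi> a"
proof -
  have "partial i (foldr (\<lambda>i. partial i ^^ \<kappa> i) L \<Phi>) a = foldr (\<lambda>j. partial j ^^ (\<kappa>(i := Suc (\<kappa> i))) j) L \<Phi> a"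
    if "distinct L" "i \<in> set L" "a \<in> U" for L a
    using that
  proof (induction L arbitrary: a)
    case (Cons j L)
    let ?F = "foldr (\<lambda>i. partial i ^^ \<kappa> i) L \<Phi>"
    show ?case
    proof (cases "i = j")
      case True
      have "foldr (\<lambda>j. partial j ^^ (\<kappa>(i := Suc (\<kappa> i))) j) L \<Phi> = ?F"
        using Cons.prems True by (intro foldr_cong) auto
      then show ?thesis using True by simp
    next
      case False
      have "partial i ((partial j ^^ \<kappa> j) ?F) a = (partial j ^^ \<kappa> j) (partial i ?F) a"
        by (rule partial_funpow_commute[OF holomorphic_Cn_foldr Cons.prems(3)])
      also have "\<dots> = (partial j ^^ \<kappa> j) (foldr (\<lambda>j. partial j ^^ (\<kappa>(i := Suc (\<kappa> i))) j) L \<Phi>) a"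
        using Cons False by (intro partial_funpow_cong[OF U]) auto
      finally show ?thesis using False by simp
    qed
  qed simp
  from this[OF index_list(1) _ assms] show ?thesis
    unfolding multi_partial_def by (simp add: index_list)
qed

end

section \<open>Taylor coefficients of the Gamma factors\<close>

text \<open>The Gamma factor without the power of \<open>a\<^sub>i\<close>; the index \<open>None\<close> carries the sign \<open>(-1)\<^bsup>m\<^esup>\<close>.\<close>

definition gfun :: "'p option \<Rightarrow> int \<Rightarrow> complex \<Rightarrow> complex" where
  "gfun i m z = (case i of None \<Rightarrow> (-1) powi m * Gamma (- of_int m - z + 1)
                         | Some j \<Rightarrow> rGamma (of_int m + z + 1))"

text \<open>For \<open>i = None\<close> and \<open>m \<le> 0\<close> the argument \<open>1 - m - z\<close> stays away from the poles of \<open>\<Gamma>\<close> on the unit disc.\<close>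

definition admissible :: "'p option \<Rightarrow> int \<Rightarrow> bool" where
  "admissible i m \<longleftrightarrow> (i = None \<longrightarrow> m \<le> 0)"

text \<open>The factor \<open>1 / a\<^sub>0\<close> in front of the series is absorbed into the exponent of \<open>a\<^sub>0\<close>.\<close>

definition expo :: "'p option \<Rightarrow> int \<Rightarrow> int" where
  "expo i m = (case i of None \<Rightarrow> m - 1 | Some j \<Rightarrow> m)"

definition gcoef :: "'p option \<Rightarrow> int \<Rightarrow> nat \<Rightarrow> complex" where
  "gcoef i m n = fps_nth (fps_expansion (gfun i m) 0) n"

text \<open>The \<open>n\<close>-th Taylor coefficient of \<open>gfun i m z * exp (L * z)\<close>, a polynomial in \<open>L = log a\<^sub>i\<close>.\<close>

definition lpoly :: "'p option \<Rightarrow> int \<Rightarrow> nat \<Rightarrow> complex \<Rightarrow> complex" where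
  "lpoly i m n L = (\<Sum>j\<le>n. gcoef i m (n - j) * (L ^ j / fact j))"

definition hfun :: "'p option \<Rightarrow> int \<Rightarrow> nat \<Rightarrow> complex \<Rightarrow> complex" where
  "hfun i m n a = a powi (expo i m) * lpoly i m n (Ln a)"

lemma admissible_pred: "admissible i m \<Longrightarrow> admissible i (m - 1)"
  and expo_pred: "expo i (m - 1) = expo i m - 1"
  by (auto simp: admissible_def expo_def split: option.splits)

lemma Gamma_arg_not_nonpos:
  assumes "m \<le> 0" "norm (z::complex) < 1"
  shows "- of_int m - z + 1 \<notin> \<int>\<^sub>\<le>\<^sub>0"
proof
  assume "- of_int m - z + 1 \<in> \<int>\<^sub>\<le>\<^sub>0"
  then obtain n where n: "- of_int m - z + 1 = of_int n" "n \<le> 0" by (auto elim!: nonpos_Ints_cases)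
  from n(2) have "Re (- of_int m - z + 1) \<le> 0" unfolding n(1) by simp
  moreover have "Re z < 1" using assms(2) complex_Re_le_cmod[of z] by linarith
  moreover have "real_of_int m \<le> 0" using assms(1) by simp
  ultimately show False by simp
qed

lemma gfun_holomorphic:
  assumes "admissible i m"
  shows "gfun i m holomorphic_on ball 0 1"
proof (cases i)
  case None
  have "(\<lambda>z. (-1) powi m * Gamma (- of_int m - z + 1)) holomorphic_on ball 0 1"
    using assms None Gamma_arg_not_nonpos[of m]
    by (intro holomorphic_intros) (auto simp: admissible_def)
  then show ?thesis using None by (simp add: gfun_def[abs_def])
next
  case (Some j)
  have "(\<lambda>z. rGamma (of_int m + z + 1)) holomorphic_on ball 0 1"
    by (intro holomorphic_intros)
  then show ?thesis using Some by (simp add: gfun_def[abs_def])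
qed

text \<open>With the sign in \<open>gfun\<close>, the functional equations of \<open>\<Gamma>\<close> (index \<open>None\<close>) and of \<open>1 / \<Gamma>\<close> take the same form.  This is why differentiation lowers exponents uniformly in \<open>i\<close>.\<close>

lemma gfun_pred:
  assumes "admissible i m" "norm z < 1"
  shows "gfun i (m - 1) z = (of_int (expo i m) + z) * gfun i m z"
proof (cases i)
  case None
  define G where "G = Gamma (- of_int m - z + 1)"
  have "Gamma ((- of_int m - z + 1) + 1) = (- of_int m - z + 1) * G"
    unfolding G_def using assms None by (intro Gamma_plus1 Gamma_arg_not_nonpos) (auto simp: admissible_def)
  moreover have "- of_int (m - 1) - z + 1 = (- of_int m - z + 1) + 1" by simp
  ultimately have 1: "Gamma (- of_int (m - 1) - z + 1) = (- of_int m - z + 1) * G" by (simp only:)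
  have 2: "(-1::complex) powi (m - 1) = - ((-1) powi m)"
    by (subst power_int_diff) auto
  have "gfun i (m - 1) z = - ((-1) powi m) * ((- of_int m - z + 1) * G)"
    using None by (simp only: gfun_def option.case 1 2)
  also have "\<dots> = (of_int (expo i m) + z) * ((-1) powi m * G)"
    using None by (simp add: expo_def algebra_simps)
  finally show ?thesis using None by (simp only: gfun_def option.case G_def)
next
  case (Some j)
  then show ?thesis using rGamma_plus1[of "of_int m + z"] by (simp add: gfun_def expo_def algebra_simps)
qed

lemma gfun_expansion: "admissible i m \<Longrightarrow> gfun i m has_fps_expansion fps_expansion (gfun i m) 0"
  by (rule has_fps_expansion_fps_expansion[OF open_ball _ gfun_holomorphic]) auto

lemma fps_expansion_eqI: "f has_fps_expansion F \<Longrightarrow> fps_expansion f 0 = F"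
  by (rule fps_ext) (simp add: fps_expansion_def fps_nth_fps_expansion)

lemma gcoef_pred:
  assumes "admissible i m"
  shows "gcoef i (m - 1) n = of_int (expo i m) * gcoef i m n + (if n = 0 then 0 else gcoef i m (n - 1))"
proof -
  let ?F = "fps_expansion (gfun i m) 0"
  have "(\<lambda>z. (of_int (expo i m) + z) * gfun i m z) has_fps_expansion (fps_const (of_int (expo i m)) + fps_X) * ?F"
    by (intro fps_expansion_intros gfun_expansion assms)
  note 1 = this
  have ev: "eventually (\<lambda>z. (of_int (expo i m) + z) * gfun i m z = gfun i (m - 1) z) (nhds 0)"
    using eventually_nhds_in_open[of "ball 0 1" "0::complex"]
    by (auto elim!: eventually_mono simp: gfun_pred[OF assms])
  have "gfun i (m - 1) has_fps_expansion (fps_const (of_int (expo i m)) + fps_X) * ?F"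
    using 1 has_fps_expansion_cong[OF ev refl] by simp
  then have "fps_expansion (gfun i (m - 1)) 0 = (fps_const (of_int (expo i m)) + fps_X) * ?F"
    by (rule fps_expansion_eqI)
  then show ?thesis by (simp add: gcoef_def distrib_right)
qed

lemma lpoly_pred:
  assumes "admissible i m"
  shows "lpoly i (m - 1) n L = of_int (expo i m) * lpoly i m n L + (if n = 0 then 0 else lpoly i m (n - 1) L)"
proof (cases n)
  case 0
  then show ?thesis by (simp add: lpoly_def gcoef_pred[OF assms])
next
  case (Suc n')
  have low: "(\<Sum>j\<le>n. (if n - j = 0 then 0 else gcoef i m (n - j - 1)) * (L ^ j / fact j)) = lpoly i m n' L"
    unfolding Suc lpoly_def by (simp add: Suc_diff_le)
  have "lpoly i (m - 1) n L = (\<Sum>j\<le>n. of_int (expo i m) * (gcoef i m (n - j) * (L ^ j / fact j))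
      + (if n - j = 0 then 0 else gcoef i m (n - j - 1)) * (L ^ j / fact j))"
    unfolding lpoly_def gcoef_pred[OF assms] by (simp only: distrib_right mult.assoc)
  also have "\<dots> = of_int (expo i m) * lpoly i m n L + lpoly i m n' L"
    unfolding sum.distrib low by (simp only: lpoly_def sum_distrib_left)
  finally show ?thesis by (simp add: Suc)
qed

lemma lpoly_has_derivative:
  "(lpoly i m n has_field_derivative (if n = 0 then 0 else lpoly i m (n - 1) L)) (at L)"
proof (cases n)
  case 0
  then show ?thesis by (simp add: lpoly_def[abs_def])
next
  case (Suc n')
  have "(lpoly i m n has_field_derivative (\<Sum>j\<le>n. gcoef i m (n - j) * (of_nat j * L ^ (j - 1) / fact j))) (at L)"
    unfolding lpoly_def[abs_def] by (auto intro!: derivative_eq_intros sum.cong)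
  also have "(\<Sum>j\<le>n. gcoef i m (n - j) * (of_nat j * L ^ (j - 1) / fact j)) =
     (\<Sum>j\<le>n'. gcoef i m (n - Suc j) * (of_nat (Suc j) * L ^ j / fact (Suc j)))"
    unfolding Suc by (subst sum.atMost_Suc_shift) simp
  also have "\<dots> = lpoly i m n' L"
    unfolding lpoly_def Suc by (intro sum.cong refl) (simp add: fact_Suc del: of_nat_Suc)
  finally show ?thesis using Suc by simp
qed

lemma hfun_times:
  assumes "admissible i m" "a \<noteq> 0"
  shows "a * hfun i (m - 1) n a = of_int (expo i m) * hfun i m n a + (if n = 0 then 0 else hfun i m (n - 1) a)"
proof -
  have "a * a powi (expo i m - 1) = a powi (expo i m)"
    using assms(2) by (simp add: power_int_diff)
  then have "a * hfun i (m - 1) n a = a powi (expo i m) * lpoly i (m - 1) n (Ln a)"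
    by (simp add: hfun_def expo_pred flip: mult.assoc)
  then show ?thesis by (simp add: lpoly_pred[OF assms(1)] hfun_def algebra_simps)
qed

text \<open>In this normalization \<open>d/da\<close> shifts \<open>m\<close> to \<open>m - 1\<close> and leaves the Taylor index alone.\<close>

lemma hfun_has_derivative:
  assumes "admissible i m" "a \<notin> \<real>\<^sub>\<le>\<^sub>0"
  shows "(hfun i m n has_field_derivative hfun i (m - 1) n a) (at a)"
proof -
  have a0: "a \<noteq> 0" using assms(2) by auto
  let ?e = "expo i m" and ?P = "if n = 0 then 0 else lpoly i m (n - 1) (Ln a)"
  have "((\<lambda>a. a powi ?e * lpoly i m n (Ln a)) has_field_derivative
      of_int ?e * a powi (?e - 1) * 1 * lpoly i m n (Ln a) + (?P * inverse a) * a powi ?e) (at a)"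
    by (intro DERIV_mult DERIV_power_int DERIV_chain2[OF lpoly_has_derivative] DERIV_ident has_field_derivative_Ln assms)
      (use a0 in auto)
  also have "of_int ?e * a powi (?e - 1) * 1 * lpoly i m n (Ln a) + (?P * inverse a) * a powi ?e = hfun i (m - 1) n a"
    using a0 by (simp add: hfun_def lpoly_pred[OF assms(1)] expo_pred power_int_diff field_simps)
  finally show ?thesis unfolding hfun_def[abs_def] .
qed

text \<open>The zeros of \<open>1 / \<Gamma>\<close> at the nonpositive integers make the summands with a negative exponent divisible by the corresponding \<open>D\<^sub>j\<close>.\<close>

lemma gcoef_negative: "m < 0 \<Longrightarrow> gcoef (Some j) m 0 = 0"
proof -
  assume "m < 0"
  have "of_int m + 1 = (of_int (m + 1) :: complex)" by simp
  also have "\<dots> \<in> \<int>\<^sub>\<le>\<^sub>0" using \<open>m < 0\<close> by (intro nonpos_Ints_of_int) simp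
  finally have "rGamma (of_int m + 1 :: complex) = 0" by (simp add: rGamma_eq_zero_iff)
  then show ?thesis by (simp add: gcoef_def fps_expansion_def gfun_def)
qed

lemma hfun_negative: "m < 0 \<Longrightarrow> hfun (Some j) m 0 a = 0"
  by (simp add: hfun_def lpoly_def gcoef_negative)

lemma lpoly_expansion:
  assumes "admissible i m"
  shows "(\<lambda>z. gfun i m z * exp (L * z)) has_fps_expansion fps_expansion (gfun i m) 0 * fps_exp L"
    and "fps_nth (fps_expansion (gfun i m) 0 * fps_exp L) n = lpoly i m n L"
proof -
  show "(\<lambda>z. gfun i m z * exp (L * z)) has_fps_expansion fps_expansion (gfun i m) 0 * fps_exp L"
    by (intro fps_expansion_intros gfun_expansion assms)
  have "fps_nth (fps_expansion (gfun i m) 0 * fps_exp L) n = fps_nth (fps_exp L * fps_expansion (gfun i m) 0) n"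
    by (simp add: mult.commute)
  also have "\<dots> = lpoly i m n L"
    by (simp add: fps_mult_nth lpoly_def gcoef_def atLeast0AtMost mult.commute)
  finally show "fps_nth (fps_expansion (gfun i m) 0 * fps_exp L) n = lpoly i m n L" .
qed

lemma gamma_factor_coefficient:
  fixes a :: "complex ^ ('p::finite) option"
  assumes "admissible i (l $ i)" "a $ i \<noteq> 0"
  shows "fps_nth (fps_expansion (gamma_factor a l i) 0) n =
    (if i = None then a $ i else 1) * hfun i (l $ i) n (a $ i)"
proof -
  let ?m = "l $ i" and ?b = "a $ i"
  have eq: "gamma_factor a l i z = ?b powi ?m * (gfun i ?m z * exp (Ln ?b * z))" for z
  proof -
    have "?b powi ?m = exp (of_int ?m * Ln ?b)"
      using assms(2) by (simp flip: exp_power_int)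
    then have "?b powr (of_int ?m + z) = ?b powi ?m * exp (Ln ?b * z)"
      using assms(2) by (simp add: powr_def distrib_right exp_add mult.commute[of z])
    then show ?thesis
      by (cases i) (simp_all add: gamma_factor_def gfun_def)
  qed
  have "gamma_factor a l i has_fps_expansion fps_const (?b powi ?m) * (fps_expansion (gfun i ?m) 0 * fps_exp (Ln ?b))"
    unfolding eq[abs_def] by (intro has_fps_expansion_cmult_left lpoly_expansion assms)
  from fps_expansion_eqI[OF this]
  have "fps_nth (fps_expansion (gamma_factor a l i) 0) n = ?b powi ?m * lpoly i ?m n (Ln ?b)"
    by (simp add: lpoly_expansion(2)[OF assms(1)])
  then show ?thesis using assms(2) by (cases i) (auto simp: hfun_def expo_def power_int_diff)
qed

subsection \<open>Growth of the Gamma factors\<close>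

text \<open>The growth of \<open>gfun i m\<close> near \<open>0\<close>, up to a factor exponential in \<open>|m|\<close>.\<close>

definition wt :: "'p option \<Rightarrow> int \<Rightarrow> real" where
  "wt i m = (case i of None \<Rightarrow> fact (nat (- m)) | Some j \<Rightarrow> fact (nat (- m)) / fact (nat m))"

text \<open>Induction on \<open>|m|\<close> with the functional equation; each step costs a factor of at most \<open>2\<close> compared with the factorials.\<close>

lemma gfun_bound:
  "\<exists>C\<ge>1. \<forall>(i::'p option) m z. admissible i m \<longrightarrow> norm z \<le> 1/2 \<longrightarrow> norm (gfun i m z) \<le> C * 2 ^ nat \<bar>m\<bar> * wt i m"
proof -
  have "1 - z \<notin> \<int>\<^sub>\<le>\<^sub>0" if "norm z * 2 \<le> 1" for z :: complex
    using Gamma_arg_not_nonpos[of 0 z] that by simp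
  then have "compact ((\<lambda>z. Gamma (1 - z :: complex)) ` cball 0 (1/2))"
    by (intro compact_continuous_image holomorphic_on_imp_continuous_on holomorphic_intros compact_cball)
      auto
  then obtain C1 where C1: "\<And>z. norm z \<le> 1/2 \<Longrightarrow> norm (Gamma (1 - z :: complex)) \<le> C1"
    by (force dest!: compact_imp_bounded simp: bounded_iff)
  have "compact ((\<lambda>z. rGamma (1 + z :: complex)) ` cball 0 (1/2))"
    by (intro compact_continuous_image holomorphic_on_imp_continuous_on holomorphic_intros) auto
  then obtain C2 where C2: "\<And>z. norm z \<le> 1/2 \<Longrightarrow> norm (rGamma (1 + z :: complex)) \<le> C2"
    by (force dest!: compact_imp_bounded simp: bounded_iff)
  define C where "C = max 1 (max C1 C2)"
  have C: "C \<ge> 1" "C1 \<le> C" "C2 \<le> C" by (auto simp: C_def)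
  have None: "norm (Gamma (of_nat n + 1 - z)) \<le> C * 2 ^ n * fact n" if z: "norm z \<le> 1/2" for n and z :: complex
  proof (induction n)
    case 0
    then show ?case using C1[OF z] C by simp
  next
    case (Suc n)
    have "of_nat n + 1 - z \<notin> \<int>\<^sub>\<le>\<^sub>0"
      using Gamma_arg_not_nonpos[of "- int n" z] z by (simp add: algebra_simps)
    from Gamma_plus1[OF this]
    have "Gamma (of_nat (Suc n) + 1 - z) = (of_nat n + 1 - z) * Gamma (of_nat n + 1 - z)"
      by (simp add: algebra_simps)
    moreover have "norm (of_nat n + 1 - z) \<le> 2 * real (Suc n)"
      using norm_triangle_ineq4[of "of_nat (Suc n)" z] z by (simp add: norm_of_nat add.commute del: of_nat_Suc) (simp)
    ultimately have "norm (Gamma (of_nat (Suc n) + 1 - z)) \<le> (2 * real (Suc n)) * (C * 2 ^ n * fact n)"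
      unfolding norm_mult by (simp only: norm_mult) (intro mult_mono Suc.IH, auto)
    then show ?case by (simp add: algebra_simps)
  qed
  have Neg: "norm (rGamma (- of_nat n + z + 1)) \<le> C * 2 ^ n * fact n" if z: "norm z \<le> 1/2" for n and z :: complex
  proof (induction n)
    case 0
    then show ?case using C2[OF z] C by (simp add: add.commute)
  next
    case (Suc n)
    have "rGamma (- of_nat (Suc n) + z + 1) = (z - of_nat n) * rGamma (- of_nat n + z + 1)"
      using rGamma_plus1[of "z - of_nat n"] by (simp add: algebra_simps)
    moreover have "norm (z - of_nat n) \<le> 2 * real (Suc n)"
      using norm_triangle_ineq4[of z "of_nat n"] z by (simp add: norm_of_nat)
    ultimately have "norm (rGamma (- of_nat (Suc n) + z + 1)) \<le> (2 * real (Suc n)) * (C * 2 ^ n * fact n)"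
      by (simp only: norm_mult) (intro mult_mono Suc.IH, auto)
    then show ?case by (simp add: algebra_simps)
  qed
  have Pos: "norm (rGamma (of_nat n + z + 1)) \<le> C * 2 ^ n / fact n" if z: "norm z \<le> 1/2" for n and z :: complex
  proof (induction n)
    case 0
    then show ?case using C2[OF z] C by (simp add: add.commute)
  next
    case (Suc n)
    let ?w = "of_nat n + z + 1"
    have "?w * rGamma (of_nat (Suc n) + z + 1) = rGamma ?w"
      using rGamma_plus1[of ?w] by (simp add: algebra_simps)
    then have eq: "norm ?w * norm (rGamma (of_nat (Suc n) + z + 1)) = norm (rGamma ?w)"
      by (metis norm_mult)
    have weq: "of_nat (Suc n) + z = ?w" by simp
    have "real (Suc n) - norm z \<le> norm ?w"
      using norm_diff_ineq[of "of_nat (Suc n)" z] unfolding weq norm_of_nat .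
    then have "real (Suc n) / 2 \<le> norm ?w"
      using z by (simp add: field_simps)
    then have "real (Suc n) / 2 * norm (rGamma (of_nat (Suc n) + z + 1)) \<le> norm (rGamma ?w)"
      unfolding eq[symmetric] by (intro mult_right_mono) auto
    also have "\<dots> \<le> C * 2 ^ n / fact n" by (rule Suc.IH)
    finally have "norm (rGamma (of_nat (Suc n) + z + 1)) \<le> (C * 2 ^ n / fact n) / (real (Suc n) / 2)"
      by (subst pos_le_divide_eq) (simp_all only: mult.commute, simp)
    also have "\<dots> = C * 2 ^ Suc n / fact (Suc n)" by (simp add: mult.commute)
    finally show ?case .
  qed
  have "norm (gfun i m z) \<le> C * 2 ^ nat \<bar>m\<bar> * wt i m" if "admissible i m" "norm z \<le> 1/2" for i :: "'p option" and m z
  proof (cases i)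
    case i: None
    then have "m \<le> 0" using that by (simp add: admissible_def)
    then obtain n where "m = - int n" by (metis nonpos_int_cases)
    then show ?thesis using None[OF that(2), of n] i
      by (simp add: gfun_def wt_def norm_mult norm_power_int algebra_simps)
  next
    case (Some j)
    show ?thesis
    proof (cases "m \<ge> 0")
      case True
      then obtain n where "m = int n" using nonneg_int_cases by blast
      then show ?thesis using Pos[OF that(2), of n] Some by (simp add: gfun_def wt_def)
    next
      case False
      then obtain n where "m = - int n" by (metis nle_le nonpos_int_cases)
      then show ?thesis using Neg[OF that(2), of n] Some by (simp add: gfun_def wt_def)
    qed
  qed
  then show ?thesis using C(1) by blast
qed

text \<open>Cauchy's inequality on the circle of radius \<open>r\<close>.  The radius is kept free: a small \<open>r\<close> makes the factor \<open>exp (r * norm L)\<close> negligible when \<open>L\<close> tends to infinity.\<close>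

lemma lpoly_bound:
  assumes adm: "admissible i m" and r: "0 < r" "r \<le> 1/2"
    and B: "\<And>z. norm z = r \<Longrightarrow> norm (gfun i m z) \<le> B"
  shows "norm (lpoly i m n L) \<le> (1 / r) ^ n * exp (r * norm L) * B"
proof -
  let ?f = "\<lambda>z. gfun i m z * exp (L * z)"
  have hol: "?f holomorphic_on ball 0 1"
    by (intro holomorphic_intros gfun_holomorphic adm)
  have sub: "cball 0 r \<subseteq> ball (0::complex) 1" "ball 0 r \<subseteq> ball (0::complex) 1" using r by auto
  have "norm (gfun i m (of_real r)) \<le> B" using r by (intro B) simp
  then have Bnn: "B \<ge> 0" by (rule order_trans[OF norm_ge_zero])
  have "norm ((deriv ^^ n) ?f 0) \<le> fact n * (exp (r * norm L) * B) / r ^ n"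
  proof (rule Cauchy_inequality)
    show "?f holomorphic_on ball 0 r" by (rule holomorphic_on_subset[OF hol sub(2)])
    show "continuous_on (cball 0 r) ?f"
      by (rule holomorphic_on_imp_continuous_on[OF holomorphic_on_subset[OF hol sub(1)]])
    fix z :: complex assume z: "norm (0 - z) = r"
    have "Re (L * z) \<le> norm (L * z)" by (rule complex_Re_le_cmod)
    also have "\<dots> = r * norm L" using z by (simp add: norm_mult)
    finally have "norm (exp (L * z)) \<le> exp (r * norm L)" by simp
    moreover have "norm (gfun i m z) \<le> B" using z by (intro B) simp
    ultimately have "norm (gfun i m z) * norm (exp (L * z)) \<le> B * exp (r * norm L)"
      by (intro mult_mono) (auto simp: Bnn)
    then show "norm (?f z) \<le> exp (r * norm L) * B" by (simp add: norm_mult mult.commute)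
  qed (rule r)
  moreover have "(deriv ^^ n) ?f 0 = fact n * lpoly i m n L"
    using fps_nth_fps_expansion[OF lpoly_expansion(1)[OF adm, of L], of n]
    by (simp add: lpoly_expansion(2)[OF adm])
  ultimately have "fact n * norm (lpoly i m n L) \<le> fact n * (exp (r * norm L) * B) / r ^ n"
    by (simp add: norm_mult)
  then have "fact n * norm (lpoly i m n L) \<le> fact n * ((exp (r * norm L) * B) / r ^ n)"
    by (simp only: times_divide_eq_right)
  then have "norm (lpoly i m n L) \<le> (exp (r * norm L) * B) / r ^ n"
    by (rule mult_left_le_imp_le) simp
  then show ?thesis by (simp add: power_one_over)
qed

lemma fact_add_le: "fact (a + b) \<le> (2 ^ (a + b) * fact a * fact b :: real)"
proof -
  have "fact a * fact b * ((a + b) choose a) = (fact (a + b) :: nat)"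
    using binomial_fact_lemma[of a "a + b"] by simp
  then have "real (fact (a + b)) = real (fact a * fact b * ((a + b) choose a))" by simp
  then have "fact (a + b) = fact a * fact b * real ((a + b) choose a)" by simp
  also have "\<dots> \<le> fact a * fact b * 2 ^ (a + b)"
    using binomial_le_pow2[of "a + b" a] by (intro mult_left_mono) (simp_all flip: of_nat_le_iff)
  finally show ?thesis by (simp add: algebra_simps)
qed

lemma fact_mult_le: "fact a * fact b \<le> (fact (a + b) :: real)"
proof -
  have "fact a * fact b \<le> (fact (a + b) :: nat)"
    by (rule dvd_imp_le[OF fact_fact_dvd_fact]) simp
  then have "real (fact a * fact b) \<le> real (fact (a + b))" by (rule of_nat_mono)
  then show ?thesis by simp
qed

lemma fact_sum_le:
  "finite A \<Longrightarrow> fact (\<Sum>i\<in>A. f i) \<le> (2 ^ (card A * (\<Sum>i\<in>A. f i)) * (\<Prod>i\<in>A. fact (f i)) :: real)"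
proof (induction A rule: finite_induct)
  case (insert x A)
  let ?S = "\<Sum>i\<in>A. f i"
  have "fact (f x + ?S) \<le> (2 ^ (f x + ?S) * fact (f x) * fact ?S :: real)" by (rule fact_add_le)
  also have "\<dots> \<le> 2 ^ (f x + ?S) * fact (f x) * (2 ^ (card A * ?S) * (\<Prod>i\<in>A. fact (f i)))"
    by (intro mult_left_mono insert.IH) auto
  also have "\<dots> = 2 ^ (f x + ?S + card A * ?S) * (fact (f x) * (\<Prod>i\<in>A. fact (f i)))"
    by (simp add: power_add)
  also have "\<dots> \<le> 2 ^ (Suc (card A) * (f x + ?S)) * (fact (f x) * (\<Prod>i\<in>A. fact (f i)))"
    by (intro mult_right_mono power_increasing mult_nonneg_nonneg prod_nonneg) auto
  finally show ?case using insert by simp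
qed simp

lemma prod_fact_le: "finite A \<Longrightarrow> (\<Prod>i\<in>A. fact (f i)) \<le> (fact (\<Sum>i\<in>A. f i) :: real)"
proof (induction A rule: finite_induct)
  case (insert x A)
  have "(\<Prod>i\<in>insert x A. fact (f i)) = fact (f x) * (\<Prod>i\<in>A. fact (f i) :: real)" using insert by simp
  also have "\<dots> \<le> fact (f x) * fact (\<Sum>i\<in>A. f i)" by (intro mult_left_mono insert.IH) auto
  also have "\<dots> \<le> fact (f x + (\<Sum>i\<in>A. f i))" by (rule fact_mult_le)
  finally show ?case using insert by simp
qed simp

lemma prod_option: "(\<Prod>i\<in>UNIV. f i) = f None * (\<Prod>j\<in>UNIV. f (Some j))"
  for f :: "'p::finite option \<Rightarrow> 'b::comm_monoid_mult"
  by (simp add: UNIV_option_conv prod.reindex)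

lemma sum_option: "(\<Sum>i\<in>UNIV. f i) = f None + (\<Sum>j\<in>UNIV. f (Some j))"
  for f :: "'p::finite option \<Rightarrow> 'b::comm_monoid_add"
  by (simp add: UNIV_option_conv sum.reindex)

abbreviation l1 :: "int ^ 'i::finite \<Rightarrow> nat" where
  "l1 l \<equiv> (\<Sum>i\<in>UNIV. nat \<bar>l $ i\<bar>)"

text \<open>Since the entries of \<open>m\<close> sum to \<open>- q\<close>, the factorials in the numerator have total size \<open>q\<close> more than those in the denominator.  The quotient is therefore at most an exponential factor times \<open>q!\<close> and a multinomial coefficient, and the latter is exponential in \<open>|m|\<close> as well.\<close>

lemma prod_wt_bound:
  fixes m :: "int ^ ('p::finite) option"
  assumes sum: "(\<Sum>i\<in>UNIV. m $ i) = - int q" and m0: "m $ None \<le> 0"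
  shows "(\<Prod>i\<in>UNIV. wt i (m $ i)) \<le> 2 ^ q * fact q * (2 * 2 ^ CARD('p)) ^ l1 m"
proof -
  define N where "N = (\<Sum>j\<in>UNIV. nat (m $ Some j))"
  define M where "M = (\<Sum>i\<in>UNIV. nat (- (m $ i)))"
  have "int M = int (N + q)"
  proof -
    have "(\<Sum>j\<in>UNIV. m $ Some j) = (\<Sum>j\<in>UNIV. int (nat (m $ Some j)) - int (nat (- (m $ Some j))))"
      by (intro sum.cong refl) linarith
    also have "\<dots> = int N - (\<Sum>j\<in>UNIV. int (nat (- (m $ Some j))))"
      unfolding N_def by (simp only: sum_subtractf of_nat_sum)
    finally have "(\<Sum>j\<in>UNIV. m $ Some j) = int N - (\<Sum>j\<in>UNIV. int (nat (- (m $ Some j))))" .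
    moreover have "int M = - (m $ None) + (\<Sum>j\<in>UNIV. int (nat (- (m $ Some j))))"
      unfolding M_def sum_option using m0 by simp
    ultimately show ?thesis using sum unfolding sum_option by simp
  qed
  then have M: "M = N + q" by simp
  have N: "N \<le> l1 m"
    unfolding N_def sum_option by (intro trans_le_add2 sum_mono) auto
  have base: "(1::real) \<le> 2 * 2 ^ CARD('p)" using one_le_power[of "2::real" "CARD('p)"] by linarith
  have "(\<Prod>i\<in>UNIV. wt i (m $ i)) = (\<Prod>i\<in>UNIV. fact (nat (- (m $ i)))) / (\<Prod>j\<in>UNIV. fact (nat (m $ Some j)))"
    unfolding prod_option by (simp add: wt_def prod_dividef)
  also have "\<dots> \<le> fact M / (\<Prod>j\<in>UNIV. fact (nat (m $ Some j)))"
    unfolding M_def by (intro divide_right_mono prod_fact_le prod_nonneg) auto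
  also have "fact M \<le> (2 ^ M * fact N * fact q :: real)"
    unfolding M by (rule fact_add_le)
  also have "fact N \<le> (2 ^ (CARD('p) * N) * (\<Prod>j\<in>UNIV. fact (nat (m $ Some j))) :: real)"
    unfolding N_def by (rule fact_sum_le) simp
  finally have "(\<Prod>i\<in>UNIV. wt i (m $ i)) \<le>
     2 ^ M * (2 ^ (CARD('p) * N) * (\<Prod>j\<in>UNIV. fact (nat (m $ Some j)))) * fact q / (\<Prod>j\<in>UNIV. fact (nat (m $ Some j)))"
    by (simp add: divide_right_mono mult_left_mono mult_right_mono prod_nonneg)
  also have "\<dots> = 2 ^ M * 2 ^ (CARD('p) * N) * fact q"
    by (simp add: prod_zero_iff)
  also have "\<dots> = 2 ^ q * fact q * (2 * 2 ^ CARD('p)) ^ N"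
    unfolding M by (simp add: power_add power_mult power_mult_distrib)
  also have "\<dots> \<le> 2 ^ q * fact q * (2 * 2 ^ CARD('p)) ^ l1 m"
    using N base by (intro mult_left_mono power_increasing) auto
  finally show ?thesis .
qed

section \<open>Simplicial fans and their generators\<close>

lemma convex_cone_hull_explicit:
  assumes "finite B"
  shows "convex_cone hull B = {\<Sum>b\<in>B. t b *\<^sub>R b | t. \<forall>b\<in>B. 0 \<le> t b}" (is "_ = ?R")
proof
  show "convex_cone hull B \<subseteq> ?R"
  proof (rule hull_minimal)
    show "B \<subseteq> ?R"
    proof
      fix b assume b: "b \<in> B"
      have "(\<Sum>x\<in>B. (if x = b then 1 else 0) *\<^sub>R x) = (\<Sum>x\<in>B. if x = b then x else 0)"
        by (rule sum.cong) auto
      also have "\<dots> = b" using b assms by simp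
      finally show "b \<in> ?R" by (auto intro!: exI[of _ "\<lambda>x. if x = b then 1 else 0"])
    qed
    show "convex_cone ?R"
      unfolding convex_cone_iff
    proof (intro conjI ballI allI impI)
      show "0 \<in> ?R" by (auto intro!: exI[of _ "\<lambda>_. 0"])
    next
      fix x y assume "x \<in> ?R" "y \<in> ?R"
      then obtain s t where "x = (\<Sum>b\<in>B. s b *\<^sub>R b)" "y = (\<Sum>b\<in>B. t b *\<^sub>R b)"
        "\<forall>b\<in>B. 0 \<le> s b" "\<forall>b\<in>B. 0 \<le> t b" by blast
      then show "x + y \<in> ?R"
        by (auto intro!: exI[of _ "\<lambda>b. s b + t b"] simp: scaleR_add_left sum.distrib)
    next
      fix x and c :: real assume "x \<in> ?R" "0 \<le> c"
      then obtain s where "x = (\<Sum>b\<in>B. s b *\<^sub>R b)" "\<forall>b\<in>B. 0 \<le> s b" by blast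
      then show "c *\<^sub>R x \<in> ?R"
        using \<open>0 \<le> c\<close> by (auto intro!: exI[of _ "\<lambda>b. c * s b"] simp: scaleR_sum_right)
    qed
  qed
  have "(\<Sum>b\<in>A. t b *\<^sub>R b) \<in> convex_cone hull B" if "finite A" "A \<subseteq> B" "\<forall>b\<in>B. 0 \<le> t b" for A t
    using that
  proof (induction A rule: finite_induct)
    case empty
    then show ?case by (simp add: convex_cone_hull_contains_0)
  next
    case (insert x A)
    then show ?case
      by (auto intro!: convex_cone_hull_add convex_cone_hull_mul simp: hull_inc)
  qed
  then show "?R \<subseteq> convex_cone hull B" using assms by blast
qed

lemma convex_cone_hull_singleton: "convex_cone hull {v} = {t *\<^sub>R v | t. 0 \<le> t}"
proof -
  have "{t v *\<^sub>R v | t. 0 \<le> t v} = {t *\<^sub>R v | t. 0 \<le> t}"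
    by (auto intro: exI[of _ "\<lambda>_. _"])
  then show ?thesis by (simp add: convex_cone_hull_explicit)
qed

lemma in_convex_cone_hullE:
  assumes "finite B" "x \<in> convex_cone hull B"
  obtains t where "x = (\<Sum>b\<in>B. t b *\<^sub>R b)" "\<forall>b\<in>B. 0 \<le> t b"
  using assms by (auto simp: convex_cone_hull_explicit)

text \<open>The component of \<open>b\<close> orthogonal to the span of the other vectors, rescaled.\<close>

lemma independent_dual_vector:
  fixes B :: "'a::euclidean_space set"
  assumes "independent B" "b \<in> B"
  shows "\<exists>u. u \<bullet> b = 1 \<and> (\<forall>b'\<in>B - {b}. u \<bullet> b' = 0)"
proof -
  have nb: "b \<notin> span (B - {b})" using assms by (auto simp: dependent_def)
  obtain y z where yz: "y \<in> span (B - {b})" "\<And>w. w \<in> span (B - {b}) \<Longrightarrow> orthogonal z w" "b = y + z"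
    using orthogonal_subspace_decomp_exists[of "B - {b}" b] by blast
  have "z \<noteq> 0" using nb yz by auto
  moreover have "z \<bullet> b = z \<bullet> z" using yz(2)[OF yz(1)] unfolding yz(3) by (simp add: inner_add_right orthogonal_def)
  ultimately show ?thesis
    using yz(2) by (intro exI[of _ "(1 / (z \<bullet> z)) *\<^sub>R z"]) (auto simp: orthogonal_def span_base)
qed

lemma independent_dual_family:
  fixes B :: "'a::euclidean_space set"
  assumes "independent B"
  obtains u where "\<And>b b'. b \<in> B \<Longrightarrow> b' \<in> B \<Longrightarrow> u b \<bullet> b' = (if b = b' then 1 else (0::real))"
proof -
  have "\<forall>b. \<exists>u. b \<in> B \<longrightarrow> u \<bullet> b = 1 \<and> (\<forall>b'\<in>B - {b}. u \<bullet> b' = 0)"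
    using independent_dual_vector[OF assms] by blast
  then obtain u where "\<And>b. b \<in> B \<Longrightarrow> u b \<bullet> b = 1 \<and> (\<forall>b'\<in>B - {b}. u b \<bullet> b' = 0)" by metis
  then show ?thesis by (intro that[of u]) auto
qed

lemma inner_dual_sum:
  assumes "finite B" "b \<in> B" and u: "\<And>b b'. b \<in> B \<Longrightarrow> b' \<in> B \<Longrightarrow> u b \<bullet> b' = (if b = b' then 1 else (0::real))"
  shows "u b \<bullet> (\<Sum>x\<in>B. t x *\<^sub>R x) = t b"
proof -
  have "u b \<bullet> (\<Sum>x\<in>B. t x *\<^sub>R x) = (\<Sum>x\<in>B. if x = b then t b else 0)"
    unfolding inner_sum_right using assms(2) by (intro sum.cong) (auto simp: u)
  then show ?thesis using assms by simp
qed

text \<open>The dual vectors of the remaining generators are nonnegative on the cone and vanish together exactly on the ray.\<close>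

lemma ray_face_of_simplicial_cone:
  fixes B :: "'a::euclidean_space set"
  assumes B: "independent B" "b \<in> B"
  shows "convex_cone hull {b} face_of convex_cone hull B"
  unfolding face_of_def
proof (intro conjI ballI impI)
  have fin: "finite B" by (rule independent_imp_finite[OF B(1)])
  obtain u where u: "\<And>b b'. b \<in> B \<Longrightarrow> b' \<in> B \<Longrightarrow> u b \<bullet> b' = (if b = b' then 1 else (0::real))"
    using independent_dual_family[OF B(1)] by blast
  show "convex_cone hull {b} \<subseteq> convex_cone hull B" using B by (intro hull_mono) auto
  show "convex (convex_cone hull {b})" by (rule convex_convex_cone_hull)
  have key: "x \<in> convex_cone hull {b}" if h: "x \<in> convex_cone hull B" "\<And>b'. b' \<in> B - {b} \<Longrightarrow> u b' \<bullet> x = 0" for x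
  proof -
    obtain t where t: "x = (\<Sum>b\<in>B. t b *\<^sub>R b)" "\<forall>b\<in>B. 0 \<le> t b"
      using in_convex_cone_hullE[OF fin h(1)] by blast
    have "t b' = 0" if "b' \<in> B - {b}" for b'
      using inner_dual_sum[OF fin, of b' u t] u t(1) that h(2)[OF that] by auto
    then have "x = t b *\<^sub>R b" using B fin t(1) by (subst (asm) sum.remove[of _ b]) auto
    then show ?thesis using t(2) B(2) unfolding convex_cone_hull_singleton by blast
  qed
  have nonneg: "u b' \<bullet> x \<ge> 0" if h: "x \<in> convex_cone hull B" "b' \<in> B" for x b'
  proof -
    obtain t where t: "x = (\<Sum>b\<in>B. t b *\<^sub>R b)" "\<forall>b\<in>B. 0 \<le> t b"
      using in_convex_cone_hullE[OF fin h(1)] by blast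
    then show ?thesis using inner_dual_sum[OF fin h(2) u] h(2) by auto
  qed
  fix x y z
  assume x: "x \<in> convex_cone hull B" and y: "y \<in> convex_cone hull B"
    and z: "z \<in> convex_cone hull {b}" "z \<in> open_segment x y"
  obtain s where s: "z = (1 - s) *\<^sub>R x + s *\<^sub>R y" "0 < s" "s < 1"
    using z(2) by (auto simp: in_segment)
  have "u b' \<bullet> x = 0 \<and> u b' \<bullet> y = 0" if b': "b' \<in> B - {b}" for b'
  proof -
    have "u b' \<bullet> z = 0" using z(1) u[of b' b] b' B(2) by (auto simp: convex_cone_hull_singleton)
    then have e: "(1 - s) * (u b' \<bullet> x) + s * (u b' \<bullet> y) = 0" by (simp add: s(1) inner_add_right)
    moreover have "(1 - s) * (u b' \<bullet> x) \<ge> 0" "s * (u b' \<bullet> y) \<ge> 0"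
      using nonneg[OF x] nonneg[OF y] b' s by auto
    ultimately have "(1 - s) * (u b' \<bullet> x) = 0" "s * (u b' \<bullet> y) = 0" by linarith+
    then show ?thesis using s by simp
  qed
  then show "x \<in> convex_cone hull {b}" "y \<in> convex_cone hull {b}" using key x y by blast+
qed

lemma ray_face_is_generator:
  fixes B :: "'a::euclidean_space set"
  assumes B: "independent B" and f: "convex_cone hull {v} face_of convex_cone hull B" and v: "v \<noteq> 0"
  shows "\<exists>b\<in>B. \<exists>t>0. v = t *\<^sub>R b"
proof -
  have fin: "finite B" by (rule independent_imp_finite[OF B])
  have "v \<in> convex_cone hull {v}" by (simp add: hull_inc)
  then have "v \<in> convex_cone hull B" using f face_of_imp_subset by blast
  then obtain t where t: "v = (\<Sum>b\<in>B. t b *\<^sub>R b)" "\<forall>b\<in>B. 0 \<le> t b"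
    using in_convex_cone_hullE[OF fin] by blast
  have "\<exists>b\<in>B. t b \<noteq> 0"
  proof (rule ccontr)
    assume "\<not> ?thesis"
    then have "v = 0" unfolding t(1) by (intro sum.neutral) auto
    then show False using v by simp
  qed
  then obtain b where b: "b \<in> B" "t b > 0" using t(2) by force
  let ?w = "\<Sum>x\<in>B - {b}. t x *\<^sub>R x"
  have vw: "v = t b *\<^sub>R b + ?w" using t(1) fin b(1) by (simp add: sum.remove)
  show ?thesis
  proof (cases "t b *\<^sub>R b = ?w")
    case True
    then have "v = (2 * t b) *\<^sub>R b" using vw by (metis scaleR_2 scaleR_scaleR)
    then show ?thesis using b by (intro bexI[of _ b] exI[of _ "2 * t b"]) auto
  next
    case False
    have "?w \<in> convex_cone hull (B - {b})"
      using convex_cone_hull_explicit[of "B - {b}"] fin t(2) by auto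
    then have w: "?w \<in> convex_cone hull B" using hull_mono[of "B - {b}" B convex_cone] by blast
    have "2 *\<^sub>R (t b *\<^sub>R b) \<in> convex_cone hull B" "2 *\<^sub>R ?w \<in> convex_cone hull B"
      using w b by (auto intro!: convex_cone_hull_mul simp: hull_inc)
    moreover have "2 *\<^sub>R (t b *\<^sub>R b) \<noteq> 2 *\<^sub>R ?w"
      using False by (simp only: scaleR_cancel_left) simp
    then have "v \<in> open_segment (2 *\<^sub>R (t b *\<^sub>R b)) (2 *\<^sub>R ?w)"
      unfolding in_segment using vw by (intro conjI exI[of _ "1/2"]) simp_all
    ultimately have "2 *\<^sub>R (t b *\<^sub>R b) \<in> convex_cone hull {v}"
      using f \<open>v \<in> convex_cone hull {v}\<close> unfolding face_of_def by blast
    then obtain s where s: "2 *\<^sub>R (t b *\<^sub>R b) = s *\<^sub>R v" "s \<ge> 0" unfolding convex_cone_hull_singleton by blast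
    have "b \<noteq> 0" using B b dependent_zero by blast
    then have "s \<noteq> 0" using s(1) b by auto
    have "(1 / s) *\<^sub>R (s *\<^sub>R v) = (1 / s) *\<^sub>R (2 *\<^sub>R (t b *\<^sub>R b))" using s(1) by simp
    then have "v = (2 * t b / s) *\<^sub>R b" using \<open>s \<noteq> 0\<close> by simp
    then show ?thesis using b s \<open>s \<noteq> 0\<close> by (intro bexI[of _ b] exI[of _ "2 * t b / s"]) auto
  qed
qed

subsection \<open>Lattice points\<close>

lemma lattice_0 [simp]: "0 \<in> integer_lattice"
  by (simp add: integer_lattice_def)

lemma lattice_add: "v \<in> integer_lattice \<Longrightarrow> w \<in> integer_lattice \<Longrightarrow> v + w \<in> integer_lattice"
  and lattice_diff: "v \<in> integer_lattice \<Longrightarrow> w \<in> integer_lattice \<Longrightarrow> v - w \<in> integer_lattice"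
  and lattice_scale: "v \<in> integer_lattice \<Longrightarrow> of_int k *\<^sub>R v \<in> integer_lattice"
  by (auto simp: integer_lattice_def)

lemma lattice_sum: "(\<And>i. i \<in> A \<Longrightarrow> f i \<in> integer_lattice) \<Longrightarrow> sum f A \<in> integer_lattice"
  by (induction A rule: infinite_finite_induct) (auto intro: lattice_add)

text \<open>The multiples \<open>t\<close> with \<open>t g\<close> integral lie in \<open>(1/n) \<int>\<close> for a nonzero coordinate \<open>\<plusminus>n\<close> of \<open>g\<close>; the least positive one generates all others by division with remainder.\<close>

lemma primitive_vector_exists:
  assumes g: "g \<in> integer_lattice" "g \<noteq> 0"
  shows "\<exists>s>0. s *\<^sub>R g \<in> integer_lattice \<and>
    (\<forall>t\<ge>0. t *\<^sub>R g \<in> integer_lattice \<longrightarrow> (\<exists>k::nat. t = real k * s))"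
proof -
  obtain i where i: "g $ i \<noteq> 0" using g(2) by (auto simp: vec_eq_iff)
  obtain z :: int where z: "g $ i = of_int z" using g(1) by (auto simp: integer_lattice_def elim: Ints_cases)
  define n where "n = nat \<bar>z\<bar>"
  have n: "n > 0" "real n = \<bar>g $ i\<bar>" using i z by (auto simp: n_def)
  have quant: "\<exists>k::nat. t * real n = real k" if t: "t \<ge> 0" "t *\<^sub>R g \<in> integer_lattice" for t
  proof -
    have "t * g $ i \<in> \<int>" using t(2) by (auto simp: integer_lattice_def)
    then obtain w :: int where "t * g $ i = of_int w" by (auto elim: Ints_cases)
    then have "t * real n = real (nat \<bar>w\<bar>)" using t(1) n(2) by (metis abs_mult abs_of_nonneg of_int_abs of_nat_nat abs_ge_zero of_int_of_nat_eq)
    then show ?thesis by blast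
  qed
  let ?P = "\<lambda>k. k > 0 \<and> (real k / real n) *\<^sub>R g \<in> integer_lattice"
  define k where "k = (LEAST k. ?P k)"
  have "?P n" using n g by simp
  then have k: "?P k" unfolding k_def by (rule LeastI[of ?P])
  have least: "k \<le> k'" if "?P k'" for k'
    using that unfolding k_def by (rule Least_le[of ?P])
  define s where "s = real k / real n"
  have s: "s > 0" "s *\<^sub>R g \<in> integer_lattice" using k n by (auto simp: s_def)
  have "\<exists>q::nat. t = real q * s" if t: "t \<ge> 0" "t *\<^sub>R g \<in> integer_lattice" for t
  proof -
    define q where "q = nat \<lfloor>t / s\<rfloor>"
    have q: "real q * s \<le> t" "t < (real q + 1) * s"
    proof -
      have "real q = of_int \<lfloor>t / s\<rfloor>" using t(1) s(1) by (simp add: q_def)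
      then have "real q \<le> t / s" "t / s < real q + 1" by linarith+
      then show "real q * s \<le> t" "t < (real q + 1) * s" using s(1) by (auto simp: field_simps)
    qed
    define t' where "t' = t - real q * s"
    have t': "t' \<ge> 0" "t' < s" using q by (auto simp: t'_def algebra_simps)
    have "t' *\<^sub>R g = t *\<^sub>R g - of_int (int q) *\<^sub>R (s *\<^sub>R g)" by (simp add: t'_def algebra_simps)
    also have "\<dots> \<in> integer_lattice" by (intro lattice_diff lattice_scale t s)
    finally have lat: "t' *\<^sub>R g \<in> integer_lattice" .
    obtain k' where k': "t' * real n = real k'" using quant[OF t'(1) lat] by blast
    have "t' = real k' / real n" using k' n(1) by (simp add: field_simps)
    have "t' = 0"
    proof (rule ccontr)
      assume "t' \<noteq> 0"
      then have "?P k'" using lat \<open>t' = real k' / real n\<close> by (auto intro!: Nat.gr0I)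
      then have "k \<le> k'" by (rule least)
      then have "s \<le> t'" unfolding s_def \<open>t' = real k' / real n\<close> using n(1) by (simp add: divide_right_mono)
      then show False using t' by simp
    qed
    then show ?thesis by (auto simp: t'_def)
  qed
  then show ?thesis using s by blast
qed

subsection \<open>Cones of a simplicial fan\<close>

locale toric_fan =
  fixes \<Sigma> :: "(real ^ 'n) set set" and \<mu> :: "'p::finite \<Rightarrow> real ^ 'n"
  assumes simplicial: "simplicial_fan \<Sigma>"
    and max_full: "maximal_cones_full_dimensional \<Sigma>"
    and convex_support: "convex (fan_support \<Sigma>)"
    and rays: "bij_betw \<mu> UNIV (ray_generators \<Sigma>)"
begin

lemma fan_facts:
  shows finite_fan: "finite \<Sigma>"
    and cone_rational: "\<sigma> \<in> \<Sigma> \<Longrightarrow> rational_cone \<sigma>"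
    and cone_face: "\<sigma> \<in> \<Sigma> \<Longrightarrow> \<tau> face_of \<sigma> \<Longrightarrow> \<tau> \<noteq> {} \<Longrightarrow> \<tau> \<in> \<Sigma>"
    and cone_inter: "\<sigma> \<in> \<Sigma> \<Longrightarrow> \<tau> \<in> \<Sigma> \<Longrightarrow> (\<sigma> \<inter> \<tau>) face_of \<sigma>"
    and cone_basis: "\<sigma> \<in> \<Sigma> \<Longrightarrow> \<exists>B. independent B \<and> \<sigma> = convex_cone hull B"
  using simplicial unfolding simplicial_fan_def fan_def by blast+

lemma cone_convex_cone: "\<sigma> \<in> \<Sigma> \<Longrightarrow> convex_cone \<sigma>"
  using cone_basis convex_cone_convex_cone_hull by blast

lemma cone_in_full_cone:
  assumes "\<sigma> \<in> \<Sigma>"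
  shows "\<exists>\<tau>\<in>\<Sigma>. \<sigma> \<subseteq> \<tau> \<and> dim \<tau> = CARD('n)"
proof -
  obtain \<tau> where \<tau>: "\<tau> \<in> \<Sigma>" "\<sigma> \<subseteq> \<tau>" "\<And>\<rho>. \<rho> \<in> \<Sigma> \<Longrightarrow> \<tau> \<subseteq> \<rho> \<Longrightarrow> \<tau> = \<rho>"
    using finite_has_maximal2[OF finite_fan assms] by blast
  have "dim \<tau> = CARD('n)"
    using max_full \<tau>(1) \<tau>(3)[symmetric] unfolding maximal_cones_full_dimensional_def by simp
  with \<tau> show ?thesis by blast
qed

lemma mu_generator: "\<mu> j \<in> ray_generators \<Sigma>"
  using rays by (auto simp: bij_betw_def)

lemma mu_lattice: "\<mu> j \<in> integer_lattice" and mu_nonzero: "\<mu> j \<noteq> 0"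
  using mu_generator[of j] unfolding ray_generators_def by blast+

lemma dim_convex_cone_hull: "dim (convex_cone hull B) = dim (B :: 'a::euclidean_space set)"
proof -
  have "convex_cone hull B \<subseteq> span B" by (rule hull_minimal) (rule span_superset, rule convex_cone_span)
  then have "span (convex_cone hull B) \<subseteq> span B" by (rule span_minimal) (rule subspace_span)
  moreover have "span B \<subseteq> span (convex_cone hull B)" by (rule span_mono) (rule hull_subset)
  ultimately have "dim (span (convex_cone hull B)) = dim (span B)" by simp
  then show ?thesis by (simp only: dim_span)
qed

lemma ray_of_generator:
  assumes "v \<in> ray_generators \<Sigma>"
  shows "convex_cone hull {v} \<in> \<Sigma>"
    and "w \<in> convex_cone hull {v} \<Longrightarrow> w \<in> integer_lattice \<Longrightarrow> \<exists>k::nat. w = real k *\<^sub>R v"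
proof -
  obtain \<rho> where \<rho>: "\<rho> \<in> \<Sigma>" "dim \<rho> = 1" "v \<in> \<rho>" "v \<noteq> 0"
    "\<forall>w \<in> \<rho> \<inter> integer_lattice. \<exists>k::nat. w = real k *\<^sub>R v"
    using assms unfolding ray_generators_def by blast
  obtain B where B: "independent B" "\<rho> = convex_cone hull B" using cone_basis[OF \<rho>(1)] by blast
  have "card B = 1" using \<rho>(2) dim_eq_card_independent[OF B(1)] by (simp add: B(2) dim_convex_cone_hull)
  then obtain b where b: "B = {b}" by (auto simp: card_1_singleton_iff)
  obtain t where t: "v = t *\<^sub>R b" "t \<ge> 0" using \<rho>(3) unfolding B(2) b convex_cone_hull_singleton by blast
  have "t \<noteq> 0" using t(1) \<rho>(4) by auto
  have "\<rho> \<subseteq> convex_cone hull {v}"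
  proof
    fix x assume "x \<in> \<rho>"
    then obtain s where "x = s *\<^sub>R b" "s \<ge> 0" unfolding B(2) b convex_cone_hull_singleton by blast
    then have "x = (s / t) *\<^sub>R v" "s / t \<ge> 0" using t \<open>t \<noteq> 0\<close> by auto
    then show "x \<in> convex_cone hull {v}" unfolding convex_cone_hull_singleton by blast
  qed
  moreover have "convex_cone hull {v} \<subseteq> \<rho>"
    using \<rho>(3) cone_convex_cone[OF \<rho>(1)] by (intro hull_minimal) auto
  ultimately have eq: "convex_cone hull {v} = \<rho>" by blast
  show "convex_cone hull {v} \<in> \<Sigma>" using \<rho>(1) eq by simp
  show "w \<in> convex_cone hull {v} \<Longrightarrow> w \<in> integer_lattice \<Longrightarrow> \<exists>k::nat. w = real k *\<^sub>R v"
    using \<rho>(5) eq by blast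
qed

text \<open>The ray spanned by a basis vector is a face of \<open>\<sigma>\<close> and hence a rational cone of the fan; its primitive lattice vector is one of the \<open>\<mu>\<^sub>j\<close>.\<close>

lemma generator_on_basis_ray:
  assumes \<sigma>: "\<sigma> \<in> \<Sigma>" "\<sigma> = convex_cone hull B" "independent B" and b: "b \<in> B"
  shows "\<exists>j. \<exists>t>0. \<mu> j = t *\<^sub>R b"
proof -
  let ?\<rho> = "convex_cone hull {b}"
  have "?\<rho> face_of \<sigma>" using ray_face_of_simplicial_cone[OF \<sigma>(3) b] \<sigma>(2) by simp
  then have \<rho>: "?\<rho> \<in> \<Sigma>" using cone_face[OF \<sigma>(1)] convex_cone_hull_nonempty by blast
  have b0: "b \<noteq> 0" using \<sigma>(3) b dependent_zero by blast
  have dim1: "dim ?\<rho> = 1" using b0 by (simp add: dim_convex_cone_hull dim_singleton)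
  obtain G where G: "finite G" "G \<subseteq> integer_lattice" "?\<rho> = convex_cone hull G"
    using cone_rational[OF \<rho>] unfolding rational_cone_def by blast
  have "\<exists>g\<in>G. g \<noteq> 0"
  proof (rule ccontr)
    assume "\<not> ?thesis"
    then have "?\<rho> \<subseteq> {0}" unfolding G(3) by (intro hull_minimal) auto
    then show False using b0 hull_inc[of b "{b}" convex_cone] by auto
  qed
  then obtain g where g: "g \<in> G" "g \<noteq> 0" by blast
  then have "g \<in> ?\<rho>" using G(3) by (simp add: hull_inc)
  then obtain c where c: "g = c *\<^sub>R b" "c \<ge> 0" unfolding convex_cone_hull_singleton by blast
  then have c0: "c > 0" using g(2) by (cases "c = 0") auto
  obtain s where s: "s > 0" "s *\<^sub>R g \<in> integer_lattice"
    "\<And>t. t \<ge> 0 \<Longrightarrow> t *\<^sub>R g \<in> integer_lattice \<Longrightarrow> \<exists>k::nat. t = real k * s"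
    using primitive_vector_exists[of g] G(2) g by blast
  have "s *\<^sub>R g \<in> ray_generators \<Sigma>"
    unfolding ray_generators_def
  proof (intro CollectI bexI[OF _ \<rho>] conjI ballI)
    show "dim ?\<rho> = 1" by (rule dim1)
    have "s *\<^sub>R g = (s * c) *\<^sub>R b" "s * c \<ge> 0" using c s by auto
    then show "s *\<^sub>R g \<in> ?\<rho> \<inter> integer_lattice" using s(2) unfolding convex_cone_hull_singleton by blast
    show "s *\<^sub>R g \<noteq> 0" using s(1) g(2) by simp
    fix w assume w: "w \<in> ?\<rho> \<inter> integer_lattice"
    then obtain t where t: "w = t *\<^sub>R b" "t \<ge> 0" unfolding convex_cone_hull_singleton by blast
    then have wg: "w = (t / c) *\<^sub>R g" "t / c \<ge> 0" using c c0 by auto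
    then obtain k :: nat where "t / c = real k * s" using s(3) w by auto
    then show "\<exists>k::nat. w = real k *\<^sub>R s *\<^sub>R g" using wg by auto
  qed
  then obtain j where "\<mu> j = s *\<^sub>R g" using rays by (metis bij_betw_def imageE)
  then show ?thesis using c s(1) c0 by (intro exI[of _ j] exI[of _ "s * c"]) auto
qed

text \<open>The ray of \<open>\<mu>\<^sub>j\<close> is a cone of the fan contained in \<open>\<sigma>\<close>, so it is a face of \<open>\<sigma>\<close>, and the one-dimensional faces of a simplicial cone are the rays of its basis.\<close>

lemma mu_on_basis_ray:
  assumes \<sigma>: "\<sigma> \<in> \<Sigma>" "\<sigma> = convex_cone hull B" "independent B" and j: "\<mu> j \<in> \<sigma>"
  shows "\<exists>b\<in>B. \<exists>t>0. \<mu> j = t *\<^sub>R b"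
proof -
  have \<rho>: "convex_cone hull {\<mu> j} \<in> \<Sigma>" by (rule ray_of_generator(1)[OF mu_generator])
  have "convex_cone hull {\<mu> j} \<subseteq> \<sigma>"
    using j cone_convex_cone[OF \<sigma>(1)] by (intro hull_minimal) auto
  then have "convex_cone hull {\<mu> j} face_of \<sigma>"
    using cone_inter[OF \<sigma>(1) \<rho>] by (simp add: Int_absorb1)
  then show ?thesis using ray_face_is_generator[OF \<sigma>(3) _ mu_nonzero] \<sigma>(2) by simp
qed

lemma mu_inj_ray:
  assumes "\<mu> i = t *\<^sub>R b" "\<mu> j = s *\<^sub>R b" "s > 0" "t > 0"
  shows "i = j"
proof -
  have 1: "\<mu> i = (t / s) *\<^sub>R \<mu> j" "\<mu> j = (s / t) *\<^sub>R \<mu> i" "t / s \<ge> 0" "s / t \<ge> 0" using assms by auto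
  then have "\<mu> i \<in> convex_cone hull {\<mu> j}" "\<mu> j \<in> convex_cone hull {\<mu> i}"
    unfolding convex_cone_hull_singleton by blast+
  then obtain k k' :: nat where k: "\<mu> i = real k *\<^sub>R \<mu> j" "\<mu> j = real k' *\<^sub>R \<mu> i"
    using ray_of_generator(2)[OF mu_generator _ mu_lattice] by metis
  have "1 *\<^sub>R \<mu> j = (real k' * real k) *\<^sub>R \<mu> j" using k by (simp only: scaleR_scaleR[symmetric] scaleR_one)
  then have "1 = real k' * real k" using mu_nonzero[of j] by (simp only: scaleR_cancel_right) simp
  then have "real (k' * k) = real 1" by simp
  then have "k' * k = 1" by (simp only: of_nat_eq_iff)
  then have "\<mu> i = \<mu> j" using k by simp
  then show "i = j" using rays by (metis bij_betw_def inj_eq)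
qed

text \<open>All that the algebraic part needs to know about the fan: the generators of a cone have a dual basis.\<close>

lemma dual_vectors:
  assumes "\<exists>\<sigma>\<in>\<Sigma>. \<mu> ` S \<subseteq> \<sigma>" "j \<in> S"
  shows "\<exists>u. u \<bullet> \<mu> j = 1 \<and> (\<forall>i\<in>S - {j}. u \<bullet> \<mu> i = 0)"
proof -
  obtain \<sigma> B where \<sigma>: "\<sigma> \<in> \<Sigma>" "\<sigma> = convex_cone hull B" "independent B" "\<mu> ` S \<subseteq> \<sigma>"
    using assms(1) cone_basis by blast
  obtain b t where b: "b \<in> B" "t > 0" "\<mu> j = t *\<^sub>R b"
    using mu_on_basis_ray[OF \<sigma>(1-3), of j] \<sigma>(4) assms(2) by blast
  obtain u where u: "u \<bullet> b = 1" "\<And>b'. b' \<in> B - {b} \<Longrightarrow> u \<bullet> b' = 0"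
    using independent_dual_vector[OF \<sigma>(3) b(1)] by blast
  show ?thesis
  proof (intro exI[of _ "(1 / t) *\<^sub>R u"] conjI ballI)
    show "(1 / t) *\<^sub>R u \<bullet> \<mu> j = 1" using b u by simp
    fix i assume i: "i \<in> S - {j}"
    obtain b' t' where b': "b' \<in> B" "t' > 0" "\<mu> i = t' *\<^sub>R b'"
      using mu_on_basis_ray[OF \<sigma>(1-3), of i] \<sigma>(4) i by blast
    have "b' \<noteq> b" using mu_inj_ray[OF b'(3) _ _ b'(2)] b i by auto
    then show "(1 / t) *\<^sub>R u \<bullet> \<mu> i = 0" using u(2)[of b'] b' by simp
  qed
qed

abbreviation gens :: "(real ^ 'n) set \<Rightarrow> 'p set" where "gens \<sigma> \<equiv> {j. \<mu> j \<in> \<sigma>}"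

lemma cone_dual_family:
  assumes "\<sigma> \<in> \<Sigma>"
  obtains u where "\<And>i j. i \<in> gens \<sigma> \<Longrightarrow> j \<in> gens \<sigma> \<Longrightarrow> u i \<bullet> \<mu> j = (if i = j then 1 else 0)"
proof -
  have "\<forall>j. \<exists>u. j \<in> gens \<sigma> \<longrightarrow> u \<bullet> \<mu> j = 1 \<and> (\<forall>i\<in>gens \<sigma> - {j}. u \<bullet> \<mu> i = 0)"
    using dual_vectors[of "gens \<sigma>"] assms by blast
  then obtain u where "\<And>j. j \<in> gens \<sigma> \<Longrightarrow> u j \<bullet> \<mu> j = 1 \<and> (\<forall>i\<in>gens \<sigma> - {j}. u j \<bullet> \<mu> i = 0)" by metis
  then show ?thesis by (intro that[of u]) auto
qed

lemma inner_dual_gens: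
  assumes u: "\<And>i j. i \<in> gens \<sigma> \<Longrightarrow> j \<in> gens \<sigma> \<Longrightarrow> u i \<bullet> \<mu> j = (if i = j then 1 else (0::real))" and i: "i \<in> gens \<sigma>"
  shows "u i \<bullet> (\<Sum>j\<in>gens \<sigma>. t j *\<^sub>R \<mu> j) = t i"
proof -
  have "u i \<bullet> (\<Sum>j\<in>gens \<sigma>. t j *\<^sub>R \<mu> j) = (\<Sum>j\<in>gens \<sigma>. if j = i then t j else 0)"
    unfolding inner_sum_right by (intro sum.cong refl) (use u i in auto)
  then show ?thesis using i by simp
qed

lemma cone_eq_hull_gens:
  assumes "\<sigma> \<in> \<Sigma>"
  shows "\<sigma> = convex_cone hull (\<mu> ` gens \<sigma>)"
proof
  show "convex_cone hull (\<mu> ` gens \<sigma>) \<subseteq> \<sigma>"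
    using cone_convex_cone[OF assms] by (intro hull_minimal) auto
  obtain B where B: "independent B" "\<sigma> = convex_cone hull B" using cone_basis[OF assms] by blast
  have "B \<subseteq> convex_cone hull (\<mu> ` gens \<sigma>)"
  proof
    fix b assume b: "b \<in> B"
    obtain j t where j: "t > 0" "\<mu> j = t *\<^sub>R b" using generator_on_basis_ray[OF assms B(2,1) b] by blast
    have "\<mu> j \<in> \<sigma>" using j b unfolding B(2) by (auto intro!: convex_cone_hull_mul simp: hull_inc)
    then have "\<mu> j \<in> \<mu> ` gens \<sigma>" by blast
    then have "(1 / t) *\<^sub>R \<mu> j \<in> convex_cone hull (\<mu> ` gens \<sigma>)"
      using j(1) by (intro convex_cone_hull_mul hull_inc) auto
    then show "b \<in> convex_cone hull (\<mu> ` gens \<sigma>)" using j by simp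
  qed
  then have "convex_cone hull B \<subseteq> convex_cone hull (\<mu> ` gens \<sigma>)"
    by (intro hull_minimal convex_cone_convex_cone_hull)
  then show "\<sigma> \<subseteq> convex_cone hull (\<mu> ` gens \<sigma>)" by (simp add: B(2))
qed

lemma mu_inj: "inj \<mu>"
  using rays by (auto simp: bij_betw_def)

lemma cone_explicit:
  assumes "\<sigma> \<in> \<Sigma>" "x \<in> \<sigma>"
  obtains t where "x = (\<Sum>j\<in>gens \<sigma>. t j *\<^sub>R \<mu> j)" "\<And>j. j \<in> gens \<sigma> \<Longrightarrow> t j \<ge> 0"
proof -
  obtain t where t: "x = (\<Sum>b\<in>\<mu> ` gens \<sigma>. t b *\<^sub>R b)" "\<forall>b\<in>\<mu> ` gens \<sigma>. 0 \<le> t b"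
    using in_convex_cone_hullE[of "\<mu> ` gens \<sigma>" x] cone_eq_hull_gens[OF assms(1)] assms(2) by auto
  have "x = (\<Sum>j\<in>gens \<sigma>. t (\<mu> j) *\<^sub>R \<mu> j)"
    unfolding t(1) by (subst sum.reindex) (auto intro: inj_on_subset[OF mu_inj])
  then show ?thesis using t(2) by (intro that[of "\<lambda>j. t (\<mu> j)"]) auto
qed

text \<open>A full-dimensional cone has exactly \<open>n\<close> generators, and they form a basis of the space.\<close>

lemma full_cone_span:
  assumes "\<sigma> \<in> \<Sigma>" "dim \<sigma> = CARD('n)"
  shows "card (gens \<sigma>) = CARD('n)" "span (\<mu> ` gens \<sigma>) = UNIV"
    and "\<And>u x. (\<And>i j. i \<in> gens \<sigma> \<Longrightarrow> j \<in> gens \<sigma> \<Longrightarrow> u i \<bullet> \<mu> j = (if i = j then 1 else (0::real))) \<Longrightarrow>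
       x = (\<Sum>j\<in>gens \<sigma>. (u j \<bullet> x) *\<^sub>R \<mu> j)"
proof -
  obtain u where u: "\<And>i j. i \<in> gens \<sigma> \<Longrightarrow> j \<in> gens \<sigma> \<Longrightarrow> u i \<bullet> \<mu> j = (if i = j then 1 else 0)"
    using cone_dual_family[OF assms(1)] by blast
  have "independent (\<mu> ` gens \<sigma>)"
    unfolding independent_explicit
  proof (intro conjI allI impI ballI)
    fix c v assume c: "(\<Sum>v\<in>\<mu> ` gens \<sigma>. c v *\<^sub>R v) = 0" and v: "v \<in> \<mu> ` gens \<sigma>"
    have "(\<Sum>j\<in>gens \<sigma>. c (\<mu> j) *\<^sub>R \<mu> j) = 0"
      using c by (subst (asm) sum.reindex) (auto intro: inj_on_subset[OF mu_inj])
    moreover obtain i where i: "i \<in> gens \<sigma>" "v = \<mu> i" using v by blast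
    ultimately show "c v = 0" using inner_dual_gens[OF u i(1), where t = "\<lambda>j. c (\<mu> j)"] by simp
  qed simp
  moreover have "dim (\<mu> ` gens \<sigma>) = CARD('n)"
    using dim_convex_cone_hull[of "\<mu> ` gens \<sigma>"]
    unfolding cone_eq_hull_gens[OF assms(1), symmetric] assms(2) by simp
  ultimately have "card (\<mu> ` gens \<sigma>) = CARD('n)" using dim_eq_card_independent[of "\<mu> ` gens \<sigma>"] by simp
  then show "card (gens \<sigma>) = CARD('n)" by (simp add: card_image inj_on_subset[OF mu_inj])
  show sp: "span (\<mu> ` gens \<sigma>) = UNIV"
    using \<open>dim (\<mu> ` gens \<sigma>) = CARD('n)\<close> by (simp add: dim_eq_full[symmetric])
  fix u x assume u: "\<And>i j. i \<in> gens \<sigma> \<Longrightarrow> j \<in> gens \<sigma> \<Longrightarrow> u i \<bullet> \<mu> j = (if i = j then 1 else (0::real))"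
  have "x \<in> span (\<mu> ` gens \<sigma>)" using sp by simp
  then obtain t where "x = (\<Sum>v\<in>\<mu> ` gens \<sigma>. t v *\<^sub>R v)" by (auto simp: span_finite)
  then have t: "x = (\<Sum>j\<in>gens \<sigma>. t (\<mu> j) *\<^sub>R \<mu> j)"
    by (subst (asm) sum.reindex) (auto intro: inj_on_subset[OF mu_inj])
  have "t (\<mu> j) = u j \<bullet> x" if "j \<in> gens \<sigma>" for j
    using inner_dual_gens[OF u that, where t = "\<lambda>j. t (\<mu> j)"] unfolding t[symmetric] by simp
  then have "(\<Sum>j\<in>gens \<sigma>. t (\<mu> j) *\<^sub>R \<mu> j) = (\<Sum>j\<in>gens \<sigma>. (u j \<bullet> x) *\<^sub>R \<mu> j)"
    by (intro sum.cong) auto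
  with t show "x = (\<Sum>j\<in>gens \<sigma>. (u j \<bullet> x) *\<^sub>R \<mu> j)" by (rule trans)
qed

end

section \<open>Convex piecewise linear functions and the dual cone\<close>

lemma relation_lattice_iff:
  "l \<in> relation_lattice \<mu> \<longleftrightarrow>
    (\<Sum>i\<in>UNIV. l $ i) = 0 \<and> (\<Sum>i\<in>UNIV. real_of_int (l $ i) *\<^sub>R mu \<mu> i) = 0"
proof -
  have "(\<Sum>i\<in>UNIV. real_of_int (l $ i) *\<^sub>R mu_bar \<mu> i) =
     (real_of_int (\<Sum>i\<in>UNIV. l $ i), \<Sum>i\<in>UNIV. real_of_int (l $ i) *\<^sub>R mu \<mu> i)"
    by (simp add: mu_bar_def prod_eq_iff fst_sum snd_sum)
  then show ?thesis by (auto simp: relation_lattice_def zero_prod_def simp flip: of_int_sum)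
qed

lemma relation_lattice_affine:
  assumes "l \<in> relation_lattice \<mu>" "linear f"
  shows "(\<Sum>i\<in>UNIV. real_of_int (l $ i) * (f (mu \<mu> i) + b)) = (0::real)"
proof -
  have "(\<Sum>i\<in>UNIV. real_of_int (l $ i) * (f (mu \<mu> i) + b)) =
     f (\<Sum>i\<in>UNIV. real_of_int (l $ i) *\<^sub>R mu \<mu> i) + of_int (\<Sum>i\<in>UNIV. l $ i) * b"
    using assms(2) by (simp add: linear_sum linear_scale distrib_left sum.distrib sum_distrib_right)
  also have "\<dots> = 0"
    using assms linear_0[OF assms(2)] by (simp add: relation_lattice_iff del: of_int_sum)
  finally show ?thesis .
qed

locale semi_positive_fan = toric_fan \<Sigma> \<mu>
  for \<Sigma> :: "(real ^ 'n) set set" and \<mu> :: "'p::finite \<Rightarrow> real ^ 'n" +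
  assumes semi_positive: "c1_semi_positive \<Sigma>"
    and regular: "regular_triangulation \<Sigma> \<mu>"
begin

lemma support_iff: "x \<in> fan_support \<Sigma> \<longleftrightarrow> (\<exists>\<sigma>\<in>\<Sigma>. x \<in> \<sigma>)"
  by (auto simp: fan_support_def)

lemma support_scale: "x \<in> fan_support \<Sigma> \<Longrightarrow> 0 \<le> c \<Longrightarrow> c *\<^sub>R x \<in> fan_support \<Sigma>"
  unfolding support_iff using cone_convex_cone convex_cone_scaleR by blast

lemma support_add:
  assumes "x \<in> fan_support \<Sigma>" "y \<in> fan_support \<Sigma>"
  shows "x + y \<in> fan_support \<Sigma>"
proof -
  have "(1/2) *\<^sub>R x + (1/2) *\<^sub>R y \<in> fan_support \<Sigma>"
    by (rule convexD[OF convex_support assms]) auto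
  then have "2 *\<^sub>R ((1/2) *\<^sub>R x + (1/2) *\<^sub>R y) \<in> fan_support \<Sigma>" by (rule support_scale) simp
  then show ?thesis by (simp add: scaleR_add_right)
qed

lemma mu_support: "\<mu> j \<in> fan_support \<Sigma>"
  using ray_of_generator(1)[OF mu_generator, of j] hull_inc[of "\<mu> j" "{\<mu> j}" convex_cone]
  unfolding support_iff by blast

lemma support_0: "0 \<in> fan_support \<Sigma>"
  using support_scale[OF mu_support, of 0] by simp

lemma mu_in_nabla: "mu \<mu> i \<in> nabla \<Sigma>"
  unfolding nabla_def using mu_generator by (intro hull_inc) (auto simp: mu_def split: option.splits)

lemma convex_nabla: "convex (nabla \<Sigma>)"
  unfolding nabla_def by (rule convex_convex_hull)

lemma nabla_subset: "nabla \<Sigma> \<subseteq> fan_support \<Sigma>"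
  unfolding nabla_def
proof (rule hull_minimal)
  have "ray_generators \<Sigma> = range \<mu>" using rays by (simp add: bij_betw_def)
  then show "insert 0 (ray_generators \<Sigma>) \<subseteq> fan_support \<Sigma>" using mu_support support_0 by auto
qed (rule convex_support)

text \<open>The support function that represents the first Chern class; it is \<open>1\<close> on all ray generators and convex by semi-positivity.\<close>

definition degree_function :: "(real ^ 'n \<Rightarrow> real) \<Rightarrow> bool" where
  "degree_function \<alpha> \<longleftrightarrow> c1_function \<Sigma> \<alpha> \<and>
    (\<forall>x\<in>fan_support \<Sigma>. \<forall>y\<in>fan_support \<Sigma>. \<alpha> (x + y) \<le> \<alpha> x + \<alpha> y)"

lemma degree_function_exists: "\<exists>\<alpha>. degree_function \<alpha>"
  using semi_positive unfolding c1_semi_positive_def degree_function_def .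

context
  fixes \<alpha> assumes \<alpha>: "degree_function \<alpha>"
begin

lemma degree_linear_on_cone: "\<sigma> \<in> \<Sigma> \<Longrightarrow> \<exists>f. linear f \<and> (\<forall>x\<in>\<sigma>. \<alpha> x = f x)"
  using \<alpha>[unfolded degree_function_def c1_function_def, THEN conjunct1, THEN conjunct1] by (rule bspec)

lemma degree_mu: "\<alpha> (\<mu> j) = 1"
  using \<alpha>[unfolded degree_function_def c1_function_def, THEN conjunct1, THEN conjunct2] mu_generator by (rule bspec)

lemma degree_add: "x \<in> fan_support \<Sigma> \<Longrightarrow> y \<in> fan_support \<Sigma> \<Longrightarrow> \<alpha> (x + y) \<le> \<alpha> x + \<alpha> y"
  using \<alpha>[unfolded degree_function_def, THEN conjunct2] by simp

lemma degree_scale: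
  assumes "x \<in> fan_support \<Sigma>" "0 \<le> c"
  shows "\<alpha> (c *\<^sub>R x) = c * \<alpha> x"
proof -
  obtain \<sigma> where \<sigma>: "\<sigma> \<in> \<Sigma>" "x \<in> \<sigma>" using assms(1) support_iff by auto
  obtain f where f: "linear f" "\<forall>x\<in>\<sigma>. \<alpha> x = f x"
    using degree_linear_on_cone[OF \<sigma>(1)] by (elim exE conjE)
  have "c *\<^sub>R x \<in> \<sigma>" using cone_convex_cone[OF \<sigma>(1)] assms(2) \<sigma>(2) by (rule convex_cone_scaleR)
  then show ?thesis using f \<sigma>(2) by (simp add: linear_scale)
qed

lemma degree_0: "\<alpha> 0 = 0"
  using degree_scale[OF support_0, of 0] by simp

end

text \<open>The convex function with value \<open>1\<close> on all rays and \<open>0\<close> at the origin belongs to \<open>pl_cone\<close>.  Pairing it with \<open>l\<close> gives \<open>- l\<^sub>0\<close>, because the entries of \<open>l\<close> sum to zero.\<close>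

lemma dual_cone_first_nonpos:
  assumes "l \<in> dual_cone_lattice \<Sigma> \<mu>"
  shows "l $ None \<le> 0"
proof -
  obtain \<alpha> where \<alpha>: "degree_function \<alpha>" using degree_function_exists by (elim exE)
  have "(\<chi> i. \<alpha> (mu \<mu> i)) \<in> pl_cone \<Sigma> \<mu>"
    unfolding pl_cone_def mem_Collect_eq
  proof (rule exI[of _ \<alpha>], intro conjI ballI allI)
    show "convex_on (nabla \<Sigma>) \<alpha>"
      unfolding convex_on_def
    proof (intro conjI ballI allI impI convex_nabla)
      fix x y and u v :: real
      assume "x \<in> nabla \<Sigma>" "y \<in> nabla \<Sigma>" and uv: "0 \<le> u" "0 \<le> v" "u + v = 1"
      then have x: "x \<in> fan_support \<Sigma>" and y: "y \<in> fan_support \<Sigma>" using nabla_subset by auto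
      have "\<alpha> (u *\<^sub>R x + v *\<^sub>R y) \<le> \<alpha> (u *\<^sub>R x) + \<alpha> (v *\<^sub>R y)"
        by (intro degree_add[OF \<alpha>] support_scale x y uv)
      then show "\<alpha> (u *\<^sub>R x + v *\<^sub>R y) \<le> u * \<alpha> x + v * \<alpha> y" using degree_scale[OF \<alpha>] x y uv by simp
    qed
    fix S assume "S \<in> triangulation_cells \<Sigma>"
    then obtain \<sigma> where \<sigma>: "S = \<sigma> \<inter> nabla \<Sigma>" "\<sigma> \<in> \<Sigma>" by (auto simp: triangulation_cells_def)
    obtain f where "linear f" "\<forall>x\<in>\<sigma>. \<alpha> x = f x"
      using degree_linear_on_cone[OF \<alpha> \<sigma>(2)] by (elim exE conjE)
    then show "\<exists>f b. linear f \<and> (\<forall>x\<in>S. \<alpha> x = f x + b)"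
      using \<sigma>(1) by (intro exI[of _ f] exI[of _ 0]) auto
  qed simp
  then have "(\<Sum>i\<in>UNIV. real_of_int (l $ i) * \<alpha> (mu \<mu> i)) \<ge> 0"
    using assms unfolding dual_cone_lattice_def by fastforce
  also have "(\<Sum>i\<in>UNIV. real_of_int (l $ i) * \<alpha> (mu \<mu> i)) = of_int (\<Sum>j\<in>UNIV. l $ Some j)"
    unfolding sum_option by (simp add: mu_def degree_0[OF \<alpha>] degree_mu[OF \<alpha>])
  finally have "0 \<le> (\<Sum>j\<in>UNIV. l $ Some j)" by (simp only: of_int_0_le_iff)
  moreover have "(\<Sum>i\<in>UNIV. l $ i) = 0"
    using assms by (auto simp: dual_cone_lattice_def relation_lattice_iff)
  ultimately show ?thesis unfolding sum_option by simp
qed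

text \<open>On a segment from an interior point of the cell to \<open>x\<close> the convex function agrees with the affine one near the start, so it lies above it at the end.\<close>

lemma pl_function_above_affine:
  assumes g: "convex_on (nabla \<Sigma>) g" and \<sigma>: "\<sigma> \<in> \<Sigma>" "dim \<sigma> = CARD('n)"
    and f: "linear f" "\<And>x. x \<in> \<sigma> \<inter> nabla \<Sigma> \<Longrightarrow> g x = f x + b"
    and x: "x \<in> nabla \<Sigma>"
  shows "f x + b \<le> g x"
proof -
  obtain u where u: "\<And>i j. i \<in> gens \<sigma> \<Longrightarrow> j \<in> gens \<sigma> \<Longrightarrow> u i \<bullet> \<mu> j = (if i = j then 1 else (0::real))"
    using cone_dual_family[OF \<sigma>(1)] by blast
  define N where "N = card (gens \<sigma>)"
  have N: "N > 0" using full_cone_span(1)[OF \<sigma>] by (simp add: N_def)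
  have ne: "\<exists>j. \<mu> j \<in> \<sigma>"
  proof (rule ccontr)
    assume "\<not> ?thesis"
    then have "gens \<sigma> = {}" by blast
    then show False using N by (simp add: N_def)
  qed
  (* the barycentre of the generators, an interior point of \<sigma> *)
  define y where "y = (\<Sum>j\<in>gens \<sigma>. (1 / real N) *\<^sub>R \<mu> j)"
  have uy: "u j \<bullet> y = 1 / N" if "j \<in> gens \<sigma>" for j
    unfolding y_def by (rule inner_dual_gens[OF u that])
  have in\<sigma>: "z \<in> \<sigma>" if "\<And>j. j \<in> gens \<sigma> \<Longrightarrow> u j \<bullet> z \<ge> 0" for z
  proof -
    have "(\<Sum>j\<in>A. (u j \<bullet> z) *\<^sub>R \<mu> j) \<in> \<sigma>" if "finite A" "A \<subseteq> gens \<sigma>" for A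
      using that
    proof (induction A rule: finite_induct)
      case empty
      then show ?case using convex_cone_contains_0[OF cone_convex_cone[OF \<sigma>(1)]] by simp
    next
      case (insert j A)
      then show ?case
        using \<open>\<And>j. j \<in> gens \<sigma> \<Longrightarrow> u j \<bullet> z \<ge> 0\<close>
        by (auto intro!: convex_cone_add[OF cone_convex_cone[OF \<sigma>(1)]] convex_cone_scaleR[OF cone_convex_cone[OF \<sigma>(1)]])
    qed
    from this[of "gens \<sigma>"] show ?thesis using full_cone_span(3)[OF \<sigma> u, of z] by simp
  qed
  have y\<sigma>: "y \<in> \<sigma>" by (rule in\<sigma>) (simp add: uy)
  have yn: "y \<in> nabla \<Sigma>"
    unfolding y_def
  proof (rule convex_sum[OF _ convex_nabla])
    show "(\<Sum>j\<in>gens \<sigma>. 1 / real N) = 1" using N ne by (simp add: N_def)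
    show "\<mu> j \<in> nabla \<Sigma>" for j using mu_in_nabla[of "Some j"] by (simp add: mu_def)
  qed (use ne in auto)
  define M where "M = 1 + (\<Sum>j\<in>gens \<sigma>. \<bar>u j \<bullet> (x - y)\<bar>)"
  have M1: "M \<ge> 1" by (simp add: M_def sum_nonneg)
  have Mj: "\<bar>u j \<bullet> (x - y)\<bar> \<le> M" if "j \<in> gens \<sigma>" for j
    using member_le_sum[OF that, of "\<lambda>j. \<bar>u j \<bullet> (x - y)\<bar>"] by (simp add: M_def)
  (* so small that the point at parameter t on the segment from y to x is still in \<sigma> *)
  define t where "t = 1 / (real N * M)"
  have NM: "real N * M \<ge> 1" using N M1 mult_mono[of 1 "real N" 1 M] by simp
  have t: "t > 0" "t \<le> 1" using NM unfolding t_def by (auto simp: divide_le_eq_1)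
  let ?z = "(1 - t) *\<^sub>R y + t *\<^sub>R x"
  have "?z \<in> \<sigma>"
  proof (rule in\<sigma>)
    fix j assume j: "j \<in> gens \<sigma>"
    have neg: "- \<bar>u j \<bullet> (x - y)\<bar> \<le> u j \<bullet> (x - y)" by simp
    have "t * \<bar>u j \<bullet> (x - y)\<bar> \<le> t * M" using t Mj[OF j] by (intro mult_left_mono) auto
    also have "\<dots> = 1 / N" using M1 by (simp add: t_def)
    finally have "- (1 / N) \<le> t * (u j \<bullet> (x - y))"
      using mult_left_mono[OF neg, of t] t(1) by simp
    moreover have "u j \<bullet> ?z = u j \<bullet> y + t * (u j \<bullet> (x - y))"
      by (simp add: inner_add_right inner_diff_right algebra_simps)
    ultimately show "u j \<bullet> ?z \<ge> 0" using uy[OF j] by simp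
  qed
  moreover have "?z \<in> nabla \<Sigma>"
    by (rule convexD[OF convex_nabla yn x]) (use t in auto)
  ultimately have "g ?z = f ?z + b" using f(2) by blast
  moreover have "g y = f y + b" using f(2) y\<sigma> yn by blast
  moreover have "g ?z \<le> (1 - t) * g y + t * g x"
    using convex_onD[OF g, of t y x] t yn x by simp
  moreover have "f ?z = (1 - t) * f y + t * f x" using f(1) by (simp add: linear_add linear_scale)
  ultimately have "t * (f x + b) \<le> t * g x" by (simp add: algebra_simps)
  then show ?thesis using t(1) by simp
qed

text \<open>Subtract from a function in \<open>pl_cone\<close> its affine piece on a full-dimensional cone that contains the negative part of \<open>l\<close>.  The pairing with the relation \<open>l\<close> does not change, and afterwards the function vanishes where \<open>l\<close> is negative and is nonnegative everywhere.\<close>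

lemma in_dual_cone_if_negative_part_in_cone:
  assumes l: "l \<in> relation_lattice \<mu>" and "\<exists>\<sigma>\<in>\<Sigma>. \<mu> ` {j. l $ Some j < 0} \<subseteq> \<sigma>"
  shows "l \<in> dual_cone_lattice \<Sigma> \<mu>"
  unfolding dual_cone_lattice_def
proof (intro CollectI conjI ballI l)
  fix c assume "c \<in> pl_cone \<Sigma> \<mu>"
  then obtain g where g: "convex_on (nabla \<Sigma>) g"
    "\<And>S. S \<in> triangulation_cells \<Sigma> \<Longrightarrow> \<exists>f b. linear f \<and> (\<forall>x\<in>S. g x = f x + b)"
    "\<And>i. c $ i = g (mu \<mu> i)" unfolding pl_cone_def by blast
  obtain \<sigma> where \<sigma>: "\<sigma> \<in> \<Sigma>" "dim \<sigma> = CARD('n)" "\<mu> ` {j. l $ Some j < 0} \<subseteq> \<sigma>"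
    using assms(2) cone_in_full_cone by (meson subset_trans)
  have "\<sigma> \<inter> nabla \<Sigma> \<in> triangulation_cells \<Sigma>" using \<sigma> by (auto simp: triangulation_cells_def)
  from g(2)[OF this] obtain f b where f: "linear f" "\<And>x. x \<in> \<sigma> \<inter> nabla \<Sigma> \<Longrightarrow> g x = f x + b" by blast
  have "0 \<le> real_of_int (l $ i) * (c $ i - (f (mu \<mu> i) + b))" for i
  proof (cases "l $ i < 0")
    case True
    have "mu \<mu> i \<in> \<sigma>"
    proof (cases i)
      case None
      then show ?thesis using convex_cone_contains_0[OF cone_convex_cone[OF \<sigma>(1)]] by (simp add: mu_def)
    next
      case (Some j)
      then show ?thesis using \<sigma>(3) True by (auto simp: mu_def)
    qed
    then have "g (mu \<mu> i) = f (mu \<mu> i) + b" using f(2) mu_in_nabla by blast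
    then show ?thesis by (simp add: g(3))
  next
    case False
    have "f (mu \<mu> i) + b \<le> g (mu \<mu> i)"
      by (rule pl_function_above_affine[OF g(1) \<sigma>(1,2) f mu_in_nabla])
    then show ?thesis using False by (simp add: g(3))
  qed
  then have "0 \<le> (\<Sum>i\<in>UNIV. real_of_int (l $ i) * (c $ i - (f (mu \<mu> i) + b)))"
    by (intro sum_nonneg) auto
  also have "\<dots> = (\<Sum>i\<in>UNIV. real_of_int (l $ i) * c $ i)"
    using relation_lattice_affine[OF l f(1), of b] by (simp only: right_diff_distrib sum_subtractf diff_0_right)
  finally show "0 \<le> (\<Sum>i\<in>UNIV. real_of_int (l $ i) * c $ i)" .
qed

lemma convex_cone_pl_cone: "convex_cone (pl_cone \<Sigma> \<mu>)"
  unfolding convex_cone_iff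
proof (intro conjI ballI allI impI)
  have "convex_on (nabla \<Sigma>) (\<lambda>_. 0 :: real)" using convex_nabla by (simp add: convex_on_def)
  moreover have "\<forall>S\<in>triangulation_cells \<Sigma>. \<exists>f b. linear f \<and> (\<forall>x\<in>S. (0::real) = f x + b)"
    by (intro ballI exI[of _ "\<lambda>_. 0"] exI[of _ 0]) (simp add: linear_zero)
  ultimately show "0 \<in> pl_cone \<Sigma> \<mu>" unfolding pl_cone_def by auto
next
  fix c d assume "c \<in> pl_cone \<Sigma> \<mu>" "d \<in> pl_cone \<Sigma> \<mu>"
  then obtain g h where g: "convex_on (nabla \<Sigma>) g" "convex_on (nabla \<Sigma>) h"
    "\<And>S. S \<in> triangulation_cells \<Sigma> \<Longrightarrow> \<exists>f b. linear f \<and> (\<forall>x\<in>S. g x = f x + b)"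
    "\<And>S. S \<in> triangulation_cells \<Sigma> \<Longrightarrow> \<exists>f b. linear f \<and> (\<forall>x\<in>S. h x = f x + b)"
    "\<And>i. c $ i = g (mu \<mu> i)" "\<And>i. d $ i = h (mu \<mu> i)" unfolding pl_cone_def by auto
  show "c + d \<in> pl_cone \<Sigma> \<mu>"
    unfolding pl_cone_def mem_Collect_eq
  proof (rule exI[of _ "\<lambda>x. g x + h x"], intro conjI ballI allI)
    show "convex_on (nabla \<Sigma>) (\<lambda>x. g x + h x)" by (rule convex_on_add[OF g(1,2)])
    fix S assume S: "S \<in> triangulation_cells \<Sigma>"
    obtain f b f' b' where "linear f" "\<forall>x\<in>S. g x = f x + b" "linear f'" "\<forall>x\<in>S. h x = f' x + b'"
      using g(3,4)[OF S] by blast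
    then show "\<exists>f b. linear f \<and> (\<forall>x\<in>S. g x + h x = f x + b)"
      by (intro exI[of _ "\<lambda>x. f x + f' x"] exI[of _ "b + b'"]) (auto intro: linear_compose_add)
  qed (simp add: g)
next
  fix c and t :: real assume "c \<in> pl_cone \<Sigma> \<mu>" and t: "0 \<le> t"
  then obtain g where g: "convex_on (nabla \<Sigma>) g"
    "\<And>S. S \<in> triangulation_cells \<Sigma> \<Longrightarrow> \<exists>f b. linear f \<and> (\<forall>x\<in>S. g x = f x + b)"
    "\<And>i. c $ i = g (mu \<mu> i)" unfolding pl_cone_def by blast
  show "t *\<^sub>R c \<in> pl_cone \<Sigma> \<mu>"
    unfolding pl_cone_def mem_Collect_eq
  proof (rule exI[of _ "\<lambda>x. t * g x"], intro conjI ballI allI)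
    show "convex_on (nabla \<Sigma>) (\<lambda>x. t * g x)" by (rule convex_on_cmul[OF t g(1)])
    fix S assume S: "S \<in> triangulation_cells \<Sigma>"
    obtain f b where "linear f" "\<forall>x\<in>S. g x = f x + b" using g(2)[OF S] by blast
    then show "\<exists>f b. linear f \<and> (\<forall>x\<in>S. t * g x = f x + b)"
      using linear_compose_scale_right[of f t]
      by (intro exI[of _ "\<lambda>x. t *\<^sub>R f x"] exI[of _ "t * b"]) (auto simp: distrib_left)
  qed (simp add: g)
qed

lemma pl_add_interior:
  assumes "x \<in> pl_cone \<Sigma> \<mu>" "y \<in> interior (pl_cone \<Sigma> \<mu>)"
  shows "x + y \<in> interior (pl_cone \<Sigma> \<mu>)"
proof -
  have "(+) x ` interior (pl_cone \<Sigma> \<mu>) \<subseteq> interior (pl_cone \<Sigma> \<mu>)"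
  proof (rule interior_maximal)
    show "(+) x ` interior (pl_cone \<Sigma> \<mu>) \<subseteq> pl_cone \<Sigma> \<mu>"
      using interior_subset[of "pl_cone \<Sigma> \<mu>"] assms(1) convex_cone_add[OF convex_cone_pl_cone] by blast
    show "open ((+) x ` interior (pl_cone \<Sigma> \<mu>))" by (rule open_translation) simp
  qed
  then show ?thesis using assms by blast
qed

lemma pl_scale_interior:
  assumes "t > 0" "y \<in> interior (pl_cone \<Sigma> \<mu>)"
  shows "t *\<^sub>R y \<in> interior (pl_cone \<Sigma> \<mu>)"
proof -
  have "(*\<^sub>R) t ` interior (pl_cone \<Sigma> \<mu>) \<subseteq> interior (pl_cone \<Sigma> \<mu>)"
  proof (rule interior_maximal)
    show "(*\<^sub>R) t ` interior (pl_cone \<Sigma> \<mu>) \<subseteq> pl_cone \<Sigma> \<mu>"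
      using interior_subset[of "pl_cone \<Sigma> \<mu>"] assms(1) convex_cone_scaleR[OF convex_cone_pl_cone, of t] by auto
    show "open ((*\<^sub>R) t ` interior (pl_cone \<Sigma> \<mu>))" using assms(1) by (intro open_scaling) auto
  qed
  then show ?thesis using assms by blast
qed

lemma interior_pl_cone_nonempty: "interior (pl_cone \<Sigma> \<mu>) \<noteq> {}"
proof -
  have "aff_dim (pl_cone \<Sigma> \<mu>) = int (dim (pl_cone \<Sigma> \<mu>))"
    using convex_cone_contains_0[OF convex_cone_pl_cone] by (simp add: aff_dim_zero hull_inc)
  also have "\<dots> = int DIM(real ^ 'p option)"
    using regular by (simp add: regular_triangulation_def)
  finally have "rel_interior (pl_cone \<Sigma> \<mu>) = interior (pl_cone \<Sigma> \<mu>)" by (rule interior_rel_interior)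
  moreover have "convex (pl_cone \<Sigma> \<mu>)" "pl_cone \<Sigma> \<mu> \<noteq> {}"
    using convex_cone_pl_cone by (auto simp: convex_cone_def)
  ultimately show ?thesis using rel_interior_eq_empty[of "pl_cone \<Sigma> \<mu>"] by simp
qed

text \<open>If a ball around \<open>v\<^sub>0\<close> is contained in the cone, then so is \<open>v - \<epsilon> sgn l\<close> for \<open>v\<close> near \<open>v\<^sub>0\<close>, and pairing it with \<open>l\<close> gives the bound.\<close>

lemma interior_point_bound:
  obtains v0 \<epsilon> where "\<epsilon> > 0" "\<And>v. v \<in> ball v0 \<epsilon> \<Longrightarrow> v \<in> interior (pl_cone \<Sigma> \<mu>)"
    and "\<And>v l. v \<in> ball v0 \<epsilon> \<Longrightarrow> l \<in> dual_cone_lattice \<Sigma> \<mu> \<Longrightarrow>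
      \<epsilon> * real (l1 l) \<le> (\<Sum>i\<in>UNIV. real_of_int (l $ i) * v $ i)"
proof -
  obtain v0 where "v0 \<in> interior (pl_cone \<Sigma> \<mu>)" using interior_pl_cone_nonempty by blast
  then obtain r where r: "r > 0" "ball v0 r \<subseteq> interior (pl_cone \<Sigma> \<mu>)"
    using open_interior openE by blast
  define P where "P = real CARD('p option)"
  have P: "P \<ge> 1" by (simp add: P_def)
  define \<epsilon> where "\<epsilon> = r / (4 * P)"
  have \<epsilon>: "\<epsilon> > 0" "P * \<epsilon> < r / 2" using r P by (auto simp: \<epsilon>_def)
  have \<epsilon>r: "\<epsilon> \<le> r / 2"
  proof -
    have "1 * \<epsilon> \<le> P * \<epsilon>" using P \<epsilon>(1) by (intro mult_right_mono) auto
    then show ?thesis using \<epsilon>(2) by simp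
  qed
  have "\<epsilon> * real (l1 l) \<le> (\<Sum>i\<in>UNIV. real_of_int (l $ i) * v $ i)"
    if v: "v \<in> ball v0 \<epsilon>" and l: "l \<in> dual_cone_lattice \<Sigma> \<mu>" for v l
  proof -
    define s :: "real ^ 'p option" where "s = (\<chi> i. \<epsilon> * sgn (real_of_int (l $ i)))"
    have "norm s \<le> (\<Sum>i\<in>UNIV. \<bar>s $ i\<bar>)" by (rule norm_le_l1_cart)
    also have "\<dots> \<le> (\<Sum>i\<in>(UNIV :: 'p option set). \<epsilon>)"
      using \<epsilon>(1) by (intro sum_mono) (auto simp: s_def abs_mult abs_sgn_eq)
    also have "\<dots> = P * \<epsilon>" by (simp add: P_def)
    finally have "norm s < r / 2" using \<epsilon>(2) by simp
    moreover have "dist v0 v < r / 2" using v \<epsilon>r by simp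
    ultimately have "dist v0 (v - s) < r"
      using norm_triangle_ineq[of "v0 - v" s] by (simp add: dist_norm algebra_simps)
    then have "v - s \<in> pl_cone \<Sigma> \<mu>" using r(2) interior_subset by (metis mem_ball subset_iff)
    then have "0 \<le> (\<Sum>i\<in>UNIV. real_of_int (l $ i) * (v - s) $ i)"
      using l unfolding dual_cone_lattice_def by blast
    also have "\<dots> = (\<Sum>i\<in>UNIV. real_of_int (l $ i) * v $ i) - (\<Sum>i\<in>UNIV. real_of_int (l $ i) * s $ i)"
      by (simp add: right_diff_distrib sum_subtractf)
    also have "(\<Sum>i\<in>UNIV. real_of_int (l $ i) * s $ i) = (\<Sum>i\<in>UNIV. \<epsilon> * real (nat \<bar>l $ i\<bar>))"
      by (intro sum.cong refl) (simp add: s_def sgn_if)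
    also have "\<dots> = \<epsilon> * real (l1 l)" by (simp add: sum_distrib_left)
    finally show ?thesis by simp
  qed
  moreover have "v \<in> interior (pl_cone \<Sigma> \<mu>)" if "v \<in> ball v0 \<epsilon>" for v
    using that r(1,2) \<epsilon>r by (auto simp: subset_iff)
  ultimately show ?thesis using that[of \<epsilon> v0] \<epsilon>(1) by blast
qed

end

section \<open>The ideal of the fan and its quotient ring\<close>

interpretation ideal: module "(*) :: 'a::comm_ring_1 \<Rightarrow> 'a \<Rightarrow> 'a"
  by unfold_locales (auto simp: algebra_simps)

lemma lookup_single_0_times:
  "Poly_Mapping.lookup (Poly_Mapping.single 0 c * f) k = c * Poly_Mapping.lookup f k"
  for f :: "'k::comm_monoid_add \<Rightarrow>\<^sub>0 'b::comm_semiring_1"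
  unfolding mult_map_scale_conv_mult[symmetric] by (simp add: Poly_Mapping.map.rep_eq when_def)

lemma lookup_pm_scale [simp]: "Poly_Mapping.lookup (pm_scale c f) k = c * Poly_Mapping.lookup f k"
  by (simp add: pm_scale_def lookup_single_0_times)

interpretation pm: vector_space
  "pm_scale :: complex \<Rightarrow> ('k::comm_monoid_add \<Rightarrow>\<^sub>0 complex) \<Rightarrow> ('k \<Rightarrow>\<^sub>0 complex)"
  by unfold_locales (rule poly_mapping_eqI, simp add: lookup_add ring_distribs)+

abbreviation X :: "'k \<Rightarrow> ('k::comm_monoid_add \<Rightarrow>\<^sub>0 complex)" where
  "X k \<equiv> Poly_Mapping.single k 1"

lemma pm_scale_times: "pm_scale c f * g = pm_scale c (f * g)" "f * pm_scale c g = pm_scale c (f * g)"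
  unfolding pm_scale_def by (rule mult.assoc, rule mult.left_commute)

lemma pm_scale_X: "pm_scale c (X k) = Poly_Mapping.single k c"
  by (simp add: pm_scale_def mult_single)

lemma poly_expansion: "f = (\<Sum>k\<in>Poly_Mapping.keys f. pm_scale (Poly_Mapping.lookup f k) (X k))"
  by (rule poly_mapping_eqI)
    (auto simp: lookup_sum lookup_single when_def in_keys_iff if_distrib cong: if_cong)

text \<open>Functionals on the polynomials are represented by their values on the monomials.\<close>

definition lin_ext :: "('k \<Rightarrow> complex) \<Rightarrow> ('k \<Rightarrow>\<^sub>0 complex) \<Rightarrow> complex" where
  "lin_ext \<phi> f = (\<Sum>k\<in>Poly_Mapping.keys f. Poly_Mapping.lookup f k * \<phi> k)"

lemma lin_ext_superset:
  "finite A \<Longrightarrow> Poly_Mapping.keys f \<subseteq> A \<Longrightarrow> lin_ext \<phi> f = (\<Sum>k\<in>A. Poly_Mapping.lookup f k * \<phi> k)"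
  unfolding lin_ext_def by (rule sum.mono_neutral_left) (auto simp: in_keys_iff)

lemma lin_ext_add: "lin_ext \<phi> (f + g) = lin_ext \<phi> f + lin_ext \<phi> g"
proof -
  let ?A = "Poly_Mapping.keys f \<union> Poly_Mapping.keys g"
  have "Poly_Mapping.keys (f + g) \<subseteq> ?A" by (rule Poly_Mapping.keys_add)
  then show ?thesis
    by (simp add: lin_ext_superset[of ?A] lookup_add algebra_simps sum.distrib)
qed

lemma lin_ext_scale: "lin_ext \<phi> (pm_scale c f) = c * lin_ext \<phi> f"
proof -
  have "Poly_Mapping.keys (pm_scale c f) \<subseteq> Poly_Mapping.keys f"
    by (auto simp: in_keys_iff)
  then show ?thesis
    by (simp only: lin_ext_superset[of "Poly_Mapping.keys f"] finite_keys order_refl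
        lookup_pm_scale sum_distrib_left mult.assoc)
qed

lemma lin_ext_0 [simp]: "lin_ext \<phi> 0 = 0"
  by (simp add: lin_ext_def)

lemma lin_ext_sum: "lin_ext \<phi> (sum f A) = (\<Sum>x\<in>A. lin_ext \<phi> (f x))"
  by (induction A rule: infinite_finite_induct) (auto simp: lin_ext_add)

lemma lin_ext_diff: "lin_ext \<phi> (f - g) = lin_ext \<phi> f - lin_ext \<phi> g"
  using lin_ext_add[of \<phi> "f - g" g] by simp

lemma lin_ext_single [simp]: "lin_ext \<phi> (Poly_Mapping.single k c) = c * \<phi> k"
  by (simp add: lin_ext_def lookup_single)

lemma lin_ext_times_X: "lin_ext \<phi> (X k * f) = lin_ext (\<lambda>j. \<phi> (k + j)) f"
proof -
  have "X k * f = (\<Sum>j\<in>Poly_Mapping.keys f. pm_scale (Poly_Mapping.lookup f j) (X (k + j)))"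
    by (subst poly_expansion[of f])
      (simp add: sum_distrib_left pm_scale_times mult_single)
  then show ?thesis
    by (simp only: lin_ext_sum lin_ext_scale lin_ext_single) (simp add: lin_ext_def)
qed

text \<open>Describing the ideal as a complex vector space makes it possible to test functionals on the products of monomials and generators.\<close>

lemma ideal_eq_linear_span:
  fixes G :: "('k::comm_monoid_add \<Rightarrow>\<^sub>0 complex) set"
  shows "ideal.span G = pm.span {X k * g | k g. g \<in> G}" (is "_ = pm.span ?B")
proof (intro subset_antisym subsetI)
  fix f assume "f \<in> ideal.span G"
  then show "f \<in> pm.span ?B"
  proof (induction rule: ideal.span_induct_alt)
    case base
    then show ?case by (rule pm.span_zero)
  next
    case (step c x y)
    have "c * x = (\<Sum>k\<in>Poly_Mapping.keys c. pm_scale (Poly_Mapping.lookup c k) (X k * x))"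
      by (subst poly_expansion[of c]) (simp add: sum_distrib_right pm_scale_times)
    also have "\<dots> \<in> pm.span ?B"
      using step by (intro pm.span_sum pm.span_scale pm.span_base) auto
    finally show ?case using step by (intro pm.span_add)
  qed
next
  fix f assume "f \<in> pm.span ?B"
  then show "f \<in> ideal.span G"
  proof (induction rule: pm.span_induct_alt)
    case base
    then show ?case by (rule ideal.span_zero)
  next
    case (step c x y)
    then obtain k g where "x = X k * g" "g \<in> G" by blast
    then have "pm_scale c x = (pm_scale c (X k)) * g" by (simp add: pm_scale_times)
    also have "\<dots> \<in> ideal.span G" using \<open>g \<in> G\<close> by (intro ideal.span_scale ideal.span_base)
    finally show ?case using step by (intro ideal.span_add)
  qed
qed

lemma pm_scale_in_ideal: "f \<in> ideal.span G \<Longrightarrow> pm_scale c f \<in> ideal.span G"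
  unfolding pm_scale_def by (rule ideal.span_scale)

subsection \<open>Homogeneous parts\<close>

lemma finite_total_degree: "finite {k :: ('p::finite) monomial. total_degree k \<le> d}"
proof -
  let ?F = "{f :: 'p option \<Rightarrow> nat. \<forall>i. (i \<in> UNIV \<longrightarrow> f i \<in> {..d}) \<and> (i \<notin> UNIV \<longrightarrow> f i = 0)}"
  have "finite ?F" by (rule finite_set_of_finite_funs) auto
  moreover have "Poly_Mapping.lookup ` {k :: 'p monomial. total_degree k \<le> d} \<subseteq> ?F"
  proof (clarsimp simp: total_degree_def)
    fix k :: "'p monomial" and i
    assume "sum (Poly_Mapping.lookup k) UNIV \<le> d"
    then show "Poly_Mapping.lookup k i \<le> d"
      using member_le_sum[of i UNIV "Poly_Mapping.lookup k"] by auto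
  qed
  ultimately have "finite (Poly_Mapping.lookup ` {k :: 'p monomial. total_degree k \<le> d})"
    by (rule rev_finite_subset)
  then show ?thesis
    by (rule finite_imageD) (rule inj_onI, rule poly_mapping_eqI, simp)
qed

lemma finite_total_degree_eq: "finite {k :: ('p::finite) monomial. total_degree k = d}"
  by (rule finite_subset[OF _ finite_total_degree[of d]]) auto

lemma total_degree_add: "total_degree (j + k) = total_degree j + total_degree k"
  by (simp add: total_degree_def lookup_add sum.distrib)

lemma total_degree_single [simp]: "total_degree (Poly_Mapping.single i n) = n"
  by (simp add: total_degree_def lookup_single when_def)

lemma total_degree_0 [simp]: "total_degree 0 = 0"
  by (simp add: total_degree_def)

lemma lookup_homogeneous_part:
  "Poly_Mapping.lookup (homogeneous_part d F) k = (if total_degree k = d then F k else 0)"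
proof -
  have "Poly_Mapping.lookup (homogeneous_part d F) k = (\<Sum>x | total_degree x = d. if x = k then F x else 0)"
    unfolding homogeneous_part_def by (simp add: lookup_sum lookup_single when_def)
  also have "\<dots> = (if total_degree k = d then F k else 0)"
    by (subst sum.delta) (simp_all add: finite_total_degree_eq)
  finally show ?thesis .
qed

abbreviation hpart :: "nat \<Rightarrow> ('p::finite) cpoly \<Rightarrow> 'p cpoly" where
  "hpart d f \<equiv> homogeneous_part d (Poly_Mapping.lookup f)"

lemma hpart_add: "hpart d (f + g) = hpart d f + hpart d g"
  and hpart_diff: "hpart d (f - g) = hpart d f - hpart d g"
  and hpart_scale: "hpart d (pm_scale c f) = pm_scale c (hpart d f)"
  and hpart_0 [simp]: "homogeneous_part d (\<lambda>k. 0) = 0"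
  by (auto intro!: poly_mapping_eqI simp: lookup_homogeneous_part lookup_add lookup_minus)

lemma hpart_sum: "hpart d (sum f A) = (\<Sum>x\<in>A. hpart d (f x))"
  by (induction A rule: infinite_finite_induct) (auto simp: hpart_add)

definition homogeneous_of :: "nat \<Rightarrow> ('p::finite) cpoly \<Rightarrow> bool" where
  "homogeneous_of e f \<longleftrightarrow> (\<forall>k\<in>Poly_Mapping.keys f. total_degree k = e)"

lemma hpart_homogeneous_of: "homogeneous_of e f \<Longrightarrow> hpart d f = (if d = e then f else 0)"
  by (rule poly_mapping_eqI)
    (auto simp: lookup_homogeneous_part homogeneous_of_def in_keys_iff)

lemma homogeneous_of_X [simp]: "homogeneous_of (total_degree k) (X k)"
  by (simp add: homogeneous_of_def)

lemma homogeneous_of_times: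
  "homogeneous_of d f \<Longrightarrow> homogeneous_of e g \<Longrightarrow> homogeneous_of (d + e) (f * g)"
  unfolding homogeneous_of_def using keys_mult[of f g] by (fastforce simp: total_degree_add)

text \<open>The grading is kept inside the span: later estimates compare only products of one degree.\<close>

lemma hpart_in_linear_span:
  fixes G :: "('p::finite) cpoly set"
  assumes f: "f \<in> ideal.span G" and G: "\<And>g. g \<in> G \<Longrightarrow> \<exists>e. homogeneous_of e g"
  shows "hpart d f \<in> pm.span {X k * g | k g. g \<in> G \<and> homogeneous_of d (X k * g)}"
    (is "_ \<in> pm.span ?B")
  using f unfolding ideal_eq_linear_span
proof (induction rule: pm.span_induct_alt)
  case base
  then show ?case by (simp add: pm.span_zero)
next
  case (step c x y)
  then obtain k g where x: "x = X k * g" "g \<in> G" by blast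
  then obtain e where e: "homogeneous_of e g" using G by blast
  have h: "homogeneous_of (total_degree k + e) x"
    unfolding x by (intro homogeneous_of_times e homogeneous_of_X)
  have "hpart d x \<in> pm.span ?B"
  proof (cases "d = total_degree k + e")
    case True
    then have "x \<in> ?B" using x h by auto
    then show ?thesis using hpart_homogeneous_of[OF h] True by (simp add: pm.span_base)
  qed (use hpart_homogeneous_of[OF h] pm.span_zero in auto)
  then show ?case using step
    by (simp only: hpart_add hpart_scale) (intro pm.span_add pm.span_scale)
qed

lemma hpart_in_ideal:
  fixes G :: "('p::finite) cpoly set"
  assumes f: "f \<in> ideal.span G" and G: "\<And>g. g \<in> G \<Longrightarrow> \<exists>e. homogeneous_of e g"
  shows "hpart d f \<in> ideal.span G"
proof -
  have "pm.span {X k * g | k g. g \<in> G \<and> homogeneous_of d (X k * g)} \<subseteq> pm.span {X k * g | k g. g \<in> G}"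
    by (rule pm.span_mono) auto
  with hpart_in_linear_span[OF f G, of d] show ?thesis
    unfolding ideal_eq_linear_span by blast
qed

subsection \<open>Bases and coordinates modulo a subspace\<close>

text \<open>Extend a basis of \<open>W\<close> by elements of \<open>M\<close>.\<close>

lemma basis_modulo_exists:
  fixes W :: "('k::comm_monoid_add \<Rightarrow>\<^sub>0 complex) set"
  assumes W: "pm.subspace W" and M: "finite M" "pm.span (W \<union> M) = UNIV"
  shows "\<exists>m b. basis_modulo UNIV W m b \<and> (\<forall>i<m. b i \<in> M)"
proof -
  obtain B0 where B0: "B0 \<subseteq> W" "pm.independent B0" "W \<subseteq> pm.span B0"
    using pm.maximal_independent_subset by metis
  have WB0: "W = pm.span B0"
    using B0 W by (metis pm.span_subspace)
  obtain B1 where B1: "B0 \<subseteq> B1" "B1 \<subseteq> B0 \<union> M" "pm.independent B1" "B0 \<union> M \<subseteq> pm.span B1"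
    using pm.maximal_independent_subset_extend[of B0 "B0 \<union> M"] B0 by blast
  define B where "B = B1 - B0"
  have finB: "finite B" and BM: "B \<subseteq> M"
    using B1 M finite_subset[of B M] by (auto simp: B_def)
  have B1eq: "B1 = B \<union> B0" using B1 by (auto simp: B_def)
  obtain b where b: "bij_betw b {0..<card B} B"
    using ex_bij_betw_nat_finite[OF finB] by blast
  let ?m = "card B"
  have b': "bij_betw b {..<?m} B" using b by (simp add: atLeast0LessThan)
  have sums: "(\<Sum>i<?m. pm_scale (c i) (b i)) = (\<Sum>x\<in>B. pm_scale (c (the_inv_into {..<?m} b x)) x)" for c
    by (rule sum.reindex_bij_betw[OF b', where g = "\<lambda>x. pm_scale (c (the_inv_into {..<?m} b x)) x", symmetric, THEN trans, THEN sym])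
       (rule sum.cong, auto simp: the_inv_into_f_f[OF bij_betw_imp_inj_on[OF b']])
  have full: "pm.span B1 = UNIV"
  proof -
    have "W \<union> M \<subseteq> pm.span B1"
      using B1 WB0 pm.span_mono[of B0 B1] by auto
    then have "pm.span (W \<union> M) \<subseteq> pm.span B1"
      by (rule pm.span_minimal) (rule pm.subspace_span)
    then show ?thesis using M by auto
  qed
  have "basis_modulo UNIV W ?m b"
    unfolding basis_modulo_def
  proof (intro conjI allI impI ballI)
    fix f
    have "f \<in> pm.span (B \<union> B0)" using full B1eq by auto
    then obtain x y where xy: "f = x + y" "x \<in> pm.span B" "y \<in> pm.span B0"
      unfolding pm.span_Un by blast
    obtain u where u: "x = (\<Sum>v\<in>B. pm_scale (u v) v)"
      using xy(2) pm.span_finite[OF finB] by auto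
    have "x = (\<Sum>i<?m. pm_scale (u (b i)) (b i))"
      unfolding u by (rule sum.reindex_bij_betw[OF b', symmetric])
    then show "\<exists>c. f - (\<Sum>i<?m. pm_scale (c i) (b i)) \<in> W"
      using xy WB0 by (metis add_diff_cancel_left')
  next
    fix c i assume "(\<Sum>i<?m. pm_scale (c i) (b i)) \<in> W" and i: "i < ?m"
    then have "(\<Sum>x\<in>B. pm_scale (c (the_inv_into {..<?m} b x)) x) \<in> pm.span B0" (is "?s \<in> _")
      using sums WB0 by auto
    then obtain t r where t: "finite t" "t \<subseteq> B0" "?s = (\<Sum>a\<in>t. pm_scale (r a) a)"
      unfolding pm.span_explicit by blast
    define u where "u x = (if x \<in> B then c (the_inv_into {..<?m} b x) else - r x)" for x
    have disj: "B \<inter> t = {}" using t by (auto simp: B_def)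
    have "(\<Sum>x\<in>B \<union> t. pm_scale (u x) x) = (\<Sum>x\<in>B. pm_scale (u x) x) + (\<Sum>x\<in>t. pm_scale (u x) x)"
      using finB t disj by (intro sum.union_disjoint)
    also have "(\<Sum>x\<in>B. pm_scale (u x) x) = ?s" by (rule sum.cong) (auto simp: u_def)
    also have "(\<Sum>x\<in>t. pm_scale (u x) x) = - (\<Sum>a\<in>t. pm_scale (r a) a)"
      unfolding sum_negf[symmetric] using disj by (intro sum.cong) (auto simp: u_def)
    finally have "(\<Sum>x\<in>B \<union> t. pm_scale (u x) x) = 0" using t by simp
    moreover have "B \<union> t \<subseteq> B1" using B1eq t by auto
    moreover have "b i \<in> B" using b' i by (auto simp: bij_betw_def)
    ultimately have "u (b i) = 0"
      using pm.independentD[OF B1(3), of "B \<union> t" u "b i"] finB t by auto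
    then show "c i = 0"
      using \<open>b i \<in> B\<close> i the_inv_into_f_f[OF bij_betw_imp_inj_on[OF b'], of i] by (simp add: u_def)
  qed auto
  moreover have "\<forall>i<?m. b i \<in> M" using b' BM by (auto simp: bij_betw_def)
  ultimately show ?thesis by blast
qed

lemma basis_modulo_coordinates:
  fixes W :: "('k::comm_monoid_add \<Rightarrow>\<^sub>0 complex) set"
  assumes W: "pm.subspace W" and b: "basis_modulo UNIV W m b"
  obtains \<phi> :: "nat \<Rightarrow> 'k \<Rightarrow> complex"
  where "\<And>f. f - (\<Sum>i<m. pm_scale (lin_ext (\<phi> i) f) (b i)) \<in> W"
    and "\<And>i f. f \<in> W \<Longrightarrow> i < m \<Longrightarrow> lin_ext (\<phi> i) f = 0"
    and "\<And>i j. i < m \<Longrightarrow> j < m \<Longrightarrow> lin_ext (\<phi> i) (b j) = (if i = j then 1 else 0)"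
proof -
  have "\<exists>c. \<forall>f. f - (\<Sum>i<m. pm_scale (c f i) (b i)) \<in> W"
    using b unfolding basis_modulo_def by (intro choice) auto
  then obtain c where c: "\<And>f. f - (\<Sum>i<m. pm_scale (c f i) (b i)) \<in> W" by blast
  define \<phi> where "\<phi> i k = c (X k) i" for i k
  have 1: "f - (\<Sum>i<m. pm_scale (lin_ext (\<phi> i) f) (b i)) \<in> W" for f
  proof -
    let ?K = "Poly_Mapping.keys f" and ?l = "Poly_Mapping.lookup f"
    have "(\<Sum>k\<in>?K. pm_scale (?l k) (X k - (\<Sum>i<m. pm_scale (c (X k) i) (b i)))) \<in> W"
      using W c by (intro pm.subspace_sum pm.subspace_scale)
    also have "(\<Sum>k\<in>?K. pm_scale (?l k) (X k - (\<Sum>i<m. pm_scale (c (X k) i) (b i)))) =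
        (\<Sum>k\<in>?K. pm_scale (?l k) (X k)) - (\<Sum>k\<in>?K. \<Sum>i<m. pm_scale (?l k * c (X k) i) (b i))"
      by (simp add: pm.scale_right_diff_distrib sum_subtractf pm.scale_sum_right)
    also have "(\<Sum>k\<in>?K. pm_scale (?l k) (X k)) = f" using poly_expansion[of f] by simp
    also have "(\<Sum>k\<in>?K. \<Sum>i<m. pm_scale (?l k * c (X k) i) (b i)) =
       (\<Sum>i<m. pm_scale (lin_ext (\<phi> i) f) (b i))"
      by (subst sum.swap) (simp add: lin_ext_def \<phi>_def pm.scale_sum_left)
    finally show ?thesis .
  qed
  have uniq: "\<And>u. (\<Sum>i<m. pm_scale (u i) (b i)) \<in> W \<Longrightarrow> (\<forall>i<m. u i = 0)"
    using b unfolding basis_modulo_def by blast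
  have 2: "lin_ext (\<phi> i) f = 0" if "f \<in> W" "i < m" for i f
  proof -
    have "f - (f - (\<Sum>i<m. pm_scale (lin_ext (\<phi> i) f) (b i))) \<in> W"
      by (rule pm.subspace_diff[OF W that(1) 1])
    then show ?thesis using uniq[of "\<lambda>i. lin_ext (\<phi> i) f"] that by simp
  qed
  have 3: "lin_ext (\<phi> i) (b j) = (if i = j then 1 else 0)" if "i < m" "j < m" for i j
  proof -
    let ?u = "\<lambda>i. (if i = j then 1 else 0) - lin_ext (\<phi> i) (b j)"
    have "(\<Sum>i<m. pm_scale (if i = j then 1 else 0) (b i)) = (\<Sum>i<m. if i = j then b i else 0)"
      by (rule sum.cong) auto
    also have "\<dots> = b j"
      using that by (simp add: sum.delta)
    finally have "(\<Sum>i<m. pm_scale (?u i) (b i)) \<in> W"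
      using 1[of "b j"] by (simp add: pm.scale_left_diff_distrib sum_subtractf)
    then have "?u i = 0" using uniq[of ?u] that by blast
    then show ?thesis by simp
  qed
  show ?thesis using 1 2 3 that by blast
qed

subsection \<open>The ideal of the fan\<close>

text \<open>The squarefree monomial of a set of rays.\<close>

definition sq :: "'p set \<Rightarrow> ('p::finite) monomial" where
  "sq S = (\<Sum>j\<in>S. Poly_Mapping.single (Some j) 1)"

lemma lookup_sq: "Poly_Mapping.lookup (sq S) i = (case i of None \<Rightarrow> 0 | Some j \<Rightarrow> if j \<in> S then 1 else 0)"
  by (cases i) (auto simp: sq_def lookup_sum lookup_single when_def)

lemma total_degree_sq [simp]: "total_degree (sq S) = card S"
proof -
  have "total_degree (sq S) = (\<Sum>i\<in>Some ` S. Poly_Mapping.lookup (sq S) i)"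
    unfolding total_degree_def
    by (rule sum.mono_neutral_right) (auto simp: lookup_sq split: option.splits)
  also have "\<dots> = card S" by (subst sum.reindex) (simp_all add: lookup_sq)
  finally show ?thesis .
qed

lemma prod_D_var: "(\<Prod>j\<in>S. D_var (Some j)) = X (sq S)"
  using finite[of S]
  by (induction S rule: finite_induct) (auto simp: sq_def D_var_def mult_single)

text \<open>The linear form of the affine function \<open>u0 + u \<bullet> x\<close>; the linear forms in \<open>J\<close> are combinations over the dual of the ambient space.\<close>

definition lform :: "('p::finite \<Rightarrow> real ^ 'n) \<Rightarrow> real \<Rightarrow> real ^ 'n \<Rightarrow> 'p cpoly" where
  "lform \<mu> u0 u = (\<Sum>i\<in>UNIV. pm_scale (of_real (u0 + u \<bullet> mu \<mu> i)) (D_var i))"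

lemma lform_in_J: "lform \<mu> u0 u \<in> J_ideal \<Sigma> \<mu>"
proof -
  let ?e = "\<Sum>i\<in>UNIV. pm_scale (of_real (fst (mu_bar \<mu> i))) (D_var i)"
  let ?f = "\<lambda>k. \<Sum>i\<in>UNIV. pm_scale (of_real (snd (mu_bar \<mu> i) $ k)) (D_var i)"
  have "lform \<mu> u0 u = pm_scale (of_real u0) ?e + (\<Sum>k\<in>UNIV. pm_scale (of_real (u $ k)) (?f k))"
    unfolding lform_def pm.scale_sum_right
    by (subst sum.swap)
      (simp add: sum.distrib[symmetric] pm.scale_sum_left[symmetric] pm.scale_left_distrib[symmetric]
        inner_vec_def mu_bar_def)
  also have "\<dots> \<in> J_ideal \<Sigma> \<mu>"
    unfolding J_ideal_def
    by (intro ideal.span_add ideal.span_sum pm_scale_in_ideal ideal.span_base UnI2)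
      (auto simp: linear_forms_def)
  finally show ?thesis .
qed

lemma J_nonface: "\<not> (\<exists>\<sigma>\<in>\<Sigma>. \<mu> ` S \<subseteq> \<sigma>) \<Longrightarrow> X (sq S) \<in> J_ideal \<Sigma> \<mu>"
  unfolding J_ideal_def prod_D_var[symmetric]
  by (intro ideal.span_base) (auto simp: stanley_reisner_generators_def)

lemma J_times: "f \<in> J_ideal \<Sigma> \<mu> \<Longrightarrow> g * f \<in> J_ideal \<Sigma> \<mu>"
  unfolding J_ideal_def by (rule ideal.span_scale)

lemma J_subspace: "pm.subspace (J_ideal \<Sigma> \<mu>)"
  unfolding J_ideal_def ideal_eq_linear_span by (rule pm.subspace_span)

lemma homogeneous_of_sum:
  "(\<And>i. i \<in> A \<Longrightarrow> homogeneous_of e (f i)) \<Longrightarrow> homogeneous_of e (sum f A)"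
  unfolding homogeneous_of_def using keys_sum[of f A] by blast

lemma homogeneous_of_scale: "homogeneous_of e f \<Longrightarrow> homogeneous_of e (pm_scale c f)"
  by (auto simp: homogeneous_of_def in_keys_iff)

lemma homogeneous_of_D_var: "homogeneous_of (Suc 0) (D_var i)"
  by (simp add: D_var_def homogeneous_of_def)

lemma J_generators_homogeneous:
  assumes "g \<in> stanley_reisner_generators \<Sigma> \<mu> \<union> linear_forms \<mu>"
  shows "\<exists>e. homogeneous_of e g"
  using assms
proof
  assume "g \<in> stanley_reisner_generators \<Sigma> \<mu>"
  then obtain S where "g = X (sq S)"
    by (auto simp: stanley_reisner_generators_def prod_D_var)
  then show ?thesis using homogeneous_of_X by blast
next
  assume "g \<in> linear_forms \<mu>"
  then have "homogeneous_of (Suc 0) g"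
    by (auto simp: linear_forms_def intro!: homogeneous_of_sum homogeneous_of_scale homogeneous_of_D_var)
  then show ?thesis by blast
qed

lemma hpart_in_J: "f \<in> J_ideal \<Sigma> \<mu> \<Longrightarrow> hpart d f \<in> J_ideal \<Sigma> \<mu>"
  unfolding J_ideal_def by (rule hpart_in_ideal[OF _ J_generators_homogeneous])

text \<open>Modulo the ideal a variable may be replaced by the other ones with the help of an affine function that takes the value \<open>1\<close> at its generator.\<close>

lemma J_D_var_replace:
  assumes "u0 + u \<bullet> mu \<mu> i = 1"
  shows "(X (k + Poly_Mapping.single i 1)
    + (\<Sum>i'\<in>UNIV - {i}. pm_scale (of_real (u0 + u \<bullet> mu \<mu> i')) (X (k + Poly_Mapping.single i' 1))))
      \<in> J_ideal \<Sigma> \<mu>"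
proof -
  have "X k * lform \<mu> u0 u \<in> J_ideal \<Sigma> \<mu>" by (intro J_times lform_in_J)
  also have "X k * lform \<mu> u0 u =
     (\<Sum>i'\<in>UNIV. pm_scale (of_real (u0 + u \<bullet> mu \<mu> i')) (X (k + Poly_Mapping.single i' 1)))"
    by (simp add: lform_def sum_distrib_left pm_scale_times D_var_def mult_single)
  also have "\<dots> = X (k + Poly_Mapping.single i 1)
    + (\<Sum>i'\<in>UNIV - {i}. pm_scale (of_real (u0 + u \<bullet> mu \<mu> i')) (X (k + Poly_Mapping.single i' 1)))"
    by (subst sum.remove[of _ i]) (simp_all add: assms)
  finally show ?thesis .
qed

lemma minus_single_add:
  fixes k :: "'a monomial"
  assumes "Poly_Mapping.lookup k i > 0"
  shows "(k - Poly_Mapping.single i 1) + Poly_Mapping.single i 1 = k"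
  using assms by (intro poly_mapping_eqI) (auto simp: lookup_add lookup_minus lookup_single when_def)

text \<open>The constant depends only on the expansion of \<open>f\<close>, not on the functional.\<close>

lemma bounded_on_span:
  assumes "f \<in> pm.span A"
  shows "\<exists>C\<ge>0. \<forall>\<psi> B. (\<forall>b\<in>A. norm (lin_ext \<psi> b) \<le> B) \<longrightarrow> norm (lin_ext \<psi> f) \<le> C * B"
proof -
  obtain t r where t: "finite t" "t \<subseteq> A" "f = (\<Sum>a\<in>t. pm_scale (r a) a)"
    using assms unfolding pm.span_explicit by blast
  show ?thesis
  proof (intro exI[of _ "\<Sum>a\<in>t. norm (r a)"] conjI allI impI)
    fix \<psi> B assume B: "\<forall>b\<in>A. norm (lin_ext \<psi> b) \<le> B"
    have "norm (lin_ext \<psi> f) \<le> (\<Sum>a\<in>t. norm (r a * lin_ext \<psi> a))"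
      unfolding t(3) lin_ext_sum lin_ext_scale by (rule norm_sum)
    also have "\<dots> \<le> (\<Sum>a\<in>t. norm (r a) * B)"
      using B t(2) by (intro sum_mono) (auto simp: norm_mult intro!: mult_left_mono)
    finally show "norm (lin_ext \<psi> f) \<le> (\<Sum>a\<in>t. norm (r a)) * B" by (simp add: sum_distrib_right)
  qed (simp add: sum_nonneg)
qed

lemma monomial_split:
  fixes k :: "('p::finite) monomial"
  assumes "e \<le> total_degree k"
  shows "\<exists>j. \<exists>j'. k = j + j' \<and> total_degree j' = e"
  using assms
proof (induction e)
  case 0
  then show ?case by (intro exI[of _ k] exI[of _ 0]) simp
next
  case (Suc e)
  then obtain j j' where jj: "k = j + j'" "total_degree j' = e" by auto
  then have "total_degree j > 0" using Suc by (simp add: total_degree_add)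
  then obtain i where i: "Poly_Mapping.lookup j i > 0"
    by (auto simp: total_degree_def sum_eq_0_iff simp flip: neq0_conv)
  show ?case
    using minus_single_add[OF i] jj
    by (intro exI[of _ "j - Poly_Mapping.single i 1"] exI[of _ "Poly_Mapping.single i 1 + j'"])
      (simp add: total_degree_add flip: add.assoc)
qed

context
  fixes \<Sigma> :: "(real ^ 'n) set set" and \<mu> :: "'p::finite \<Rightarrow> real ^ 'n"
  assumes dual: "\<And>S j. (\<exists>\<sigma>\<in>\<Sigma>. \<mu> ` S \<subseteq> \<sigma>) \<Longrightarrow> j \<in> S \<Longrightarrow>
    \<exists>u. u \<bullet> \<mu> j = 1 \<and> (\<forall>i\<in>S - {j}. u \<bullet> \<mu> i = 0)"
begin

text \<open>A monomial of degree greater than \<open>p\<close> that does not involve \<open>D\<^sub>0\<close> has a repeated variable \<open>D\<^sub>j\<close>.  If its support is a face, a linear form dual to \<open>\<mu>\<^sub>j\<close> on that face replaces one factor \<open>D\<^sub>j\<close> by variables outside the support.  So the support grows until it is no longer a face.\<close>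

lemma J_high_degree_aux:
  fixes k :: "'p monomial"
  assumes "Poly_Mapping.lookup k None = 0" "total_degree k > CARD('p)"
  shows "X k \<in> J_ideal \<Sigma> \<mu>"
  using assms
proof (induction "CARD('p) - card {j. Poly_Mapping.lookup k (Some j) > 0}" arbitrary: k rule: less_induct)
  case less
  let ?S = "{j. Poly_Mapping.lookup k (Some j) > 0}"
  have le: "Poly_Mapping.lookup (sq ?S) i \<le> Poly_Mapping.lookup k i" for i
    by (cases i) (auto simp: lookup_sq)
  then have split: "k = (k - sq ?S) + sq ?S"
    by (intro poly_mapping_eqI) (simp add: lookup_add lookup_minus)
  show ?case
  proof (cases "\<exists>\<sigma>\<in>\<Sigma>. \<mu> ` ?S \<subseteq> \<sigma>")
    case False
    then have "X (k - sq ?S) * X (sq ?S) \<in> J_ideal \<Sigma> \<mu>"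
      by (intro J_times J_nonface)
    then show ?thesis using split by (simp add: mult_single)
  next
    case True
    have "\<exists>j\<in>?S. Poly_Mapping.lookup k (Some j) \<ge> 2"
    proof (rule ccontr)
      assume no: "\<not> ?thesis"
      have "Poly_Mapping.lookup k (Some j) \<le> 1" for j
      proof (rule ccontr)
        assume "\<not> ?thesis"
        then have "j \<in> ?S \<and> 2 \<le> Poly_Mapping.lookup k (Some j)" by auto
        then show False using no by blast
      qed
      then have "Poly_Mapping.lookup k i \<le> Poly_Mapping.lookup (sq ?S) i" for i
        using less.prems(1) by (cases i) (auto simp: lookup_sq)
      then have "total_degree k \<le> total_degree (sq ?S)"
        unfolding total_degree_def by (rule sum_mono)
      also have "\<dots> \<le> CARD('p)" using card_mono[of UNIV ?S] by simp
      finally show False using less.prems by simp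
    qed
    then obtain j where j: "j \<in> ?S" "Poly_Mapping.lookup k (Some j) \<ge> 2" by blast
    obtain u where u: "u \<bullet> \<mu> j = 1" "\<And>i. i \<in> ?S - {j} \<Longrightarrow> u \<bullet> \<mu> i = 0"
      using dual[OF True j(1)] by blast
    define k' where "k' = k - Poly_Mapping.single (Some j) 1"
    have k: "k = k' + Poly_Mapping.single (Some j) 1"
      using j minus_single_add[of k "Some j"] by (simp add: k'_def)
    have deg: "total_degree k = total_degree k' + 1" by (subst k) (simp add: total_degree_add)
    have k'pos: "Poly_Mapping.lookup k' (Some i) > 0 \<longleftrightarrow> i \<in> ?S" for i
      using j by (auto simp: k'_def lookup_minus lookup_single when_def)
    have in_J: "pm_scale (of_real (0 + u \<bullet> mu \<mu> i)) (X (k' + Poly_Mapping.single i 1)) \<in> J_ideal \<Sigma> \<mu>"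
      if "i \<noteq> Some j" for i
    proof (cases "i = None \<or> i \<in> Some ` ?S")
      case True
      then have "u \<bullet> mu \<mu> i = 0"
      proof (cases i)
        case (Some i')
        then have "i' \<in> ?S - {j}" using True that by auto
        then show ?thesis using u(2) Some by (simp add: mu_def)
      qed (simp add: mu_def)
      then show ?thesis using J_subspace[of \<Sigma> \<mu>] by (simp add: pm.subspace_0)
    next
      case False
      then obtain i' where i': "i = Some i'" "i' \<notin> ?S" by (cases i) auto
      let ?k = "k' + Poly_Mapping.single i 1"
      have supp: "{j. Poly_Mapping.lookup ?k (Some j) > 0} = insert i' ?S"
        using k'pos i' by (auto simp: lookup_add lookup_single when_def)
      have "card (insert i' ?S) \<le> CARD('p)" by (rule card_mono) auto
      then have "CARD('p) - card (insert i' ?S) < CARD('p) - card ?S"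
        using i' by simp
      then have "X ?k \<in> J_ideal \<Sigma> \<mu>"
        using less.prems deg i' supp
        by (intro less.hyps) (auto simp: total_degree_add lookup_add k'_def lookup_minus lookup_single when_def)
      then show ?thesis using J_subspace[of \<Sigma> \<mu>] by (simp add: pm.subspace_scale)
    qed
    have "X (k' + Poly_Mapping.single (Some j) 1) + (\<Sum>i'\<in>UNIV - {Some j}. pm_scale (of_real (0 + u \<bullet> mu \<mu> i')) (X (k' + Poly_Mapping.single i' 1)))
      \<in> J_ideal \<Sigma> \<mu>"
      by (rule J_D_var_replace) (use u in \<open>simp add: mu_def\<close>)
    note comb = this
    have "(\<Sum>i'\<in>UNIV - {Some j}. pm_scale (of_real (0 + u \<bullet> mu \<mu> i')) (X (k' + Poly_Mapping.single i' 1)))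
      \<in> J_ideal \<Sigma> \<mu>"
      by (rule pm.subspace_sum[OF J_subspace]) (use in_J in auto)
    from pm.subspace_diff[OF J_subspace comb this] show ?thesis
      unfolding add_diff_cancel_right' k[symmetric] .
  qed
qed

text \<open>The linear form \<open>\<Sum>\<^sub>i D\<^sub>i\<close> removes the variable \<open>D\<^sub>0\<close>.\<close>

lemma J_high_degree:
  fixes k :: "'p monomial"
  assumes "total_degree k > CARD('p)"
  shows "X k \<in> J_ideal \<Sigma> \<mu>"
  using assms
proof (induction "Poly_Mapping.lookup k None" arbitrary: k)
  case 0
  then show ?case by (intro J_high_degree_aux) auto
next
  case (Suc n)
  define k' where "k' = k - Poly_Mapping.single None 1"
  have k: "k = k' + Poly_Mapping.single None 1"
    using Suc minus_single_add[of k None] by (simp add: k'_def)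
  have deg: "total_degree k = total_degree k' + 1" by (subst k) (simp add: total_degree_add)
  have "X (k' + Poly_Mapping.single i' 1) \<in> J_ideal \<Sigma> \<mu>" if "i' \<in> UNIV - {None}" for i'
    using that Suc deg
    by (intro Suc.hyps) (auto simp: k'_def lookup_add lookup_minus lookup_single when_def total_degree_add)
  then have "(\<Sum>i'\<in>UNIV - {None}. pm_scale (of_real (1 + 0 \<bullet> mu \<mu> i')) (X (k' + Poly_Mapping.single i' 1)))
      \<in> J_ideal \<Sigma> \<mu>"
    by (intro pm.subspace_sum[OF J_subspace] pm.subspace_scale[OF J_subspace]) auto
  note rest = this
  have sub: "f \<in> J_ideal \<Sigma> \<mu>" if "f + (\<Sum>i'\<in>UNIV - {None}. pm_scale (of_real (1 + 0 \<bullet> mu \<mu> i')) (X (k' + Poly_Mapping.single i' 1))) \<in> J_ideal \<Sigma> \<mu>" for f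
    using pm.subspace_diff[OF J_subspace that rest] unfolding add_diff_cancel_right' .
  have "X (k' + Poly_Mapping.single None 1) + (\<Sum>i'\<in>UNIV - {None}. pm_scale (of_real (1 + 0 \<bullet> mu \<mu> i')) (X (k' + Poly_Mapping.single i' 1)))
      \<in> J_ideal \<Sigma> \<mu>"
    by (rule J_D_var_replace) (simp add: mu_def)
  from sub[OF this] show ?case unfolding k[symmetric] .
qed

lemma homogeneous_quotient_basis_exists:
  "\<exists>m \<alpha>. homogeneous_quotient_basis (J_ideal \<Sigma> \<mu>) m \<alpha>"
proof -
  let ?M = "X ` {k :: 'p monomial. total_degree k \<le> CARD('p)}"
  have "f \<in> pm.span (J_ideal \<Sigma> \<mu> \<union> ?M)" for f :: "'p cpoly"
  proof -
    have "X k \<in> pm.span (J_ideal \<Sigma> \<mu> \<union> ?M)" for k :: "'p monomial"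
      using J_high_degree[of k] by (intro pm.span_base) (cases "total_degree k \<le> CARD('p)"; auto)
    then have "(\<Sum>k\<in>Poly_Mapping.keys f. pm_scale (Poly_Mapping.lookup f k) (X k)) \<in> pm.span (J_ideal \<Sigma> \<mu> \<union> ?M)"
      by (intro pm.span_sum pm.span_scale)
    then show ?thesis using poly_expansion[of f] by simp
  qed
  then obtain m b where b: "basis_modulo UNIV (J_ideal \<Sigma> \<mu>) m b" "\<forall>i<m. b i \<in> ?M"
    using basis_modulo_exists[OF J_subspace[of \<Sigma> \<mu>], of ?M] finite_total_degree[of "CARD('p)"] by auto
  have "homogeneous (b i)" if i: "i < m" for i
  proof -
    obtain k where "b i = X k" using b(2) i by auto
    then show ?thesis by (auto simp: homogeneous_def)
  qed
  then show ?thesis using b by (auto simp: homogeneous_quotient_basis_def)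
qed

lemma homogeneous_basis_degrees:
  fixes \<alpha> :: "nat \<Rightarrow> 'p cpoly"
  assumes "homogeneous_quotient_basis (J_ideal \<Sigma> \<mu>) m \<alpha>"
  obtains e where "\<And>i. i < m \<Longrightarrow> homogeneous_of (e i) (\<alpha> i)"
proof -
  have "\<forall>i. \<exists>d. i < m \<longrightarrow> homogeneous_of d (\<alpha> i)"
    using assms by (auto simp: homogeneous_quotient_basis_def homogeneous_def homogeneous_of_def)
  then show ?thesis using that by metis
qed

text \<open>The coordinate functional of a basis element of degree \<open>e\<close> vanishes on monomials of other degrees, since the ideal and the basis are homogeneous.  The coordinates of a power series are therefore finite sums, and the congruence can be checked degree by degree.\<close>

lemma quotient_coordinates:
  fixes \<alpha> :: "nat \<Rightarrow> 'p cpoly"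
  assumes hb: "homogeneous_quotient_basis (J_ideal \<Sigma> \<mu>) m \<alpha>"
  obtains \<phi> :: "nat \<Rightarrow> 'p monomial \<Rightarrow> complex"
  where "\<And>i f. i < m \<Longrightarrow> f \<in> J_ideal \<Sigma> \<mu> \<Longrightarrow> lin_ext (\<phi> i) f = 0"
    and "\<And>i j. i < m \<Longrightarrow> j < m \<Longrightarrow> lin_ext (\<phi> i) (\<alpha> j) = (if i = j then 1 else 0)"
    and "\<And>F. series_cong_mod (J_ideal \<Sigma> \<mu>) F
      (\<Sum>i<m. pm_scale (\<Sum>k | total_degree k \<le> CARD('p). \<phi> i k * F k) (\<alpha> i))"
proof -
  obtain e where e: "\<And>i. i < m \<Longrightarrow> homogeneous_of (e i) (\<alpha> i)"
    using homogeneous_basis_degrees[OF hb] by blast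
  obtain \<phi> where \<phi>: "\<And>f. f - (\<Sum>i<m. pm_scale (lin_ext (\<phi> i) f) (\<alpha> i)) \<in> J_ideal \<Sigma> \<mu>"
    and J0: "\<And>i f. f \<in> J_ideal \<Sigma> \<mu> \<Longrightarrow> i < m \<Longrightarrow> lin_ext (\<phi> i) f = 0"
    and \<delta>: "\<And>i j. i < m \<Longrightarrow> j < m \<Longrightarrow> lin_ext (\<phi> i) (\<alpha> j) = (if i = j then 1 else 0)"
    using basis_modulo_coordinates[OF J_subspace, of \<Sigma> \<mu> m \<alpha>] hb
    unfolding homogeneous_quotient_basis_def by blast
  have high: "\<phi> i k = 0" if "i < m" "total_degree k > CARD('p)" for i k
    using J0[OF J_high_degree[OF that(2)] that(1)] by simp
  have hpa: "hpart d (\<Sum>i<m. pm_scale (c i) (\<alpha> i)) = (\<Sum>i<m. pm_scale (if e i = d then c i else 0) (\<alpha> i))" for d c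
    unfolding hpart_sum hpart_scale by (rule sum.cong) (auto simp: hpart_homogeneous_of[OF e])
  (* coordinates respect the grading *)
  have wrong: "\<phi> i k = 0" if i: "i < m" and ne: "total_degree k \<noteq> e i" for i k
  proof -
    have "hpart (e i) (X k - (\<Sum>j<m. pm_scale (\<phi> j k) (\<alpha> j))) \<in> J_ideal \<Sigma> \<mu>"
      using hpart_in_J[OF \<phi>[of "X k"]] by simp
    then have "- (\<Sum>j<m. pm_scale (if e j = e i then \<phi> j k else 0) (\<alpha> j)) \<in> J_ideal \<Sigma> \<mu>"
      unfolding hpart_diff hpa using ne hpart_homogeneous_of[OF homogeneous_of_X[of k], of "e i"] by simp
    then have "lin_ext (\<phi> i) (- (\<Sum>j<m. pm_scale (if e j = e i then \<phi> j k else 0) (\<alpha> j))) = 0"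
      by (rule J0[OF _ i])
    then have "lin_ext (\<phi> i) (\<Sum>j<m. pm_scale (if e j = e i then \<phi> j k else 0) (\<alpha> j)) = 0"
      using lin_ext_diff[of "\<phi> i" 0] by simp
    also have "lin_ext (\<phi> i) (\<Sum>j<m. pm_scale (if e j = e i then \<phi> j k else 0) (\<alpha> j)) =
      (\<Sum>j<m. if j = i then \<phi> i k else 0)"
      unfolding lin_ext_sum lin_ext_scale by (rule sum.cong) (use i in \<open>auto simp: \<delta>\<close>)
    also have "\<dots> = \<phi> i k" using i by simp
    finally show ?thesis .
  qed
  have "series_cong_mod (J_ideal \<Sigma> \<mu>) F
      (\<Sum>i<m. pm_scale (\<Sum>k | total_degree k \<le> CARD('p). \<phi> i k * F k) (\<alpha> i))" for F
    unfolding series_cong_mod_def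
  proof
    fix d
    let ?w = "\<lambda>i. \<Sum>k | total_degree k \<le> CARD('p). \<phi> i k * F k"
    have "(\<Sum>k | total_degree k = d. pm_scale (F k) (X k - (\<Sum>i<m. pm_scale (lin_ext (\<phi> i) (X k)) (\<alpha> i)))) \<in> J_ideal \<Sigma> \<mu>"
      by (intro pm.subspace_sum[OF J_subspace] pm.subspace_scale[OF J_subspace] \<phi>)
    also have "(\<Sum>k | total_degree k = d. pm_scale (F k) (X k - (\<Sum>i<m. pm_scale (lin_ext (\<phi> i) (X k)) (\<alpha> i)))) =
       homogeneous_part d F - (\<Sum>k | total_degree k = d. \<Sum>i<m. pm_scale (\<phi> i k * F k) (\<alpha> i))"
      unfolding pm.scale_right_diff_distrib sum_subtractf homogeneous_part_def
      by (simp add: pm.scale_sum_right mult.commute pm_scale_X)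
    also have "(\<Sum>k | total_degree k = d. \<Sum>i<m. pm_scale (\<phi> i k * F k) (\<alpha> i)) =
       (\<Sum>i<m. pm_scale (\<Sum>k | total_degree k = d. \<phi> i k * F k) (\<alpha> i))"
      by (subst sum.swap) (simp add: pm.scale_sum_left)
    also have "\<dots> = (\<Sum>i<m. pm_scale (if e i = d then ?w i else 0) (\<alpha> i))"
    proof (rule sum.cong[OF refl])
      fix i assume "i \<in> {..<m}"
      then have i: "i < m" by simp
      have "(\<Sum>k | total_degree k = d. \<phi> i k * F k) = (if e i = d then ?w i else 0)"
      proof (cases "e i = d")
        case True
        have "(\<Sum>k | total_degree k = d. \<phi> i k * F k) = ?w i"
          by (rule sum.mono_neutral_cong)
            (use True wrong[OF i] high[OF i] in \<open>auto simp: finite_total_degree finite_total_degree_eq not_le\<close>)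
        then show ?thesis using True by simp
      next
        case False
        have "(\<Sum>k | total_degree k = d. \<phi> i k * F k) = 0"
          by (rule sum.neutral) (use False wrong[OF i] in auto)
        then show ?thesis using False by simp
      qed
      then show "pm_scale (\<Sum>k | total_degree k = d. \<phi> i k * F k) (\<alpha> i) =
        pm_scale (if e i = d then ?w i else 0) (\<alpha> i)" by simp
    qed
    also have "\<dots> = hpart d (\<Sum>i<m. pm_scale (?w i) (\<alpha> i))" by (rule hpa[symmetric])
    finally show "homogeneous_part d F - hpart d (\<Sum>i<m. pm_scale (?w i) (\<alpha> i)) \<in> J_ideal \<Sigma> \<mu>" .
  qed
  then show ?thesis using that[of \<phi>] J0 \<delta> by blast
qed

text \<open>A quantitative form of the statement that a functional vanishing on the ideal and on a basis of the quotient is zero.  The constant can be chosen independently of the degree: in degrees greater than \<open>p\<close> split off a factor of degree \<open>p + 1\<close>, which already lies in the ideal, and apply the estimate to the shifted functional.\<close>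

lemma bounded_reduction:
  fixes \<alpha> :: "nat \<Rightarrow> 'p cpoly"
  assumes hb: "homogeneous_quotient_basis (J_ideal \<Sigma> \<mu>) m \<alpha>"
  shows "\<exists>C\<ge>0. \<forall>\<psi> d B \<kappa>. (\<forall>i<m. lin_ext \<psi> (\<alpha> i) = 0) \<longrightarrow>
    (\<forall>k g. g \<in> stanley_reisner_generators \<Sigma> \<mu> \<union> linear_forms \<mu> \<and> homogeneous_of d (X k * g) \<longrightarrow>
       norm (lin_ext \<psi> (X k * g)) \<le> B) \<longrightarrow>
    total_degree \<kappa> = d \<longrightarrow> 0 \<le> B \<longrightarrow> norm (\<psi> \<kappa>) \<le> C * B"
proof -
  let ?G = "stanley_reisner_generators \<Sigma> \<mu> \<union> linear_forms \<mu>"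
  let ?S = "\<lambda>d. {X k * g | k g. g \<in> ?G \<and> homogeneous_of d (X k * g)}"
  obtain e where e: "\<And>i. i < m \<Longrightarrow> homogeneous_of (e i) (\<alpha> i)"
    using homogeneous_basis_degrees[OF hb] by blast
  define P1 where "P1 \<kappa> C \<longleftrightarrow> C \<ge> 0 \<and> (\<forall>\<psi> B. (\<forall>i<m. lin_ext \<psi> (\<alpha> i) = 0) \<longrightarrow>
       (\<forall>b\<in>?S (total_degree \<kappa>). norm (lin_ext \<psi> b) \<le> B) \<longrightarrow> norm (\<psi> \<kappa>) \<le> C * B)" for \<kappa> and C :: real
  have "\<exists>C. P1 \<kappa> C" for \<kappa>
  proof -
    obtain c where c: "X \<kappa> - (\<Sum>i<m. pm_scale (c i) (\<alpha> i)) \<in> J_ideal \<Sigma> \<mu>"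
      using hb unfolding homogeneous_quotient_basis_def basis_modulo_def by blast
    let ?f = "hpart (total_degree \<kappa>) (X \<kappa> - (\<Sum>i<m. pm_scale (c i) (\<alpha> i)))"
    have f: "?f = X \<kappa> - (\<Sum>i<m. pm_scale (if e i = total_degree \<kappa> then c i else 0) (\<alpha> i))"
      unfolding hpart_diff hpart_sum hpart_scale hpart_homogeneous_of[OF homogeneous_of_X]
      by (auto simp: hpart_homogeneous_of[OF e] intro!: sum.cong)
    have "?f \<in> pm.span (?S (total_degree \<kappa>))"
      using c unfolding J_ideal_def by (rule hpart_in_linear_span) (rule J_generators_homogeneous)
    from bounded_on_span[OF this] obtain C where C: "C \<ge> 0"
      "\<And>\<psi> B. \<forall>b\<in>?S (total_degree \<kappa>). norm (lin_ext \<psi> b) \<le> B \<Longrightarrow> norm (lin_ext \<psi> ?f) \<le> C * B"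
      by blast
    have "lin_ext \<psi> ?f = \<psi> \<kappa>" if "\<forall>i<m. lin_ext \<psi> (\<alpha> i) = 0" for \<psi>
      unfolding f using that by (simp add: lin_ext_diff lin_ext_sum lin_ext_scale)
    note eq = this
    show ?thesis
      unfolding P1_def
    proof (intro exI[of _ C] conjI allI impI)
      fix \<psi> B assume 1: "\<forall>i<m. lin_ext \<psi> (\<alpha> i) = 0"
        and 2: "\<forall>b\<in>?S (total_degree \<kappa>). norm (lin_ext \<psi> b) \<le> B"
      show "norm (\<psi> \<kappa>) \<le> C * B" using C(2)[OF 2] unfolding eq[OF 1] .
    qed (rule C(1))
  qed
  then obtain C1 where "\<And>\<kappa>. P1 \<kappa> (C1 \<kappa>)" by metis
  then have C1: "\<And>\<kappa>. C1 \<kappa> \<ge> 0" "\<And>\<kappa> \<psi> B. \<forall>i<m. lin_ext \<psi> (\<alpha> i) = 0 \<Longrightarrow>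
       \<forall>b\<in>?S (total_degree \<kappa>). norm (lin_ext \<psi> b) \<le> B \<Longrightarrow> norm (\<psi> \<kappa>) \<le> C1 \<kappa> * B"
    unfolding P1_def by blast+
  define P2 where "P2 \<kappa> C \<longleftrightarrow> C \<ge> 0 \<and> (\<forall>\<psi> B. total_degree \<kappa> > CARD('p) \<longrightarrow>
       (\<forall>b\<in>?S (total_degree \<kappa>). norm (lin_ext \<psi> b) \<le> B) \<longrightarrow> norm (\<psi> \<kappa>) \<le> C * B)" for \<kappa> and C :: real
  have "\<exists>C. P2 \<kappa> C" for \<kappa>
  proof (cases "total_degree \<kappa> > CARD('p)")
    case True
    have "hpart (total_degree \<kappa>) (X \<kappa>) \<in> pm.span (?S (total_degree \<kappa>))"
      using J_high_degree[OF True] unfolding J_ideal_def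
      by (rule hpart_in_linear_span) (rule J_generators_homogeneous)
    then have "X \<kappa> \<in> pm.span (?S (total_degree \<kappa>))"
      unfolding hpart_homogeneous_of[OF homogeneous_of_X] by simp
    from bounded_on_span[OF this] True show ?thesis by (simp add: P2_def)
  qed (auto simp: P2_def)
  then obtain C2 where "\<And>\<kappa>. P2 \<kappa> (C2 \<kappa>)" by metis
  then have C2: "\<And>\<kappa>. C2 \<kappa> \<ge> 0" "\<And>\<kappa> \<psi> B. total_degree \<kappa> > CARD('p) \<Longrightarrow>
       \<forall>b\<in>?S (total_degree \<kappa>). norm (lin_ext \<psi> b) \<le> B \<Longrightarrow> norm (\<psi> \<kappa>) \<le> C2 \<kappa> * B"
    unfolding P2_def by blast+
  define C where "C = (\<Sum>\<kappa> | total_degree \<kappa> \<le> Suc CARD('p). C1 \<kappa> + C2 \<kappa>)"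
  have Cge: "C1 \<kappa> \<le> C" "C2 \<kappa> \<le> C" if "total_degree \<kappa> \<le> Suc CARD('p)" for \<kappa>
  proof -
    have "C1 \<kappa> + C2 \<kappa> \<le> C"
      unfolding C_def by (rule member_le_sum) (use that C1 C2 finite_total_degree in \<open>auto simp: add_nonneg_nonneg\<close>)
    then show "C1 \<kappa> \<le> C" "C2 \<kappa> \<le> C" using C1(1)[of \<kappa>] C2(1)[of \<kappa>] by auto
  qed
  show ?thesis
  proof (intro exI[of _ C] conjI allI impI)
    show "C \<ge> 0" unfolding C_def by (intro sum_nonneg add_nonneg_nonneg C1 C2)
  next
    fix \<psi> d B and \<kappa> :: "'p monomial"
    assume a: "\<forall>i<m. lin_ext \<psi> (\<alpha> i) = 0"
      and b: "\<forall>k g. g \<in> ?G \<and> homogeneous_of d (X k * g) \<longrightarrow> norm (lin_ext \<psi> (X k * g)) \<le> B"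
      and d: "total_degree \<kappa> = d" and B: "0 \<le> B"
    show "norm (\<psi> \<kappa>) \<le> C * B"
    proof (cases "d \<le> CARD('p)")
      case True
      have "norm (\<psi> \<kappa>) \<le> C1 \<kappa> * B"
        by (rule C1(2)[OF a]) (use b d in blast)
      also have "\<dots> \<le> C * B" using True d Cge(1)[of \<kappa>] B by (intro mult_right_mono) auto
      finally show ?thesis .
    next
      case False
      then obtain j j' where jj: "\<kappa> = j + j'" "total_degree j' = Suc CARD('p)"
        using monomial_split[of "Suc CARD('p)" \<kappa>] d by auto
      have "norm ((\<lambda>i. \<psi> (j + i)) j') \<le> C2 j' * B"
      proof (rule C2(2))
        show "\<forall>b\<in>?S (total_degree j'). norm (lin_ext (\<lambda>i. \<psi> (j + i)) b) \<le> B"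
        proof clarify
          fix k g assume g: "g \<in> ?G" "homogeneous_of (total_degree j') (X k * g)"
          have "X (j + k) * g = X j * (X k * g)"
            by (simp add: mult.assoc[symmetric] mult_single)
          moreover have "homogeneous_of d (X j * (X k * g))"
            using homogeneous_of_times[OF homogeneous_of_X[of j] g(2)] jj d by (simp add: total_degree_add)
          ultimately show "norm (lin_ext (\<lambda>i. \<psi> (j + i)) (X k * g)) \<le> B"
            using b g(1) by (metis lin_ext_times_X)
        qed
      qed (use jj in auto)
      also have "\<dots> \<le> C * B" using jj Cge(2)[of j'] B by (intro mult_right_mono) auto
      finally show ?thesis using jj by simp
    qed
  qed
qed

end

section \<open>Nonsingular cones are unimodular\<close>

text \<open>Gaussian elimination: more unknowns than equations.\<close>

lemma nontrivial_linear_relation: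
  fixes c :: "'h \<Rightarrow> 'e \<Rightarrow> 'a::field"
  assumes "finite E" "finite H" "card E < card H"
  shows "\<exists>d. (\<exists>h\<in>H. d h \<noteq> 0) \<and> (\<forall>e\<in>E. (\<Sum>h\<in>H. d h * c h e) = 0)"
  using assms
proof (induction E arbitrary: H c rule: finite_induct)
  case empty
  then have "H \<noteq> {}" by auto
  then show ?case by (intro exI[of _ "\<lambda>_. 1"]) auto
next
  case (insert e E)
  show ?case
  proof (cases "\<forall>h\<in>H. c h e = 0")
    case True
    have "card E < card H" using insert by simp
    from insert.IH[OF insert.prems(1) this, of c] show ?thesis using True by auto
  next
    case False
    then obtain h0 where h0: "h0 \<in> H" "c h0 e \<noteq> 0" by blast
    let ?H = "H - {h0}"
    have "card E < card ?H" using insert h0 by simp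
    then obtain d where d: "\<exists>h\<in>?H. d h \<noteq> 0"
      "\<forall>e'\<in>E. (\<Sum>h\<in>?H. d h * (c h e' - c h e / c h0 e * c h0 e')) = 0"
      using insert.IH[of ?H "\<lambda>h e'. c h e' - c h e / c h0 e * c h0 e'"] insert.prems by auto
    define d0 where "d0 = - (\<Sum>h\<in>?H. d h * c h e) / c h0 e"
    define d' where "d' h = (if h = h0 then d0 else d h)" for h
    have sum: "(\<Sum>h\<in>H. d' h * c h e') = d0 * c h0 e' + (\<Sum>h\<in>?H. d h * c h e')" for e'
    proof -
      have "(\<Sum>h\<in>H. d' h * c h e') = d' h0 * c h0 e' + (\<Sum>h\<in>?H. d' h * c h e')"
        by (rule sum.remove[OF insert.prems(1) h0(1)])
      also have "(\<Sum>h\<in>?H. d' h * c h e') = (\<Sum>h\<in>?H. d h * c h e')"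
        by (intro sum.cong) (auto simp: d'_def)
      finally show ?thesis by (simp add: d'_def)
    qed
    have "(\<Sum>h\<in>H. d' h * c h e') = 0" if e': "e' \<in> insert e E" for e'
    proof (cases "e' = e")
      case True
      then show ?thesis unfolding sum d0_def using h0(2) by simp
    next
      case False
      have "(\<Sum>h\<in>?H. d h * (c h e' - c h e / c h0 e * c h0 e')) =
         (\<Sum>h\<in>?H. d h * c h e') - (\<Sum>h\<in>?H. d h * c h e) / c h0 e * c h0 e'"
        by (simp add: right_diff_distrib sum_subtractf sum_divide_distrib sum_distrib_right)
      also have "\<dots> = (\<Sum>h\<in>H. d' h * c h e')" unfolding sum d0_def by simp
      finally show ?thesis using d(2) e' False by simp
    qed
    moreover have "\<exists>h\<in>H. d' h \<noteq> 0" using d(1) by (auto simp: d'_def)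
    ultimately show ?thesis by blast
  qed
qed

definition rvec :: "int ^ 'n \<Rightarrow> real ^ 'n" where
  "rvec u = (\<chi> i. real_of_int (u $ i))"

lemma rvec_simps [simp]:
  "rvec 0 = 0" "rvec (u + v) = rvec u + rvec v" "rvec (u - v) = rvec u - rvec v" "rvec (- u) = - rvec u"
  by (simp_all add: rvec_def vec_eq_iff)

lemma rvec_eq_0: "rvec u = 0 \<longleftrightarrow> u = 0"
  by (simp add: rvec_def vec_eq_iff)

lemma rvec_inner: "rvec u \<bullet> x = (\<Sum>i\<in>UNIV. real_of_int (u $ i) * x $ i)"
  by (simp add: rvec_def inner_vec_def)

lemma rvec_inner_int: "x \<in> integer_lattice \<Longrightarrow> rvec u \<bullet> x \<in> \<int>"
  unfolding rvec_inner integer_lattice_def by (auto intro!: Ints_sum Ints_mult)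

text \<open>The conditions have rational coefficients, so a nonzero rational solution exists; clear denominators.\<close>

lemma integral_orthogonal_vector:
  fixes \<mu> :: "'p \<Rightarrow> real ^ 'n"
  assumes "finite A" "card A < CARD('n)" and lat: "\<And>j. j \<in> A \<Longrightarrow> \<mu> j \<in> integer_lattice"
  shows "\<exists>u :: int ^ 'n. u \<noteq> 0 \<and> (\<forall>j\<in>A. rvec u \<bullet> \<mu> j = 0)"
proof -
  define z where "z i j = \<lfloor>\<mu> j $ i\<rfloor>" for i j
  have z: "\<mu> j $ i = of_int (z i j)" if "j \<in> A" for i j
  proof -
    have "\<mu> j $ i \<in> \<int>" using lat[OF that] by (simp add: integer_lattice_def)
    then show ?thesis by (auto simp: z_def elim: Ints_cases)
  qed
  obtain d :: "'n \<Rightarrow> rat" where d: "\<exists>i. d i \<noteq> 0" "\<And>j. j \<in> A \<Longrightarrow> (\<Sum>i\<in>UNIV. d i * of_int (z i j)) = 0"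
    using nontrivial_linear_relation[of A "UNIV :: 'n set" "\<lambda>i j. of_int (z i j) :: rat"] assms(1,2) by auto
  define q where "q i = snd (quotient_of (d i))" for i
  define Q where "Q = (\<Prod>i\<in>UNIV. q i)"
  have qpos: "q i > 0" for i unfolding q_def by (rule quotient_of_denom_pos')
  then have Q: "Q > 0" unfolding Q_def by (intro prod_pos) auto
  have "\<exists>w :: int. of_int Q * d i = of_int w" for i
  proof -
    have "d i = of_int (fst (quotient_of (d i))) / of_int (q i)"
      unfolding q_def by (rule quotient_of_div) simp
    then obtain N where "d i = of_int N / of_int (q i)" by blast
    then have N: "of_int (q i) * d i = of_int N" using qpos[of i] by simp
    have "Q = q i * (\<Prod>k\<in>UNIV - {i}. q k)" unfolding Q_def by (rule prod.remove) auto
    then have "of_int Q * d i = (of_int (q i) * d i) * of_int (\<Prod>k\<in>UNIV - {i}. q k)" by simp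
    then have "of_int Q * d i = of_int (N * (\<Prod>k\<in>UNIV - {i}. q k))" unfolding N by simp
    then show ?thesis by blast
  qed
  then obtain w :: "'n \<Rightarrow> int" where w: "\<And>i. of_int Q * d i = of_int (w i)" by metis
  define u :: "int ^ 'n" where "u = (\<chi> i. w i)"
  obtain i where "d i \<noteq> 0" using d(1) by blast
  then have "w i \<noteq> 0" using w[of i] Q by auto
  then have "u \<noteq> 0" by (auto simp: u_def vec_eq_iff)
  moreover have "rvec u \<bullet> \<mu> j = 0" if j: "j \<in> A" for j
  proof -
    have "(of_int (\<Sum>i\<in>UNIV. w i * z i j) :: rat) = of_int Q * (\<Sum>i\<in>UNIV. d i * of_int (z i j))"
      by (simp add: sum_distrib_left w mult.assoc[symmetric])
    then have "(\<Sum>i\<in>UNIV. w i * z i j) = 0" using d(2)[OF j] by (simp only: mult_zero_right of_int_eq_0_iff)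
    then have "real_of_int (\<Sum>i\<in>UNIV. w i * z i j) = 0" by simp
    then show ?thesis by (simp add: rvec_inner u_def z[OF j])
  qed
  ultimately show ?thesis by blast
qed

context toric_fan
begin

context
  fixes \<sigma> assumes \<sigma>: "\<sigma> \<in> \<Sigma>" "dim \<sigma> = CARD('n)"
begin

lemma dual_semigroup_iff: "u \<in> dual_semigroup \<sigma> \<longleftrightarrow> (\<forall>j\<in>gens \<sigma>. rvec u \<bullet> \<mu> j \<ge> 0)"
proof
  assume "u \<in> dual_semigroup \<sigma>"
  then show "\<forall>j\<in>gens \<sigma>. rvec u \<bullet> \<mu> j \<ge> 0" by (auto simp: dual_semigroup_def rvec_inner)
next
  assume *: "\<forall>j\<in>gens \<sigma>. rvec u \<bullet> \<mu> j \<ge> 0"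
  have "rvec u \<bullet> x \<ge> 0" if xs: "x \<in> \<sigma>" for x
  proof -
    obtain t where t: "x = (\<Sum>j\<in>gens \<sigma>. t j *\<^sub>R \<mu> j)" "\<And>j. j \<in> gens \<sigma> \<Longrightarrow> t j \<ge> 0"
      using cone_explicit[OF \<sigma>(1) xs] by blast
    have "rvec u \<bullet> x = (\<Sum>j\<in>gens \<sigma>. t j * (rvec u \<bullet> \<mu> j))" by (simp add: t(1) inner_sum_right)
    then show ?thesis using * t(2) by (auto intro!: sum_nonneg)
  qed
  then show "u \<in> dual_semigroup \<sigma>" by (auto simp: dual_semigroup_def rvec_inner)
qed

lemma orthogonal_to_gens_eq_0:
  assumes "\<And>j. j \<in> gens \<sigma> \<Longrightarrow> rvec u \<bullet> \<mu> j = 0"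
  shows "u = 0"
proof -
  have "rvec u \<in> span (\<mu> ` gens \<sigma>)" using full_cone_span(2)[OF \<sigma>] by simp
  then have "orthogonal (rvec u) (rvec u)"
    by (rule orthogonal_to_span) (use assms in \<open>auto simp: orthogonal_def\<close>)
  then show ?thesis by (simp add: orthogonal_self rvec_eq_0)
qed

text \<open>The sum of the generators is a grading of the dual semigroup that is positive away from zero; it serves as the measure for decompositions.\<close>

definition level :: "int ^ 'n \<Rightarrow> nat" where
  "level u = nat (\<lfloor>\<Sum>j\<in>gens \<sigma>. rvec u \<bullet> \<mu> j\<rfloor>)"

lemma level_eq: "u \<in> dual_semigroup \<sigma> \<Longrightarrow> real (level u) = (\<Sum>j\<in>gens \<sigma>. rvec u \<bullet> \<mu> j)"
proof -
  assume u: "u \<in> dual_semigroup \<sigma>"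
  have "(\<Sum>j\<in>gens \<sigma>. rvec u \<bullet> \<mu> j) \<in> \<int>" by (intro Ints_sum rvec_inner_int mu_lattice)
  then obtain z :: int where z: "(\<Sum>j\<in>gens \<sigma>. rvec u \<bullet> \<mu> j) = of_int z" by (auto elim: Ints_cases)
  have "(\<Sum>j\<in>gens \<sigma>. rvec u \<bullet> \<mu> j) \<ge> 0" using u by (intro sum_nonneg) (auto simp: dual_semigroup_iff)
  then show ?thesis by (simp add: level_def z)
qed

lemma dual_semigroup_add: "u \<in> dual_semigroup \<sigma> \<Longrightarrow> v \<in> dual_semigroup \<sigma> \<Longrightarrow> u + v \<in> dual_semigroup \<sigma>"
  by (simp add: dual_semigroup_iff inner_add_left)

lemma dual_semigroup_0: "0 \<in> dual_semigroup \<sigma>"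
  by (simp add: dual_semigroup_iff)

lemma level_add:
  assumes "u \<in> dual_semigroup \<sigma>" "v \<in> dual_semigroup \<sigma>"
  shows "level (u + v) = level u + level v"
proof -
  have "real (level (u + v)) = real (level u + level v)"
    using assms dual_semigroup_add[OF assms] by (simp add: level_eq inner_add_left sum.distrib)
  then show ?thesis by (simp only: of_nat_eq_iff)
qed

lemma level_pos:
  assumes u: "u \<in> dual_semigroup \<sigma>" "u \<noteq> 0"
  shows "level u > 0"
proof (rule ccontr)
  assume "\<not> level u > 0"
  then have "(\<Sum>j\<in>gens \<sigma>. rvec u \<bullet> \<mu> j) = 0" using level_eq[OF u(1)] by simp
  then have "\<forall>j\<in>gens \<sigma>. rvec u \<bullet> \<mu> j = 0"
    using u(1) by (subst (asm) sum_nonneg_eq_0_iff) (auto simp: dual_semigroup_iff)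
  then show False using orthogonal_to_gens_eq_0[of u] u(2) by simp
qed

definition indecomposable :: "int ^ 'n \<Rightarrow> bool" where
  "indecomposable h \<longleftrightarrow> h \<in> dual_semigroup \<sigma> \<and> h \<noteq> 0 \<and>
    (\<forall>a\<in>dual_semigroup \<sigma>. \<forall>b\<in>dual_semigroup \<sigma>. h = a + b \<longrightarrow> a = 0 \<or> b = 0)"

lemma decompose_induct [consumes 1, case_names zero indecomposable add]:
  assumes u: "u \<in> dual_semigroup \<sigma>" and "P 0" and "\<And>h. indecomposable h \<Longrightarrow> P h"
    and add: "\<And>a b. a \<in> dual_semigroup \<sigma> \<Longrightarrow> b \<in> dual_semigroup \<sigma> \<Longrightarrow> P a \<Longrightarrow> P b \<Longrightarrow> P (a + b)"
  shows "P u"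
  using u
proof (induction "level u" arbitrary: u rule: less_induct)
  case less
  show ?case
  proof (cases "u = 0 \<or> indecomposable u")
    case True
    then show ?thesis using assms by blast
  next
    case False
    then obtain a b where ab: "a \<in> dual_semigroup \<sigma>" "b \<in> dual_semigroup \<sigma>" "u = a + b" "a \<noteq> 0" "b \<noteq> 0"
      using less.prems unfolding indecomposable_def by blast
    then have "level a < level u" "level b < level u" using level_add level_pos by auto
    then show ?thesis using less.hyps ab add by blast
  qed
qed

text \<open>In a decomposition of \<open>u\<close> into indecomposable elements at least one summand is positive on \<open>\<mu>\<^sub>j\<close>.\<close>

lemma indecomposable_summand:
  assumes "u \<in> dual_semigroup \<sigma>" "j \<in> gens \<sigma>"
  shows "rvec u \<bullet> \<mu> j > 0 \<longrightarrow> (\<exists>h. indecomposable h \<and> rvec h \<bullet> \<mu> j > 0 \<and> u - h \<in> dual_semigroup \<sigma>)"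
  using assms(1)
proof (induction rule: decompose_induct)
  case (indecomposable h)
  then show ?case using dual_semigroup_0 by auto
next
  case (add a b)
  show ?case
  proof
    assume "rvec (a + b) \<bullet> \<mu> j > 0"
    then consider "rvec a \<bullet> \<mu> j > 0" | "rvec b \<bullet> \<mu> j > 0" by (force simp: inner_add_left)
    then show "\<exists>h. indecomposable h \<and> rvec h \<bullet> \<mu> j > 0 \<and> a + b - h \<in> dual_semigroup \<sigma>"
    proof cases
      case 1
      then obtain h where "indecomposable h" "rvec h \<bullet> \<mu> j > 0" "a - h \<in> dual_semigroup \<sigma>" using add by blast
      moreover have "a + b - h = (a - h) + b" by simp
      ultimately show ?thesis using dual_semigroup_add add by metis
    next
      case 2
      then obtain h where "indecomposable h" "rvec h \<bullet> \<mu> j > 0" "b - h \<in> dual_semigroup \<sigma>" using add by blast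
      moreover have "a + b - h = a + (b - h)" by simp
      ultimately show ?thesis using dual_semigroup_add add by metis
    qed
  qed
qed simp

text \<open>The character that is zero away from the origin is the torus-fixed point of the chart; its
  cotangent space has the indecomposable elements of the dual semigroup as a basis.\<close>

lemma indecomposable_card_le:
  assumes ns: "nonsingular_toric_variety \<Sigma>" and H: "finite H" "\<And>h. h \<in> H \<Longrightarrow> indecomposable h"
  shows "card H \<le> CARD('n)"
proof (rule ccontr)
  assume "\<not> ?thesis"
  then have less: "card {..<CARD('n)} < card H" by simp
  define x :: "int ^ 'n \<Rightarrow> complex" where "x u = (if u = 0 then 1 else 0)" for u
  have "x \<in> chart_points \<sigma>"
    unfolding chart_points_def
  proof (intro CollectI conjI ballI)
    fix u v assume uv: "u \<in> dual_semigroup \<sigma>" "v \<in> dual_semigroup \<sigma>"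
    have "u = 0 \<and> v = 0" if "u + v = 0"
    proof -
      have "level u + level v = 0" using level_add[OF uv] that by (simp add: level_def)
      then show ?thesis using level_pos uv by fastforce
    qed
    then show "x (u + v) = x u * x v" by (auto simp: x_def)
  qed (simp add: x_def)
  define M where "M = chart_maximal_ideal \<sigma> x"
  have M: "f \<in> M \<longleftrightarrow> Poly_Mapping.keys f \<subseteq> dual_semigroup \<sigma> \<and> Poly_Mapping.lookup f 0 = 0" for f
  proof -
    have "(\<Sum>u\<in>Poly_Mapping.keys f. Poly_Mapping.lookup f u * x u) =
       (\<Sum>u\<in>Poly_Mapping.keys f. if u = 0 then Poly_Mapping.lookup f 0 else 0)"
      by (intro sum.cong) (auto simp: x_def)
    also have "\<dots> = Poly_Mapping.lookup f 0" by (simp add: in_keys_iff)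
    finally show ?thesis by (simp add: M_def chart_maximal_ideal_def)
  qed
  let ?M2 = "pm.span {f * g | f g. f \<in> M \<and> g \<in> M}"
  obtain b where b: "basis_modulo M ?M2 CARD('n) b"
    using ns \<sigma>(1) \<open>x \<in> chart_points \<sigma>\<close> unfolding nonsingular_toric_variety_def M_def Let_def by blast
  (* products of two elements of the maximal ideal do not involve indecomposable exponents *)
  have M2: "Poly_Mapping.lookup f h = 0" if "f \<in> ?M2" "indecomposable h" for f h
    using that(1)
  proof (induction rule: pm.span_induct_alt)
    case (step c f g)
    then obtain p q where pq: "f = p * q" "p \<in> M" "q \<in> M" by blast
    have "h \<notin> Poly_Mapping.keys f"
    proof
      assume "h \<in> Poly_Mapping.keys f"
      then obtain u v where uv: "h = u + v" "u \<in> Poly_Mapping.keys p" "v \<in> Poly_Mapping.keys q"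
        using keys_mult[of p q] pq(1) by blast
      then have "u \<in> dual_semigroup \<sigma>" "v \<in> dual_semigroup \<sigma>" "u \<noteq> 0" "v \<noteq> 0"
        using pq(2,3) by (auto simp: M in_keys_iff)
      then show False using that(2) uv(1) unfolding indecomposable_def by blast
    qed
    then show ?case using step by (simp add: lookup_add in_keys_iff)
  qed simp
  have XM: "X h \<in> M" if "h \<in> H" for h
    using H(2)[OF that] by (simp add: M indecomposable_def lookup_single when_def)
  have ex: "\<exists>c. X h - (\<Sum>i<CARD('n). pm_scale (c i) (b i)) \<in> ?M2" if "h \<in> H" for h
    using b XM[OF that] unfolding basis_modulo_def by blast
  define c where "c h = (SOME c. X h - (\<Sum>i<CARD('n). pm_scale (c i) (b i)) \<in> ?M2)" for h
  have c: "X h - (\<Sum>i<CARD('n). pm_scale (c h i) (b i)) \<in> ?M2" if "h \<in> H" for h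
    unfolding c_def by (rule someI_ex[OF ex[OF that]])
  obtain d where d: "\<exists>h\<in>H. d h \<noteq> 0" "\<forall>i\<in>{..<CARD('n)}. (\<Sum>h\<in>H. d h * c h i) = 0"
    using nontrivial_linear_relation[OF _ H(1) less, of c] by auto
  have "(\<Sum>h\<in>H. pm_scale (d h) (X h - (\<Sum>i<CARD('n). pm_scale (c h i) (b i)))) \<in> ?M2"
    by (intro pm.span_sum pm.span_scale c)
  also have "(\<Sum>h\<in>H. pm_scale (d h) (X h - (\<Sum>i<CARD('n). pm_scale (c h i) (b i)))) =
     (\<Sum>h\<in>H. pm_scale (d h) (X h)) - (\<Sum>h\<in>H. \<Sum>i<CARD('n). pm_scale (d h * c h i) (b i))"
    by (simp add: pm.scale_right_diff_distrib sum_subtractf pm.scale_sum_right)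
  also have "(\<Sum>h\<in>H. \<Sum>i<CARD('n). pm_scale (d h * c h i) (b i)) =
     (\<Sum>i<CARD('n). pm_scale (\<Sum>h\<in>H. d h * c h i) (b i))"
    by (subst sum.swap) (simp add: pm.scale_sum_left)
  also have "\<dots> = 0" using d(2) by (intro sum.neutral) auto
  finally have rel: "(\<Sum>h\<in>H. pm_scale (d h) (X h)) \<in> ?M2" by simp
  obtain h where h: "h \<in> H" "d h \<noteq> 0" using d(1) by blast
  have "Poly_Mapping.lookup (\<Sum>h\<in>H. pm_scale (d h) (X h)) h = (\<Sum>h'\<in>H. if h' = h then d h else 0)"
    unfolding lookup_sum by (intro sum.cong) (auto simp: lookup_single when_def)
  also have "\<dots> = d h" using H(1) h(1) by simp
  finally show False using M2[OF rel H(2)[OF h(1)]] h(2) by simp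
qed

text \<open>For every generator \<open>\<mu>\<^sub>j\<close> of the cone there is an indecomposable \<open>h\<^sub>j\<close> that is positive on \<open>\<mu>\<^sub>j\<close> and vanishes on the other generators.  There are at most \<open>n\<close> indecomposable elements, so these are all.  They generate the dual lattice, and as \<open>\<mu>\<^sub>j\<close> is primitive, \<open>h\<^sub>j\<close> takes the value \<open>1\<close> on it.  Thus the \<open>h\<^sub>j\<close> are a dual basis with integral entries.\<close>

lemma nonsingular_integral_coordinates:
  assumes ns: "nonsingular_toric_variety \<Sigma>" and x: "x \<in> \<sigma>" "x \<in> integer_lattice"
  shows "\<exists>c :: 'p \<Rightarrow> nat. x = (\<Sum>j\<in>gens \<sigma>. real (c j) *\<^sub>R \<mu> j)"
proof -
  have "\<exists>h. indecomposable h \<and> rvec h \<bullet> \<mu> j > 0 \<and> (\<forall>i\<in>gens \<sigma> - {j}. rvec h \<bullet> \<mu> i = 0)"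
    if j: "j \<in> gens \<sigma>" for j
  proof -
    have "card (gens \<sigma> - {j}) < CARD('n)"
      using full_cone_span(1)[OF \<sigma>] j by (metis card_Diff1_less finite)
    from integral_orthogonal_vector[where \<mu> = \<mu>, OF _ this mu_lattice]
    obtain u :: "int ^ 'n" where u: "u \<noteq> 0" "\<forall>i\<in>gens \<sigma> - {j}. rvec u \<bullet> \<mu> i = 0" by auto
    define e where "e = (if rvec u \<bullet> \<mu> j \<ge> 0 then u else - u)"
    have e: "e \<noteq> 0" "\<forall>i\<in>gens \<sigma> - {j}. rvec e \<bullet> \<mu> i = 0" "rvec e \<bullet> \<mu> j \<ge> 0"
      using u by (auto simp: e_def)
    have "rvec e \<bullet> \<mu> j \<noteq> 0" using orthogonal_to_gens_eq_0[of e] e by (metis DiffI empty_iff insert_iff)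
    then have ej: "rvec e \<bullet> \<mu> j > 0" using e(3) by simp
    have eds: "e \<in> dual_semigroup \<sigma>" unfolding dual_semigroup_iff
    proof
      fix i assume "i \<in> gens \<sigma>"
      then show "0 \<le> rvec e \<bullet> \<mu> i" using e(2,3) by (cases "i = j") auto
    qed
    obtain h where h: "indecomposable h" "rvec h \<bullet> \<mu> j > 0" "e - h \<in> dual_semigroup \<sigma>"
      using indecomposable_summand[OF eds j] ej by blast
    have "rvec h \<bullet> \<mu> i = 0" if i: "i \<in> gens \<sigma> - {j}" for i
    proof -
      have "rvec h \<bullet> \<mu> i \<ge> 0" using h(1) i by (auto simp: indecomposable_def dual_semigroup_iff)
      moreover have "rvec (e - h) \<bullet> \<mu> i \<ge> 0" using h(3) i unfolding dual_semigroup_iff by blast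
      moreover have "rvec e \<bullet> \<mu> i = 0" using e(2) i by blast
      ultimately show ?thesis by (simp add: inner_diff_left)
    qed
    then show ?thesis using h by blast
  qed
  note ex = this
  define h where "h j = (SOME h. indecomposable h \<and> rvec h \<bullet> \<mu> j > 0 \<and> (\<forall>i\<in>gens \<sigma> - {j}. rvec h \<bullet> \<mu> i = 0))" for j
  have hj: "indecomposable (h j) \<and> rvec (h j) \<bullet> \<mu> j > 0 \<and> (\<forall>i\<in>gens \<sigma> - {j}. rvec (h j) \<bullet> \<mu> i = 0)"
    if "j \<in> gens \<sigma>" for j
    unfolding h_def by (rule someI_ex[OF ex[OF that]])
  have h: "\<And>j. j \<in> gens \<sigma> \<Longrightarrow> indecomposable (h j)"
    "\<And>j. j \<in> gens \<sigma> \<Longrightarrow> rvec (h j) \<bullet> \<mu> j > 0"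
    "\<And>i j. j \<in> gens \<sigma> \<Longrightarrow> i \<in> gens \<sigma> \<Longrightarrow> i \<noteq> j \<Longrightarrow> rvec (h j) \<bullet> \<mu> i = 0"
    using hj by blast+
  have inj: "inj_on h (gens \<sigma>)"
  proof (rule inj_onI, rule ccontr)
    fix i j assume ij: "i \<in> gens \<sigma>" "j \<in> gens \<sigma>" "h i = h j" "i \<noteq> j"
    then show False using h(2)[OF ij(1)] h(3)[OF ij(2) ij(1) ij(4)] by simp
  qed
  have all: "g \<in> h ` gens \<sigma>" if "indecomposable g" for g
  proof (rule ccontr)
    assume "g \<notin> h ` gens \<sigma>"
    then have "card (insert g (h ` gens \<sigma>)) = Suc CARD('n)"
      using card_image[OF inj] full_cone_span(1)[OF \<sigma>] by simp
    moreover have "card (insert g (h ` gens \<sigma>)) \<le> CARD('n)"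
      by (rule indecomposable_card_le[OF ns]) (use that h(1) in auto)
    ultimately show False by simp
  qed
  have one: "rvec (h j) \<bullet> \<mu> j = 1" if j: "j \<in> gens \<sigma>" for j
  proof -
    let ?k = "rvec (h j) \<bullet> \<mu> j"
    have multiple: "\<exists>z :: int. rvec u \<bullet> \<mu> j = of_int z * ?k" if "u \<in> dual_semigroup \<sigma>" for u
      using that
    proof (induction rule: decompose_induct)
      case zero
      show ?case by (intro exI[of _ 0]) simp
    next
      case (indecomposable g)
      then obtain i where i: "i \<in> gens \<sigma>" "g = h i" using all by blast
      show ?case
      proof (cases "i = j")
        case True
        then show ?thesis using i by (intro exI[of _ 1]) simp
      next
        case False
        then show ?thesis using i h(3)[OF i(1) j] by (intro exI[of _ 0]) simp
      qed
    next
      case (add a b)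
      then obtain z z' :: int where "rvec a \<bullet> \<mu> j = of_int z * ?k" "rvec b \<bullet> \<mu> j = of_int z' * ?k" by blast
      then show ?case by (intro exI[of _ "z + z'"]) (simp add: inner_add_left distrib_right)
    qed
    (* every lattice vector is a difference of elements of the dual semigroup *)
    have all_u: "\<exists>z :: int. rvec u \<bullet> \<mu> j = of_int z * ?k" for u :: "int ^ 'n"
    proof -
      define s where "s = (\<Sum>i\<in>gens \<sigma>. h i)"
      have s: "rvec s \<bullet> \<mu> i \<ge> 1" if i: "i \<in> gens \<sigma>" for i
      proof -
        have rs: "rvec (\<Sum>k\<in>A. h k) \<bullet> \<mu> i = (\<Sum>k\<in>A. rvec (h k) \<bullet> \<mu> i)" for A
          by (induction A rule: infinite_finite_induct) (auto simp: inner_add_left)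
        have "rvec (h i) \<bullet> \<mu> i \<le> rvec s \<bullet> \<mu> i"
          unfolding s_def rs using i h(1) by (intro member_le_sum) (auto simp: indecomposable_def dual_semigroup_iff)
        moreover obtain z :: int where "rvec (h i) \<bullet> \<mu> i = of_int z"
          using rvec_inner_int[OF mu_lattice] by (metis Ints_cases)
        moreover have "rvec (h i) \<bullet> \<mu> i > 0" by (rule h(2)[OF i])
        ultimately show ?thesis by simp
      qed
      define N :: nat where "N = nat \<lceil>\<Sum>i\<in>gens \<sigma>. \<bar>rvec u \<bullet> \<mu> i\<bar>\<rceil>"
      have N: "\<bar>rvec u \<bullet> \<mu> i\<bar> \<le> real N" if "i \<in> gens \<sigma>" for i
      proof -
        have "\<bar>rvec u \<bullet> \<mu> i\<bar> \<le> (\<Sum>i\<in>gens \<sigma>. \<bar>rvec u \<bullet> \<mu> i\<bar>)" using that by (intro member_le_sum) auto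
        then show ?thesis unfolding N_def by linarith
      qed
      have pos: "((\<lambda>v. s + v) ^^ N) u \<in> dual_semigroup \<sigma>"
        and "\<exists>z :: int. rvec (((\<lambda>v. s + v) ^^ N) u) \<bullet> \<mu> j = rvec u \<bullet> \<mu> j + of_nat N * (rvec s \<bullet> \<mu> j)"
      proof -
        have eq: "rvec (((\<lambda>v. s + v) ^^ N) u) \<bullet> y = rvec u \<bullet> y + of_nat N * (rvec s \<bullet> y)" for N y
          by (induction N) (auto simp: inner_add_left algebra_simps)
        show "((\<lambda>v. s + v) ^^ N) u \<in> dual_semigroup \<sigma>"
          unfolding dual_semigroup_iff eq
        proof
          fix i assume i: "i \<in> gens \<sigma>"
          have "real N * 1 \<le> real N * (rvec s \<bullet> \<mu> i)" using s[OF i] by (intro mult_left_mono) auto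
          then show "0 \<le> rvec u \<bullet> \<mu> i + real N * (rvec s \<bullet> \<mu> i)" using N[OF i] by linarith
        qed
        show "\<exists>z :: int. rvec (((\<lambda>v. s + v) ^^ N) u) \<bullet> \<mu> j = rvec u \<bullet> \<mu> j + of_nat N * (rvec s \<bullet> \<mu> j)"
          using eq by blast
      qed
      then have e: "rvec (((\<lambda>v. s + v) ^^ N) u) \<bullet> \<mu> j = rvec u \<bullet> \<mu> j + of_nat N * (rvec s \<bullet> \<mu> j)"
        by (elim exE)
      have "0 \<le> rvec s \<bullet> \<mu> i" if "i \<in> gens \<sigma>" for i using s[OF that] by linarith
      then have sds: "s \<in> dual_semigroup \<sigma>" unfolding dual_semigroup_iff by simp
      obtain z :: int where z: "rvec (((\<lambda>v. s + v) ^^ N) u) \<bullet> \<mu> j = of_int z * ?k"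
        using multiple[OF pos] by (elim exE)
      obtain z' :: int where z': "rvec s \<bullet> \<mu> j = of_int z' * ?k"
        using multiple[OF sds] by (elim exE)
      have "of_int z * ?k = rvec u \<bullet> \<mu> j + of_nat N * (of_int z' * ?k)"
        using e unfolding z z' .
      then have "rvec u \<bullet> \<mu> j = of_int z * ?k - of_nat N * (of_int z' * ?k)" by linarith
      also have "\<dots> = of_int (z - int N * z') * ?k" by (simp only: of_int_diff of_int_mult left_diff_distrib of_int_of_nat_eq mult.assoc)
      finally show ?thesis by (rule exI)
    qed
    have kpos: "?k > 0" by (rule h(2)[OF j])
    have "(1 / ?k) *\<^sub>R \<mu> j \<in> integer_lattice"
      unfolding integer_lattice_def
    proof (intro CollectI allI)
      fix i
      obtain z :: int where z: "rvec (axis i 1) \<bullet> \<mu> j = of_int z * ?k" using all_u by blast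
      have "rvec (axis i 1) = axis i 1" by (simp add: rvec_def axis_def vec_eq_iff)
      then have "\<mu> j $ i = of_int z * ?k" using z by (simp add: inner_axis')
      then show "((1 / ?k) *\<^sub>R \<mu> j) $ i \<in> \<int>" using kpos by simp
    qed
    moreover have "(1 / ?k) *\<^sub>R \<mu> j \<in> convex_cone hull {\<mu> j}"
      using kpos by (intro convex_cone_hull_mul) (auto simp: hull_inc)
    ultimately obtain q :: nat where "(1 / ?k) *\<^sub>R \<mu> j = real q *\<^sub>R \<mu> j"
      using ray_of_generator(2)[OF mu_generator] by blast
    then have "1 / ?k = real q" using mu_nonzero[of j] by simp
    then have qk: "real q * ?k = 1" using kpos by (simp add: field_simps)
    obtain z :: int where z: "?k = of_int z" using rvec_inner_int[OF mu_lattice] by (metis Ints_cases)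
    have "real_of_int (int q * z) = 1" using qk z by simp
    then have "int q * z = 1" by (simp only: of_int_eq_1_iff)
    moreover have "z > 0" using kpos z by simp
    ultimately have "z = 1" using zmult_eq_1_iff[of "int q" z] by auto
    then show ?thesis using z by simp
  qed
  have dual: "rvec (h i) \<bullet> \<mu> j = (if i = j then 1 else 0)" if "i \<in> gens \<sigma>" "j \<in> gens \<sigma>" for i j
    using one h(3) that by auto
  have "x = (\<Sum>j\<in>gens \<sigma>. (rvec (h j) \<bullet> x) *\<^sub>R \<mu> j)"
    by (rule full_cone_span(3)[OF \<sigma>]) (rule dual)
  also have "\<dots> = (\<Sum>j\<in>gens \<sigma>. real (nat \<lfloor>rvec (h j) \<bullet> x\<rfloor>) *\<^sub>R \<mu> j)"
  proof (rule sum.cong[OF refl])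
    fix j assume j: "j \<in> gens \<sigma>"
    obtain z :: int where z: "rvec (h j) \<bullet> x = of_int z" using rvec_inner_int[OF x(2)] by (metis Ints_cases)
    have "h j \<in> dual_semigroup \<sigma>" using h(1)[OF j] by (simp add: indecomposable_def)
    then have "rvec (h j) \<bullet> x \<ge> 0" using x(1) by (simp add: dual_semigroup_def rvec_inner)
    then show "(rvec (h j) \<bullet> x) *\<^sub>R \<mu> j = real (nat \<lfloor>rvec (h j) \<bullet> x\<rfloor>) *\<^sub>R \<mu> j" using z by simp
  qed
  finally show ?thesis by (intro exI[of _ "\<lambda>j. nat \<lfloor>rvec (h j) \<bullet> x\<rfloor>"])
qed

end

end

section \<open>Summands of the Gamma series\<close>

lemma has_sum_finite_sum:
  fixes f :: "'i \<Rightarrow> 'l \<Rightarrow> 'b::real_normed_vector"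
  shows "(\<And>i. i \<in> A \<Longrightarrow> (f i has_sum s i) K) \<Longrightarrow> ((\<lambda>l. \<Sum>i\<in>A. f i l) has_sum (\<Sum>i\<in>A. s i)) K"
  by (induction A rule: infinite_finite_induct) (auto intro: has_sum_add)

lemma has_sum_minus:
  fixes f g :: "'l \<Rightarrow> 'b::real_normed_vector"
  assumes "(f has_sum s) K" "(g has_sum t) K"
  shows "((\<lambda>l. f l - g l) has_sum (s - t)) K"
  using has_sum_add[of f K s "\<lambda>l. - g l" "- t"] assms by (simp add: has_sum_uminus)

text \<open>Split off a finite set of terms.  By the mean value inequality the remainders of the other terms add up to at most a multiple of \<open>norm (b - a)\<close> times the tail of the majorant series.\<close>

lemma has_derivative_infsum:
  fixes f :: "'l \<Rightarrow> complex ^ 'i::finite \<Rightarrow> complex" and D :: "'l \<Rightarrow> 'i \<Rightarrow> complex ^ 'i \<Rightarrow> complex"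
  assumes U: "open U" and a: "a \<in> U"
    and der: "\<And>l a. l \<in> K \<Longrightarrow> a \<in> U \<Longrightarrow> (f l has_derivative (\<lambda>h. \<Sum>i\<in>UNIV. h $ i * D l i a)) (at a)"
    and M: "M summable_on K" "\<And>l. M l \<ge> (0::real)"
    and G: "continuous_on U G"
    and bound: "\<And>l a. l \<in> K \<Longrightarrow> a \<in> U \<Longrightarrow> norm (f l a) \<le> G a * M l"
      "\<And>l a i. l \<in> K \<Longrightarrow> a \<in> U \<Longrightarrow> norm (D l i a) \<le> G a * M l"
  shows "((\<lambda>a. infsum (\<lambda>l. f l a) K) has_derivative
    (\<lambda>h. \<Sum>i\<in>UNIV. h $ i * infsum (\<lambda>l. D l i a) K)) (at a)"
proof -
  obtain r where r: "r > 0" "cball a r \<subseteq> U" using U a open_contains_cball by metis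
  have "compact (G ` cball a r)"
    by (intro compact_continuous_image continuous_on_subset[OF G r(2)] compact_cball)
  then obtain G0 where G0: "\<And>b. b \<in> cball a r \<Longrightarrow> \<bar>G b\<bar> \<le> G0"
    by (force dest!: compact_imp_bounded simp: bounded_iff)
  have G0nn: "G0 \<ge> 0" using G0[of a] r by force
  have bd: "norm (f l b) \<le> G0 * M l" "norm (D l i b) \<le> G0 * M l" if "l \<in> K" "b \<in> cball a r" for l b i
  proof -
    have "G b * M l \<le> G0 * M l" using G0[OF that(2)] M(2) by (intro mult_right_mono) auto
    moreover have "b \<in> U" using that r by blast
    ultimately show "norm (f l b) \<le> G0 * M l" "norm (D l i b) \<le> G0 * M l"
      using bound[OF that(1)] by (meson order_trans)+
  qed
  have abs: "(\<lambda>l. norm (f l b)) summable_on K" "(\<lambda>l. norm (D l i b)) summable_on K" if "b \<in> cball a r" for b i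
    by (rule summable_on_comparison_test[OF summable_on_cmult_right[OF M(1), of G0]]; use bd that in auto)+
  have smf: "(\<lambda>l. f l b) summable_on K" and smD: "(\<lambda>l. D l i b) summable_on K" if "b \<in> cball a r" for b i
    using abs[OF that] by (auto intro: abs_summable_summable)
  define N where "N = real CARD('i)"
  define Rm where "Rm l b = f l b - f l a - (\<Sum>i\<in>UNIV. (b - a) $ i * D l i a)" for l b
  have aball: "a \<in> cball a r" using r by simp
  have L_infsum: "(\<Sum>i\<in>UNIV. h $ i * infsum (\<lambda>l. D l i a) K) = infsum (\<lambda>l. \<Sum>i\<in>UNIV. h $ i * D l i a) K"
    and L_sum: "(\<lambda>l. \<Sum>i\<in>UNIV. h $ i * D l i a) summable_on K" for h
  proof -
    have "((\<lambda>l. \<Sum>i\<in>UNIV. h $ i * D l i a) has_sum (\<Sum>i\<in>UNIV. h $ i * infsum (\<lambda>l. D l i a) K)) K"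
      by (intro has_sum_finite_sum has_sum_cmult_right has_sum_infsum smD aball)
    then show "(\<Sum>i\<in>UNIV. h $ i * infsum (\<lambda>l. D l i a) K) = infsum (\<lambda>l. \<Sum>i\<in>UNIV. h $ i * D l i a) K"
      "(\<lambda>l. \<Sum>i\<in>UNIV. h $ i * D l i a) summable_on K"
      by (auto simp: infsumI summable_on_def)
  qed
  have Rm_has_sum: "((\<lambda>l. Rm l b) has_sum (infsum (\<lambda>l. f l b) K - infsum (\<lambda>l. f l a) K
      - (\<Sum>i\<in>UNIV. (b - a) $ i * infsum (\<lambda>l. D l i a) K))) K" if "b \<in> cball a r" for b
    unfolding Rm_def L_infsum by (intro has_sum_minus has_sum_infsum smf L_sum that aball)
  have Rm_sum: "(\<lambda>l. Rm l b) summable_on K" if "b \<in> cball a r" for b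
    using Rm_has_sum[OF that] by (rule has_sum_imp_summable)
  have Rm_infsum: "infsum (\<lambda>l. f l b) K - infsum (\<lambda>l. f l a) K - (\<Sum>i\<in>UNIV. (b - a) $ i * infsum (\<lambda>l. D l i a) K)
     = infsum (\<lambda>l. Rm l b) K" if "b \<in> cball a r" for b
    using infsumI[OF Rm_has_sum[OF that]] by (rule sym)
  have Rm_bound: "norm (Rm l b) \<le> 2 * N * G0 * norm (b - a) * M l" if l: "l \<in> K" and b: "b \<in> cball a r" for l b
  proof -
    have lin_bound: "norm (\<Sum>i\<in>UNIV. h $ i * D l i c) \<le> N * G0 * M l * norm h" if c: "c \<in> cball a r" for h c
    proof -
      have "norm (\<Sum>i\<in>UNIV. h $ i * D l i c) \<le> (\<Sum>i\<in>(UNIV :: 'i set). norm h * (G0 * M l))"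
      proof (rule sum_norm_le)
        fix i
        show "norm (h $ i * D l i c) \<le> norm h * (G0 * M l)"
          unfolding norm_mult by (intro mult_mono Finite_Cartesian_Product.norm_nth_le bd[OF l c]) auto
      qed
      also have "\<dots> = N * G0 * M l * norm h" unfolding N_def sum_constant by (simp only: mult_ac of_nat_mult)
      finally show ?thesis .
    qed
    have "norm (f l b - f l a) \<le> (N * G0 * M l) * norm (b - a)"
    proof (rule differentiable_bound)
      show "convex (cball a r)" by simp
      fix c assume c: "c \<in> cball a r"
      show "(f l has_derivative (\<lambda>h. \<Sum>i\<in>UNIV. h $ i * D l i c)) (at c within cball a r)"
        by (rule has_derivative_at_withinI[OF der[OF l subsetD[OF r(2) c]]])
      show "onorm (\<lambda>h. \<Sum>i\<in>UNIV. h $ i * D l i c) \<le> N * G0 * M l"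
        by (rule onorm_le) (rule lin_bound[OF c])
    qed (use b aball in auto)
    moreover have "norm (\<Sum>i\<in>UNIV. (b - a) $ i * D l i a) \<le> N * G0 * M l * norm (b - a)"
      by (rule lin_bound[OF aball])
    ultimately have "norm (Rm l b) \<le> (N * G0 * M l) * norm (b - a) + N * G0 * M l * norm (b - a)"
      unfolding Rm_def by (intro order_trans[OF norm_triangle_ineq4 add_mono])
    also have "\<dots> = 2 * N * G0 * norm (b - a) * M l" by algebra
    finally show ?thesis .
  qed
  show ?thesis
    unfolding has_derivative_at_alt
  proof (intro conjI allI impI)
    have "linear (\<lambda>h. \<Sum>i\<in>UNIV. h $ i * infsum (\<lambda>l. D l i a) K)"
      by (rule linearI) (simp_all add: algebra_simps sum.distrib scaleR_sum_right)
    then show "bounded_linear (\<lambda>h. \<Sum>i\<in>UNIV. h $ i * infsum (\<lambda>l. D l i a) K)"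
      by (simp add: linear_conv_bounded_linear)
  next
    fix e :: real assume e: "e > 0"
    define P where "P = 2 * N * G0"
    have Nnn: "2 * N * G0 \<ge> 0" using G0nn by (simp add: N_def)
    then have P: "P \<ge> 0" by (simp only: P_def)
    define Q where "Q = P + 1"
    have Q: "Q > 0" using P by (simp add: Q_def)
    define e' where "e' = e / (2 * Q)"
    have e'0: "e' > 0" using e Q by (simp add: e'_def)
    have "P * e' \<le> Q * e'" using e'0 by (intro mult_right_mono) (auto simp: Q_def)
    also have "\<dots> = e / 2" using Q by (simp add: e'_def)
    finally have e': "e' > 0" "2 * N * G0 * e' \<le> e / 2" using e'0 by (simp_all only: P_def)
    have "(sum M \<longlongrightarrow> infsum M K) (finite_subsets_at_top K)"
      using has_sum_infsum[OF M(1)] by (simp add: has_sum_def)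
    then have "\<forall>\<^sub>F F in finite_subsets_at_top K. dist (sum M F) (infsum M K) < e'"
      using e'(1) tendstoD by blast
    then obtain F where F: "finite F" "F \<subseteq> K" "dist (sum M F) (infsum M K) < e'"
      unfolding eventually_finite_subsets_at_top by blast
    have tail: "infsum M (K - F) < e'"
    proof -
      have "infsum M (K - F) = infsum M K - infsum M F"
        by (rule infsum_Diff[OF M(1) _ F(2)]) (simp add: F(1))
      then show ?thesis using F by (simp add: dist_real_def)
    qed
    have "((\<lambda>b. \<Sum>l\<in>F. f l b) has_derivative (\<lambda>h. \<Sum>l\<in>F. \<Sum>i\<in>UNIV. h $ i * D l i a)) (at a)"
      using F(2) by (intro has_derivative_sum der a) auto
    from this[unfolded has_derivative_at_alt, THEN conjunct2, THEN spec, of "e / 2"] e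
    obtain d where d: "d > 0" "\<forall>b. norm (b - a) < d \<longrightarrow>
      norm ((\<Sum>l\<in>F. f l b) - (\<Sum>l\<in>F. f l a) - (\<Sum>l\<in>F. \<Sum>i\<in>UNIV. (b - a) $ i * D l i a)) \<le> e / 2 * norm (b - a)"
      by (auto simp only: half_gt_zero_iff)
    have dR: "norm (\<Sum>l\<in>F. Rm l b) \<le> e / 2 * norm (b - a)" if "norm (b - a) < d" for b
      unfolding Rm_def sum_subtractf using d(2) that by simp
    show "\<exists>d>0. \<forall>b. norm (b - a) < d \<longrightarrow> norm (infsum (\<lambda>l. f l b) K - infsum (\<lambda>l. f l a) K
      - (\<Sum>i\<in>UNIV. (b - a) $ i * infsum (\<lambda>l. D l i a) K)) \<le> e * norm (b - a)"
    proof (intro exI[of _ "min d r"] conjI allI impI)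
      fix b assume b: "norm (b - a) < min d r"
      then have bb: "b \<in> cball a r" by (simp add: dist_norm norm_minus_commute)
      have "infsum (\<lambda>l. Rm l b) (K - F) = infsum (\<lambda>l. Rm l b) K - infsum (\<lambda>l. Rm l b) F"
        by (rule infsum_Diff[OF Rm_sum[OF bb] _ F(2)]) (simp add: F(1))
      then have split: "infsum (\<lambda>l. Rm l b) K = (\<Sum>l\<in>F. Rm l b) + infsum (\<lambda>l. Rm l b) (K - F)"
        using F(1) by simp
      have MF: "M summable_on (K - F)" using M(1) by (rule summable_on_subset) auto
      have "norm (infsum (\<lambda>l. Rm l b) (K - F)) \<le> infsum (\<lambda>l. 2 * N * G0 * norm (b - a) * M l) (K - F)"
        by (rule norm_infsum_le[OF has_sum_infsum has_sum_infsum])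
          (use Rm_bound bb MF in \<open>auto intro!: summable_on_cmult_right summable_on_subset[OF Rm_sum[OF bb]]\<close>)
      also have "\<dots> = 2 * N * G0 * norm (b - a) * infsum M (K - F)"
        using MF by (simp add: infsum_cmult_right)
      also have "\<dots> \<le> 2 * N * G0 * norm (b - a) * e'"
        using tail Nnn by (intro mult_left_mono) auto
      also have "\<dots> = (2 * N * G0 * e') * norm (b - a)" by simp
      also have "\<dots> \<le> e / 2 * norm (b - a)" using e'(2) by (intro mult_right_mono) auto
      finally have t2: "norm (infsum (\<lambda>l. Rm l b) (K - F)) \<le> e / 2 * norm (b - a)" .
      have "norm (\<Sum>l\<in>F. Rm l b) \<le> e / 2 * norm (b - a)" using dR[of b] b by simp
      from order_trans[OF norm_triangle_ineq add_mono[OF this t2]]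
      have "norm (infsum (\<lambda>l. Rm l b) K) \<le> e / 2 * norm (b - a) + e / 2 * norm (b - a)"
        unfolding split .
      then show "norm (infsum (\<lambda>l. f l b) K - infsum (\<lambda>l. f l a) K
        - (\<Sum>i\<in>UNIV. (b - a) $ i * infsum (\<lambda>l. D l i a) K)) \<le> e * norm (b - a)"
        unfolding Rm_infsum[OF bb] by simp
    qed (simp add: d(1) r(1))
  qed
qed

text \<open>A product of geometric series over the coordinates.\<close>

lemma summable_exp_l1: "(\<lambda>l :: int ^ 'i::finite. exp (- real (l1 l))) summable_on UNIV"
proof (rule nonneg_bdd_above_summable_on)
  define C where "C = 2 * suminf (\<lambda>n. exp (-1 :: real) ^ n)"
  have geo: "summable (\<lambda>n. exp (-1) ^ n :: real)" by (rule summable_geometric) simp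
  have one: "(\<Sum>z\<in>{- int N..int N}. exp (- real (nat \<bar>z\<bar>))) \<le> C" for N
  proof -
    have "{- int N..int N} \<subseteq> int ` {..N} \<union> (\<lambda>n. - int n) ` {..N}"
    proof
      fix z assume "z \<in> {- int N..int N}"
      then have "(z = int (nat z) \<and> nat z \<in> {..N}) \<or> (z = - int (nat (- z)) \<and> nat (- z) \<in> {..N})" by auto
      then show "z \<in> int ` {..N} \<union> (\<lambda>n. - int n) ` {..N}" by blast
    qed
    then have "(\<Sum>z\<in>{- int N..int N}. exp (- real (nat \<bar>z\<bar>))) \<le>
       (\<Sum>z\<in>int ` {..N} \<union> (\<lambda>n. - int n) ` {..N}. exp (- real (nat \<bar>z\<bar>)))"
      by (intro sum_mono2) auto
    also have "\<dots> \<le> (\<Sum>z\<in>int ` {..N}. exp (- real (nat \<bar>z\<bar>))) + (\<Sum>z\<in>(\<lambda>n. - int n) ` {..N}. exp (- real (nat \<bar>z\<bar>)))"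
      by (subst sum_Un) (auto intro!: sum_nonneg)
    also have "\<dots> = 2 * (\<Sum>n\<le>N. exp (- 1) ^ n)"
      by (subst (1 2) sum.reindex) (auto simp: inj_on_def exp_of_nat_mult[symmetric])
    also have "\<dots> \<le> C"
      unfolding C_def by (intro mult_left_mono sum_le_suminf geo) auto
    finally show ?thesis .
  qed
  have "sum (\<lambda>l :: int ^ 'i. exp (- real (l1 l))) F \<le> C ^ CARD('i)" if F: "finite F" for F
  proof -
    define N where "N = (\<Sum>l\<in>F. l1 l)"
    have lN: "\<bar>l $ i\<bar> \<le> int N" if "l \<in> F" for l i
    proof -
      have "nat \<bar>l $ i\<bar> \<le> l1 l" by (rule member_le_sum) auto
      also have "\<dots> \<le> N" unfolding N_def using F that by (intro member_le_sum) auto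
      finally show ?thesis by simp
    qed
    have "sum (\<lambda>l :: int ^ 'i. exp (- real (l1 l))) F = sum (\<lambda>l. \<Prod>i\<in>UNIV. exp (- real (nat \<bar>l $ i\<bar>))) F"
      by (simp add: exp_sum sum_negf[symmetric])
    also have "\<dots> = (\<Sum>g\<in>vec_nth ` F. \<Prod>i\<in>UNIV. exp (- real (nat \<bar>g i\<bar>)))"
      by (subst sum.reindex) (auto simp: inj_on_def vec_nth_inject)
    also have "\<dots> \<le> (\<Sum>g\<in>PiE (UNIV :: 'i set) (\<lambda>_. {- int N..int N}). \<Prod>i\<in>UNIV. exp (- real (nat \<bar>g i\<bar>)))"
    proof (rule sum_mono2)
      show "vec_nth ` F \<subseteq> PiE (UNIV :: 'i set) (\<lambda>_. {- int N..int N})"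
      proof
        fix g assume "g \<in> vec_nth ` F"
        then obtain l where l: "l \<in> F" "g = vec_nth l" by blast
        have "g i \<in> {- int N..int N}" for i using lN[OF l(1), of i] by (simp add: l(2) abs_le_iff)
        then show "g \<in> PiE (UNIV :: 'i set) (\<lambda>_. {- int N..int N})" by (simp add: PiE_iff extensional_def)
      qed
    qed (auto intro!: finite_PiE prod_nonneg)
    also have "\<dots> = (\<Prod>i\<in>(UNIV :: 'i set). \<Sum>z\<in>{- int N..int N}. exp (- real (nat \<bar>z\<bar>)))"
      by (rule prod_sum_PiE[symmetric]) auto
    also have "\<dots> \<le> (\<Prod>i\<in>(UNIV :: 'i set). C)"
      by (intro prod_mono conjI one sum_nonneg) auto
    finally show ?thesis by simp
  qed
  then show "bdd_above (sum (\<lambda>l :: int ^ 'i. exp (- real (l1 l))) ` {F. F \<subseteq> UNIV \<and> finite F})"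
    by (auto intro!: bdd_aboveI[of _ "C ^ CARD('i)"])
qed simp

text \<open>The coefficient of \<open>D\<^sup>k\<close> in the summand with exponent \<open>m\<close>, divided by \<open>a\<^sub>0\<close>.\<close>

definition T :: "complex ^ ('p::finite) option \<Rightarrow> ('p option \<Rightarrow> nat) \<Rightarrow> int ^ 'p option \<Rightarrow> complex" where
  "T a k m = (\<Prod>i\<in>UNIV. hfun i (m $ i) (k i) (a $ i))"

text \<open>Differentiating \<open>\<kappa>\<close> times subtracts \<open>\<kappa>\<close> from the exponents.\<close>

definition shift :: "int ^ 'i \<Rightarrow> ('i \<Rightarrow> nat) \<Rightarrow> int ^ 'i" where
  "shift l \<kappa> = (\<chi> i. l $ i - int (\<kappa> i))"

lemma shift_nth [simp]: "shift l \<kappa> $ i = l $ i - int (\<kappa> i)"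
  by (simp add: shift_def)

definition slit :: "(complex ^ 'i) set" where
  "slit = {a. \<forall>i. a $ i \<notin> \<real>\<^sub>\<le>\<^sub>0}"

lemma slit_nonzero: "a \<in> slit \<Longrightarrow> a $ i \<noteq> 0"
proof
  assume "a \<in> slit" "a $ i = 0"
  then have "0 \<notin> (\<real>\<^sub>\<le>\<^sub>0 :: complex set)" unfolding slit_def by (metis (mono_tags) mem_Collect_eq)
  then show False by simp
qed

lemma admissible_shift: "l $ None \<le> 0 \<Longrightarrow> admissible i (shift l \<kappa> $ i)"
  by (auto simp: admissible_def)

lemma T_has_derivative:
  fixes a :: "complex ^ ('p::finite) option"
  assumes a: "a \<in> slit" and l: "l $ None \<le> 0"
  shows "((\<lambda>a. T a k (shift l \<kappa>)) has_derivative
    (\<lambda>h. \<Sum>i\<in>UNIV. h $ i * T a k (shift l (\<kappa>(i := Suc (\<kappa> i)))))) (at a)"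
proof -
  let ?m = "shift l \<kappa>"
  have "((\<lambda>a. hfun i (?m $ i) (k i) (a $ i)) has_derivative (\<lambda>h. hfun i (?m $ i - 1) (k i) (a $ i) * h $ i)) (at a)" for i
  proof -
    have "(hfun i (?m $ i) (k i) has_derivative (*) (hfun i (?m $ i - 1) (k i) (a $ i))) (at (a $ i))"
      using hfun_has_derivative[OF admissible_shift[OF l], of "a $ i"] a
      by (simp add: has_field_derivative_def slit_def)
    from has_derivative_compose[OF bounded_linear_imp_has_derivative[OF bounded_linear_vec_nth] this]
    show ?thesis .
  qed
  from has_derivative_prod[where I = UNIV, OF this]
  have 1: "((\<lambda>a. T a k ?m) has_derivative
     (\<lambda>h. \<Sum>i\<in>UNIV. hfun i (?m $ i - 1) (k i) (a $ i) * h $ i * (\<Prod>j\<in>UNIV - {i}. hfun j (?m $ j) (k j) (a $ j)))) (at a)"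
    by (simp add: T_def)
  have 2: "T a k (shift l (\<kappa>(i := Suc (\<kappa> i)))) =
     hfun i (?m $ i - 1) (k i) (a $ i) * (\<Prod>j\<in>UNIV - {i}. hfun j (?m $ j) (k j) (a $ j))" for i
  proof -
    have "T a k (shift l (\<kappa>(i := Suc (\<kappa> i)))) = hfun i (shift l (\<kappa>(i := Suc (\<kappa> i))) $ i) (k i) (a $ i) *
      (\<Prod>j\<in>UNIV - {i}. hfun j (shift l (\<kappa>(i := Suc (\<kappa> i))) $ j) (k j) (a $ j))"
      unfolding T_def by (rule prod.remove) auto
    also have "(\<Prod>j\<in>UNIV - {i}. hfun j (shift l (\<kappa>(i := Suc (\<kappa> i))) $ j) (k j) (a $ j)) =
       (\<Prod>j\<in>UNIV - {i}. hfun j (?m $ j) (k j) (a $ j))"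
      by (rule prod.cong) auto
    also have "shift l (\<kappa>(i := Suc (\<kappa> i))) $ i = ?m $ i - 1" by simp
    finally show ?thesis .
  qed
  have "(\<lambda>h. \<Sum>i\<in>UNIV. hfun i (?m $ i - 1) (k i) (a $ i) * h $ i * (\<Prod>j\<in>UNIV - {i}. hfun j (?m $ j) (k j) (a $ j))) =
      (\<lambda>h. \<Sum>i\<in>UNIV. h $ i * T a k (shift l (\<kappa>(i := Suc (\<kappa> i)))))"
    unfolding 2 by (intro ext sum.cong refl) (simp only: mult_ac)
  with 1 show ?thesis by (simp only:)
qed

definition Rconst :: "'p::finite itself \<Rightarrow> real" where
  "Rconst _ = 2 * (2 * 2 ^ CARD('p))"

text \<open>The product of the one-variable bounds; only the sum of the exponents enters the constant, so it is uniform in the summands of any derivative of the series.\<close>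

lemma T_bound:
  "\<exists>K0. (\<forall>q. K0 q \<ge> 0) \<and> (\<forall>r (a :: complex ^ ('p::finite) option) k m q. 0 < r \<longrightarrow> r \<le> 1/2 \<longrightarrow> (\<forall>i. a $ i \<noteq> 0) \<longrightarrow>
     (\<Sum>i\<in>UNIV. m $ i) = - int q \<longrightarrow> m $ None \<le> 0 \<longrightarrow>
     norm (T a k m) \<le> K0 q * (1 / r) ^ (\<Sum>i\<in>UNIV. k i) * exp (r * (\<Sum>i\<in>UNIV. norm (Ln (a $ i))))
       * Rconst TYPE('p) ^ l1 m * (\<Prod>i\<in>UNIV. norm (a $ i) powi (expo i (m $ i))))"
proof -
  obtain C where C: "C \<ge> 1" "\<And>(i::'p option) m z. admissible i m \<Longrightarrow> norm z \<le> 1/2 \<Longrightarrow>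
    norm (gfun i m z) \<le> C * 2 ^ nat \<bar>m\<bar> * wt i m"
    using gfun_bound[where 'p = 'p] by blast
  show ?thesis
  proof (intro exI[of _ "\<lambda>q. C ^ CARD('p option) * (2 ^ q * fact q)"] conjI allI impI)
    fix r :: real and a :: "complex ^ 'p option" and k and m :: "int ^ 'p option" and q :: nat
    assume r: "0 < r" "r \<le> 1/2" and "\<forall>i. a $ i \<noteq> 0"
      and m: "(\<Sum>i\<in>UNIV. m $ i) = - int q" "m $ None \<le> 0"
    have adm: "admissible i (m $ i)" for i using m(2) by (auto simp: admissible_def)
    have wt0: "wt i (m $ i) \<ge> 0" for i by (simp add: wt_def split: option.splits)
    have "norm (hfun i (m $ i) (k i) (a $ i)) \<le> norm (a $ i) powi (expo i (m $ i)) *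
       ((1 / r) ^ k i * exp (r * norm (Ln (a $ i))) * (C * 2 ^ nat \<bar>m $ i\<bar> * wt i (m $ i)))" for i
      unfolding hfun_def norm_mult norm_power_int
      by (intro mult_left_mono lpoly_bound adm r C(2)) (use r in auto)
    then have "norm (T a k m) \<le> (\<Prod>i\<in>UNIV. norm (a $ i) powi (expo i (m $ i)) *
       ((1 / r) ^ k i * exp (r * norm (Ln (a $ i))) * (C * 2 ^ nat \<bar>m $ i\<bar> * wt i (m $ i))))"
      unfolding T_def prod_norm[symmetric] by (intro prod_mono conjI norm_ge_zero)
    also have "\<dots> = (\<Prod>i\<in>UNIV. norm (a $ i) powi (expo i (m $ i))) *
       ((1 / r) ^ (\<Sum>i\<in>UNIV. k i) * exp (r * (\<Sum>i\<in>UNIV. norm (Ln (a $ i)))) *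
        (C ^ CARD('p option) * 2 ^ l1 m * (\<Prod>i\<in>UNIV. wt i (m $ i))))"
      by (simp add: prod.distrib power_sum exp_sum sum_distrib_left)
    also have "\<dots> \<le> (\<Prod>i\<in>UNIV. norm (a $ i) powi (expo i (m $ i))) *
       ((1 / r) ^ (\<Sum>i\<in>UNIV. k i) * exp (r * (\<Sum>i\<in>UNIV. norm (Ln (a $ i)))) *
        (C ^ CARD('p option) * 2 ^ l1 m * (2 ^ q * fact q * (2 * 2 ^ CARD('p)) ^ l1 m)))"
      using r C(1) by (intro mult_left_mono prod_wt_bound m mult_nonneg_nonneg prod_nonneg) auto
    also have "\<dots> = C ^ CARD('p option) * (2 ^ q * fact q) * (1 / r) ^ (\<Sum>i\<in>UNIV. k i) * exp (r * (\<Sum>i\<in>UNIV. norm (Ln (a $ i))))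
       * Rconst TYPE('p) ^ l1 m * (\<Prod>i\<in>UNIV. norm (a $ i) powi (expo i (m $ i)))"
      unfolding Rconst_def power_mult_distrib by (simp only: mult_ac)
    finally show "norm (T a k m) \<le> \<dots>" .
  qed (use C in auto)
qed

section \<open>The domain near the large radius limit\<close>

definition lg :: "complex ^ 'i \<Rightarrow> real ^ 'i" where
  "lg a = (\<chi> i. - ln (cmod (a $ i)))"

lemma norm_powi_eq: "a $ i \<noteq> 0 \<Longrightarrow> cmod (a $ i) powi z = exp (- (of_int z * lg a $ i))"
  by (simp add: lg_def flip: exp_power_int)

lemma prod_norm_powi: "(\<And>i. a $ i \<noteq> 0) \<Longrightarrow>
    (\<Prod>i\<in>UNIV. cmod (a $ i) powi (z i)) = exp (- (\<Sum>i\<in>UNIV. of_int (z i) * lg a $ i))"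
  for a :: "complex ^ 'i::finite"
  by (simp add: norm_powi_eq exp_sum[symmetric] sum_negf)

lemma open_slit: "open (slit :: (complex ^ 'i::finite) set)"
proof -
  have "(slit :: (complex ^ 'i) set) = (\<Inter>i\<in>UNIV. (\<lambda>a. a $ i) -` (- \<real>\<^sub>\<le>\<^sub>0))"
    by (auto simp: slit_def)
  also have "open \<dots>"
    by (intro open_INT finite ballI open_vimage_vec_nth open_Compl closed_nonpos_Reals_complex)
  finally show ?thesis .
qed

lemma continuous_on_lg: "continuous_on (slit :: (complex ^ 'i::finite) set) lg"
  unfolding lg_def[abs_def]
  by (intro continuous_on_vec_lambda continuous_intros) (auto simp: slit_nonzero)

lemma Im_Ln_nonpos: "w \<noteq> 0 \<Longrightarrow> w \<in> \<real>\<^sub>\<le>\<^sub>0 \<Longrightarrow> Im (Ln w) = pi"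
  using Im_Ln_eq_pi[of w] by (auto simp: complex_nonpos_Reals_iff complex_eq_iff)

lemma expo_add: "expo i (m - n) = m + (expo i 0 - n)"
  by (simp add: expo_def split: option.splits)

text \<open>The constant \<open>B\<close> determines how far the cone is translated: it makes the decay \<open>exp (- B \<epsilon> |l|)\<close> of the powers of \<open>a\<close> beat the growth \<open>Rconst ^ |l|\<close> of the Gamma factors, with a factor \<open>exp (- |l|)\<close> to spare.\<close>

locale gkz_domain = semi_positive_fan \<Sigma> \<mu>
  for \<Sigma> :: "(real ^ 'n) set set" and \<mu> :: "'p::finite \<Rightarrow> real ^ 'n" +
  fixes v0 :: "real ^ 'p option" and \<epsilon> B :: real
  assumes eps: "\<epsilon> > 0"
    and v0_interior: "\<And>v. v \<in> ball v0 \<epsilon> \<Longrightarrow> v \<in> interior (pl_cone \<Sigma> \<mu>)"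
    and v0_bound: "\<And>v l. v \<in> ball v0 \<epsilon> \<Longrightarrow> l \<in> dual_cone_lattice \<Sigma> \<mu> \<Longrightarrow>
      \<epsilon> * real (l1 l) \<le> (\<Sum>i\<in>UNIV. real_of_int (l $ i) * v $ i)"
    and B: "1 + ln (Rconst TYPE('p)) \<le> B * \<epsilon>"
begin

abbreviation "K \<equiv> dual_cone_lattice \<Sigma> \<mu>"

definition U :: "(complex ^ 'p option) set" where
  "U = {a \<in> slit. lg a - B *\<^sub>R v0 \<in> interior (pl_cone \<Sigma> \<mu>)}"

lemma Rconst_ge: "Rconst TYPE('p) \<ge> 1"
proof -
  have "(1::real) \<le> 2 ^ CARD('p)" by (rule one_le_power) simp
  then show ?thesis unfolding Rconst_def by linarith
qed

lemma B_pos: "B > 0"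
proof -
  have "0 < B * \<epsilon>" using B ln_ge_zero[OF Rconst_ge] by linarith
  then show ?thesis using eps by (simp add: zero_less_mult_iff)
qed

lemma U_slit: "a \<in> U \<Longrightarrow> a \<in> slit" and U_nonzero: "a \<in> U \<Longrightarrow> a $ i \<noteq> 0"
  by (auto simp: U_def slit_nonzero)

lemma open_U: "open U"
proof -
  have "open (slit \<inter> (\<lambda>a. lg a - B *\<^sub>R v0) -` interior (pl_cone \<Sigma> \<mu>))"
    by (intro continuous_open_preimage continuous_intros continuous_on_lg open_slit open_interior)
  also have "slit \<inter> (\<lambda>a. lg a - B *\<^sub>R v0) -` interior (pl_cone \<Sigma> \<mu>) = U"
    by (auto simp: U_def)
  finally show ?thesis .
qed

text \<open>In logarithmic coordinates the domain is convex.\<close>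

definition W :: "(complex ^ 'p option) set" where
  "W = {z. (\<forall>i. Im (z $ i) \<in> {- pi<..<pi}) \<and> (\<chi> i. - Re (z $ i)) - B *\<^sub>R v0 \<in> interior (pl_cone \<Sigma> \<mu>)}"

definition vexp :: "complex ^ 'p option \<Rightarrow> complex ^ 'p option" where
  "vexp z = (\<chi> i. exp (z $ i))"

lemma convex_W: "convex W"
proof (rule convexI)
  fix z z' and s t :: real assume z: "z \<in> W" and z': "z' \<in> W" and st: "0 \<le> s" "0 \<le> t" "s + t = 1"
  have zI: "- pi < Im (z $ i)" "Im (z $ i) < pi" "- pi < Im (z' $ i)" "Im (z' $ i) < pi" for i
    using z z' by (simp_all add: W_def)
  have up: "s * Im (z $ i) + t * Im (z' $ i) < pi" for i
    by (rule convex_bound_lt[OF zI(2) zI(4) st])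
  have lo: "s * (- Im (z $ i)) + t * (- Im (z' $ i)) < pi" for i
    by (rule convex_bound_lt[OF _ _ st]) (use zI(1,3)[of i] in linarith)+
  have 1: "s * Im (z $ i) + t * Im (z' $ i) \<in> {- pi<..<pi}" for i
  proof -
    have "- pi < s * Im (z $ i) + t * Im (z' $ i)" using lo[of i] unfolding mult_minus_right by linarith
    with up[of i] show ?thesis by simp
  qed
  have "convex (pl_cone \<Sigma> \<mu>)" using convex_cone_pl_cone by (simp add: convex_cone_def)
  then have "convex (interior (pl_cone \<Sigma> \<mu>))" by (rule convex_interior)
  moreover have "(\<chi> i. - Re (z $ i)) - B *\<^sub>R v0 \<in> interior (pl_cone \<Sigma> \<mu>)"
    "(\<chi> i. - Re (z' $ i)) - B *\<^sub>R v0 \<in> interior (pl_cone \<Sigma> \<mu>)"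
    using z z' by (simp_all add: W_def)
  ultimately have 2: "s *\<^sub>R ((\<chi> i. - Re (z $ i)) - B *\<^sub>R v0) + t *\<^sub>R ((\<chi> i. - Re (z' $ i)) - B *\<^sub>R v0)
    \<in> interior (pl_cone \<Sigma> \<mu>)"
    using st by (rule convexD)
  have 3: "s *\<^sub>R ((\<chi> i. - Re (z $ i)) - B *\<^sub>R v0) + t *\<^sub>R ((\<chi> i. - Re (z' $ i)) - B *\<^sub>R v0) =
    (\<chi> i. - Re ((s *\<^sub>R z + t *\<^sub>R z') $ i)) - B *\<^sub>R v0"
    unfolding vec_eq_iff
  proof
    fix i
    define b where "b = B * v0 $ i"
    have sb: "s * b + t * b = b" using st(3) by (simp only: distrib_right[symmetric] mult_1)
    have "(s *\<^sub>R ((\<chi> i. - Re (z $ i)) - B *\<^sub>R v0) + t *\<^sub>R ((\<chi> i. - Re (z' $ i)) - B *\<^sub>R v0)) $ i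
      = s * (- Re (z $ i) - b) + t * (- Re (z' $ i) - b)" by (simp add: b_def)
    also have "\<dots> = - (s * Re (z $ i) + t * Re (z' $ i)) - (s * b + t * b)" by algebra
    also have "\<dots> = ((\<chi> i. - Re ((s *\<^sub>R z + t *\<^sub>R z') $ i)) - B *\<^sub>R v0) $ i"
      unfolding sb by (simp add: b_def)
    finally show "(s *\<^sub>R ((\<chi> i. - Re (z $ i)) - B *\<^sub>R v0) + t *\<^sub>R ((\<chi> i. - Re (z' $ i)) - B *\<^sub>R v0)) $ i
      = ((\<chi> i. - Re ((s *\<^sub>R z + t *\<^sub>R z') $ i)) - B *\<^sub>R v0) $ i" .
  qed
  from 1 2[unfolded 3] show "s *\<^sub>R z + t *\<^sub>R z' \<in> W" by (simp add: W_def)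
qed

lemma vexp_W: "z \<in> W \<Longrightarrow> vexp z \<in> U"
proof -
  assume z: "z \<in> W"
  have "exp (z $ i) \<notin> \<real>\<^sub>\<le>\<^sub>0" for i
  proof
    assume "exp (z $ i) \<in> \<real>\<^sub>\<le>\<^sub>0"
    then have "Im (Ln (exp (z $ i))) = pi" by (rule Im_Ln_nonpos[OF exp_not_eq_zero])
    moreover have "Im (z $ i) \<in> {- pi<..<pi}" using z by (simp add: W_def)
    ultimately show False by simp
  qed
  moreover have "lg (vexp z) = (\<chi> i. - Re (z $ i))" by (simp add: lg_def vexp_def)
  ultimately show ?thesis using z by (simp add: U_def slit_def vexp_def W_def)
qed

lemma U_vexp: "a \<in> U \<Longrightarrow> (\<chi> i. Ln (a $ i)) \<in> W \<and> vexp (\<chi> i. Ln (a $ i)) = a"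
proof
  assume a: "a \<in> U"
  have "Im (Ln (a $ i)) \<in> {- pi<..<pi}" for i
  proof -
    have nz: "a $ i \<noteq> 0" and ns: "a $ i \<notin> \<real>\<^sub>\<le>\<^sub>0" using a U_slit U_nonzero by (auto simp: slit_def)
    have "Im (Ln (a $ i)) \<noteq> pi"
      using ns Im_Ln_eq_pi[OF nz] by (auto simp: complex_nonpos_Reals_iff)
    then show ?thesis using mpi_less_Im_Ln[OF nz] Im_Ln_le_pi[OF nz] by simp
  qed
  moreover have "(\<chi> i. - Re (Ln (a $ i))) = lg a" using U_nonzero[OF a] by (simp add: lg_def vec_eq_iff)
  ultimately show "(\<chi> i. Ln (a $ i)) \<in> W" using a by (simp add: W_def U_def)
  show "vexp (\<chi> i. Ln (a $ i)) = a" using U_nonzero[OF a] by (simp add: vexp_def vec_eq_iff)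
qed

text \<open>The exponential map carries the convex set \<open>W\<close> onto \<open>U\<close>; the slits make the principal logarithm its inverse.\<close>

lemma connected_U: "connected U"
proof -
  have "U \<subseteq> vexp ` W"
  proof
    fix a assume "a \<in> U"
    from U_vexp[OF this] show "a \<in> vexp ` W" by (metis image_eqI)
  qed
  then have "U = vexp ` W" using vexp_W by blast
  moreover have "continuous_on W vexp"
    unfolding vexp_def[abs_def] by (intro continuous_on_vec_lambda continuous_intros)
  ultimately show ?thesis using connected_continuous_image[of W vexp] convex_connected[OF convex_W] by simp
qed

definition real_point :: "real ^ 'p option \<Rightarrow> complex ^ 'p option" where
  "real_point x = (\<chi> i. of_real (exp (- (x $ i))))"

lemma lg_real_point [simp]: "lg (real_point x) = x"
  by (simp add: lg_def real_point_def vec_eq_iff)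

lemma real_point_slit: "real_point x \<in> slit"
  by (simp add: slit_def real_point_def complex_nonpos_Reals_iff)

lemma real_point_U: "w \<in> ball v0 \<epsilon> \<Longrightarrow> t > 0 \<Longrightarrow> real_point (B *\<^sub>R v0 + t *\<^sub>R w) \<in> U"
  using pl_scale_interior v0_interior by (simp add: U_def real_point_slit)

lemma U_nonempty: "U \<noteq> {}"
  using real_point_U[of v0 1] eps by auto

lemma near_large_radius_limit_U: "near_large_radius_limit \<Sigma> \<mu> U"
  unfolding near_large_radius_limit_def
proof (intro exI[of _ "B *\<^sub>R v0 + v0"] allI impI)
  fix a :: "complex ^ 'p option"
  assume a: "(\<forall>i. a $ i \<notin> \<real>\<^sub>\<le>\<^sub>0) \<and> (\<chi> i. - ln (cmod (a $ i))) - (B *\<^sub>R v0 + v0) \<in> pl_cone \<Sigma> \<mu>"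
  have "(lg a - (B *\<^sub>R v0 + v0)) + v0 \<in> interior (pl_cone \<Sigma> \<mu>)"
    using a eps by (intro pl_add_interior v0_interior) (auto simp: lg_def)
  then show "a \<in> U" using a by (simp add: U_def slit_def algebra_simps)
qed

lemma K_relation: "l \<in> K \<Longrightarrow> l \<in> relation_lattice \<mu>"
  by (simp add: dual_cone_lattice_def)

lemma K_sum: "l \<in> K \<Longrightarrow> (\<Sum>i\<in>UNIV. l $ i) = 0"
  using K_relation relation_lattice_iff by blast

lemma K_pairing:
  assumes "a \<in> U" "l \<in> K"
  shows "B * \<epsilon> * real (l1 l) \<le> (\<Sum>i\<in>UNIV. of_int (l $ i) * lg a $ i)"
proof -
  have "lg a - B *\<^sub>R v0 \<in> pl_cone \<Sigma> \<mu>"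
    using assms(1) interior_subset[of "pl_cone \<Sigma> \<mu>"] unfolding U_def by blast
  then have "0 \<le> (\<Sum>i\<in>UNIV. real_of_int (l $ i) * (lg a - B *\<^sub>R v0) $ i)"
    using assms(2) unfolding dual_cone_lattice_def by blast
  also have "\<dots> = (\<Sum>i\<in>UNIV. of_int (l $ i) * lg a $ i) - B * (\<Sum>i\<in>UNIV. real_of_int (l $ i) * v0 $ i)"
  proof -
    have "(\<Sum>i\<in>UNIV. real_of_int (l $ i) * (lg a - B *\<^sub>R v0) $ i) =
      (\<Sum>i\<in>UNIV. of_int (l $ i) * lg a $ i - B * (of_int (l $ i) * v0 $ i))"
      by (intro sum.cong refl) (simp add: right_diff_distrib mult.left_commute)
    then show ?thesis unfolding sum_subtractf sum_distrib_left .
  qed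
  finally have 1: "B * (\<Sum>i\<in>UNIV. real_of_int (l $ i) * v0 $ i) \<le> (\<Sum>i\<in>UNIV. of_int (l $ i) * lg a $ i)" by linarith
  have "B * (\<epsilon> * real (l1 l)) \<le> B * (\<Sum>i\<in>UNIV. real_of_int (l $ i) * v0 $ i)"
    using v0_bound[of v0 l] assms(2) eps B_pos by (intro mult_left_mono) auto
  with 1 show ?thesis unfolding mult.assoc by linarith
qed

lemma R_exp_bound: "1 + ln (Rconst TYPE('p)) \<le> s \<Longrightarrow> Rconst TYPE('p) ^ n * exp (- (s * real n)) \<le> exp (- real n)"
proof -
  assume s: "1 + ln (Rconst TYPE('p)) \<le> s"
  have R: "Rconst TYPE('p) = exp (ln (Rconst TYPE('p)))" using Rconst_ge by simp
  have "Rconst TYPE('p) ^ n * exp (- (s * real n)) = exp (real n * ln (Rconst TYPE('p)) - s * real n)"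
    unfolding exp_diff exp_of_nat_mult R[symmetric] exp_minus divide_inverse by (rule refl)
  also have "real n * ln (Rconst TYPE('p)) - s * real n \<le> - real n"
    using mult_right_mono[OF s of_nat_0_le_iff, of n]
    unfolding distrib_right mult_1 mult.commute[of "real n" "ln (Rconst TYPE('p))"] by linarith
  finally show ?thesis by simp
qed

definition K0 :: "nat \<Rightarrow> real" where
  "K0 = (SOME K0. (\<forall>q. K0 q \<ge> 0) \<and> (\<forall>r (a :: complex ^ 'p option) k m q. 0 < r \<longrightarrow> r \<le> 1/2 \<longrightarrow> (\<forall>i. a $ i \<noteq> 0) \<longrightarrow>
     (\<Sum>i\<in>UNIV. m $ i) = - int q \<longrightarrow> m $ None \<le> 0 \<longrightarrow>
     norm (T a k m) \<le> K0 q * (1 / r) ^ (\<Sum>i\<in>UNIV. k i) * exp (r * (\<Sum>i\<in>UNIV. norm (Ln (a $ i))))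
       * Rconst TYPE('p) ^ l1 m * (\<Prod>i\<in>UNIV. norm (a $ i) powi (expo i (m $ i)))))"

lemma K0:
  shows "K0 q \<ge> 0"
    and "0 < r \<Longrightarrow> r \<le> 1/2 \<Longrightarrow> (\<And>i. (a :: complex ^ 'p option) $ i \<noteq> 0) \<Longrightarrow>
     (\<Sum>i\<in>UNIV. m $ i) = - int q \<Longrightarrow> m $ None \<le> 0 \<Longrightarrow>
     norm (T a k m) \<le> K0 q * (1 / r) ^ (\<Sum>i\<in>UNIV. k i) * exp (r * (\<Sum>i\<in>UNIV. norm (Ln (a $ i))))
       * Rconst TYPE('p) ^ l1 m * (\<Prod>i\<in>UNIV. norm (a $ i) powi (expo i (m $ i)))"
  using someI_ex[OF T_bound[where 'p = 'p]] unfolding K0_def[symmetric] by blast+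

text \<open>The part of the majorant that does not depend on \<open>l\<close>; it is continuous in \<open>a\<close>, as needed for locally uniform convergence.\<close>

definition Gd :: "('p option \<Rightarrow> nat) \<Rightarrow> ('p option \<Rightarrow> nat) \<Rightarrow> complex ^ 'p option \<Rightarrow> real" where
  "Gd \<kappa> k a = K0 (\<Sum>i\<in>UNIV. \<kappa> i) * 2 ^ (\<Sum>i\<in>UNIV. k i) * exp (1/2 * (\<Sum>i\<in>UNIV. norm (Ln (a $ i))))
     * Rconst TYPE('p) ^ (\<Sum>i\<in>UNIV. \<kappa> i) * (\<Prod>i\<in>UNIV. norm (a $ i) powi (expo i 0 - int (\<kappa> i)))"

lemma continuous_on_Gd: "continuous_on U (Gd \<kappa> k)"
  unfolding Gd_def[abs_def]
  by (intro continuous_intros) (use U_nonzero U_slit in \<open>auto simp: slit_def\<close>)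

lemma Gd_nonneg: "Gd \<kappa> k a \<ge> 0"
  unfolding Gd_def using K0(1) Rconst_ge by (intro mult_nonneg_nonneg prod_nonneg) auto

lemma T_dominated:
  assumes a: "a \<in> U" and l: "l \<in> K"
  shows "norm (T a k (shift l \<kappa>)) \<le> Gd \<kappa> k a * exp (- real (l1 l))"
proof -
  let ?q = "\<Sum>i\<in>UNIV. \<kappa> i" and ?R = "Rconst TYPE('p)"
  let ?E = "exp (1/2 * (\<Sum>i\<in>UNIV. norm (Ln (a $ i))))"
  let ?P = "\<Prod>i\<in>UNIV. norm (a $ i) powi (expo i 0 - int (\<kappa> i))"
  have "(\<Sum>i\<in>UNIV. shift l \<kappa> $ i) = - int ?q" using K_sum[OF l] by (simp add: sum_subtractf)
  moreover have "shift l \<kappa> $ None \<le> 0" using dual_cone_first_nonpos[OF l] by simp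
  ultimately have 1: "norm (T a k (shift l \<kappa>)) \<le> K0 ?q * (1 / (1/2)) ^ (\<Sum>i\<in>UNIV. k i) * ?E * ?R ^ l1 (shift l \<kappa>)
     * (\<Prod>i\<in>UNIV. norm (a $ i) powi (expo i (shift l \<kappa> $ i)))"
    by (intro K0(2) U_nonzero[OF a]) auto
  have 2: "(\<Prod>i\<in>UNIV. norm (a $ i) powi (expo i (shift l \<kappa> $ i))) = (\<Prod>i\<in>UNIV. norm (a $ i) powi (l $ i)) * ?P"
    unfolding shift_nth expo_add using U_nonzero[OF a] by (simp add: power_int_add prod.distrib)
  have "l1 (shift l \<kappa>) \<le> (\<Sum>i\<in>UNIV. nat \<bar>l $ i\<bar> + \<kappa> i)" by (intro sum_mono) simp
  then have "?R ^ l1 (shift l \<kappa>) \<le> ?R ^ (l1 l + ?q)"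
    using Rconst_ge by (intro power_increasing) (simp_all add: sum.distrib)
  then have 3: "?R ^ l1 (shift l \<kappa>) \<le> ?R ^ l1 l * ?R ^ ?q" by (simp add: power_add)
  have 4: "?R ^ l1 l * (\<Prod>i\<in>UNIV. norm (a $ i) powi (l $ i)) \<le> exp (- real (l1 l))"
  proof -
    have "(\<Prod>i\<in>UNIV. norm (a $ i) powi (l $ i)) \<le> exp (- (B * \<epsilon> * real (l1 l)))"
      unfolding prod_norm_powi[OF U_nonzero[OF a]] using K_pairing[OF a l] by simp
    then have "?R ^ l1 l * (\<Prod>i\<in>UNIV. norm (a $ i) powi (l $ i)) \<le> ?R ^ l1 l * exp (- (B * \<epsilon> * real (l1 l)))"
      using Rconst_ge by (intro mult_left_mono) auto
    also have "\<dots> \<le> exp (- real (l1 l))" by (rule R_exp_bound[OF B])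
    finally show ?thesis .
  qed
  have P: "?P \<ge> 0" by (intro prod_nonneg) auto
  have Pl: "(\<Prod>i\<in>UNIV. norm (a $ i) powi (l $ i)) \<ge> 0" by (intro prod_nonneg) auto
  have "norm (T a k (shift l \<kappa>)) \<le> K0 ?q * 2 ^ (\<Sum>i\<in>UNIV. k i) * ?E * (?R ^ l1 l * ?R ^ ?q)
     * ((\<Prod>i\<in>UNIV. norm (a $ i) powi (l $ i)) * ?P)"
    by (rule order_trans[OF 1], unfold 2, intro mult_mono 3 mult_nonneg_nonneg P Pl K0(1))
      (use Rconst_ge in auto)
  also have "\<dots> = (K0 ?q * 2 ^ (\<Sum>i\<in>UNIV. k i) * ?E * ?R ^ ?q * ?P) * (?R ^ l1 l * (\<Prod>i\<in>UNIV. norm (a $ i) powi (l $ i)))"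
    by (simp only: mult_ac)
  also have "\<dots> \<le> (K0 ?q * 2 ^ (\<Sum>i\<in>UNIV. k i) * ?E * ?R ^ ?q * ?P) * exp (- real (l1 l))"
    using Gd_nonneg[of \<kappa> k a] unfolding Gd_def by (intro mult_left_mono 4)
  finally show ?thesis by (simp only: Gd_def)
qed

text \<open>The coefficient of \<open>D\<^sup>k\<close> in the derivative \<open>\<partial>\<^sup>\<kappa>\<close> of the Gamma series.\<close>

definition S :: "('p option \<Rightarrow> nat) \<Rightarrow> ('p option \<Rightarrow> nat) \<Rightarrow> complex ^ 'p option \<Rightarrow> complex" where
  "S \<kappa> k a = infsum (\<lambda>l. T a k (shift l \<kappa>)) K"

lemma summable_exp_K: "(\<lambda>l. exp (- real (l1 l))) summable_on K"
  by (rule summable_on_subset[OF summable_exp_l1]) simp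

lemma T_summable:
  assumes a: "a \<in> U"
  shows "(\<lambda>l. T a k (shift l \<kappa>)) summable_on K"
proof (rule abs_summable_summable)
  show "(\<lambda>l. norm (T a k (shift l \<kappa>))) summable_on K"
    by (rule summable_on_comparison_test[OF summable_on_cmult_right[OF summable_exp_K, of "Gd \<kappa> k a"]])
      (rule T_dominated[OF a], assumption, rule norm_ge_zero)
qed

lemma S_has_sum: "a \<in> U \<Longrightarrow> ((\<lambda>l. T a k (shift l \<kappa>)) has_sum S \<kappa> k a) K"
  unfolding S_def by (rule has_sum_infsum[OF T_summable])

lemma S_has_derivative:
  assumes a: "a \<in> U"
  shows "(S \<kappa> k has_derivative (\<lambda>h. \<Sum>i\<in>UNIV. h $ i * S (\<kappa>(i := Suc (\<kappa> i))) k a)) (at a)"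
  unfolding S_def[abs_def]
proof (rule has_derivative_infsum[OF open_U a _ summable_exp_K])
  let ?G = "\<lambda>a. Gd \<kappa> k a + (\<Sum>i\<in>UNIV. Gd (\<kappa>(i := Suc (\<kappa> i))) k a)"
  show "continuous_on U ?G" by (intro continuous_intros continuous_on_Gd)
  fix l a assume l: "l \<in> K" and a: "a \<in> U"
  show "((\<lambda>a. T a k (shift l \<kappa>)) has_derivative
      (\<lambda>h. \<Sum>i\<in>UNIV. h $ i * T a k (shift l (\<kappa>(i := Suc (\<kappa> i)))))) (at a)"
    by (rule T_has_derivative[OF U_slit[OF a] dual_cone_first_nonpos[OF l]])
  have "Gd \<kappa> k a \<le> ?G a" using Gd_nonneg by (simp add: sum_nonneg)
  then show "norm (T a k (shift l \<kappa>)) \<le> ?G a * exp (- real (l1 l))"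
    by (rule order_trans[OF T_dominated[OF a l] mult_right_mono[OF _ exp_ge_zero]])
  fix i
  have "Gd (\<kappa>(i := Suc (\<kappa> i))) k a \<le> (\<Sum>i\<in>UNIV. Gd (\<kappa>(i := Suc (\<kappa> i))) k a)"
    using Gd_nonneg by (intro member_le_sum) auto
  then have "Gd (\<kappa>(i := Suc (\<kappa> i))) k a \<le> ?G a" using Gd_nonneg[of \<kappa> k a] by linarith
  then show "norm (T a k (shift l (\<kappa>(i := Suc (\<kappa> i))))) \<le> ?G a * exp (- real (l1 l))"
    by (rule order_trans[OF T_dominated[OF a l] mult_right_mono[OF _ exp_ge_zero]])
qed simp

text \<open>The Taylor coefficients in the definition of the series are the products of the one-variable coefficients studied above.\<close>

lemma gamma_term_eq:
  assumes a: "a \<in> slit" and l: "l $ None \<le> 0"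
  shows "gamma_term a k l = a $ None * T a (Poly_Mapping.lookup k) (shift l (\<lambda>_. 0))"
proof -
  have "gamma_term a k l = (\<Prod>i\<in>UNIV. (if i = None then a $ i else 1) * hfun i (l $ i) (Poly_Mapping.lookup k i) (a $ i))"
    unfolding gamma_term_def
    by (intro prod.cong refl gamma_factor_coefficient) (use l slit_nonzero[OF a] in \<open>auto simp: admissible_def\<close>)
  also have "\<dots> = (\<Prod>i\<in>UNIV. if i = None then a $ i else 1) * T a (Poly_Mapping.lookup k) (shift l (\<lambda>_. 0))"
    unfolding prod.distrib by (simp add: T_def)
  also have "(\<Prod>i\<in>UNIV. if i = None then a $ i else 1) = a $ None"
    unfolding prod_option by simp
  finally show ?thesis .
qed

lemma gamma_series_converges_U: "a \<in> U \<Longrightarrow> gamma_series_converges \<Sigma> \<mu> a"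
  unfolding gamma_series_converges_def
proof
  fix k assume a: "a \<in> U"
  have "(\<lambda>l. a $ None * T a (Poly_Mapping.lookup k) (shift l (\<lambda>_. 0))) summable_on K"
    by (intro summable_on_cmult_right T_summable a)
  then show "gamma_term a k summable_on K"
    by (rule summable_on_cong[THEN iffD1, rotated]) (simp add: gamma_term_eq U_slit[OF a] dual_cone_first_nonpos)
qed

lemma gamma_series_eq: "a \<in> U \<Longrightarrow> gamma_series \<Sigma> \<mu> a k = S (\<lambda>_. 0) (Poly_Mapping.lookup k) a"
proof -
  assume a: "a \<in> U"
  have "infsum (gamma_term a k) K = infsum (\<lambda>l. a $ None * T a (Poly_Mapping.lookup k) (shift l (\<lambda>_. 0))) K"
    by (rule infsum_cong) (simp add: gamma_term_eq U_slit[OF a] dual_cone_first_nonpos)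
  also have "\<dots> = a $ None * S (\<lambda>_. 0) (Poly_Mapping.lookup k) a"
    unfolding S_def by (intro infsum_cmult_right T_summable a)
  finally show ?thesis using U_nonzero[OF a] by (simp add: gamma_series_def)
qed

end

section \<open>Solutions from functionals on the quotient ring\<close>

lemma relation_lattice_add:
  assumes "l \<in> relation_lattice \<mu>" "l' \<in> relation_lattice \<mu>"
  shows "l + l' \<in> relation_lattice \<mu>" "- l \<in> relation_lattice \<mu>"
  using assms by (simp_all add: relation_lattice_iff sum.distrib scaleR_add_left sum_negf)

lemma T_remove:
  "T a k m = hfun i (m $ i) (k i) (a $ i) * (\<Prod>j\<in>UNIV - {i}. hfun j (m $ j) (k j) (a $ j))"
  unfolding T_def by (rule prod.remove) auto

text \<open>Multiplication by \<open>a\<^sub>i\<close> undoes the shift of the exponent.  On the level of power series in \<open>D\<close> the operator \<open>a\<^sub>i \<partial>/\<partial>a\<^sub>i\<close> multiplies the summand by its exponent plus \<open>D\<^sub>i\<close>; the last term is the coefficient of the product with \<open>D\<^sub>i\<close>.\<close>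

lemma T_times:
  assumes a: "a \<in> slit" and l: "l $ None \<le> 0"
  shows "a $ i * T a k (shift l ((\<lambda>_. 0)(i := Suc 0))) =
    of_int (expo i (l $ i)) * T a k (shift l (\<lambda>_. 0)) + (if k i = 0 then 0 else T a (k(i := k i - 1)) (shift l (\<lambda>_. 0)))"
proof -
  define P where "P = (\<Prod>j\<in>UNIV - {i}. hfun j (l $ j) (k j) (a $ j))"
  have adm: "admissible i (l $ i)" using l by (auto simp: admissible_def)
  have "(\<Prod>j\<in>UNIV - {i}. hfun j (shift l ((\<lambda>_. 0)(i := Suc 0)) $ j) (k j) (a $ j)) = P"
    unfolding P_def by (rule prod.cong) auto
  then have 1: "T a k (shift l ((\<lambda>_. 0)(i := Suc 0))) = hfun i (l $ i - 1) (k i) (a $ i) * P"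
    by (subst T_remove[of _ _ _ i]) simp
  have 2: "T a k (shift l (\<lambda>_. 0)) = hfun i (l $ i) (k i) (a $ i) * P"
    by (subst T_remove[of _ _ _ i]) (simp add: P_def)
  have "(\<Prod>j\<in>UNIV - {i}. hfun j (shift l (\<lambda>_. 0) $ j) ((k(i := k i - 1)) j) (a $ j)) = P"
    unfolding P_def by (rule prod.cong) auto
  then have 3: "T a (k(i := k i - 1)) (shift l (\<lambda>_. 0)) = hfun i (l $ i) (k i - 1) (a $ i) * P"
    by (subst T_remove[of _ _ _ i]) simp
  have "a $ i * T a k (shift l ((\<lambda>_. 0)(i := Suc 0))) = (a $ i * hfun i (l $ i - 1) (k i) (a $ i)) * P"
    unfolding 1 by (simp only: mult.assoc)
  also have "\<dots> = (of_int (expo i (l $ i)) * hfun i (l $ i) (k i) (a $ i) + (if k i = 0 then 0 else hfun i (l $ i) (k i - 1) (a $ i))) * P"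
    unfolding hfun_times[OF adm slit_nonzero[OF a]] by (rule refl)
  also have "\<dots> = of_int (expo i (l $ i)) * (hfun i (l $ i) (k i) (a $ i) * P) + (if k i = 0 then 0 else hfun i (l $ i) (k i - 1) (a $ i) * P)"
    by (cases "k i = 0") (simp_all only: distrib_right mult.assoc if_True if_False mult_zero_left refl)
  finally show ?thesis unfolding 2 3 .
qed

context gkz_domain
begin

definition J_functional :: "('p monomial \<Rightarrow> complex) \<Rightarrow> bool" where
  "J_functional \<phi> \<longleftrightarrow> (\<forall>f\<in>J_ideal \<Sigma> \<mu>. lin_ext \<phi> f = 0)"

text \<open>The monomials on which a functional that vanishes on the ideal can be nonzero.\<close>

definition Mon :: "'p monomial set" where
  "Mon = {k. total_degree k \<le> CARD('p)}"

lemma finite_Mon: "finite Mon"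
  unfolding Mon_def by (rule finite_total_degree)

context
  fixes \<phi> assumes \<phi>: "J_functional \<phi>"
begin

lemma functional_J: "f \<in> J_ideal \<Sigma> \<mu> \<Longrightarrow> lin_ext \<phi> f = 0"
  using \<phi> by (simp add: J_functional_def)

lemma functional_high: "total_degree k > CARD('p) \<Longrightarrow> \<phi> k = 0"
  using functional_J[OF J_high_degree[OF dual_vectors], of k] by simp

text \<open>Such a functional kills all multiples of a Stanley-Reisner monomial.\<close>

lemma functional_nonface:
  assumes "\<not> (\<exists>\<sigma>\<in>\<Sigma>. \<mu> ` A \<subseteq> \<sigma>)"
  shows "\<phi> (k + sq A) = 0"
  using functional_J[OF J_times[OF J_nonface[OF assms]], of "X k"] by (simp add: mult_single)

lemma functional_lform:
  "(\<Sum>i\<in>UNIV. of_real (u0 + u \<bullet> mu \<mu> i) * \<phi> (k + Poly_Mapping.single i 1)) = 0"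
proof -
  have "lin_ext \<phi> (X k * lform \<mu> u0 u) = 0" by (rule functional_J[OF J_times[OF lform_in_J]])
  then show ?thesis by (simp only: lin_ext_times_X lform_def lin_ext_sum lin_ext_scale D_var_def lin_ext_single mult_1)
qed

text \<open>The functional \<open>\<phi>\<close> applied to the summand with exponent \<open>m\<close>.\<close>

definition tt :: "complex ^ 'p option \<Rightarrow> int ^ 'p option \<Rightarrow> complex" where
  "tt a m = (\<Sum>k\<in>Mon. \<phi> k * T a (Poly_Mapping.lookup k) m)"

text \<open>The functional \<open>\<phi>\<close> applied to the derivative \<open>\<partial>\<^sup>\<kappa>\<close> of the series.\<close>

definition wsol :: "('p option \<Rightarrow> nat) \<Rightarrow> complex ^ 'p option \<Rightarrow> complex" where
  "wsol \<kappa> a = (\<Sum>k\<in>Mon. \<phi> k * S \<kappa> (Poly_Mapping.lookup k) a)"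

lemma wsol_has_sum: "a \<in> U \<Longrightarrow> ((\<lambda>l. tt a (shift l \<kappa>)) has_sum wsol \<kappa> a) K"
  unfolding tt_def wsol_def by (intro has_sum_finite_sum has_sum_cmult_right S_has_sum)

lemma wsol_has_derivative:
  assumes "a \<in> U"
  shows "(wsol \<kappa> has_derivative (\<lambda>h. \<Sum>i\<in>UNIV. h $ i * wsol (\<kappa>(i := Suc (\<kappa> i))) a)) (at a)"
proof -
  have "(wsol \<kappa> has_derivative (\<lambda>h. \<Sum>k\<in>Mon. \<phi> k * (\<Sum>i\<in>UNIV. h $ i * S (\<kappa>(i := Suc (\<kappa> i))) (Poly_Mapping.lookup k) a))) (at a)"
    unfolding wsol_def[abs_def] by (intro has_derivative_sum has_derivative_mult_right S_has_derivative assms)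
  moreover have "(\<Sum>k\<in>Mon. \<phi> k * (\<Sum>i\<in>UNIV. h $ i * S (\<kappa>(i := Suc (\<kappa> i))) (Poly_Mapping.lookup k) a)) =
     (\<Sum>i\<in>UNIV. h $ i * wsol (\<kappa>(i := Suc (\<kappa> i))) a)" for h
    unfolding wsol_def sum_distrib_left by (subst sum.swap) (simp only: mult.left_commute)
  ultimately show ?thesis by (simp only:)
qed

lemma wsol_holomorphic: "holomorphic_Cn (wsol \<kappa>) U"
  and wsol_partial: "a \<in> U \<Longrightarrow> partial i (wsol \<kappa>) a = wsol (\<kappa>(i := Suc (\<kappa> i))) a"
  using holomorphic_CnI[of U "wsol \<kappa>" "\<lambda>a i. wsol (\<kappa>(i := Suc (\<kappa> i))) a", OF wsol_has_derivative] by auto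

lemma wsol_multi_partial: "a \<in> U \<Longrightarrow> multi_partial \<kappa> (wsol (\<lambda>_. 0)) a = wsol \<kappa> a"
  by (rule multi_partial_family[OF open_U wsol_partial refl])

text \<open>A coefficient is nonzero only if \<open>D\<^sup>k\<close> is divisible by \<open>D\<^sub>j\<close> for every negative exponent, hence by a Stanley-Reisner monomial.\<close>

lemma tt_nonface:
  assumes "\<not> (\<exists>\<sigma>\<in>\<Sigma>. \<mu> ` {j. m $ Some j < 0} \<subseteq> \<sigma>)"
  shows "tt a m = 0"
  unfolding tt_def
proof (rule sum.neutral, rule ballI)
  fix k :: "'p monomial" assume "k \<in> Mon"
  let ?N = "{j. m $ Some j < 0}"
  show "\<phi> k * T a (Poly_Mapping.lookup k) m = 0"
  proof (cases "\<exists>j\<in>?N. Poly_Mapping.lookup k (Some j) = 0")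
    case True
    then obtain j where "m $ Some j < 0" "Poly_Mapping.lookup k (Some j) = 0" by blast
    then have "T a (Poly_Mapping.lookup k) m = 0"
      unfolding T_remove[of _ _ _ "Some j"] by (simp add: hfun_negative)
    then show ?thesis by simp
  next
    case False
    then have pos: "Poly_Mapping.lookup k (Some j) \<ge> 1" if "j \<in> ?N" for j using that by force
    have "Poly_Mapping.lookup (sq ?N) i \<le> Poly_Mapping.lookup k i" for i
      using pos by (cases i) (auto simp: lookup_sq)
    then have "(k - sq ?N) + sq ?N = k"
      by (intro poly_mapping_eqI) (simp add: lookup_add lookup_minus)
    then have "\<phi> k = 0" using functional_nonface[OF assms, of "k - sq ?N"] by simp
    then show ?thesis by simp
  qed
qed

text \<open>Both sides are sums of the same function over translates of \<open>K\<close>.  On the symmetric difference of the translates the function vanishes: if \<open>l \<in> K\<close> and \<open>l + e \<notin> K\<close> for a relation \<open>e\<close>, then the negative part of \<open>l + e\<close> is not a face, and the exponent in question is even smaller.\<close>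

lemma wsol_box:
  assumes a: "a \<in> U" and d: "d \<in> relation_lattice \<mu>"
  shows "wsol (\<lambda>i. nat (d $ i)) a = wsol (\<lambda>i. nat (- d $ i)) a"
proof -
  have inj: "inj_on (\<lambda>l. shift l \<kappa>) K" for \<kappa>
    by (rule inj_onI) (simp add: shift_def vec_eq_iff)
  have image: "wsol \<kappa> a = infsum (tt a) ((\<lambda>l. shift l \<kappa>) ` K)" for \<kappa>
    using infsum_reindex[OF inj, of "tt a" \<kappa>] infsumI[OF wsol_has_sum[OF a, of \<kappa>]] by (simp add: o_def)
  have zero: "tt a m = 0"
    if e: "e \<in> relation_lattice \<mu>" "\<And>i. int (\<kappa> i) - int (\<kappa>' i) = e $ i"
      and m: "m \<in> (\<lambda>l. shift l \<kappa>') ` K - (\<lambda>l. shift l \<kappa>) ` K" for e \<kappa> \<kappa>' m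
  proof -
    obtain l where l: "l \<in> K" "m = shift l \<kappa>'" using m by blast
    have ms: "m = shift (l + e) \<kappa>"
      unfolding vec_eq_iff
    proof
      fix i show "m $ i = shift (l + e) \<kappa> $ i" using e(2)[of i] by (simp add: l(2))
    qed
    have rel: "l + e \<in> relation_lattice \<mu>" by (rule relation_lattice_add(1)[OF K_relation[OF l(1)] e(1)])
    have "l + e \<notin> K" using m ms by blast
    then have nf: "\<not> (\<exists>\<sigma>\<in>\<Sigma>. \<mu> ` {j. (l + e) $ Some j < 0} \<subseteq> \<sigma>)"
      using in_dual_cone_if_negative_part_in_cone[OF rel] by blast
    have "{j. (l + e) $ Some j < 0} \<subseteq> {j. m $ Some j < 0}"
      unfolding ms by auto
    then have "\<not> (\<exists>\<sigma>\<in>\<Sigma>. \<mu> ` {j. m $ Some j < 0} \<subseteq> \<sigma>)"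
      using nf by (meson image_mono order_trans)
    then show ?thesis by (rule tt_nonface)
  qed
  show ?thesis
    unfolding image
  proof (rule infsum_cong_neutral)
    fix m assume "m \<in> (\<lambda>l. shift l (\<lambda>i. nat (- d $ i))) ` K - (\<lambda>l. shift l (\<lambda>i. nat (d $ i))) ` K"
    then show "tt a m = 0" by (rule zero[OF d, rotated]) simp
  next
    fix m assume "m \<in> (\<lambda>l. shift l (\<lambda>i. nat (d $ i))) ` K - (\<lambda>l. shift l (\<lambda>i. nat (- d $ i))) ` K"
    then show "tt a m = 0" by (rule zero[OF relation_lattice_add(2)[OF d d], rotated]) simp
  qed simp
qed

text \<open>Multiplication by \<open>D\<^sub>i\<close> moved from the series to the functional.\<close>

lemma tt_lower_sum:
  "(\<Sum>k\<in>Mon. \<phi> k * (if Poly_Mapping.lookup k i = 0 then 0 else T a ((Poly_Mapping.lookup k)(i := Poly_Mapping.lookup k i - 1)) m)) =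
   (\<Sum>k\<in>Mon. \<phi> (k + Poly_Mapping.single i 1) * T a (Poly_Mapping.lookup k) m)"
proof -
  let ?e = "Poly_Mapping.single i (1::nat) :: 'p monomial"
  have upd: "(Poly_Mapping.lookup k)(i := Poly_Mapping.lookup k i - 1) = Poly_Mapping.lookup (k - ?e)" for k :: "'p monomial"
    by (rule ext) (simp add: lookup_minus lookup_single when_def)
  have "(\<Sum>k\<in>Mon. \<phi> (k + ?e) * T a (Poly_Mapping.lookup k) m) =
     (\<Sum>k\<in>Mon. \<phi> k * (if Poly_Mapping.lookup k i = 0 then 0 else T a (Poly_Mapping.lookup (k - ?e)) m))"
  proof (rule sum.reindex_bij_witness_not_neutral[where S' = "{k \<in> Mon. total_degree k = CARD('p)}"
        and T' = "{k \<in> Mon. Poly_Mapping.lookup k i = 0}" and j = "\<lambda>k. k + ?e" and i = "\<lambda>k. k - ?e"])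
    show "finite {k \<in> Mon. total_degree k = CARD('p)}" "finite {k \<in> Mon. Poly_Mapping.lookup k i = 0}"
      using finite_Mon by auto
    fix k :: "'p monomial"
    show "k + ?e - ?e = k" by simp
    show "k + ?e \<in> Mon - {k \<in> Mon. Poly_Mapping.lookup k i = 0}"
      if "k \<in> Mon - {k \<in> Mon. total_degree k = CARD('p)}"
      using that by (auto simp: Mon_def total_degree_add lookup_add)
    show "\<phi> (k + ?e) * T a (Poly_Mapping.lookup k) m = 0" if "k \<in> {k \<in> Mon. total_degree k = CARD('p)}"
      using that functional_high[of "k + ?e"] by (simp add: total_degree_add)
    show "\<phi> k * (if Poly_Mapping.lookup k i = 0 then 0 else T a (Poly_Mapping.lookup (k - ?e)) m) = 0"
      if "k \<in> {k \<in> Mon. Poly_Mapping.lookup k i = 0}" using that by simp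
    show "\<phi> (k + ?e) * (if Poly_Mapping.lookup (k + ?e) i = 0 then 0 else T a (Poly_Mapping.lookup (k + ?e - ?e)) m) =
      \<phi> (k + ?e) * T a (Poly_Mapping.lookup k) m" by (simp add: lookup_add)
    assume k: "k \<in> Mon - {k \<in> Mon. Poly_Mapping.lookup k i = 0}"
    then have "Poly_Mapping.lookup k i > 0" by auto
    from minus_single_add[OF this] show eq: "k - ?e + ?e = k" .
    have "total_degree (k - ?e + ?e) \<le> CARD('p)" unfolding eq using k by (simp add: Mon_def)
    then show "k - ?e \<in> Mon - {k \<in> Mon. total_degree k = CARD('p)}"
      by (simp add: Mon_def total_degree_add)
  qed
  then show ?thesis unfolding upd by (rule sym)
qed

text \<open>Termwise the Euler operator of an affine function gives its pairing with the exponents, which is \<open>- u0\<close> because of the exponent \<open>- 1\<close> of \<open>a\<^sub>0\<close>, plus the product with a linear form in the ideal.\<close>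

lemma wsol_euler:
  assumes a: "a \<in> U"
  shows "(\<Sum>i\<in>UNIV. of_real (u0 + u \<bullet> mu \<mu> i) * (a $ i * wsol ((\<lambda>_. 0)(i := Suc 0)) a)) = - of_real u0 * wsol (\<lambda>_. 0) a"
proof -
  let ?c = "\<lambda>i. complex_of_real (u0 + u \<bullet> mu \<mu> i)"
  have termwise: "(\<Sum>i\<in>UNIV. ?c i * (a $ i * tt a (shift l ((\<lambda>_. 0)(i := Suc 0))))) = - of_real u0 * tt a (shift l (\<lambda>_. 0))"
    if l: "l \<in> K" for l
  proof -
    let ?m = "shift l (\<lambda>_. 0)"
    have one: "a $ i * tt a (shift l ((\<lambda>_. 0)(i := Suc 0))) = of_int (expo i (l $ i)) * tt a ?m +
       (\<Sum>k\<in>Mon. \<phi> (k + Poly_Mapping.single i 1) * T a (Poly_Mapping.lookup k) ?m)" for i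
    proof -
      have "a $ i * tt a (shift l ((\<lambda>_. 0)(i := Suc 0))) =
        (\<Sum>k\<in>Mon. \<phi> k * (a $ i * T a (Poly_Mapping.lookup k) (shift l ((\<lambda>_. 0)(i := Suc 0)))))"
        unfolding tt_def sum_distrib_left by (simp only: mult.left_commute)
      also have "\<dots> = (\<Sum>k\<in>Mon. of_int (expo i (l $ i)) * (\<phi> k * T a (Poly_Mapping.lookup k) ?m) +
         \<phi> k * (if Poly_Mapping.lookup k i = 0 then 0 else T a ((Poly_Mapping.lookup k)(i := Poly_Mapping.lookup k i - 1)) ?m))"
        unfolding T_times[OF U_slit[OF a] dual_cone_first_nonpos[OF l]]
        by (simp only: distrib_left mult.left_commute)
      also have "\<dots> = of_int (expo i (l $ i)) * tt a ?m +
       (\<Sum>k\<in>Mon. \<phi> (k + Poly_Mapping.single i 1) * T a (Poly_Mapping.lookup k) ?m)"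
        unfolding sum.distrib tt_lower_sum by (simp only: tt_def sum_distrib_left)
      finally show ?thesis .
    qed
    have low: "(\<Sum>i\<in>UNIV. ?c i * (\<Sum>k\<in>Mon. \<phi> (k + Poly_Mapping.single i 1) * T a (Poly_Mapping.lookup k) ?m)) = 0"
    proof -
      have "(\<Sum>i\<in>UNIV. ?c i * (\<Sum>k\<in>Mon. \<phi> (k + Poly_Mapping.single i 1) * T a (Poly_Mapping.lookup k) ?m)) =
        (\<Sum>k\<in>Mon. (\<Sum>i\<in>UNIV. ?c i * \<phi> (k + Poly_Mapping.single i 1)) * T a (Poly_Mapping.lookup k) ?m)"
        unfolding sum_distrib_left sum_distrib_right by (subst sum.swap) (simp only: mult.assoc)
      also have "\<dots> = 0" unfolding functional_lform by simp
      finally show ?thesis .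
    qed
    have "(\<Sum>i\<in>UNIV. of_int (l $ i) * (u \<bullet> mu \<mu> i + u0)) = (0::real)"
      by (rule relation_lattice_affine[OF K_relation[OF l]])
        (simp add: bounded_linear.linear bounded_linear_inner_right)
    moreover have "(\<Sum>i\<in>UNIV. (u0 + u \<bullet> mu \<mu> i) * of_int (expo i (l $ i))) =
       (\<Sum>i\<in>UNIV. of_int (l $ i) * (u \<bullet> mu \<mu> i + u0)) - u0"
      unfolding sum_option by (simp add: expo_def mu_def algebra_simps)
    ultimately have "(\<Sum>i\<in>UNIV. (u0 + u \<bullet> mu \<mu> i) * of_int (expo i (l $ i))) = - u0" by simp
    then have main: "(\<Sum>i\<in>UNIV. ?c i * of_int (expo i (l $ i))) = - of_real u0"
      by (metis (no_types, lifting) of_real_minus of_real_mult of_real_of_int_eq of_real_sum sum.cong)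
    have "(\<Sum>i\<in>UNIV. ?c i * (a $ i * tt a (shift l ((\<lambda>_. 0)(i := Suc 0))))) =
      (\<Sum>i\<in>UNIV. ?c i * of_int (expo i (l $ i))) * tt a ?m +
      (\<Sum>i\<in>UNIV. ?c i * (\<Sum>k\<in>Mon. \<phi> (k + Poly_Mapping.single i 1) * T a (Poly_Mapping.lookup k) ?m))"
      unfolding one distrib_left sum.distrib sum_distrib_right mult.assoc by (rule refl)
    then show ?thesis unfolding low main by simp
  qed
  have "((\<lambda>l. \<Sum>i\<in>UNIV. ?c i * (a $ i * tt a (shift l ((\<lambda>_. 0)(i := Suc 0))))) has_sum
     (\<Sum>i\<in>UNIV. ?c i * (a $ i * wsol ((\<lambda>_. 0)(i := Suc 0)) a))) K"
    by (intro has_sum_finite_sum has_sum_cmult_right wsol_has_sum a)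
  then have 1: "((\<lambda>l. - of_real u0 * tt a (shift l (\<lambda>_. 0))) has_sum
     (\<Sum>i\<in>UNIV. ?c i * (a $ i * wsol ((\<lambda>_. 0)(i := Suc 0)) a))) K"
    by (rule has_sum_cong[THEN iffD1, rotated]) (rule termwise)
  have 2: "((\<lambda>l. - of_real u0 * tt a (shift l (\<lambda>_. 0))) has_sum (- of_real u0 * wsol (\<lambda>_. 0) a)) K"
    by (intro has_sum_cmult_right wsol_has_sum a)
  show ?thesis by (rule has_sum_unique[OF 1 2])
qed

theorem wsol_gkz_solution: "gkz_solution \<mu> (-1, 0) U (wsol (\<lambda>_. 0))"
  unfolding gkz_solution_def
proof (intro conjI ballI allI)
  show "holomorphic_Cn (wsol (\<lambda>_. 0)) U" by (rule wsol_holomorphic)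
  fix a assume a: "a \<in> U"
  have p: "partial i (wsol (\<lambda>_. 0)) a = wsol ((\<lambda>_. 0)(i := Suc 0)) a" for i
    using wsol_partial[OF a, of i "\<lambda>_. 0"] .
  show "(\<Sum>i\<in>UNIV. complex_of_real (fst (mu_bar \<mu> i)) * (a $ i * partial i (wsol (\<lambda>_. 0)) a)) -
     fst (- 1, 0) * wsol (\<lambda>_. 0) a = 0"
    unfolding p using wsol_euler[OF a, of 1 0] by (simp add: mu_bar_def)
  show "(\<Sum>i\<in>UNIV. complex_of_real (snd (mu_bar \<mu> i) $ k) * (a $ i * partial i (wsol (\<lambda>_. 0)) a)) -
     snd (- 1, 0) $ k * wsol (\<lambda>_. 0) a = 0" for k
  proof -
    have c: "0 + axis k 1 \<bullet> mu \<mu> i = snd (mu_bar \<mu> i) $ k" for i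
      by (simp only: mu_bar_def snd_conv inner_axis' add_0 inner_real_def mult_1)
    show ?thesis
      unfolding p using wsol_euler[OF a, of 0 "axis k 1"] unfolding c by simp
  qed
  show "box_operator l (wsol (\<lambda>_. 0)) a = 0" if "l \<in> relation_lattice \<mu>" for l
    unfolding box_operator_def wsol_multi_partial[OF a] wsol_box[OF a that] vector_uminus_component by (rule diff_self)
qed

end

end

section \<open>Linear independence of the solutions\<close>

text \<open>Induction on the number of variables: in one variable a polynomial with infinitely many zeros is zero, and its coefficients are polynomials in the remaining variables.  Exponents are indexed by an arbitrary set so that the monomials with a given exponent of one variable form an instance of the same statement.\<close>

lemma polynomial_zero_on_box:
  fixes c :: "'k \<Rightarrow> complex" and e :: "'k \<Rightarrow> 'i \<Rightarrow> nat" and v :: "'i \<Rightarrow> real"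
  assumes "finite A" "finite M" "\<delta> > 0"
    and "\<And>k k'. k \<in> M \<Longrightarrow> k' \<in> M \<Longrightarrow> (\<forall>i\<in>A. e k i = e k' i) \<Longrightarrow> k = k'"
    and "\<And>w. (\<forall>i. \<bar>w i - v i\<bar> < \<delta>) \<Longrightarrow> (\<Sum>k\<in>M. c k * (\<Prod>i\<in>A. of_real (w i) ^ e k i)) = 0"
    and "k \<in> M"
  shows "c k = 0"
  using assms(1,2,4,5,6)
proof (induction A arbitrary: M k)
  case empty
  then have "M = {k}" by blast
  then show ?case using empty.prems(3)[of v] \<open>\<delta> > 0\<close> by simp
next
  case (insert x A)
  define N where "N = Max ((\<lambda>k. e k x) ` M)"
  have N: "e k x \<le> N" if "k \<in> M" for k unfolding N_def using insert.prems(1) that by simp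
  define M' where "M' = {k' \<in> M. e k' x = e k x}"
  define q where "q = (\<lambda>n w. \<Sum>k\<in>{k \<in> M. e k x = n}. c k * (\<Prod>i\<in>A. complex_of_real (w i) ^ e k i))"
  have q0: "q n w = 0" if w: "\<forall>i. \<bar>w i - v i\<bar> < \<delta>" and n: "n \<le> N" for n w
  proof (rule ccontr)
    assume "q n w \<noteq> 0"
    then have fin: "finite {z. (\<Sum>j\<le>N. q j w * z ^ j) = 0}"
      using n unfolding polyfun_finite_roots by blast
    have "complex_of_real ` {v x - \<delta><..<v x + \<delta>} \<subseteq> {z. (\<Sum>j\<le>N. q j w * z ^ j) = 0}"
    proof (rule image_subsetI, rule CollectI)
      fix s :: real assume s: "s \<in> {v x - \<delta><..<v x + \<delta>}"
      let ?w = "w(x := s)"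
      have "\<forall>i. \<bar>?w i - v i\<bar> < \<delta>" using w s by (auto simp: abs_less_iff)
      then have "0 = (\<Sum>k\<in>M. c k * (\<Prod>i\<in>insert x A. complex_of_real (?w i) ^ e k i))"
        by (rule insert.prems(3)[symmetric])
      also have "\<dots> = (\<Sum>k\<in>M. c k * (\<Prod>i\<in>A. complex_of_real (w i) ^ e k i) * of_real s ^ e k x)"
      proof (rule sum.cong[OF refl])
        fix k
        have "(\<Prod>i\<in>A. complex_of_real (?w i) ^ e k i) = (\<Prod>i\<in>A. complex_of_real (w i) ^ e k i)"
          using insert.hyps(2) by (intro prod.cong) auto
        then show "c k * (\<Prod>i\<in>insert x A. complex_of_real (?w i) ^ e k i) =
          c k * (\<Prod>i\<in>A. complex_of_real (w i) ^ e k i) * of_real s ^ e k x"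
          unfolding prod.insert[OF insert.hyps(1,2)] by (simp only: fun_upd_same mult_ac)
      qed
      also have "\<dots> = (\<Sum>n\<le>N. \<Sum>k\<in>{k \<in> M. e k x = n}. c k * (\<Prod>i\<in>A. complex_of_real (w i) ^ e k i) * of_real s ^ e k x)"
        by (rule sum.group[symmetric]) (use insert.prems(1) N in auto)
      also have "\<dots> = (\<Sum>j\<le>N. q j w * complex_of_real s ^ j)"
        unfolding q_def sum_distrib_right by (intro sum.cong refl) simp
      finally show "(\<Sum>j\<le>N. q j w * complex_of_real s ^ j) = 0" by (rule sym)
    qed
    then have "finite (complex_of_real ` {v x - \<delta><..<v x + \<delta>})" by (rule finite_subset[OF _ fin])
    then have "finite {v x - \<delta><..<v x + \<delta>}" by (rule finite_imageD) (simp add: inj_on_def)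
    moreover have "infinite {v x - \<delta><..<v x + \<delta>}" by (rule infinite_Ioo) (use \<open>\<delta> > 0\<close> in linarith)
    ultimately show False by blast
  qed
  show ?case
  proof (rule insert.IH[of M'])
    show "finite M'" using insert.prems(1) by (simp add: M'_def)
    show "k1 = k2" if "k1 \<in> M'" "k2 \<in> M'" "\<forall>i\<in>A. e k1 i = e k2 i" for k1 k2
      using that by (intro insert.prems(2)) (auto simp: M'_def)
    show "k \<in> M'" using insert.prems(4) by (simp add: M'_def)
    fix w :: "'i \<Rightarrow> real" assume "\<forall>i. \<bar>w i - v i\<bar> < \<delta>"
    from q0[OF this N[OF insert.prems(4)]]
    show "(\<Sum>k\<in>M'. c k * (\<Prod>i\<in>A. of_real (w i) ^ e k i)) = 0" by (simp only: q_def M'_def)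
  qed
qed

lemma gcoef_0: "gcoef i 0 0 = 1"
  by (cases i) (simp_all add: gcoef_def gfun_def fps_expansion_def rGamma_inverse_Gamma)

text \<open>Only the top power of the logarithm survives, with the value \<open>1\<close> of the Gamma factor at \<open>D = 0\<close> as coefficient.\<close>

lemma lpoly_scaled_tendsto:
  "((\<lambda>t. lpoly i 0 n (of_real (- (b + t * w))) / of_real t ^ n) \<longlongrightarrow> of_real (- w) ^ n / fact n) at_top"
proof -
  let ?f = "\<lambda>y. \<Sum>j\<le>n. gcoef i 0 (n - j) * (of_real (- (b * y) - w) ^ j / fact j) * of_real y ^ (n - j)"
  have inv: "(inverse \<longlongrightarrow> (0::real)) at_top" by (rule tendsto_inverse_0_at_top) (rule filterlim_ident)
  have lim: "((\<lambda>t. ?f (inverse t)) \<longlongrightarrow> ?f 0) at_top"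
    by (intro tendsto_intros inv) simp_all
  have "?f 0 = (\<Sum>j\<le>n. if j = n then of_real (- w) ^ n / fact n else 0)"
    by (rule sum.cong[OF refl]) (auto simp: gcoef_0)
  also have "\<dots> = of_real (- w) ^ n / fact n" by simp
  finally have f0: "?f 0 = of_real (- w) ^ n / fact n" .
  have ev: "eventually (\<lambda>t. ?f (inverse t) = lpoly i 0 n (of_real (- (b + t * w))) / of_real t ^ n) at_top"
    using eventually_gt_at_top[of "0::real"]
  proof eventually_elim
    case (elim t)
    have tt: "t * inverse t = 1" using elim by simp
    have y: "- (b + t * w) = t * (- (b * inverse t) - w)" using tt by algebra
    show "?f (inverse t) = lpoly i 0 n (of_real (- (b + t * w))) / of_real t ^ n"
      unfolding lpoly_def sum_divide_distrib
    proof (rule sum.cong[OF refl])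
      fix j assume j: "j \<in> {..n}"
      define z where "z = complex_of_real (- (b * inverse t) - w)"
      have tn: "complex_of_real t ^ n = of_real t ^ j * of_real t ^ (n - j)" using j by (simp flip: power_add)
      have nz: "complex_of_real t \<noteq> 0" using elim by simp
      have "gcoef i 0 (n - j) * (of_real (- (b + t * w)) ^ j / fact j) / of_real t ^ n
         = gcoef i 0 (n - j) * ((of_real t * z) ^ j / fact j) / (of_real t ^ j * of_real t ^ (n - j))"
        unfolding y tn z_def of_real_mult ..
      also have "\<dots> = gcoef i 0 (n - j) * (z ^ j / fact j) * of_real (inverse t) ^ (n - j)"
        unfolding power_mult_distrib of_real_inverse power_inverse using nz by (simp add: divide_inverse)
      finally show "gcoef i 0 (n - j) * (of_real (- (b * inverse t) - w) ^ j / fact j) * of_real (inverse t) ^ (n - j)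
        = gcoef i 0 (n - j) * (of_real (- (b + t * w)) ^ j / fact j) / of_real t ^ n"
        unfolding z_def by (rule sym)
    qed
  qed
  show ?thesis using Lim_transform_eventually[OF lim ev] unfolding f0 .
qed

context gkz_domain
begin

text \<open>Minus the logarithms of the absolute values along a path to the large radius limit in direction \<open>w\<close>.\<close>

definition limit_ray :: "real ^ 'p option \<Rightarrow> real \<Rightarrow> real ^ 'p option" where
  "limit_ray w t = B *\<^sub>R v0 + t *\<^sub>R w"

lemma limit_ray_U: "w \<in> ball v0 \<epsilon> \<Longrightarrow> t > 0 \<Longrightarrow> real_point (limit_ray w t) \<in> U"
  unfolding limit_ray_def by (rule real_point_U)

lemma Ln_real_point: "Ln (real_point x $ i) = of_real (- (x $ i))"
  by (simp add: real_point_def Ln_of_real del: of_real_exp)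

lemma limit_ray_pairing:
  assumes w: "w \<in> ball v0 \<epsilon>" and t: "t > 0" and l: "l \<in> K"
  shows "B * \<epsilon> * real (l1 l) + t * \<epsilon> * real (l1 l) \<le> (\<Sum>i\<in>UNIV. of_int (l $ i) * limit_ray w t $ i)"
proof -
  have "(\<Sum>i\<in>UNIV. of_int (l $ i) * limit_ray w t $ i) =
    (\<Sum>i\<in>UNIV. B * (of_int (l $ i) * v0 $ i) + t * (of_int (l $ i) * w $ i))"
    by (intro sum.cong refl) (simp add: limit_ray_def distrib_left mult.left_commute)
  also have "\<dots> = B * (\<Sum>i\<in>UNIV. of_int (l $ i) * v0 $ i) + t * (\<Sum>i\<in>UNIV. of_int (l $ i) * w $ i)"
    unfolding sum.distrib sum_distrib_left ..
  finally have eq: "(\<Sum>i\<in>UNIV. of_int (l $ i) * limit_ray w t $ i) = \<dots>" .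
  have "B * (\<epsilon> * real (l1 l)) \<le> B * (\<Sum>i\<in>UNIV. of_int (l $ i) * v0 $ i)"
    by (rule mult_left_mono[OF v0_bound[OF _ l]]) (use eps B_pos in auto)
  moreover have "t * (\<epsilon> * real (l1 l)) \<le> t * (\<Sum>i\<in>UNIV. of_int (l $ i) * w $ i)"
    by (rule mult_left_mono[OF v0_bound[OF w l]]) (use t in auto)
  ultimately show ?thesis unfolding eq mult.assoc by linarith
qed

lemma l1_pos: "l \<noteq> 0 \<Longrightarrow> l1 (l :: int ^ 'i::finite) \<ge> 1"
proof -
  assume "l \<noteq> 0"
  then obtain i where "l $ i \<noteq> 0" by (auto simp: vec_eq_iff)
  then have "1 \<le> nat \<bar>l $ i\<bar>" by simp
  also have "\<dots> \<le> l1 l" by (rule member_le_sum) auto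
  finally show ?thesis .
qed

text \<open>The summands with \<open>l \<noteq> 0\<close> decay like \<open>exp (- t \<epsilon>)\<close>.  The radius \<open>r\<close> in the Cauchy estimate is chosen so small that the logarithms, which grow linearly in \<open>t\<close>, use up only half of this rate.\<close>

lemma remainder_bound:
  assumes w: "w \<in> ball v0 \<epsilon>"
  obtains C where "C \<ge> 0" and "\<And>t l. t > 0 \<Longrightarrow> l \<in> K - {0} \<Longrightarrow>
    norm (T (real_point (limit_ray w t)) k l) \<le>
      C * exp (- (t * \<epsilon> / 2)) * (\<Prod>i\<in>UNIV. norm (real_point (limit_ray w t) $ i) powi expo i 0) * exp (- real (l1 l))"
proof -
  define s where "s = 1 + (\<Sum>i\<in>UNIV. \<bar>w $ i\<bar>)"
  define r where "r = min (1/2) (\<epsilon> / (2 * s))"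
  define V where "V = (\<Sum>i\<in>UNIV. \<bar>v0 $ i\<bar>)"
  define C where "C = K0 0 * (1 / r) ^ (\<Sum>i\<in>UNIV. k i) * exp (r * (B * V))"
  have s: "s > 0" unfolding s_def by (rule add_pos_nonneg) (auto intro: sum_nonneg)
  have r: "0 < r" "r \<le> 1/2" using eps s by (auto simp: r_def)
  have rs: "r * (\<Sum>i\<in>UNIV. \<bar>w $ i\<bar>) \<le> \<epsilon> / 2"
  proof -
    have "r * (\<Sum>i\<in>UNIV. \<bar>w $ i\<bar>) \<le> r * s" using r by (intro mult_left_mono) (auto simp: s_def)
    also have "\<dots> \<le> \<epsilon> / (2 * s) * s" using s by (intro mult_right_mono) (auto simp: r_def)
    also have "\<dots> = \<epsilon> / 2" using s by simp
    finally show ?thesis .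
  qed
  have C: "C \<ge> 0" unfolding C_def using K0(1) r by (intro mult_nonneg_nonneg) auto
  show ?thesis
  proof (rule that[OF C])
    fix t :: real and l assume t: "t > 0" and l: "l \<in> K - {0}"
    let ?a = "real_point (limit_ray w t)" and ?R = "Rconst TYPE('p)"
    let ?P = "\<Prod>i\<in>UNIV. norm (?a $ i) powi expo i 0"
    have a: "?a $ i \<noteq> 0" for i by (rule slit_nonzero[OF real_point_slit])
    have P: "?P \<ge> 0" by (intro prod_nonneg) auto
    have sum0: "(\<Sum>i\<in>UNIV. l $ i) = - int 0" using K_sum l by simp
    have first: "l $ None \<le> 0" using dual_cone_first_nonpos l by blast
    have 1: "norm (T ?a k l) \<le> K0 0 * (1 / r) ^ (\<Sum>i\<in>UNIV. k i) * exp (r * (\<Sum>i\<in>UNIV. norm (Ln (?a $ i))))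
       * ?R ^ l1 l * (\<Prod>i\<in>UNIV. norm (?a $ i) powi (expo i (l $ i)))"
      by (rule K0(2)[OF r a sum0 first])
    have "r * (\<Sum>i\<in>UNIV. norm (Ln (?a $ i))) \<le> r * (B * V + t * (\<Sum>i\<in>UNIV. \<bar>w $ i\<bar>))"
    proof (rule mult_left_mono)
      have "(\<Sum>i\<in>UNIV. norm (Ln (?a $ i))) \<le> (\<Sum>i\<in>UNIV. B * \<bar>v0 $ i\<bar> + t * \<bar>w $ i\<bar>)"
      proof (rule sum_mono)
        fix i
        have "norm (Ln (?a $ i)) = \<bar>B * v0 $ i + t * w $ i\<bar>"
          unfolding Ln_real_point norm_of_real by (simp add: limit_ray_def)
        also have "\<dots> \<le> B * \<bar>v0 $ i\<bar> + t * \<bar>w $ i\<bar>"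
          using abs_triangle_ineq[of "B * v0 $ i" "t * w $ i"] B_pos t by (simp add: abs_mult)
        finally show "norm (Ln (?a $ i)) \<le> B * \<bar>v0 $ i\<bar> + t * \<bar>w $ i\<bar>" .
      qed
      then show "(\<Sum>i\<in>UNIV. norm (Ln (?a $ i))) \<le> B * V + t * (\<Sum>i\<in>UNIV. \<bar>w $ i\<bar>)"
        unfolding V_def sum.distrib sum_distrib_left .
    qed (use r in simp)
    also have "\<dots> \<le> r * (B * V) + t * (\<epsilon> / 2)"
      using mult_left_mono[OF rs, of t] t unfolding distrib_left mult.left_commute[of r t] by linarith
    finally have "exp (r * (\<Sum>i\<in>UNIV. norm (Ln (?a $ i)))) \<le> exp (r * (B * V) + t * (\<epsilon> / 2))" by simp
    then have 2: "exp (r * (\<Sum>i\<in>UNIV. norm (Ln (?a $ i)))) \<le> exp (r * (B * V)) * exp (t * \<epsilon> / 2)"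
      by (simp add: exp_add)
    have ex: "expo i (l $ i) = l $ i + expo i 0" for i using expo_add[of i "l $ i" 0] by simp
    have 3: "(\<Prod>i\<in>UNIV. norm (?a $ i) powi (expo i (l $ i))) = (\<Prod>i\<in>UNIV. norm (?a $ i) powi (l $ i)) * ?P"
      unfolding ex using a by (simp add: power_int_add prod.distrib)
    have 4: "?R ^ l1 l * (\<Prod>i\<in>UNIV. norm (?a $ i) powi (l $ i)) \<le> exp (- real (l1 l)) * exp (- (t * \<epsilon>))"
    proof -
      have "t * \<epsilon> * 1 \<le> t * \<epsilon> * real (l1 l)"
      proof (rule mult_left_mono)
        have "real 1 \<le> real (l1 l)" by (rule of_nat_mono[OF l1_pos]) (use l in blast)
        then show "1 \<le> real (l1 l)" by (simp only: of_nat_1)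
      qed (use t eps in simp)
      then have "- (\<Sum>i\<in>UNIV. of_int (l $ i) * lg ?a $ i) \<le> - (B * \<epsilon> * real (l1 l)) + - (t * \<epsilon>)"
        using limit_ray_pairing[OF w t, of l] l unfolding lg_real_point by simp
      then have "(\<Prod>i\<in>UNIV. norm (?a $ i) powi (l $ i)) \<le> exp (- (B * \<epsilon> * real (l1 l))) * exp (- (t * \<epsilon>))"
        unfolding prod_norm_powi[OF a] exp_add[symmetric] by (simp only: exp_le_cancel_iff)
      then have "?R ^ l1 l * (\<Prod>i\<in>UNIV. norm (?a $ i) powi (l $ i)) \<le>
         ?R ^ l1 l * (exp (- (B * \<epsilon> * real (l1 l))) * exp (- (t * \<epsilon>)))"
        using Rconst_ge by (intro mult_left_mono) auto
      also have "\<dots> = ?R ^ l1 l * exp (- (B * \<epsilon> * real (l1 l))) * exp (- (t * \<epsilon>))" by (simp only: mult.assoc)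
      also have "\<dots> \<le> exp (- real (l1 l)) * exp (- (t * \<epsilon>))"
        by (rule mult_right_mono[OF R_exp_bound[OF B]]) simp
      finally show ?thesis .
    qed
    have K00: "0 \<le> K0 0 * (1 / r) ^ (\<Sum>i\<in>UNIV. k i)" using K0(1) r by (intro mult_nonneg_nonneg) auto
    have "norm (T ?a k l) \<le> K0 0 * (1 / r) ^ (\<Sum>i\<in>UNIV. k i) * exp (r * (\<Sum>i\<in>UNIV. norm (Ln (?a $ i))))
       * (?R ^ l1 l * (\<Prod>i\<in>UNIV. norm (?a $ i) powi (l $ i))) * ?P"
      using 1 unfolding 3 by (simp only: mult.assoc)
    also have "\<dots> \<le> K0 0 * (1 / r) ^ (\<Sum>i\<in>UNIV. k i) * (exp (r * (B * V)) * exp (t * \<epsilon> / 2))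
       * (exp (- real (l1 l)) * exp (- (t * \<epsilon>))) * ?P"
      by (intro mult_right_mono[OF _ P] mult_mono[OF _ 4] mult_left_mono[OF 2 K00])
        (use K00 Rconst_ge in \<open>auto intro!: mult_nonneg_nonneg prod_nonneg\<close>)
    also have "\<dots> = C * (exp (t * \<epsilon> / 2) * exp (- (t * \<epsilon>))) * ?P * exp (- real (l1 l))"
      unfolding C_def by (simp only: mult_ac)
    also have "exp (t * \<epsilon> / 2) * exp (- (t * \<epsilon>)) = exp (- (t * \<epsilon> / 2))"
      unfolding exp_add[symmetric] by (rule arg_cong[where f = exp]) simp
    finally show "norm (T ?a k l) \<le> C * exp (- (t * \<epsilon> / 2)) * ?P * exp (- real (l1 l))" .
  qed
qed

lemma zero_in_K: "0 \<in> K"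
  by (simp add: dual_cone_lattice_def relation_lattice_def)

text \<open>The coefficient of \<open>D\<^sup>k\<close> in the summand \<open>l = 0\<close>, up to the power of \<open>a\<^sub>0\<close>.\<close>

definition lterm :: "real ^ 'p option \<Rightarrow> 'p monomial \<Rightarrow> real \<Rightarrow> complex" where
  "lterm w k t = (\<Prod>i\<in>UNIV. lpoly i 0 (Poly_Mapping.lookup k i) (of_real (- (B * v0 $ i + t * w $ i))))"

lemma T_limit_ray_0:
  "T (real_point (limit_ray w t)) (Poly_Mapping.lookup k) 0 = (\<Prod>i\<in>UNIV. real_point (limit_ray w t) $ i powi expo i 0) * lterm w k t"
  unfolding T_def lterm_def hfun_def Ln_real_point prod.distrib by (simp add: limit_ray_def)

lemma S_limit_ray_bound:
  assumes w: "w \<in> ball v0 \<epsilon>"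
  obtains C where "\<And>t. t > 0 \<Longrightarrow>
    norm (S (\<lambda>_. 0) (Poly_Mapping.lookup k) (real_point (limit_ray w t)) / (\<Prod>i\<in>UNIV. real_point (limit_ray w t) $ i powi expo i 0)
      - lterm w k t) \<le> C * exp (- (t * \<epsilon> / 2))"
proof -
  let ?k = "Poly_Mapping.lookup k"
  obtain C where C: "C \<ge> 0" "\<And>t l. t > 0 \<Longrightarrow> l \<in> K - {0} \<Longrightarrow>
    norm (T (real_point (limit_ray w t)) ?k l) \<le>
      C * exp (- (t * \<epsilon> / 2)) * (\<Prod>i\<in>UNIV. norm (real_point (limit_ray w t) $ i) powi expo i 0) * exp (- real (l1 l))"
    using remainder_bound[OF w] by blast
  define Z where "Z = infsum (\<lambda>l. exp (- real (l1 l))) (K - {0})"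
  show ?thesis
  proof (rule that[of "C * Z"])
    fix t :: real assume t: "t > 0"
    let ?a = "real_point (limit_ray w t)"
    let ?P = "\<Prod>i\<in>UNIV. ?a $ i powi expo i 0"
    have a: "?a \<in> U" by (rule limit_ray_U[OF w t])
    have nP: "norm ?P = (\<Prod>i\<in>UNIV. norm (?a $ i) powi expo i 0)"
      by (simp add: prod_norm[symmetric] norm_power_int)
    have P0: "?P \<noteq> 0" using U_nonzero[OF a] by (simp add: power_int_eq_0_iff)
    have sh: "shift l (\<lambda>_. 0) = l" for l :: "int ^ 'p option" by (simp add: vec_eq_iff)
    have sK: "T ?a ?k summable_on K" using T_summable[OF a, of ?k "\<lambda>_. 0"] unfolding sh .
    have sK0: "T ?a ?k summable_on (K - {0})" by (rule summable_on_subset[OF sK]) blast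
    have "S (\<lambda>_. 0) ?k ?a = infsum (T ?a ?k) (insert 0 (K - {0}))"
      unfolding S_def sh using zero_in_K by (simp add: insert_absorb)
    also have "\<dots> = T ?a ?k 0 + infsum (T ?a ?k) (K - {0})" by (rule infsum_insert[OF sK0]) simp
    finally have S: "S (\<lambda>_. 0) ?k ?a = ?P * lterm w k t + infsum (T ?a ?k) (K - {0})" unfolding T_limit_ray_0 .
    have "norm (infsum (T ?a ?k) (K - {0})) \<le> C * exp (- (t * \<epsilon> / 2)) * norm ?P * Z"
    proof (rule norm_infsum_le[OF has_sum_infsum[OF sK0]])
      show "((\<lambda>l. C * exp (- (t * \<epsilon> / 2)) * norm ?P * exp (- real (l1 l))) has_sum C * exp (- (t * \<epsilon> / 2)) * norm ?P * Z) (K - {0})"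
        unfolding Z_def
        by (intro has_sum_cmult_right has_sum_infsum summable_on_subset[OF summable_exp_K]) blast
      show "norm (T ?a ?k l) \<le> C * exp (- (t * \<epsilon> / 2)) * norm ?P * exp (- real (l1 l))" if "l \<in> K - {0}" for l
        unfolding nP by (rule C(2)[OF t that])
    qed
    then have n: "norm (infsum (T ?a ?k) (K - {0})) / norm ?P \<le> C * Z * exp (- (t * \<epsilon> / 2))"
      unfolding pos_divide_le_eq[OF zero_less_norm_iff[THEN iffD2, OF P0]] by (simp only: mult_ac)
    have "S (\<lambda>_. 0) ?k ?a / ?P - lterm w k t = infsum (T ?a ?k) (K - {0}) / ?P"
      unfolding S add_divide_distrib nonzero_mult_div_cancel_left[OF P0] by (rule add_diff_cancel_left')
    then show "norm (S (\<lambda>_. 0) ?k ?a / ?P - lterm w k t) \<le> C * Z * exp (- (t * \<epsilon> / 2))"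
      using n by (simp only: norm_divide)
  qed
qed

lemma lterm_scaled_tendsto:
  assumes "total_degree k \<le> d"
  shows "((\<lambda>t. lterm w k t / of_real t ^ d) \<longlongrightarrow>
    (\<Prod>i\<in>UNIV. of_real (- w $ i) ^ Poly_Mapping.lookup k i / fact (Poly_Mapping.lookup k i)) * 0 ^ (d - total_degree k)) at_top"
proof -
  let ?g = "\<lambda>t. (\<Prod>i\<in>UNIV. lpoly i 0 (Poly_Mapping.lookup k i) (of_real (- (B * v0 $ i + t * w $ i))) / of_real t ^ Poly_Mapping.lookup k i)
     * complex_of_real (inverse t) ^ (d - total_degree k)"
  have inv: "((\<lambda>t. complex_of_real (inverse t)) \<longlongrightarrow> 0) at_top"
    using tendsto_of_real[OF tendsto_inverse_0_at_top[OF filterlim_ident]] unfolding of_real_0 .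
  have "(?g \<longlongrightarrow> (\<Prod>i\<in>UNIV. of_real (- w $ i) ^ Poly_Mapping.lookup k i / fact (Poly_Mapping.lookup k i)) * 0 ^ (d - total_degree k)) at_top"
    unfolding vector_uminus_component
    by (intro tendsto_mult tendsto_prod tendsto_power inv lpoly_scaled_tendsto)
  moreover have "eventually (\<lambda>t. ?g t = lterm w k t / of_real t ^ d) at_top"
    using eventually_gt_at_top[of "0::real"]
  proof eventually_elim
    case (elim t)
    have "complex_of_real t ^ d = of_real t ^ total_degree k * of_real t ^ (d - total_degree k)"
      using assms by (simp flip: power_add)
    moreover have "(\<Prod>i\<in>UNIV. complex_of_real t ^ Poly_Mapping.lookup k i) = of_real t ^ total_degree k"
      by (simp add: total_degree_def power_sum)
    ultimately show ?case
      unfolding lterm_def prod_dividef of_real_inverse power_inverse by (simp add: divide_inverse)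
  qed
  ultimately show ?thesis by (rule Lim_transform_eventually)
qed

text \<open>Divide by \<open>t ^ d\<close> and let \<open>t\<close> tend to infinity: the remainder is exponentially small, and in the term \<open>l = 0\<close> only the monomials of degree \<open>d\<close> survive.\<close>

lemma leading_form_zero:
  assumes J: "J_functional \<phi>"
    and d: "\<And>k. k \<in> Mon \<Longrightarrow> \<phi> k \<noteq> 0 \<Longrightarrow> total_degree k \<le> d"
    and zero: "\<And>a. a \<in> U \<Longrightarrow> wsol \<phi> (\<lambda>_. 0) a = 0"
    and w: "w \<in> ball v0 \<epsilon>"
  shows "(\<Sum>k\<in>Mon. \<phi> k * ((\<Prod>i\<in>UNIV. of_real (- w $ i) ^ Poly_Mapping.lookup k i / fact (Poly_Mapping.lookup k i)) * 0 ^ (d - total_degree k))) = 0"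
proof -
  let ?L = "\<lambda>k. (\<Prod>i\<in>UNIV. complex_of_real (- w $ i) ^ Poly_Mapping.lookup k i / fact (Poly_Mapping.lookup k i)) * 0 ^ (d - total_degree k)"
  let ?F = "\<lambda>t. \<Sum>k\<in>Mon. \<phi> k * lterm w k t"
  have 1: "((\<lambda>t. \<Sum>k\<in>Mon. \<phi> k * (lterm w k t / of_real t ^ d)) \<longlongrightarrow> (\<Sum>k\<in>Mon. \<phi> k * ?L k)) at_top"
  proof (rule tendsto_sum)
    fix k assume k: "k \<in> Mon"
    show "((\<lambda>t. \<phi> k * (lterm w k t / of_real t ^ d)) \<longlongrightarrow> \<phi> k * ?L k) at_top"
    proof (cases "\<phi> k = 0")
      case False
      then show ?thesis by (intro tendsto_mult_left lterm_scaled_tendsto d k)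
    qed simp
  qed
  let ?D = "\<lambda>t k. S (\<lambda>_. 0) (Poly_Mapping.lookup k) (real_point (limit_ray w t)) / (\<Prod>i\<in>UNIV. real_point (limit_ray w t) $ i powi expo i 0)
      - lterm w k t"
  have "\<exists>C. \<forall>t>0. norm (?D t k) \<le> C * exp (- (t * \<epsilon> / 2))" for k
    using S_limit_ray_bound[OF w, of k] by blast
  then have "\<forall>k. \<exists>C. \<forall>t>0. norm (?D t k) \<le> C * exp (- (t * \<epsilon> / 2))" by (rule allI)
  from choice[OF this] obtain C where "\<forall>k. \<forall>t>0. norm (?D t k) \<le> C k * exp (- (t * \<epsilon> / 2))" by (rule exE)
  note C = this[rule_format]
  have F: "norm (?F t / of_real t ^ d) \<le> (\<Sum>k\<in>Mon. norm (\<phi> k) * C k) * exp (- (t * \<epsilon> / 2))" if t: "t \<ge> 1" for t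
  proof -
    have t0: "t > 0" using t by simp
    let ?P = "\<Prod>i\<in>UNIV. real_point (limit_ray w t) $ i powi expo i 0"
    have "(\<Sum>k\<in>Mon. \<phi> k * ?D t k) = wsol \<phi> (\<lambda>_. 0) (real_point (limit_ray w t)) / ?P - ?F t"
      by (simp only: wsol_def[OF J] right_diff_distrib sum_subtractf sum_divide_distrib times_divide_eq_right)
    then have "?F t = - (\<Sum>k\<in>Mon. \<phi> k * ?D t k)" unfolding zero[OF limit_ray_U[OF w t0]] by simp
    then have "norm (?F t) \<le> (\<Sum>k\<in>Mon. norm (\<phi> k * ?D t k))" using norm_sum[of "\<lambda>k. \<phi> k * ?D t k" Mon] by simp
    also have "\<dots> \<le> (\<Sum>k\<in>Mon. norm (\<phi> k) * C k * exp (- (t * \<epsilon> / 2)))"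
      unfolding norm_mult mult.assoc by (intro sum_mono mult_left_mono C t0) simp
    finally have n: "norm (?F t) \<le> (\<Sum>k\<in>Mon. norm (\<phi> k) * C k) * exp (- (t * \<epsilon> / 2))" unfolding sum_distrib_right .
    have "1 \<le> t ^ d" using t by simp
    then have "norm (?F t) / t ^ d \<le> norm (?F t) / 1" by (intro divide_left_mono) auto
    then show ?thesis using n t0 by (simp add: norm_divide norm_power)
  qed
  have "((\<lambda>t. ?F t / of_real t ^ d) \<longlongrightarrow> 0) at_top"
  proof (rule Lim_null_comparison)
    show "eventually (\<lambda>t. norm (?F t / of_real t ^ d) \<le> (\<Sum>k\<in>Mon. norm (\<phi> k) * C k) * exp (- (t * \<epsilon> / 2))) at_top"
      using eventually_ge_at_top[of 1] by eventually_elim (rule F)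
    have "filterlim (\<lambda>t. \<epsilon> / 2 * t) at_top at_top"
      using eps by (intro filterlim_tendsto_pos_mult_at_top[OF tendsto_const _ filterlim_ident]) simp
    then have "((\<lambda>t. exp (- (\<epsilon> / 2 * t))) \<longlongrightarrow> 0) at_top"
      by (intro filterlim_compose[OF exp_at_bot]) (simp only: filterlim_uminus_at_bot minus_minus)
    then have "((\<lambda>t. (\<Sum>k\<in>Mon. norm (\<phi> k) * C k) * exp (- (\<epsilon> / 2 * t))) \<longlongrightarrow> 0) at_top"
      by (rule tendsto_mult_right_zero)
    then show "((\<lambda>t. (\<Sum>k\<in>Mon. norm (\<phi> k) * C k) * exp (- (t * \<epsilon> / 2))) \<longlongrightarrow> 0) at_top"
      by (simp add: mult.commute)
  qed
  then have "((\<lambda>t. \<Sum>k\<in>Mon. \<phi> k * (lterm w k t / of_real t ^ d)) \<longlongrightarrow> 0) at_top"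
    unfolding sum_divide_distrib times_divide_eq_right .
  from tendsto_unique[OF _ 1 this] show ?thesis by simp
qed

theorem wsol_independent:
  assumes J: "J_functional \<phi>"
    and zero: "\<And>a. a \<in> U \<Longrightarrow> wsol \<phi> (\<lambda>_. 0) a = 0"
  shows "\<phi> k = 0"
proof (rule ccontr)
  assume "\<phi> k \<noteq> 0"
  define N where "N = {k \<in> Mon. \<phi> k \<noteq> 0}"
  have k: "k \<in> N" using \<open>\<phi> k \<noteq> 0\<close> functional_high[OF J, of k] by (auto simp: N_def Mon_def intro: leI)
  have fin: "finite N" using finite_Mon by (simp add: N_def)
  define d where "d = Max (total_degree ` N)"
  have dN: "total_degree k \<le> d" if "k \<in> Mon" "\<phi> k \<noteq> 0" for k
    unfolding d_def using that fin by (simp add: N_def)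
  have "d \<in> total_degree ` N" unfolding d_def using fin k by (intro Max_in) auto
  then obtain k' where k': "k' \<in> N" "total_degree k' = d" by blast
  define c where "c = (\<lambda>k. \<phi> k * (\<Prod>i\<in>UNIV. (-1) ^ Poly_Mapping.lookup k i / fact (Poly_Mapping.lookup k i)) * 0 ^ (d - total_degree k))"
  define \<delta> where "\<delta> = \<epsilon> / real CARD('p option)"
  have "c k' = 0"
  proof (rule polynomial_zero_on_box[where A = UNIV and M = Mon and e = Poly_Mapping.lookup and v = "\<lambda>i. v0 $ i" and \<delta> = \<delta>])
    show "finite (UNIV :: 'p option set)" "finite Mon" "k' \<in> Mon" using finite_Mon k' by (auto simp: N_def)
    show "\<delta> > 0" using eps by (simp add: \<delta>_def zero_less_card_finite del: card_option)
    show "k1 = k2" if "\<forall>i\<in>UNIV. Poly_Mapping.lookup k1 i = Poly_Mapping.lookup k2 i" for k1 k2 :: "'p monomial"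
      using that by (intro poly_mapping_eqI) simp
    fix w :: "'p option \<Rightarrow> real" assume w: "\<forall>i. \<bar>w i - v0 $ i\<bar> < \<delta>"
    let ?w = "(\<chi> i. w i) :: real ^ 'p option"
    have "dist v0 ?w = norm (?w - v0)" by (simp add: dist_norm norm_minus_commute)
    also have "\<dots> \<le> (\<Sum>i\<in>UNIV. \<bar>(?w - v0) $ i\<bar>)" by (rule norm_le_l1_cart)
    also have "\<dots> < (\<Sum>i\<in>(UNIV :: 'p option set). \<delta>)" by (rule sum_strict_mono) (use w in auto)
    also have "\<dots> = \<epsilon>" by (simp add: \<delta>_def del: card_option)
    finally have wb: "?w \<in> ball v0 \<epsilon>" by simp
    have c_eq: "c k * (\<Prod>i\<in>UNIV. complex_of_real (w i) ^ Poly_Mapping.lookup k i) =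
      \<phi> k * ((\<Prod>i\<in>UNIV. of_real (- ?w $ i) ^ Poly_Mapping.lookup k i / fact (Poly_Mapping.lookup k i)) * 0 ^ (d - total_degree k))" for k
    proof -
      have "(\<Prod>i\<in>UNIV. of_real (- ?w $ i) ^ Poly_Mapping.lookup k i / fact (Poly_Mapping.lookup k i)) =
        (\<Prod>i\<in>UNIV. ((-1) ^ Poly_Mapping.lookup k i / fact (Poly_Mapping.lookup k i)) * complex_of_real (w i) ^ Poly_Mapping.lookup k i)"
        by (rule prod.cong[OF refl]) (simp add: power_minus[of "complex_of_real (w _)"])
      then show ?thesis unfolding c_def prod.distrib by (simp only: mult_ac)
    qed
    show "(\<Sum>k\<in>Mon. c k * (\<Prod>i\<in>UNIV. complex_of_real (w i) ^ Poly_Mapping.lookup k i)) = 0"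
      unfolding c_eq
      by (rule leading_form_zero[OF J _ _ wb]) (rule dN, assumption, assumption, rule zero, assumption)
  qed
  then show False using k' by (simp add: c_def N_def)
qed

end

section \<open>Tools for the completeness of the solutions\<close>

lemma derivative_sequence_zero:
  fixes G :: "nat \<Rightarrow> complex \<Rightarrow> complex"
  assumes S: "open A" "connected A" "z \<in> A" "w \<in> A"
    and G: "\<And>n t. t \<in> A \<Longrightarrow> (G n has_field_derivative G (Suc n) t) (at t)"
    and zero: "\<And>n. G n z = 0"
  shows "G 0 w = 0"
proof (rule holomorphic_fun_eq_0_on_connected[of "G 0" A z w])
  show "G 0 holomorphic_on A"
    unfolding holomorphic_on_def field_differentiable_def
    using G has_field_derivative_at_within by blast
  have "(deriv ^^ n) (G 0) t = G n t" if "t \<in> A" for n t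
    using that
  proof (induction n arbitrary: t)
    case (Suc n)
    have "eventually (\<lambda>t. t \<in> A) (nhds t)" using S(1) Suc.prems by (simp add: eventually_nhds_in_open)
    then have "eventually (\<lambda>t. (deriv ^^ n) (G 0) t = G n t) (nhds t)"
      by eventually_elim (rule Suc.IH)
    then have "deriv ((deriv ^^ n) (G 0)) t = deriv (G n) t" by (rule deriv_cong_ev) simp
    then show ?case using DERIV_imp_deriv[OF G[OF Suc.prems]] by simp
  qed simp
  then show "(deriv ^^ n) (G 0) z = 0" for n using S(3) zero by simp
qed (use S in auto)

lemma multi_partial_0: "multi_partial (\<lambda>_. 0) \<Phi> = \<Phi>"
proof -
  have "foldr (\<lambda>i. partial i ^^ 0) L \<Phi> = \<Phi>" for L by (induction L) auto
  then show ?thesis by (simp only: multi_partial_def)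
qed

text \<open>The set where all derivatives vanish is closed in \<open>U\<close> by continuity.  It is open because on a line through such a point all derivatives of the restriction vanish.\<close>

lemma holomorphic_Cn_identity:
  fixes \<Phi> :: "complex ^ 'i::finite \<Rightarrow> complex"
  assumes U: "open U" "connected U" and hol: "holomorphic_Cn \<Phi> U"
    and a: "a \<in> U" "\<And>\<kappa>. multi_partial \<kappa> \<Phi> a = 0" and b: "b \<in> U"
  shows "\<Phi> b = 0"
proof -
  define D where "D = (\<lambda>\<kappa>. multi_partial \<kappa> \<Phi>)"
  have D_hol: "holomorphic_Cn (D \<kappa>) U" for \<kappa>
    unfolding D_def by (rule holomorphic_Cn_multi_partial[OF U(1) hol])
  have D_partial: "partial i (D \<kappa>) x = D (\<kappa>(i := Suc (\<kappa> i))) x" if "x \<in> U" for i \<kappa> x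
    unfolding D_def by (rule partial_multi_partial[OF U(1) hol that])
  have D0: "D (\<lambda>_. 0) x = \<Phi> x" for x
    unfolding D_def multi_partial_0 ..
  define Z where "Z = {x \<in> U. \<forall>\<kappa>. D \<kappa> x = 0}"
  have spread: "D \<kappa> y = 0" if x: "x \<in> Z" and r: "r > 0" "ball x r \<subseteq> U" and y: "y \<in> ball x r" for x y r \<kappa>
  proof (cases "y = x")
    case False
    define h where "h = y - x"
    have h: "norm h > 0" "norm h < r" using False y by (auto simp: h_def dist_norm norm_minus_commute)
    define L where "L = ball (0::complex) (r / norm h)"
    have in_U: "x + t *s h \<in> U" if "t \<in> L" for t
    proof -
      have "norm (t *s h) = norm t * norm h" by (rule norm_times_vec_le)
      moreover have "norm t * norm h < r" using that h by (simp add: L_def pos_less_divide_eq)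
      ultimately have "x + t *s h \<in> ball x r" by (simp add: dist_norm)
      then show ?thesis using r by blast
    qed
    (* G n is the n-th directional derivative in direction h, as a function on the line *)
    define G where "G = rec_nat (\<lambda>\<kappa> t. D \<kappa> (x + t *s h)) (\<lambda>n g \<kappa> t. \<Sum>i\<in>UNIV. h $ i * g (\<kappa>(i := Suc (\<kappa> i))) t)"
    have G0: "G 0 \<kappa> t = D \<kappa> (x + t *s h)"
      and GS: "G (Suc n) \<kappa> t = (\<Sum>i\<in>UNIV. h $ i * G n (\<kappa>(i := Suc (\<kappa> i))) t)" for n \<kappa> t
      unfolding G_def by simp_all
    have G_deriv: "(G n \<kappa> has_field_derivative G (Suc n) \<kappa> t) (at t)" if t: "t \<in> L" for n \<kappa> t
    proof (induction n arbitrary: \<kappa>)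
      case 0
      have "((\<lambda>t. D \<kappa> (x + t *s h)) has_field_derivative
         (\<Sum>i\<in>UNIV. h $ i * partial i (D \<kappa>) (x + t *s h))) (at t)"
        by (rule holomorphic_Cn_line[OF D_hol in_U[OF t]])
      then show ?case unfolding GS G0 D_partial[OF in_U[OF t]] G0[abs_def] .
    next
      case (Suc n)
      have "((\<lambda>t. \<Sum>i\<in>UNIV. h $ i * G n (\<kappa>(i := Suc (\<kappa> i))) t) has_field_derivative
         (\<Sum>i\<in>UNIV. h $ i * G (Suc n) (\<kappa>(i := Suc (\<kappa> i))) t)) (at t)"
        by (intro DERIV_sum DERIV_cmult Suc.IH)
      then show ?case unfolding GS[of "Suc n"] GS[of n \<kappa>, abs_def] .
    qed
    have Gzero: "G n \<kappa> 0 = 0" for n \<kappa>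
    proof (induction n arbitrary: \<kappa>)
      case 0
      show ?case using x by (simp add: G0 Z_def)
    qed (simp add: GS)
    have "G 0 \<kappa> 1 = 0"
    proof (rule derivative_sequence_zero[where A = L and z = 0 and G = "\<lambda>n. G n \<kappa>"])
      show "open L" "connected L" by (simp_all add: L_def)
      show "0 \<in> L" "1 \<in> L" using h r by (simp_all add: L_def pos_less_divide_eq)
    qed (auto intro: G_deriv Gzero)
    then show ?thesis by (simp add: G0 h_def)
  qed (use x in \<open>simp add: Z_def\<close>)
  have "open Z"
    unfolding open_contains_ball
  proof
    fix x assume x: "x \<in> Z"
    then have "x \<in> U" by (simp add: Z_def)
    then obtain r where r: "r > 0" "ball x r \<subseteq> U" using U(1) openE by blast
    have "ball x r \<subseteq> Z" unfolding Z_def using spread[OF x r] r by blast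
    then show "\<exists>r>0. ball x r \<subseteq> Z" using r(1) by blast
  qed
  define N where "N = (\<Union>\<kappa>. {x \<in> U. D \<kappa> x \<noteq> 0})"
  have "open {x \<in> U. D \<kappa> x \<noteq> 0}" for \<kappa>
  proof -
    have "open (U \<inter> D \<kappa> -` (- {0}))"
      by (rule continuous_open_preimage[OF holomorphic_Cn_continuous[OF U(1) D_hol] U(1)]) auto
    also have "U \<inter> D \<kappa> -` (- {0}) = {x \<in> U. D \<kappa> x \<noteq> 0}" by blast
    finally show ?thesis .
  qed
  then have "open N" unfolding N_def by (intro open_UN) blast
  have "Z \<inter> U = {} \<or> N \<inter> U = {}"
    by (rule connectedD[OF U(2) \<open>open Z\<close> \<open>open N\<close>]) (auto simp: Z_def N_def)
  moreover have "a \<in> Z" using a by (simp add: Z_def D_def)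
  ultimately have "N \<inter> U = {}" using a(1) by blast
  then have "D (\<lambda>_. 0) b = 0" using b by (auto simp: N_def)
  then show ?thesis by (simp only: D0)
qed

text \<open>The sum of the generators in \<open>A\<close> lies in some cone of the fan by convexity of the support, and by unimodularity it is a nonnegative integral combination of the generators of that cone.  The coefficients sum to at most \<open>card A\<close> because the degree function is subadditive; the deficit becomes the coefficient of \<open>\<mu>\<^sub>0 = 0\<close>.\<close>

lemma (in semi_positive_fan) nonface_reduction:
  assumes ns: "nonsingular_toric_variety \<Sigma>" and A: "\<not> (\<exists>\<sigma>\<in>\<Sigma>. \<mu> ` A \<subseteq> \<sigma>)"
  obtains c :: "'p monomial" and l where "total_degree c = card A" "l \<in> dual_cone_lattice \<Sigma> \<mu>" "l \<noteq> 0"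
    "\<And>i. l $ i = int (Poly_Mapping.lookup (sq A) i) - int (Poly_Mapping.lookup c i)"
proof -
  obtain \<alpha> where \<alpha>: "degree_function \<alpha>" using degree_function_exists by blast
  define x where "x = (\<Sum>j\<in>A. \<mu> j)"
  have "x \<in> fan_support \<Sigma> \<and> \<alpha> x \<le> real (card A)"
    unfolding x_def using finite[of A]
  proof (induction A rule: finite_induct)
    case empty
    show ?case using support_0 degree_0[OF \<alpha>] by simp
  next
    case (insert j A)
    have "\<alpha> (\<mu> j + (\<Sum>j\<in>A. \<mu> j)) \<le> \<alpha> (\<mu> j) + \<alpha> (\<Sum>j\<in>A. \<mu> j)"
      using insert.IH by (intro degree_add[OF \<alpha>] mu_support) blast
    then show ?case
      using insert support_add[OF mu_support] degree_mu[OF \<alpha>, of j] by simp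
  qed
  then have xs: "x \<in> fan_support \<Sigma>" and xd: "\<alpha> x \<le> real (card A)" by auto
  then obtain \<sigma> where \<sigma>: "\<sigma> \<in> \<Sigma>" "x \<in> \<sigma>" "dim \<sigma> = CARD('n)"
    unfolding support_iff using cone_in_full_cone by blast
  have "x \<in> integer_lattice" unfolding x_def by (rule lattice_sum[OF mu_lattice])
  from nonsingular_integral_coordinates[OF \<sigma>(1,3) ns \<sigma>(2) this]
  obtain c0 :: "'p \<Rightarrow> nat" where c0: "x = (\<Sum>j\<in>gens \<sigma>. real (c0 j) *\<^sub>R \<mu> j)" by blast
  obtain f where f: "linear f" "\<forall>x\<in>\<sigma>. \<alpha> x = f x" using degree_linear_on_cone[OF \<alpha> \<sigma>(1)] by blast
  have "f (\<mu> j) = 1" if "j \<in> gens \<sigma>" for j using f(2) degree_mu[OF \<alpha>, of j] that by auto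
  then have "\<alpha> x = (\<Sum>j\<in>gens \<sigma>. real (c0 j))"
    using f \<sigma>(2) by (subst c0[THEN sym] | simp add: c0 linear_sum linear_scale)+
  then have le: "(\<Sum>j\<in>gens \<sigma>. c0 j) \<le> card A" using xd by (simp flip: of_nat_sum)
  define c :: "'p monomial" where "c = (\<Sum>j\<in>gens \<sigma>. Poly_Mapping.single (Some j) (c0 j))
     + Poly_Mapping.single None (card A - (\<Sum>j\<in>gens \<sigma>. c0 j))"
  have c_None: "Poly_Mapping.lookup c None = card A - (\<Sum>j\<in>gens \<sigma>. c0 j)"
    by (simp add: c_def lookup_add lookup_sum lookup_single)
  have c_Some: "Poly_Mapping.lookup c (Some j) = (if j \<in> gens \<sigma> then c0 j else 0)" for j
    by (simp add: c_def lookup_add lookup_sum lookup_single when_def)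
  have cdeg: "total_degree c = card A"
    unfolding total_degree_def sum_option c_None c_Some using le by (simp add: sum.If_cases)
  define l :: "int ^ 'p option" where
    "l = (\<chi> i. int (Poly_Mapping.lookup (sq A) i) - int (Poly_Mapping.lookup c i))"
  have l: "l $ i = int (Poly_Mapping.lookup (sq A) i) - int (Poly_Mapping.lookup c i)" for i
    by (simp add: l_def)
  have "(\<Sum>i\<in>UNIV. l $ i) = int (total_degree (sq A)) - int (total_degree c)"
    unfolding l total_degree_def sum_subtractf by simp
  then have l0: "(\<Sum>i\<in>UNIV. l $ i) = 0" using cdeg by simp
  have "(\<Sum>i\<in>UNIV. real_of_int (l $ i) *\<^sub>R mu \<mu> i) =
     (\<Sum>j\<in>UNIV. (if j \<in> A then \<mu> j else 0) - (if j \<in> gens \<sigma> then real (c0 j) *\<^sub>R \<mu> j else 0))"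
    unfolding sum_option by (simp add: mu_def l lookup_sq c_Some if_distrib scaleR_diff_left cong: if_cong)
      (intro sum.cong refl, simp add: scaleR_diff_left)
  also have "\<dots> = x - x"
    unfolding sum_subtractf by (simp add: sum.If_cases x_def[symmetric] c0[symmetric])
  finally have rel: "l \<in> relation_lattice \<mu>" using l0 by (simp add: relation_lattice_iff)
  have neg: "j \<in> gens \<sigma>" if "l $ Some j < 0" for j
    using that unfolding l c_Some by (auto split: if_splits)
  have lK: "l \<in> dual_cone_lattice \<Sigma> \<mu>"
    by (rule in_dual_cone_if_negative_part_in_cone[OF rel]) (use neg \<sigma>(1) in \<open>intro bexI[of _ \<sigma>], auto\<close>)
  have "l \<noteq> 0"
  proof
    assume "l = 0"
    have "\<mu> j \<in> \<sigma>" if "j \<in> A" for j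
      using l[of "Some j"] that unfolding \<open>l = 0\<close> c_Some lookup_sq by (auto split: if_splits)
    then show False using A \<sigma>(1) by blast
  qed
  from that[OF cdeg lK this l] show ?thesis .
qed

lemma partial_sum:
  fixes F :: "'j \<Rightarrow> complex ^ 'i::finite \<Rightarrow> complex"
  assumes "\<And>j. j \<in> A \<Longrightarrow> holomorphic_Cn (F j) U"
  shows "holomorphic_Cn (\<lambda>a. \<Sum>j\<in>A. c j * F j a) U"
    and "a \<in> U \<Longrightarrow> partial i (\<lambda>a. \<Sum>j\<in>A. c j * F j a) a = (\<Sum>j\<in>A. c j * partial i (F j) a)"
proof -
  have "((\<lambda>a. \<Sum>j\<in>A. c j * F j a) has_derivative
     (\<lambda>h. \<Sum>i\<in>UNIV. h $ i * (\<Sum>j\<in>A. c j * partial i (F j) a))) (at a)" if a: "a \<in> U" for a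
  proof -
    have "((\<lambda>a. \<Sum>j\<in>A. c j * F j a) has_derivative
      (\<lambda>h. \<Sum>j\<in>A. c j * (\<Sum>i\<in>UNIV. h $ i * partial i (F j) a))) (at a)"
      by (intro has_derivative_sum has_derivative_mult_right holomorphic_Cn_has_derivative[OF assms a])
    moreover have "(\<Sum>j\<in>A. c j * (\<Sum>i\<in>UNIV. h $ i * partial i (F j) a)) =
      (\<Sum>i\<in>UNIV. h $ i * (\<Sum>j\<in>A. c j * partial i (F j) a))" for h :: "complex ^ 'i"
      unfolding sum_distrib_left by (subst sum.swap) (simp only: mult.left_commute)
    ultimately show ?thesis by (simp only:)
  qed
  note H = holomorphic_CnI[of U "\<lambda>a. \<Sum>j\<in>A. c j * F j a" "\<lambda>a i. \<Sum>j\<in>A. c j * partial i (F j) a", OF this]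
  show "holomorphic_Cn (\<lambda>a. \<Sum>j\<in>A. c j * F j a) U" by (rule H(1))
  show "a \<in> U \<Longrightarrow> partial i (\<lambda>a. \<Sum>j\<in>A. c j * F j a) a = (\<Sum>j\<in>A. c j * partial i (F j) a)" by (rule H(2))
qed

lemma multi_partial_sum:
  fixes F :: "'j \<Rightarrow> complex ^ 'i::finite \<Rightarrow> complex"
  assumes "open U" "\<And>j. j \<in> A \<Longrightarrow> holomorphic_Cn (F j) U" "a \<in> U"
  shows "multi_partial \<kappa> (\<lambda>a. \<Sum>j\<in>A. c j * F j a) a = (\<Sum>j\<in>A. c j * multi_partial \<kappa> (F j) a)"
proof (rule multi_partial_family[OF assms(1) _ _ assms(3), of "\<lambda>\<kappa> a. \<Sum>j\<in>A. c j * multi_partial \<kappa> (F j) a"])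
  fix \<kappa> i a assume a: "a \<in> U"
  show "partial i (\<lambda>a. \<Sum>j\<in>A. c j * multi_partial \<kappa> (F j) a) a =
    (\<Sum>j\<in>A. c j * multi_partial (\<kappa>(i := Suc (\<kappa> i))) (F j) a)"
  proof -
    have "partial i (\<lambda>a. \<Sum>j\<in>A. c j * multi_partial \<kappa> (F j) a) a = (\<Sum>j\<in>A. c j * partial i (multi_partial \<kappa> (F j)) a)"
      by (rule partial_sum(2)[OF _ a]) (rule holomorphic_Cn_multi_partial[OF assms(1,2)])
    also have "\<dots> = (\<Sum>j\<in>A. c j * multi_partial (\<kappa>(i := Suc (\<kappa> i))) (F j) a)"
      by (intro sum.cong refl arg_cong2[where f = "(*)"] partial_multi_partial[OF assms(1,2) a])
    finally show ?thesis .
  qed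
next
  fix a
  show "(\<Sum>j\<in>A. c j * F j a) = (\<Sum>j\<in>A. c j * multi_partial (\<lambda>_. 0) (F j) a)"
    unfolding multi_partial_0 ..
qed

lemma gkz_solution_sum:
  assumes U: "open U" and sol: "\<And>j. j \<in> A \<Longrightarrow> gkz_solution \<mu> \<beta> U (F j)"
  shows "gkz_solution \<mu> \<beta> U (\<lambda>a. \<Sum>j\<in>A. c j * F j a)"
proof -
  have hol: "holomorphic_Cn (F j) U" if "j \<in> A" for j using sol[OF that] by (simp add: gkz_solution_def)
  have euler: "(\<Sum>i\<in>UNIV. s i * (a $ i * partial i (\<lambda>a. \<Sum>j\<in>A. c j * F j a) a)) - b * (\<Sum>j\<in>A. c j * F j a) =
     (\<Sum>j\<in>A. c j * ((\<Sum>i\<in>UNIV. s i * (a $ i * partial i (F j) a)) - b * F j a))" if a: "a \<in> U" for s a b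
  proof -
    have "(\<Sum>i\<in>UNIV. s i * (a $ i * (\<Sum>j\<in>A. c j * partial i (F j) a))) =
      (\<Sum>j\<in>A. c j * (\<Sum>i\<in>UNIV. s i * (a $ i * partial i (F j) a)))"
      unfolding sum_distrib_left by (subst sum.swap) (simp only: mult.left_commute)
    moreover have "b * (\<Sum>j\<in>A. c j * F j a) = (\<Sum>j\<in>A. c j * (b * F j a))"
      unfolding sum_distrib_left by (simp only: mult.left_commute)
    moreover have "partial i (\<lambda>a. \<Sum>j\<in>A. c j * F j a) a = (\<Sum>j\<in>A. c j * partial i (F j) a)" for i
      by (rule partial_sum(2)[OF _ a]) (rule hol)
    ultimately show ?thesis
      unfolding right_diff_distrib sum_subtractf by (simp only:)
  qed
  show ?thesis
    unfolding gkz_solution_def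
  proof (intro conjI ballI allI)
    show "holomorphic_Cn (\<lambda>a. \<Sum>j\<in>A. c j * F j a) U" by (rule partial_sum(1)[OF hol])
    fix a assume a: "a \<in> U"
    have e: "(\<Sum>i\<in>UNIV. of_real (fst (mu_bar \<mu> i)) * (a $ i * partial i (F j) a)) - fst \<beta> * F j a = 0"
      "(\<Sum>i\<in>UNIV. of_real (snd (mu_bar \<mu> i) $ k) * (a $ i * partial i (F j) a)) - snd \<beta> $ k * F j a = 0"
      "l \<in> relation_lattice \<mu> \<Longrightarrow> box_operator l (F j) a = 0"
      if "j \<in> A" for j k l
      using sol[OF that] a by (simp_all add: gkz_solution_def)
    show "(\<Sum>i\<in>UNIV. of_real (fst (mu_bar \<mu> i)) * (a $ i * partial i (\<lambda>a. \<Sum>j\<in>A. c j * F j a) a)) - fst \<beta> * (\<Sum>j\<in>A. c j * F j a) = 0"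
      unfolding euler[OF a] by (rule sum.neutral, rule ballI) (simp only: e(1) mult_zero_right)
    show "(\<Sum>i\<in>UNIV. of_real (snd (mu_bar \<mu> i) $ k) * (a $ i * partial i (\<lambda>a. \<Sum>j\<in>A. c j * F j a) a)) - snd \<beta> $ k * (\<Sum>j\<in>A. c j * F j a) = 0" for k
      unfolding euler[OF a] by (rule sum.neutral, rule ballI) (simp only: e(2) mult_zero_right)
    show "box_operator l (\<lambda>a. \<Sum>j\<in>A. c j * F j a) a = 0" if l: "l \<in> relation_lattice \<mu>" for l
    proof -
      have "box_operator l (\<lambda>a. \<Sum>j\<in>A. c j * F j a) a = (\<Sum>j\<in>A. c j * box_operator l (F j) a)"
      proof -
        have "multi_partial \<kappa> (\<lambda>a. \<Sum>j\<in>A. c j * F j a) a = (\<Sum>j\<in>A. c j * multi_partial \<kappa> (F j) a)" for \<kappa>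
          by (rule multi_partial_sum[OF U _ a]) (rule hol)
        then show ?thesis unfolding box_operator_def by (simp only: right_diff_distrib sum_subtractf)
      qed
      also have "\<dots> = 0" by (rule sum.neutral, rule ballI) (simp only: e(3)[OF _ l] mult_zero_right)
      finally show ?thesis .
    qed
  qed
qed

text \<open>Differentiate the Euler equation: commuting \<open>\<partial>\<^sub>j\<close> past \<open>a\<^sub>j \<partial>\<^sub>j\<close> adds \<open>\<partial>\<^sub>j\<close>, which shifts the eigenvalue.\<close>

lemma euler_derivatives:
  fixes \<Phi> :: "complex ^ 'i::finite \<Rightarrow> complex"
  assumes U: "open U" and hol: "holomorphic_Cn \<Phi> U"
    and euler: "\<And>a. a \<in> U \<Longrightarrow> (\<Sum>i\<in>UNIV. c i * (a $ i * partial i \<Phi> a)) = s * \<Phi> a"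
  shows "a \<in> U \<Longrightarrow> (\<Sum>i\<in>UNIV. c i * (a $ i * multi_partial (\<kappa>(i := Suc (\<kappa> i))) \<Phi> a)) =
    (s - (\<Sum>i\<in>UNIV. c i * of_nat (\<kappa> i))) * multi_partial \<kappa> \<Phi> a"
proof (induction "\<Sum>i\<in>UNIV. \<kappa> i" arbitrary: \<kappa> a)
  case 0
  then have \<kappa>: "\<kappa> = (\<lambda>_. 0)" by auto
  note z = multi_partial_0[of \<Phi>]
  have "multi_partial (\<kappa>(i := Suc (\<kappa> i))) \<Phi> a = partial i \<Phi> a" for i
    using partial_multi_partial[OF U hol 0(2), of i \<kappa>, symmetric] by (simp only: \<kappa> z)
  then show ?case using euler[OF 0(2)] by (simp only: \<kappa> z of_nat_0 mult_zero_right sum.neutral_const diff_zero)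
next
  case (Suc n)
  let ?D = "\<lambda>\<kappa>. multi_partial \<kappa> \<Phi>"
  have "\<exists>j. \<kappa> j \<noteq> 0"
  proof (rule ccontr)
    assume "\<not> (\<exists>j. \<kappa> j \<noteq> 0)"
    then have "(\<Sum>i\<in>UNIV. \<kappa> i) = 0" by simp
    with Suc.hyps(2) show False by simp
  qed
  then obtain j where j: "\<kappa> j \<noteq> 0" by blast
  define \<rho> where "\<rho> = \<kappa>(j := \<kappa> j - 1)"
  have \<kappa>: "\<kappa> = \<rho>(j := Suc (\<rho> j))" using j by (auto simp: \<rho>_def)
  have lsum: "(\<Sum>i\<in>UNIV. \<kappa> i) = Suc (\<Sum>i\<in>UNIV. \<rho> i)"
    using sum.remove[of UNIV j \<kappa>] sum.remove[of UNIV j \<rho>] sum.cong[of "UNIV - {j}" "UNIV - {j}" \<kappa> \<rho>]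
    by (simp add: \<kappa>)
  define \<epsilon> where "\<epsilon> = axis j (1::complex)"
  let ?s = "s - (\<Sum>i\<in>UNIV. c i * of_nat (\<rho> i))"
  have line: "((\<lambda>t. ?D \<nu> (a + t *s \<epsilon>)) has_field_derivative ?D (\<nu>(j := Suc (\<nu> j))) a) (at 0)" for \<nu>
  proof -
    have "a + 0 *s \<epsilon> \<in> U" using Suc.prems by simp
    from holomorphic_Cn_line[OF holomorphic_Cn_multi_partial[OF U hol] this, of \<nu>]
    show ?thesis
      unfolding \<epsilon>_def sum_axis using Suc.prems partial_multi_partial[OF U hol Suc.prems] by simp
  qed
  have coord: "((\<lambda>t. (a + t *s \<epsilon>) $ i) has_field_derivative \<epsilon> $ i) (at 0)" for i
    by (auto intro!: derivative_eq_intros)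
  have d1: "((\<lambda>t. (\<Sum>i\<in>UNIV. c i * ((a + t *s \<epsilon>) $ i * ?D (\<rho>(i := Suc (\<rho> i))) (a + t *s \<epsilon>))) - ?s * ?D \<rho> (a + t *s \<epsilon>))
     has_field_derivative
     (\<Sum>i\<in>UNIV. c i * (\<epsilon> $ i * ?D (\<rho>(i := Suc (\<rho> i))) (a + 0 *s \<epsilon>) + ?D ((\<rho>(i := Suc (\<rho> i)))(j := Suc ((\<rho>(i := Suc (\<rho> i))) j))) a * (a + 0 *s \<epsilon>) $ i))
       - ?s * ?D (\<rho>(j := Suc (\<rho> j))) a) (at 0)"
    by (intro DERIV_diff DERIV_sum DERIV_cmult DERIV_mult coord line)
  have "open ((\<lambda>t. a + t *s \<epsilon>) -` U)"
    by (rule open_vimage[OF U])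
      (intro continuous_on_add continuous_on_const linear_continuous_on linear_linear[THEN iffD2] linear_times_vec)
  moreover have "0 \<in> (\<lambda>t. a + t *s \<epsilon>) -` U" using Suc.prems by simp
  ultimately have "eventually (\<lambda>t. t \<in> (\<lambda>t. a + t *s \<epsilon>) -` U) (nhds 0)" by (rule eventually_nhds_in_open)
  then have ev: "eventually (\<lambda>t. (\<Sum>i\<in>UNIV. c i * ((a + t *s \<epsilon>) $ i * ?D (\<rho>(i := Suc (\<rho> i))) (a + t *s \<epsilon>))) - ?s * ?D \<rho> (a + t *s \<epsilon>) = 0) (nhds 0)"
  proof eventually_elim
    case (elim t)
    then have "a + t *s \<epsilon> \<in> U" by simp
    moreover have "n = (\<Sum>i\<in>UNIV. \<rho> i)" using Suc.hyps(2) lsum by simp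
    ultimately show ?case using Suc.hyps(1)[of \<rho> "a + t *s \<epsilon>"] by simp
  qed
  have "((\<lambda>t. 0) has_field_derivative
     (\<Sum>i\<in>UNIV. c i * (\<epsilon> $ i * ?D (\<rho>(i := Suc (\<rho> i))) (a + 0 *s \<epsilon>) + ?D ((\<rho>(i := Suc (\<rho> i)))(j := Suc ((\<rho>(i := Suc (\<rho> i))) j))) a * (a + 0 *s \<epsilon>) $ i))
       - ?s * ?D (\<rho>(j := Suc (\<rho> j))) a) (at (0::complex))"
    by (rule DERIV_cong_ev[THEN iffD1, OF refl ev refl d1])
  from DERIV_unique[OF this DERIV_const]
  have zero: "(\<Sum>i\<in>UNIV. c i * (\<epsilon> $ i * ?D (\<rho>(i := Suc (\<rho> i))) (a + 0 *s \<epsilon>) + ?D ((\<rho>(i := Suc (\<rho> i)))(j := Suc ((\<rho>(i := Suc (\<rho> i))) j))) a * (a + 0 *s \<epsilon>) $ i))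
       = ?s * ?D \<kappa> a" unfolding \<kappa> by simp
  have upd: "(\<rho>(i := Suc (\<rho> i)))(j := Suc ((\<rho>(i := Suc (\<rho> i))) j)) = \<kappa>(i := Suc (\<kappa> i))" for i
    unfolding \<kappa> by (rule ext) auto
  have a0: "a + 0 *s \<epsilon> = a" by simp
  have first: "(\<Sum>i\<in>UNIV. \<epsilon> $ i * (c i * ?D (\<rho>(i := Suc (\<rho> i))) a)) = c j * ?D \<kappa> a"
    unfolding \<epsilon>_def sum_axis \<kappa>[symmetric] ..
  have reorder: "c i * (\<epsilon> $ i * x + y * a $ i) = \<epsilon> $ i * (c i * x) + c i * (a $ i * y)" for i x y by algebra
  have "(\<Sum>i\<in>UNIV. c i * (a $ i * ?D (\<kappa>(i := Suc (\<kappa> i))) a)) + c j * ?D \<kappa> a = ?s * ?D \<kappa> a"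
    using zero unfolding upd a0 reorder sum.distrib first by (simp only: add.commute)
  moreover have "(\<Sum>i\<in>UNIV. c i * of_nat (\<kappa> i)) = (\<Sum>i\<in>UNIV. c i * of_nat (\<rho> i)) + c j"
  proof -
    have "c i * of_nat (\<kappa> i) = c i * of_nat (\<rho> i) + axis j 1 $ i * c i" for i
      unfolding \<kappa> by (simp add: axis_def distrib_left)
    then show ?thesis by (simp add: sum.distrib)
  qed
  ultimately show ?case unfolding left_diff_distrib distrib_right by (simp only: eq_diff_eq diff_diff_eq distrib_right add_ac)
qed

section \<open>Jets of solutions and completeness\<close>

lemma multi_partial_cong:
  fixes \<Phi> :: "complex ^ 'i::finite \<Rightarrow> complex"
  assumes "open U" "holomorphic_Cn \<Psi> U" "\<And>a. a \<in> U \<Longrightarrow> \<Phi> a = \<Psi> a" "a \<in> U"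
  shows "multi_partial \<kappa> \<Phi> a = multi_partial \<kappa> \<Psi> a"
  by (rule multi_partial_family[OF assms(1) partial_multi_partial[OF assms(1,2)] _ assms(4)])
    (simp_all only: multi_partial_0 assms(3))

lemma multi_partial_add:
  fixes \<Phi> :: "complex ^ 'i::finite \<Rightarrow> complex"
  assumes "open U" "holomorphic_Cn \<Phi> U" "a \<in> U"
  shows "multi_partial \<kappa> (multi_partial \<nu> \<Phi>) a = multi_partial (\<lambda>i. \<kappa> i + \<nu> i) \<Phi> a"
proof (rule multi_partial_family[OF assms(1) _ _ assms(3), of "\<lambda>\<kappa>. multi_partial (\<lambda>i. \<kappa> i + \<nu> i) \<Phi>"])
  fix \<kappa> i and a assume a: "a \<in> U"
  have "(\<lambda>i. \<kappa> i + \<nu> i)(i := Suc (\<kappa> i + \<nu> i)) = (\<lambda>j. (\<kappa>(i := Suc (\<kappa> i))) j + \<nu> j)" by (rule ext) simp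
  then show "partial i (multi_partial (\<lambda>i. \<kappa> i + \<nu> i) \<Phi>) a = multi_partial (\<lambda>j. (\<kappa>(i := Suc (\<kappa> i))) j + \<nu> j) \<Phi> a"
    using partial_multi_partial[OF assms(1,2) a, of i "\<lambda>i. \<kappa> i + \<nu> i"] by simp
qed (simp only: add_0)

text \<open>The exponents \<open>P\<close> and \<open>Q\<close> may have a common part; it is an additional derivative of the box equation.\<close>

lemma box_equation_derivatives:
  fixes \<Phi> :: "complex ^ 'i::finite \<Rightarrow> complex"
  assumes U: "open U" and hol: "holomorphic_Cn \<Phi> U"
    and box: "\<And>a. a \<in> U \<Longrightarrow> box_operator l \<Phi> a = 0"
    and l: "\<And>i. l $ i = int (P i) - int (Q i)" and a: "a \<in> U"
  shows "multi_partial (\<lambda>i. \<kappa> i + P i) \<Phi> a = multi_partial (\<lambda>i. \<kappa> i + Q i) \<Phi> a"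
proof -
  let ?p = "\<lambda>i. nat (l $ i)" and ?n = "\<lambda>i. nat (- l $ i)"
  define g where "g = (\<lambda>i. \<kappa> i + (P i - ?p i))"
  have P: "\<kappa> i + P i = g i + ?p i" and Q: "\<kappa> i + Q i = g i + ?n i" for i
    using l[of i] by (auto simp: g_def)
  have "multi_partial (\<lambda>i. g i + ?p i) \<Phi> a = multi_partial g (multi_partial ?p \<Phi>) a"
    by (rule multi_partial_add[OF U hol a, symmetric])
  also have "\<dots> = multi_partial g (multi_partial ?n \<Phi>) a"
    by (rule multi_partial_cong[OF U holomorphic_Cn_multi_partial[OF U hol] _ a])
      (use box in \<open>simp add: box_operator_def\<close>)
  also have "\<dots> = multi_partial (\<lambda>i. g i + ?n i) \<Phi> a"
    by (rule multi_partial_add[OF U hol a])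
  finally show ?thesis unfolding P Q .
qed

text \<open>The scaling by \<open>a\<^sup>\<kappa>\<close> makes the Euler and box equations look like the generators of the ideal acting on a functional.\<close>

definition jet :: "(complex ^ 'p option \<Rightarrow> complex) \<Rightarrow> complex ^ 'p option \<Rightarrow> ('p::finite) monomial \<Rightarrow> complex" where
  "jet \<Phi> a \<kappa> = (\<Prod>i\<in>UNIV. a $ i ^ Poly_Mapping.lookup \<kappa> i) * multi_partial (Poly_Mapping.lookup \<kappa>) \<Phi> a"

lemma jet_euler:
  fixes \<Phi> :: "complex ^ ('p::finite) option \<Rightarrow> complex"
  assumes "open U" "holomorphic_Cn \<Phi> U"
    "\<And>a. a \<in> U \<Longrightarrow> (\<Sum>i\<in>UNIV. c i * (a $ i * partial i \<Phi> a)) = s * \<Phi> a" "a \<in> U"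
  shows "(\<Sum>i\<in>UNIV. c i * jet \<Phi> a (\<kappa> + Poly_Mapping.single i 1)) =
    (s - (\<Sum>i\<in>UNIV. c i * of_nat (Poly_Mapping.lookup \<kappa> i))) * jet \<Phi> a \<kappa>"
proof -
  let ?k = "Poly_Mapping.lookup \<kappa>"
  let ?P = "\<Prod>i\<in>UNIV. a $ i ^ ?k i"
  have jet: "jet \<Phi> a (\<kappa> + Poly_Mapping.single i 1) = ?P * (a $ i * multi_partial (?k(i := Suc (?k i))) \<Phi> a)" for i
  proof -
    have "Poly_Mapping.lookup (\<kappa> + Poly_Mapping.single i 1) = ?k(i := Suc (?k i))"
      by (rule ext) (simp add: lookup_add lookup_single when_def)
    moreover have "(\<Prod>j\<in>UNIV. a $ j ^ (?k(i := Suc (?k i))) j) = a $ i * ?P"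
    proof -
      have "(\<Prod>j\<in>UNIV - {i}. a $ j ^ (?k(i := Suc (?k i))) j) = (\<Prod>j\<in>UNIV - {i}. a $ j ^ ?k j)"
        by (rule prod.cong) auto
      then show ?thesis by (simp add: prod.remove[of UNIV i])
    qed
    ultimately show ?thesis unfolding jet_def by (simp only: mult_ac)
  qed
  have "(\<Sum>i\<in>UNIV. c i * jet \<Phi> a (\<kappa> + Poly_Mapping.single i 1)) =
    ?P * (\<Sum>i\<in>UNIV. c i * (a $ i * multi_partial (?k(i := Suc (?k i))) \<Phi> a))"
    unfolding jet sum_distrib_left by (simp only: mult.left_commute)
  also have "\<dots> = ?P * ((s - (\<Sum>i\<in>UNIV. c i * of_nat (?k i))) * multi_partial ?k \<Phi> a)"
    by (rule arg_cong[where f = "(*) ?P"], rule euler_derivatives[OF assms(1,2) _ assms(4)]) (rule assms(3))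
  finally show ?thesis unfolding jet_def by (simp only: mult.left_commute)
qed

lemma jet_box:
  fixes \<Phi> :: "complex ^ ('p::finite) option \<Rightarrow> complex"
  assumes U: "open U" "holomorphic_Cn \<Phi> U" "\<And>a. a \<in> U \<Longrightarrow> box_operator l \<Phi> a = 0"
    and l: "\<And>i. l $ i = int (Poly_Mapping.lookup P i) - int (Poly_Mapping.lookup Q i)"
    and a: "a \<in> U" "\<And>i. a $ i \<noteq> 0"
  shows "jet \<Phi> a (\<kappa> + P) = (\<Prod>i\<in>UNIV. a $ i powi l $ i) * jet \<Phi> a (\<kappa> + Q)"
proof -
  have lk: "Poly_Mapping.lookup (\<kappa> + R) = (\<lambda>i. Poly_Mapping.lookup \<kappa> i + Poly_Mapping.lookup R i)" for R
    by (rule ext) (simp add: lookup_add)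
  have "a $ i ^ (Poly_Mapping.lookup \<kappa> i + Poly_Mapping.lookup P i) =
    a $ i powi l $ i * a $ i ^ (Poly_Mapping.lookup \<kappa> i + Poly_Mapping.lookup Q i)" for i
  proof -
    have "l $ i + int (Poly_Mapping.lookup \<kappa> i + Poly_Mapping.lookup Q i) =
      int (Poly_Mapping.lookup \<kappa> i + Poly_Mapping.lookup P i)" unfolding l by simp
    then have "a $ i ^ (Poly_Mapping.lookup \<kappa> i + Poly_Mapping.lookup P i) =
      a $ i powi (l $ i + int (Poly_Mapping.lookup \<kappa> i + Poly_Mapping.lookup Q i))"
      by (simp only: power_int_of_nat)
    also have "\<dots> = a $ i powi l $ i * a $ i ^ (Poly_Mapping.lookup \<kappa> i + Poly_Mapping.lookup Q i)"
      using a(2)[of i] by (simp only: power_int_add power_int_of_nat simp_thms not_False_eq_True)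
    finally show ?thesis .
  qed
  then have "(\<Prod>i\<in>UNIV. a $ i ^ (Poly_Mapping.lookup \<kappa> i + Poly_Mapping.lookup P i)) =
    (\<Prod>i\<in>UNIV. a $ i powi l $ i) * (\<Prod>i\<in>UNIV. a $ i ^ (Poly_Mapping.lookup \<kappa> i + Poly_Mapping.lookup Q i))"
    by (simp only: prod.distrib)
  moreover have "multi_partial (\<lambda>i. Poly_Mapping.lookup \<kappa> i + Poly_Mapping.lookup P i) \<Phi> a =
    multi_partial (\<lambda>i. Poly_Mapping.lookup \<kappa> i + Poly_Mapping.lookup Q i) \<Phi> a"
    by (rule box_equation_derivatives[OF U(1,2) _ l a(1)]) (rule U(3))
  ultimately show ?thesis
    unfolding jet_def lk by (simp only: mult.assoc)
qed

lemma jet_sum: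
  fixes F :: "'j \<Rightarrow> complex ^ ('p::finite) option \<Rightarrow> complex"
  assumes "open U" "\<And>j. j \<in> A \<Longrightarrow> holomorphic_Cn (F j) U" "a \<in> U"
  shows "jet (\<lambda>a. \<Sum>j\<in>A. c j * F j a) a \<kappa> = (\<Sum>j\<in>A. c j * jet (F j) a \<kappa>)"
proof -
  have "multi_partial (Poly_Mapping.lookup \<kappa>) (\<lambda>a. \<Sum>j\<in>A. c j * F j a) a =
    (\<Sum>j\<in>A. c j * multi_partial (Poly_Mapping.lookup \<kappa>) (F j) a)"
    by (rule multi_partial_sum[OF assms(1) _ assms(3)]) (rule assms(2))
  then show ?thesis unfolding jet_def by (simp only: sum_distrib_left mult.left_commute)
qed

lemma lin_ext_linear_form:
  "lin_ext \<psi> (X k * (\<Sum>i\<in>UNIV. pm_scale (c i) (D_var i))) =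
    (\<Sum>i\<in>UNIV. c i * \<psi> (k + Poly_Mapping.single i 1))"
  by (simp only: lin_ext_times_X lin_ext_sum lin_ext_scale D_var_def lin_ext_single mult_1)

lemma lin_ext_sum_functional:
  "lin_ext (\<lambda>k. \<Sum>j\<in>A. c j * \<psi> j k) f = (\<Sum>j\<in>A. c j * lin_ext (\<psi> j) f)"
  unfolding lin_ext_def sum_distrib_left by (subst sum.swap) (simp only: mult.left_commute)

lemma contraction_estimate:
  fixes C b M :: real
  assumes "0 \<le> C" "0 \<le> b" "b = M / (2 * (C + 1))"
  shows "C * b \<le> M / 2"
proof -
  have pos: "0 < 2 * (C + 1)" using assms(1) by simp
  have nz: "2 * (C + 1) \<noteq> 0" using pos by (rule dual_order.strict_implies_not_eq)
  have "2 * (C * b) + 2 * b = b * (2 * (C + 1))"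
    by (simp only: distrib_left distrib_right mult_1_right mult_1_left mult_ac)
  also have "\<dots> = M" by (rule nonzero_eq_divide_eq[OF nz, THEN iffD1, OF assms(3)])
  finally show ?thesis using assms(2) by linarith
qed

context gkz_domain
begin

text \<open>All nonzero elements of the dual cone are made small at once, because their pairing with \<open>v\<^sub>0\<close> is bounded below.\<close>

lemma deep_point:
  assumes C: "C \<ge> 0"
  obtains a where "a \<in> U" "\<And>l. l \<in> K \<Longrightarrow> l \<noteq> 0 \<Longrightarrow> C * norm (\<Prod>i\<in>UNIV. a $ i powi l $ i) \<le> 1 / 2"
proof -
  define t where "t = max 1 (ln (2 * (C + 1)) / \<epsilon>)"
  have t: "t > 0" by (simp add: t_def)
  have v0: "v0 \<in> ball v0 \<epsilon>" using eps by simp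
  have "ln (2 * (C + 1)) \<le> t * \<epsilon>" using eps unfolding t_def by (simp add: pos_divide_le_eq[symmetric])
  then have "exp (- (t * \<epsilon>)) \<le> exp (- ln (2 * (C + 1)))" by simp
  also have "\<dots> = 1 / (2 * (C + 1))" using C by (simp add: exp_minus inverse_eq_divide)
  finally have small: "exp (- (t * \<epsilon>)) \<le> 1 / (2 * (C + 1))" .
  let ?a = "real_point (limit_ray v0 t)"
  show ?thesis
  proof (rule that[OF limit_ray_U[OF v0 t]])
    fix l assume l: "l \<in> K" "l \<noteq> 0"
    have "real 1 \<le> real (l1 l)" by (rule of_nat_mono[OF l1_pos[OF l(2)]])
    then have l1: "1 \<le> real (l1 l)" by (simp only: of_nat_1)
    have "t * \<epsilon> * 1 \<le> t * \<epsilon> * real (l1 l)" using t eps by (intro mult_left_mono l1) simp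
    moreover have "0 \<le> B * \<epsilon> * real (l1 l)" using B_pos eps by (intro mult_nonneg_nonneg) auto
    ultimately have "t * \<epsilon> \<le> (\<Sum>i\<in>UNIV. of_int (l $ i) * limit_ray v0 t $ i)"
      using limit_ray_pairing[OF v0 t l(1)] by linarith
    moreover have "norm (\<Prod>i\<in>UNIV. ?a $ i powi l $ i) = exp (- (\<Sum>i\<in>UNIV. of_int (l $ i) * limit_ray v0 t $ i))"
      using prod_norm_powi[OF slit_nonzero[OF real_point_slit], of "limit_ray v0 t" "\<lambda>i. l $ i"]
      unfolding lg_real_point by (simp add: prod_norm[symmetric] norm_power_int)
    ultimately have "norm (\<Prod>i\<in>UNIV. ?a $ i powi l $ i) \<le> exp (- (t * \<epsilon>))" by simp
    with small have "norm (\<Prod>i\<in>UNIV. ?a $ i powi l $ i) \<le> 1 / (2 * (C + 1))" by (rule order_trans[rotated])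
    then have "C * norm (\<Prod>i\<in>UNIV. ?a $ i powi l $ i) \<le> C * (1 / (2 * (C + 1)))"
      using C by (rule mult_left_mono)
    also have "\<dots> \<le> 1 / 2" using C by (simp add: field_simps)
    finally show "C * norm (\<Prod>i\<in>UNIV. ?a $ i powi l $ i) \<le> 1 / 2" .
  qed
qed

text \<open>A product that \<open>\<psi>\<close> does not kill is a nonzero polynomial, so its degree is determined.\<close>

lemma homogeneous_linear_form_times:
  assumes "homogeneous_of d (X k * (\<Sum>i\<in>UNIV. pm_scale (c i) (D_var i)))"
    and "lin_ext \<psi> (X k * (\<Sum>i\<in>UNIV. pm_scale (c i) (D_var i :: 'p cpoly))) \<noteq> 0"
  shows "total_degree k < d"
proof -
  let ?f = "X k * (\<Sum>i\<in>UNIV. pm_scale (c i) (D_var i :: 'p cpoly))"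
  have "homogeneous_of (total_degree k + 1) ?f"
    by (intro homogeneous_of_times homogeneous_of_X homogeneous_of_sum homogeneous_of_scale)
      (use homogeneous_of_D_var in simp)
  moreover have "Poly_Mapping.keys ?f \<noteq> {}"
  proof
    assume "Poly_Mapping.keys ?f = {}"
    then have "lin_ext \<psi> ?f = 0" by (simp only: lin_ext_def sum.empty)
    with assms(2) show False by contradiction
  qed
  moreover from this obtain \<kappa> where "\<kappa> \<in> Poly_Mapping.keys ?f" by blast
  ultimately show ?thesis using assms(1) unfolding homogeneous_of_def by fastforce
qed

text \<open>Induction on the degree \<open>d\<close>.  On products of degree \<open>d\<close> with linear forms the functional vanishes by the Euler equations and the induction hypothesis.  On products with Stanley-Reisner monomials it is bounded by a small multiple of its maximum \<open>M\<close> in degree \<open>d\<close>.  The reduction lemma bounds \<open>M\<close> by \<open>M / 2\<close>, so \<open>M = 0\<close>.\<close>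

theorem jets_determined_by_basis:
  assumes ns: "nonsingular_toric_variety \<Sigma>"
    and hb: "homogeneous_quotient_basis (J_ideal \<Sigma> \<mu>) m \<alpha>"
  obtains a where "a \<in> U" and "\<And>\<Phi> \<kappa>. gkz_solution \<mu> \<beta> U \<Phi> \<Longrightarrow>
    (\<forall>i<m. lin_ext (jet \<Phi> a) (\<alpha> i) = 0) \<Longrightarrow> jet \<Phi> a \<kappa> = 0"
proof -
  have "\<exists>C\<ge>0. \<forall>\<psi> d B \<kappa>. (\<forall>i<m. lin_ext \<psi> (\<alpha> i) = 0) \<longrightarrow>
    (\<forall>k g. g \<in> stanley_reisner_generators \<Sigma> \<mu> \<union> linear_forms \<mu> \<and> homogeneous_of d (X k * g) \<longrightarrow>
       norm (lin_ext \<psi> (X k * g)) \<le> B) \<longrightarrow>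
    total_degree \<kappa> = d \<longrightarrow> 0 \<le> B \<longrightarrow> norm (\<psi> \<kappa>) \<le> C * B"
    by (rule bounded_reduction[OF dual_vectors hb])
  then obtain C :: real where C: "C \<ge> 0" and red: "\<forall>\<psi> d B \<kappa>. (\<forall>i<m. lin_ext \<psi> (\<alpha> i) = 0) \<longrightarrow>
    (\<forall>k g. g \<in> stanley_reisner_generators \<Sigma> \<mu> \<union> linear_forms \<mu> \<and> homogeneous_of d (X k * g) \<longrightarrow>
       norm (lin_ext \<psi> (X k * g)) \<le> B) \<longrightarrow>
    total_degree \<kappa> = d \<longrightarrow> 0 \<le> B \<longrightarrow> norm (\<psi> \<kappa>) \<le> C * B" by (elim exE conjE)
  obtain a where a: "a \<in> U" and deep: "\<And>l. l \<in> K \<Longrightarrow> l \<noteq> 0 \<Longrightarrow> (C + 1) * norm (\<Prod>i\<in>UNIV. a $ i powi l $ i) \<le> 1 / 2"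
    using deep_point[of "C + 1"] C by auto
  show ?thesis
  proof (rule that[OF a])
    fix \<Phi> \<kappa> assume sol: "gkz_solution \<mu> \<beta> U \<Phi>" and zero: "\<forall>i<m. lin_ext (jet \<Phi> a) (\<alpha> i) = 0"
    let ?\<psi> = "jet \<Phi> a"
    have hol: "holomorphic_Cn \<Phi> U" using sol by (simp add: gkz_solution_def)
    have box: "box_operator l \<Phi> x = 0" if "l \<in> relation_lattice \<mu>" "x \<in> U" for l x
      using sol that by (simp add: gkz_solution_def)
    have form: "\<exists>s. \<forall>k. lin_ext ?\<psi> (X k * g) = s k * ?\<psi> k" and form_sum: "\<exists>c. g = (\<Sum>i\<in>UNIV. pm_scale (c i) (D_var i))"
      if g: "g \<in> linear_forms \<mu>" for g
    proof -
      have e1: "(\<Sum>i\<in>UNIV. of_real (fst (mu_bar \<mu> i)) * (x $ i * partial i \<Phi> x)) = fst \<beta> * \<Phi> x"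
        and e2: "(\<Sum>i\<in>UNIV. of_real (snd (mu_bar \<mu> i) $ k) * (x $ i * partial i \<Phi> x)) = snd \<beta> $ k * \<Phi> x"
        if "x \<in> U" for x k
        using sol that by (simp_all add: gkz_solution_def)
      have "\<exists>c s. g = (\<Sum>i\<in>UNIV. pm_scale (c i) (D_var i)) \<and>
        (\<forall>x\<in>U. (\<Sum>i\<in>UNIV. c i * (x $ i * partial i \<Phi> x)) = s * \<Phi> x)"
      proof -
        consider "g = (\<Sum>i\<in>UNIV. pm_scale (of_real (fst (mu_bar \<mu> i))) (D_var i))"
          | k where "g = (\<Sum>i\<in>UNIV. pm_scale (of_real (snd (mu_bar \<mu> i) $ k)) (D_var i))"
          using g unfolding linear_forms_def by blast
        then show ?thesis
        proof cases
          case 1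
          then show ?thesis
            by (intro exI[of _ "\<lambda>i. of_real (fst (mu_bar \<mu> i))"] exI[of _ "fst \<beta>"] conjI ballI e1)
        next
          case (2 k)
          then show ?thesis
            by (intro exI[of _ "\<lambda>i. of_real (snd (mu_bar \<mu> i) $ k)"] exI[of _ "snd \<beta> $ k"] conjI ballI e2)
        qed
      qed
      then obtain c s where c: "g = (\<Sum>i\<in>UNIV. pm_scale (c i) (D_var i))"
        and s: "\<And>x. x \<in> U \<Longrightarrow> (\<Sum>i\<in>UNIV. c i * (x $ i * partial i \<Phi> x)) = s * \<Phi> x" by blast
      show "\<exists>c. g = (\<Sum>i\<in>UNIV. pm_scale (c i) (D_var i))" by (rule exI[of _ c], rule c)
      show "\<exists>s. \<forall>k. lin_ext ?\<psi> (X k * g) = s k * ?\<psi> k"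
        unfolding c lin_ext_linear_form
        by (intro exI[of _ "\<lambda>k. s - (\<Sum>i\<in>UNIV. c i * of_nat (Poly_Mapping.lookup k i))"] allI
            jet_euler[OF open_U hol _ a] s)
    qed
    have "\<forall>\<kappa>. total_degree \<kappa> = d \<longrightarrow> ?\<psi> \<kappa> = 0" for d
    proof (induction d rule: less_induct)
      case (less d)
      let ?A = "{\<kappa> :: 'p monomial. total_degree \<kappa> = d}"
      define M where "M = Max (insert 0 ((\<lambda>\<kappa>. norm (?\<psi> \<kappa>)) ` ?A))"
      have fin: "finite (insert 0 ((\<lambda>\<kappa>. norm (?\<psi> \<kappa>)) ` ?A))" by (intro finite.insertI finite_imageI finite_total_degree_eq)
      have M: "norm (?\<psi> \<kappa>) \<le> M" if "total_degree \<kappa> = d" for \<kappa>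
        unfolding M_def by (rule Max_ge[OF fin]) (use that in blast)
      have M0: "M \<ge> 0" unfolding M_def by (rule Max_ge[OF fin]) blast
      define b where "b = M / (2 * (C + 1))"
      have b0: "b \<ge> 0" using M0 C by (simp add: b_def)
      have gen: "norm (lin_ext ?\<psi> (X k * g)) \<le> b"
        if g: "g \<in> stanley_reisner_generators \<Sigma> \<mu> \<union> linear_forms \<mu>" and hom: "homogeneous_of d (X k * g)" for k g
      proof (cases "g \<in> linear_forms \<mu>")
        case True
        obtain s where s: "\<forall>k. lin_ext ?\<psi> (X k * g) = s k * ?\<psi> k" using form[OF True] by (rule exE)
        obtain c where c: "g = (\<Sum>i\<in>UNIV. pm_scale (c i) (D_var i))" using form_sum[OF True] by (rule exE)
        have "lin_ext ?\<psi> (X k * g) = 0"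
        proof (rule ccontr)
          assume nz: "lin_ext ?\<psi> (X k * g) \<noteq> 0"
          then have "total_degree k < d"
            using homogeneous_linear_form_times[of d k c ?\<psi>] hom unfolding c by blast
          then have "?\<psi> k = 0" using less.IH by blast
          then show False using nz s by simp
        qed
        then show ?thesis using b0 by simp
      next
        case False
        then obtain S where S: "g = (\<Prod>j\<in>S. D_var (Some j))" "\<not> (\<exists>\<sigma>\<in>\<Sigma>. \<mu> ` S \<subseteq> \<sigma>)"
          using g unfolding stanley_reisner_generators_def by blast
        obtain c l where c: "total_degree c = card S" and l: "l \<in> K" "l \<noteq> 0"
          and lc: "\<And>i. l $ i = int (Poly_Mapping.lookup (sq S) i) - int (Poly_Mapping.lookup c i)"
          using nonface_reduction[OF ns S(2)] by blast
        have Xk: "X k * g = X (k + sq S)" unfolding S(1) prod_D_var by (simp add: mult_single)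
        have deg: "total_degree (k + c) = d"
          using hom unfolding Xk by (simp add: homogeneous_of_def total_degree_add c)
        have "lin_ext ?\<psi> (X k * g) = (\<Prod>i\<in>UNIV. a $ i powi l $ i) * ?\<psi> (k + c)"
          unfolding Xk lin_ext_single mult_1
          by (rule jet_box[OF open_U hol box[OF K_relation[OF l(1)]] lc a U_nonzero[OF a]])
        then have n: "norm (lin_ext ?\<psi> (X k * g)) = norm (\<Prod>i\<in>UNIV. a $ i powi l $ i) * norm (?\<psi> (k + c))"
          by (simp only: norm_mult)
        have "norm (\<Prod>i\<in>UNIV. a $ i powi l $ i) \<le> 1 / (2 * (C + 1))"
          using deep[OF l] C by (simp add: pos_le_divide_eq mult.commute)
        then have "norm (lin_ext ?\<psi> (X k * g)) \<le> 1 / (2 * (C + 1)) * M"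
          unfolding n using C by (intro mult_mono M[OF deg]) auto
        then show ?thesis by (simp add: b_def)
      qed
      have bound: "norm (?\<psi> \<kappa>) \<le> C * b" if "total_degree \<kappa> = d" for \<kappa>
        using red[rule_format, of ?\<psi> d b \<kappa>] zero gen that b0 by blast
      have "C * b \<le> M / 2" by (rule contraction_estimate[OF C b0 b_def])
      moreover have "M \<le> max 0 (C * b)"
        unfolding M_def by (rule Max.boundedI[OF fin]) (use bound in \<open>auto simp: le_max_iff_disj\<close>)
      ultimately have "M = 0" using M0 by linarith
      then show ?case using M by force
    qed
    then show "?\<psi> \<kappa> = 0" by blast
  qed
qed

text \<open>The jets of the \<open>m\<close> functions and of one more solution give \<open>m + 1\<close> vectors of length \<open>m\<close>, hence a linear relation.  The corresponding combination of solutions has vanishing jets, so it is zero, and by independence it involves the additional solution.\<close>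

theorem gkz_solutions_complete:
  assumes ns: "nonsingular_toric_variety \<Sigma>"
    and hb: "homogeneous_quotient_basis (J_ideal \<Sigma> \<mu>) m \<alpha>"
    and J: "\<And>i. i < m \<Longrightarrow> J_functional (\<phi> i)"
    and dual: "\<And>i j. i < m \<Longrightarrow> j < m \<Longrightarrow> lin_ext (\<phi> i) (\<alpha> j) = (if i = j then 1 else 0)"
  shows "complete_gkz_solutions \<mu> (-1, 0) U m (\<lambda>i. wsol (\<phi> i) (\<lambda>_. 0))"
  unfolding complete_gkz_solutions_def
proof (intro conjI allI impI)
  show sol: "gkz_solution \<mu> (-1, 0) U (wsol (\<phi> i) (\<lambda>_. 0))" if "i < m" for i
    by (rule wsol_gkz_solution[OF J[OF that]])
  show indep: "c i = 0" if zero: "\<forall>a\<in>U. (\<Sum>i<m. c i * wsol (\<phi> i) (\<lambda>_. 0) a) = 0" and i: "i < m" for c i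
  proof -
    define \<psi> where "\<psi> = (\<lambda>k. \<Sum>i<m. c i * \<phi> i k)"
    have J\<psi>: "J_functional \<psi>"
      unfolding J_functional_def \<psi>_def lin_ext_sum_functional
      by (intro ballI sum.neutral) (use J in \<open>simp add: J_functional_def\<close>)
    have "wsol \<psi> (\<lambda>_. 0) a = 0" if a: "a \<in> U" for a
    proof -
      have "wsol \<psi> (\<lambda>_. 0) a = (\<Sum>i<m. c i * (\<Sum>k\<in>Mon. \<phi> i k * S (\<lambda>_. 0) (Poly_Mapping.lookup k) a))"
        unfolding wsol_def[OF J\<psi>] unfolding \<psi>_def sum_distrib_right sum_distrib_left
        by (subst sum.swap) (simp only: mult.assoc)
      also have "\<dots> = (\<Sum>i<m. c i * wsol (\<phi> i) (\<lambda>_. 0) a)"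
        by (intro sum.cong refl) (simp add: wsol_def[OF J])
      also have "\<dots> = 0" using zero a by blast
      finally show ?thesis .
    qed
    then have "\<psi> k = 0" for k by (rule wsol_independent[OF J\<psi>])
    then have "lin_ext \<psi> (\<alpha> i) = 0" by (simp add: lin_ext_def)
    moreover have "lin_ext \<psi> (\<alpha> i) = (\<Sum>j<m. if j = i then c j else 0)"
      unfolding \<psi>_def lin_ext_sum_functional by (intro sum.cong refl) (use dual i in simp)
    ultimately show "c i = 0" using i by simp
  qed
  show "\<exists>c. \<forall>a\<in>U. \<Phi> a = (\<Sum>i<m. c i * wsol (\<phi> i) (\<lambda>_. 0) a)" if \<Phi>: "gkz_solution \<mu> (-1, 0) U \<Phi>" for \<Phi>
  proof -
    define F where "F = (\<lambda>j. if j < m then wsol (\<phi> j) (\<lambda>_. 0) else \<Phi>)"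
    have F: "gkz_solution \<mu> (-1, 0) U (F j)" for j using sol \<Phi> by (simp add: F_def)
    have F_hol: "holomorphic_Cn (F j) U" for j using F[of j] by (simp add: gkz_solution_def)
    obtain a where a: "a \<in> U" and jets: "\<And>\<Phi> \<kappa>. gkz_solution \<mu> (-1, 0) U \<Phi> \<Longrightarrow>
      (\<forall>i<m. lin_ext (jet \<Phi> a) (\<alpha> i) = 0) \<Longrightarrow> jet \<Phi> a \<kappa> = 0"
      by (rule jets_determined_by_basis[OF ns hb, where \<beta> = "(-1, 0)"]) blast
    obtain e where e: "\<exists>j\<in>{..m}. e j \<noteq> 0" "\<forall>i\<in>{..<m}. (\<Sum>j\<in>{..m}. e j * lin_ext (jet (F j) a) (\<alpha> i)) = 0"
      using nontrivial_linear_relation[of "{..<m}" "{..m}" "\<lambda>j i. lin_ext (jet (F j) a) (\<alpha> i)"] by auto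
    define \<Psi> where "\<Psi> = (\<lambda>a. \<Sum>j\<le>m. e j * F j a)"
    have \<Psi>: "gkz_solution \<mu> (-1, 0) U \<Psi>" unfolding \<Psi>_def by (rule gkz_solution_sum[OF open_U F])
    have \<Psi>_jet: "jet \<Psi> a = (\<lambda>\<kappa>. \<Sum>j\<le>m. e j * jet (F j) a \<kappa>)"
      unfolding \<Psi>_def by (rule ext, rule jet_sum[OF open_U F_hol a])
    have jet0: "jet \<Psi> a \<kappa> = 0" for \<kappa>
    proof (rule jets[OF \<Psi>])
      show "\<forall>i<m. lin_ext (jet \<Psi> a) (\<alpha> i) = 0"
        unfolding \<Psi>_jet lin_ext_sum_functional using e(2) by simp
    qed
    have mp0: "multi_partial \<kappa> \<Psi> a = 0" for \<kappa>
    proof -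
      have "Poly_Mapping.lookup (Abs_poly_mapping \<kappa>) = \<kappa>" by (rule Abs_poly_mapping_inverse) simp
      then have "(\<Prod>i\<in>UNIV. a $ i ^ \<kappa> i) * multi_partial \<kappa> \<Psi> a = 0"
        using jet0[of "Abs_poly_mapping \<kappa>"] by (simp add: jet_def)
      moreover have "(\<Prod>i\<in>UNIV. a $ i ^ \<kappa> i) \<noteq> 0" using U_nonzero[OF a] by simp
      ultimately show ?thesis by simp
    qed
    have \<Psi>0: "\<Psi> b = 0" if "b \<in> U" for b
      by (rule holomorphic_Cn_identity[OF open_U connected_U _ a mp0 that])
        (use \<Psi> in \<open>simp add: gkz_solution_def\<close>)
    have split: "(\<Sum>j<m. e j * wsol (\<phi> j) (\<lambda>_. 0) b) + e m * \<Phi> b = 0" if "b \<in> U" for b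
    proof -
      have "\<Psi> b = (\<Sum>j<m. e j * F j b) + e m * F m b"
        unfolding \<Psi>_def by (simp add: lessThan_Suc_atMost[symmetric])
      moreover have "(\<Sum>j<m. e j * F j b) = (\<Sum>j<m. e j * wsol (\<phi> j) (\<lambda>_. 0) b)"
        by (rule sum.cong) (auto simp: F_def)
      ultimately show ?thesis using \<Psi>0[OF that] by (simp add: F_def)
    qed
    have em: "e m \<noteq> 0"
    proof
      assume em: "e m = 0"
      have "\<forall>b\<in>U. (\<Sum>j<m. e j * wsol (\<phi> j) (\<lambda>_. 0) b) = 0" using split em by simp
      then have "e j = 0" if "j < m" for j using indep that by blast
      then show False using e(1) em by (metis atMost_iff le_neq_implies_less)
    qed
    show ?thesis
    proof (intro exI[of _ "\<lambda>j. - (e j / e m)"] ballI)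
      fix b assume b: "b \<in> U"
      have "(\<Sum>j<m. - (e j / e m) * wsol (\<phi> j) (\<lambda>_. 0) b) = - ((\<Sum>j<m. e j * wsol (\<phi> j) (\<lambda>_. 0) b) / e m)"
        unfolding sum_divide_distrib sum_negf[symmetric] by (intro sum.cong refl) simp
      also have "\<dots> = \<Phi> b" using split[OF b] em by (simp add: eq_neg_iff_add_eq_0[symmetric])
      finally show "\<Phi> b = (\<Sum>j<m. - (e j / e m) * wsol (\<phi> j) (\<lambda>_. 0) b)" by (rule sym)
    qed
  qed
qed

end

section \<open>Solutions of the GKZ system near a large radius limit\<close>

theorem theorem5p4:
  fixes \<Sigma> :: "(real ^ 'n) set set"
    and \<mu> :: "'p::finite \<Rightarrow> real ^ 'n"
  assumes "simplicial_fan \<Sigma>"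
    and "maximal_cones_full_dimensional \<Sigma>"
    and "convex (fan_support \<Sigma>)"
    and "bij_betw \<mu> UNIV (ray_generators \<Sigma>)"
    and "c1_semi_positive \<Sigma>"
    and "regular_triangulation \<Sigma> \<mu>"
  shows "\<exists>U. open U \<and> connected U \<and> U \<noteq> {} \<and> near_large_radius_limit \<Sigma> \<mu> U \<and>
    (\<forall>a\<in>U. gamma_series_converges \<Sigma> \<mu> a) \<and>
    (\<exists>m \<alpha>. homogeneous_quotient_basis (J_ideal \<Sigma> \<mu>) m \<alpha>) \<and>
    (\<forall>m \<alpha>. homogeneous_quotient_basis (J_ideal \<Sigma> \<mu>) m \<alpha> \<longrightarrow>
      (\<exists>w. (\<forall>a\<in>U. series_cong_mod (J_ideal \<Sigma> \<mu>) (gamma_series \<Sigma> \<mu> a)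
                     (\<Sum>i<m. pm_scale (w i a) (\<alpha> i))) \<and>
           (\<forall>i<m. gkz_solution \<mu> (-1, 0) U (w i)) \<and>
           (nonsingular_toric_variety \<Sigma> \<longrightarrow> complete_gkz_solutions \<mu> (-1, 0) U m w)))"
proof -
  interpret semi_positive_fan \<Sigma> \<mu>
    by unfold_locales (fact assms)+
  obtain v0 \<epsilon> where v0: "\<epsilon> > 0" "\<And>v. v \<in> ball v0 \<epsilon> \<Longrightarrow> v \<in> interior (pl_cone \<Sigma> \<mu>)"
    "\<And>v l. v \<in> ball v0 \<epsilon> \<Longrightarrow> l \<in> dual_cone_lattice \<Sigma> \<mu> \<Longrightarrow>
      \<epsilon> * real (l1 l) \<le> (\<Sum>i\<in>UNIV. real_of_int (l $ i) * v $ i)"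
    by (rule interior_point_bound) blast
  interpret gkz_domain \<Sigma> \<mu> v0 \<epsilon> "(1 + ln (Rconst TYPE('p))) / \<epsilon>"
  proof unfold_locales
    show "1 + ln (Rconst TYPE('p)) \<le> (1 + ln (Rconst TYPE('p))) / \<epsilon> * \<epsilon>" using v0(1) by simp
  qed (fact v0)+
  show ?thesis
  proof (intro exI[of _ U] conjI allI impI ballI)
    show "open U" "connected U" "U \<noteq> {}" "near_large_radius_limit \<Sigma> \<mu> U"
      by (fact open_U connected_U U_nonempty near_large_radius_limit_U)+
    show "gamma_series_converges \<Sigma> \<mu> a" if "a \<in> U" for a
      by (rule gamma_series_converges_U[OF that])
    show "\<exists>m \<alpha>. homogeneous_quotient_basis (J_ideal \<Sigma> \<mu>) m \<alpha>"
      by (rule homogeneous_quotient_basis_exists[OF dual_vectors])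
    fix m and \<alpha> :: "nat \<Rightarrow> 'p cpoly"
    assume hb: "homogeneous_quotient_basis (J_ideal \<Sigma> \<mu>) m \<alpha>"
    obtain \<phi> :: "nat \<Rightarrow> 'p monomial \<Rightarrow> complex"
      where \<phi>: "\<And>i f. i < m \<Longrightarrow> f \<in> J_ideal \<Sigma> \<mu> \<Longrightarrow> lin_ext (\<phi> i) f = 0"
        and dual: "\<And>i j. i < m \<Longrightarrow> j < m \<Longrightarrow> lin_ext (\<phi> i) (\<alpha> j) = (if i = j then 1 else 0)"
        and series: "\<And>F. series_cong_mod (J_ideal \<Sigma> \<mu>) F
          (\<Sum>i<m. pm_scale (\<Sum>k | total_degree k \<le> CARD('p). \<phi> i k * F k) (\<alpha> i))"
    proof (rule quotient_coordinates[OF dual_vectors hb])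
      fix \<phi> :: "nat \<Rightarrow> 'p monomial \<Rightarrow> complex"
      assume "\<And>i f. i < m \<Longrightarrow> f \<in> J_ideal \<Sigma> \<mu> \<Longrightarrow> lin_ext (\<phi> i) f = 0"
        "\<And>i j. i < m \<Longrightarrow> j < m \<Longrightarrow> lin_ext (\<phi> i) (\<alpha> j) = (if i = j then 1 else 0)"
        "\<And>F. series_cong_mod (J_ideal \<Sigma> \<mu>) F
          (\<Sum>i<m. pm_scale (\<Sum>k | total_degree k \<le> CARD('p). \<phi> i k * F k) (\<alpha> i))"
      then show thesis by (rule that)
    qed
    have J: "J_functional (\<phi> i)" if "i < m" for i
      using \<phi>[OF that] by (simp add: J_functional_def)
    show "\<exists>w. (\<forall>a\<in>U. series_cong_mod (J_ideal \<Sigma> \<mu>) (gamma_series \<Sigma> \<mu> a)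
                     (\<Sum>i<m. pm_scale (w i a) (\<alpha> i))) \<and>
           (\<forall>i<m. gkz_solution \<mu> (-1, 0) U (w i)) \<and>
           (nonsingular_toric_variety \<Sigma> \<longrightarrow> complete_gkz_solutions \<mu> (-1, 0) U m w)"
    proof (intro exI[of _ "\<lambda>i. wsol (\<phi> i) (\<lambda>_. 0)"] conjI ballI allI impI)
      fix a assume a: "a \<in> U"
      have "wsol (\<phi> i) (\<lambda>_. 0) a = (\<Sum>k | total_degree k \<le> CARD('p). \<phi> i k * gamma_series \<Sigma> \<mu> a k)"
        if "i < m" for i
        unfolding wsol_def[OF J[OF that]] Mon_def gamma_series_eq[OF a] ..
      then have "(\<Sum>i<m. pm_scale (wsol (\<phi> i) (\<lambda>_. 0) a) (\<alpha> i)) =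
        (\<Sum>i<m. pm_scale (\<Sum>k | total_degree k \<le> CARD('p). \<phi> i k * gamma_series \<Sigma> \<mu> a k) (\<alpha> i))"
        by (intro sum.cong refl) simp
      then show "series_cong_mod (J_ideal \<Sigma> \<mu>) (gamma_series \<Sigma> \<mu> a)
        (\<Sum>i<m. pm_scale (wsol (\<phi> i) (\<lambda>_. 0) a) (\<alpha> i))"
        using series[of "gamma_series \<Sigma> \<mu> a"] by (simp only:)
    next
      show "gkz_solution \<mu> (-1, 0) U (wsol (\<phi> i) (\<lambda>_. 0))" if "i < m" for i
        by (rule wsol_gkz_solution[OF J[OF that]])
    next
      assume "nonsingular_toric_variety \<Sigma>"
      then show "complete_gkz_solutions \<mu> (-1, 0) U m (\<lambda>i. wsol (\<phi> i) (\<lambda>_. 0))"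
        by (rule gkz_solutions_complete[OF _ hb J dual])
    qed
  qed
qed

end
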